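(* Let $G$ be a compactly generated locally compact group of polynomial growth, let $\Omega_{\mathbb{T}}\in \mathcal{Z}_b^2(G,\mathbb{T})$, and let $\circledast_{\mathbb{T}}$ be the twisted convolution coming from $\Omega_{\mathbb{T}}$. Let $C>0$. Then: (i) If $\sigma_{\alpha,C}$ is the subexponential weight $\sigma_{\alpha,C}(s)=e^{C\tau(s)^\alpha}$ with $0<\alpha<1$, then $(L^\Phi_{\sigma_{\alpha,C}}(G),\circledast_{\mathbb{T}})$ is a symmetric twisted Orlicz algebra. (ii) If $\rho_{\gamma,C}$ is the subexponential weight $\rho_{\gamma,C}(s)=\exp\left(\frac{C\tau(s)}{(\ln(e+\tau(s)))^\gamma}\right)$ with $\gamma>0$, then $(L^\Phi_{\rho_{\gamma,C}}(G),\circledast_{\mathbb{T}})$ is a symmetric twisted Orlicz algebra.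
   Context: $G$ carries a fixed left Haar measure $ds$, with $\lambda(S)$ the measure of $S$, and a fixed compact symmetric generating neighborhood $U$ of the identity. $G$ has polynomial growth if there are $K>0$ and $d\in\mathbb{N}$ with $\lambda(U^n)\le Kn^d$ for all $n\in\mathbb{N}$, where $U^n=\{u_1\cdots u_n:u_i\in U\}$ (such $G$ is unimodular). Writing $e_G$ for the identity of $G$, the length function $\tau=\tau_U:G\to[0,\infty)$ is $\tau(x)=\inf\{n\in\mathbb{N}:x\in U^n\}$ for $x\ne e_G$ and $\tau(e_G)=0$. In the formula for $\rho_{\gamma,C}$, $e$ inside the logarithm is Euler's number. A Young function is a nonzero convex function $\Phi:[0,\infty)\to[0,\infty]$ with $\Phi(0)=0$ and $\lim_{x\to\infty}\Phi(x)=\infty$; its complementary Young function is $\Psi(y)=\sup\{xy-\Phi(x):x\ge 0\}$. Standing assumption: $(\Phi,\Psi)$ is a complementary pair of Young functions with $\Phi$ real-valued and continuous on $[0,\infty)$ and positive on $(0,\infty)$. $L^\Phi(G)$ is the space of measurable $f:G\to\mathbb{C}$ (modulo a.e. equality) with $\int_G\Phi(\alpha|f(s)|)\,ds<\infty$ for some $\alpha>0$, with norm $\|f\|_\Phi=\sup\{\int_G|f v|\,ds:\int_G\Psi(|v(s)|)\,ds\le 1\}$. $\mathcal{Z}_b^2(G,\mathbb{T})$ is the group of continuous maps $\Omega_{\mathbb{T}}:G\times G\to\mathbb{T}$ (unit circle) with $\Omega_{\mathbb{T}}(r,s)\Omega_{\mathbb{T}}(rs,t)=\Omega_{\mathbb{T}}(s,t)\Omega_{\mathbb{T}}(r,st)$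 and $\Omega_{\mathbb{T}}(r,e_G)=\Omega_{\mathbb{T}}(e_G,r)=1$. For $\omega:G\to(0,\infty)$ measurable, $L^\Phi_\omega(G)=\{f: f\omega\in L^\Phi(G)\}$ with norm $\|f\|_{\Phi,\omega}=\|f\omega\|_\Phi$. Twisted convolution: $(f\circledast_{\mathbb{T}}g)(t)=\int_G f(s)g(s^{-1}t)\Omega_{\mathbb{T}}(s,s^{-1}t)\,ds$. Involution: $f^*(s)=\overline{f(s^{-1})}\,\overline{\Omega_{\mathbb{T}}(s,s^{-1})}$. That $(L^\Phi_\omega(G),\circledast_{\mathbb{T}})$ is a symmetric twisted Orlicz algebra means: there is $K>0$ with $f\circledast_{\mathbb{T}}g\in L^\Phi_\omega(G)$ and $\|f\circledast_{\mathbb{T}}g\|_{\Phi,\omega}\le K\|f\|_{\Phi,\omega}\|g\|_{\Phi,\omega}$ for all $f,g\in L^\Phi_\omega(G)$, so that with the involution $f^*(s)=\overline{f(s^{-1})}\,\overline{\Omega_{\mathbb{T}}(s,s^{-1})}$ it is a Banach $*$-algebra $A$, and $A$ is symmetric, i.e. $\sigma_A(a^*a)\subseteq[0,\infty)$ for every $a\in A$, where $\sigma_A$ denotes the spectrum in $A$ (taken in the unitization if $A$ is non-unital). *)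

theory Defs
  imports "HOL-Analysis.Analysis"
begin

text \<open>
  Groups are written additively, with the (not necessarily commutative) library class
  \<open>topological_group_add\<close>: the product \<open>s t\<close> is \<open>s + t\<close>, the inverse is \<open>- s\<close>, the identity
  \<open>e\<^sub>G\<close> is \<open>0\<close>, and \<open>s\<^sup>-\<^sup>1 t\<close> is \<open>- s + t\<close>.
\<close>

text \<open>A left Haar measure is a left invariant nonzero Radon measure on the Borel sets, where Radon
  means: finite on compact sets, outer regular, and inner regular on open sets.\<close>

definition left_haar_measure :: "'a::topological_group_add measure \<Rightarrow> bool" where
  "left_haar_measure M \<longleftrightarrow>
     sets M = sets borel \<and>
     emeasure M UNIV \<noteq> 0 \<and>
     (\<forall>K. compact K \<longrightarrow> emeasure M K < \<infinity>) \<and>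
     (\<forall>A\<in>sets M. emeasure M A = (INF V\<in>{V. open V \<and> A \<subseteq> V}. emeasure M V)) \<and>
     (\<forall>V. open V \<longrightarrow> emeasure M V = (SUP K\<in>{K. compact K \<and> K \<subseteq> V}. emeasure M K)) \<and>
     (\<forall>s. \<forall>A\<in>sets M. emeasure M ((\<lambda>x. s + x) ` A) = emeasure M A)"

definition is_subgroup :: "'a::group_add set \<Rightarrow> bool" where
  "is_subgroup H \<longleftrightarrow> 0 \<in> H \<and> (\<forall>x\<in>H. \<forall>y\<in>H. x + y \<in> H) \<and> (\<forall>x\<in>H. - x \<in> H)"

definition compact_symmetric_generating_nbhd :: "'a::topological_group_add set \<Rightarrow> bool" where
  "compact_symmetric_generating_nbhd U \<longleftrightarrow>
     compact U \<and> 0 \<in> interior U \<and> uminus ` U = U \<and> is_subgroup hull U = UNIV"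

definition set_pow :: "'a::monoid_add set \<Rightarrow> nat \<Rightarrow> 'a set" where
  "set_pow U n = {sum_list us |us. length us = n \<and> set us \<subseteq> U}"

text \<open>The growth bound is for \<open>n \<ge> 1\<close>; at \<open>n = 0\<close> one has \<open>U\<^sup>0 = {e\<^sub>G}\<close>, and the bound would fail
  for discrete groups when \<open>d > 0\<close>.\<close>

definition polynomial_growth :: "'a::topological_group_add measure \<Rightarrow> 'a set \<Rightarrow> bool" where
  "polynomial_growth M U \<longleftrightarrow>
     (\<exists>K>0. \<exists>d::nat. \<forall>n\<ge>1. emeasure M (set_pow U n) \<le> ennreal (K * real n ^ d))"

definition len :: "'a::group_add set \<Rightarrow> 'a \<Rightarrow> real" where
  "len U x = (if x = 0 then 0 else real (Inf {n. x \<in> set_pow U n}))"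

definition sigma_weight :: "'a::group_add set \<Rightarrow> real \<Rightarrow> real \<Rightarrow> 'a \<Rightarrow> real" where
  "sigma_weight U \<alpha> C s = exp (C * len U s powr \<alpha>)"

definition rho_weight :: "'a::group_add set \<Rightarrow> real \<Rightarrow> real \<Rightarrow> 'a \<Rightarrow> real" where
  "rho_weight U \<gamma> C s = exp (C * len U s / ln (exp 1 + len U s) powr \<gamma>)"

text \<open>A Young function \<open>[0,\<infinity>) \<rightarrow> [0,\<infinity>]\<close> is a function on \<open>real\<close> of which only the values on
  \<open>{0..}\<close> matter.\<close>

definition young_function :: "(real \<Rightarrow> ennreal) \<Rightarrow> bool" where
  "young_function \<Phi> \<longleftrightarrow>
     (\<exists>x\<ge>0. \<Phi> x \<noteq> 0) \<and>
     (\<forall>x\<ge>0. \<forall>y\<ge>0. \<forall>t\<in>{0..1}.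
        \<Phi> ((1 - t) * x + t * y) \<le> ennreal (1 - t) * \<Phi> x + ennreal t * \<Phi> y) \<and>
     \<Phi> 0 = 0 \<and> (\<Phi> \<longlongrightarrow> \<infinity>) at_top"

text \<open>Subtraction on \<open>ennreal\<close> truncates at \<open>0\<close>; this does not affect the supremum, since
  \<open>x = 0\<close> contributes \<open>0\<close>.\<close>

definition complementary_young_pair :: "(real \<Rightarrow> ennreal) \<Rightarrow> (real \<Rightarrow> ennreal) \<Rightarrow> bool" where
  "complementary_young_pair \<Phi> \<Psi> \<longleftrightarrow>
     young_function \<Phi> \<and> young_function \<Psi> \<and>
     (\<forall>y\<ge>0. \<Psi> y = (SUP x\<in>{0..}. ennreal (x * y) - \<Phi> x))"

definition orlicz_space :: "'a measure \<Rightarrow> (real \<Rightarrow> ennreal) \<Rightarrow> ('a \<Rightarrow> complex) set" where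
  "orlicz_space M \<Phi> =
     {f \<in> borel_measurable M. \<exists>\<alpha>>0. (\<integral>\<^sup>+ s. \<Phi> (\<alpha> * norm (f s)) \<partial>M) < \<infinity>}"

definition orlicz_norm :: "'a measure \<Rightarrow> (real \<Rightarrow> ennreal) \<Rightarrow> ('a \<Rightarrow> complex) \<Rightarrow> ennreal" where
  "orlicz_norm M \<Psi> f =
     (SUP v\<in>{v \<in> borel_measurable M. (\<integral>\<^sup>+ s. \<Psi> (norm (v s :: complex)) \<partial>M) \<le> 1}.
        \<integral>\<^sup>+ s. ennreal (norm (f s * v s)) \<partial>M)"

definition weighted_orlicz_space ::
    "'a measure \<Rightarrow> (real \<Rightarrow> ennreal) \<Rightarrow> ('a \<Rightarrow> real) \<Rightarrow> ('a \<Rightarrow> complex) set" where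
  "weighted_orlicz_space M \<Phi> \<omega> =
     {f \<in> borel_measurable M. (\<lambda>s. f s * of_real (\<omega> s)) \<in> orlicz_space M \<Phi>}"

definition weighted_orlicz_norm ::
    "'a measure \<Rightarrow> (real \<Rightarrow> ennreal) \<Rightarrow> ('a \<Rightarrow> real) \<Rightarrow> ('a \<Rightarrow> complex) \<Rightarrow> ennreal" where
  "weighted_orlicz_norm M \<Psi> \<omega> f = orlicz_norm M \<Psi> (\<lambda>s. f s * of_real (\<omega> s))"

definition circle_cocycles :: "('a::topological_group_add \<Rightarrow> 'a \<Rightarrow> complex) set" where
  "circle_cocycles =
     {\<Omega>. continuous_on UNIV (\<lambda>(r, s). \<Omega> r s) \<and>
         (\<forall>r s. norm (\<Omega> r s) = 1) \<and>
         (\<forall>r s t. \<Omega> r s * \<Omega> (r + s) t = \<Omega> s t * \<Omega> r (s + t)) \<and>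
         (\<forall>r. \<Omega> r 0 = 1 \<and> \<Omega> 0 r = 1)}"

definition twisted_conv ::
    "'a::group_add measure \<Rightarrow> ('a \<Rightarrow> 'a \<Rightarrow> complex) \<Rightarrow> ('a \<Rightarrow> complex) \<Rightarrow> ('a \<Rightarrow> complex) \<Rightarrow> 'a \<Rightarrow> complex"
where
  "twisted_conv M \<Omega> f g t = (\<integral>s. f s * g (- s + t) * \<Omega> s (- s + t) \<partial>M)"

definition twisted_star :: "('a::group_add \<Rightarrow> 'a \<Rightarrow> complex) \<Rightarrow> ('a \<Rightarrow> complex) \<Rightarrow> 'a \<Rightarrow> complex" where
  "twisted_star \<Omega> f s = cnj (f (- s)) * cnj (\<Omega> s (- s))"

text \<open>Complex star-algebras with an explicit carrier, not assumed to be unital.\<close>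

record 'b star_alg =
  acarrier :: "'b set"
  azero :: 'b
  aadd :: "'b \<Rightarrow> 'b \<Rightarrow> 'b"
  ascale :: "complex \<Rightarrow> 'b \<Rightarrow> 'b"
  amult :: "'b \<Rightarrow> 'b \<Rightarrow> 'b"
  astar :: "'b \<Rightarrow> 'b"
  anorm :: "'b \<Rightarrow> real"

definition adiff :: "'b star_alg \<Rightarrow> 'b \<Rightarrow> 'b \<Rightarrow> 'b" where
  "adiff A x y = aadd A x (ascale A (-1) y)"

locale complex_star_algebra =
  fixes A :: "'b star_alg"
  assumes zero_closed: "azero A \<in> acarrier A"
    and add_closed: "\<lbrakk>x \<in> acarrier A; y \<in> acarrier A\<rbrakk> \<Longrightarrow> aadd A x y \<in> acarrier A"
    and scale_closed: "x \<in> acarrier A \<Longrightarrow> ascale A c x \<in> acarrier A"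
    and mult_closed: "\<lbrakk>x \<in> acarrier A; y \<in> acarrier A\<rbrakk> \<Longrightarrow> amult A x y \<in> acarrier A"
    and star_closed: "x \<in> acarrier A \<Longrightarrow> astar A x \<in> acarrier A"
    and add_assoc: "\<lbrakk>x \<in> acarrier A; y \<in> acarrier A; z \<in> acarrier A\<rbrakk>
        \<Longrightarrow> aadd A (aadd A x y) z = aadd A x (aadd A y z)"
    and add_commute: "\<lbrakk>x \<in> acarrier A; y \<in> acarrier A\<rbrakk> \<Longrightarrow> aadd A x y = aadd A y x"
    and add_zero: "x \<in> acarrier A \<Longrightarrow> aadd A x (azero A) = x"
    and diff_self: "x \<in> acarrier A \<Longrightarrow> adiff A x x = azero A"
    and scale_one: "x \<in> acarrier A \<Longrightarrow> ascale A 1 x = x"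
    and scale_scale: "x \<in> acarrier A \<Longrightarrow> ascale A c (ascale A d x) = ascale A (c * d) x"
    and scale_add_left: "x \<in> acarrier A
        \<Longrightarrow> ascale A (c + d) x = aadd A (ascale A c x) (ascale A d x)"
    and scale_add_right: "\<lbrakk>x \<in> acarrier A; y \<in> acarrier A\<rbrakk>
        \<Longrightarrow> ascale A c (aadd A x y) = aadd A (ascale A c x) (ascale A c y)"
    and mult_assoc: "\<lbrakk>x \<in> acarrier A; y \<in> acarrier A; z \<in> acarrier A\<rbrakk>
        \<Longrightarrow> amult A (amult A x y) z = amult A x (amult A y z)"
    and mult_add_left: "\<lbrakk>x \<in> acarrier A; y \<in> acarrier A; z \<in> acarrier A\<rbrakk>
        \<Longrightarrow> amult A (aadd A x y) z = aadd A (amult A x z) (amult A y z)"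
    and mult_add_right: "\<lbrakk>x \<in> acarrier A; y \<in> acarrier A; z \<in> acarrier A\<rbrakk>
        \<Longrightarrow> amult A x (aadd A y z) = aadd A (amult A x y) (amult A x z)"
    and mult_scale_left: "\<lbrakk>x \<in> acarrier A; y \<in> acarrier A\<rbrakk>
        \<Longrightarrow> amult A (ascale A c x) y = ascale A c (amult A x y)"
    and mult_scale_right: "\<lbrakk>x \<in> acarrier A; y \<in> acarrier A\<rbrakk>
        \<Longrightarrow> amult A x (ascale A c y) = ascale A c (amult A x y)"
    and star_star: "x \<in> acarrier A \<Longrightarrow> astar A (astar A x) = x"
    and star_add: "\<lbrakk>x \<in> acarrier A; y \<in> acarrier A\<rbrakk>
        \<Longrightarrow> astar A (aadd A x y) = aadd A (astar A x) (astar A y)"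
    and star_scale: "x \<in> acarrier A \<Longrightarrow> astar A (ascale A c x) = ascale A (cnj c) (astar A x)"
    and star_mult: "\<lbrakk>x \<in> acarrier A; y \<in> acarrier A\<rbrakk>
        \<Longrightarrow> astar A (amult A x y) = amult A (astar A y) (astar A x)"

text \<open>As is usual for Orlicz algebras, the norm is only required to be submultiplicative up to a
  constant.\<close>

locale banach_star_algebra = complex_star_algebra +
  assumes norm_nonneg: "x \<in> acarrier A \<Longrightarrow> 0 \<le> anorm A x"
    and norm_eq_zero: "x \<in> acarrier A \<Longrightarrow> anorm A x = 0 \<longleftrightarrow> x = azero A"
    and norm_scale: "x \<in> acarrier A \<Longrightarrow> anorm A (ascale A c x) = cmod c * anorm A x"
    and norm_triangle: "\<lbrakk>x \<in> acarrier A; y \<in> acarrier A\<rbrakk>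
        \<Longrightarrow> anorm A (aadd A x y) \<le> anorm A x + anorm A y"
    and norm_mult: "\<exists>K>0. \<forall>x\<in>acarrier A. \<forall>y\<in>acarrier A.
        anorm A (amult A x y) \<le> K * anorm A x * anorm A y"
    and norm_star: "x \<in> acarrier A \<Longrightarrow> anorm A (astar A x) = anorm A x"
    and complete: "\<lbrakk>\<And>n::nat. X n \<in> acarrier A;
          \<And>e::real. e > 0 \<Longrightarrow> \<exists>N. \<forall>m\<ge>N. \<forall>n\<ge>N. anorm A (adiff A (X m) (X n)) < e\<rbrakk>
        \<Longrightarrow> \<exists>x\<in>acarrier A. (\<lambda>n. anorm A (adiff A (X n) x)) \<longlonglongrightarrow> 0"

definition is_unit_of :: "'b star_alg \<Rightarrow> 'b \<Rightarrow> bool" where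
  "is_unit_of A e \<longleftrightarrow> e \<in> acarrier A \<and> (\<forall>x\<in>acarrier A. amult A e x = x \<and> amult A x e = x)"

definition unital :: "'b star_alg \<Rightarrow> bool" where
  "unital A \<longleftrightarrow> (\<exists>e. is_unit_of A e)"

definition aone :: "'b star_alg \<Rightarrow> 'b" where
  "aone A = (THE e. is_unit_of A e)"

definition ainvertible :: "'b star_alg \<Rightarrow> 'b \<Rightarrow> bool" where
  "ainvertible A x \<longleftrightarrow>
     (\<exists>y\<in>acarrier A. amult A x y = aone A \<and> amult A y x = aone A)"

definition unitization :: "'b star_alg \<Rightarrow> ('b \<times> complex) star_alg" where
  "unitization A =
     \<lparr>acarrier = acarrier A \<times> UNIV,
      azero = (azero A, 0),
      aadd = (\<lambda>(x, c) (y, d). (aadd A x y, c + d)),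
      ascale = (\<lambda>k (x, c). (ascale A k x, k * c)),
      amult = (\<lambda>(x, c) (y, d).
        (aadd A (amult A x y) (aadd A (ascale A c y) (ascale A d x)), c * d)),
      astar = (\<lambda>(x, c). (astar A x, cnj c)),
      anorm = (\<lambda>(x, c). anorm A x + cmod c)\<rparr>"

definition unital_spectrum :: "'b star_alg \<Rightarrow> 'b \<Rightarrow> complex set" where
  "unital_spectrum A x = {c. \<not> ainvertible A (adiff A (ascale A c (aone A)) x)}"

definition spectrum :: "'b star_alg \<Rightarrow> 'b \<Rightarrow> complex set" where
  "spectrum A x =
     (if unital A then unital_spectrum A x else unital_spectrum (unitization A) (x, 0))"

definition symmetric_algebra :: "'b star_alg \<Rightarrow> bool" where
  "symmetric_algebra A \<longleftrightarrow>
     (\<forall>x\<in>acarrier A. spectrum A (amult A (astar A x) x) \<subseteq> \<real>\<^sub>\<ge>\<^sub>0)"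

definition ae_rel ::
    "'a measure \<Rightarrow> (real \<Rightarrow> ennreal) \<Rightarrow> ('a \<Rightarrow> real) \<Rightarrow> (('a \<Rightarrow> complex) \<times> ('a \<Rightarrow> complex)) set"
where
  "ae_rel M \<Phi> \<omega> =
     {(f, g). f \<in> weighted_orlicz_space M \<Phi> \<omega> \<and> g \<in> weighted_orlicz_space M \<Phi> \<omega> \<and>
              (AE s in M. f s = g s)}"

text \<open>The algebra of almost-everywhere classes. The operations are those on representatives,
  lifted in the manner of \<^theory>\<open>HOL.Equiv_Relations\<close>. The norm is constant on each class.\<close>

definition twisted_orlicz_star_alg ::
    "'a::group_add measure \<Rightarrow> (real \<Rightarrow> ennreal) \<Rightarrow> (real \<Rightarrow> ennreal) \<Rightarrow> ('a \<Rightarrow> 'a \<Rightarrow> complex) \<Rightarrow>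
     ('a \<Rightarrow> real) \<Rightarrow> ('a \<Rightarrow> complex) set star_alg"
where
  "twisted_orlicz_star_alg M \<Phi> \<Psi> \<Omega> \<omega> =
     (let cls = (\<lambda>f. ae_rel M \<Phi> \<omega> `` {f}) in
     \<lparr>acarrier = weighted_orlicz_space M \<Phi> \<omega> // ae_rel M \<Phi> \<omega>,
      azero = cls (\<lambda>_. 0),
      aadd = (\<lambda>X Y. \<Union>f\<in>X. \<Union>g\<in>Y. cls (\<lambda>s. f s + g s)),
      ascale = (\<lambda>c X. \<Union>f\<in>X. cls (\<lambda>s. c * f s)),
      amult = (\<lambda>X Y. \<Union>f\<in>X. \<Union>g\<in>Y. cls (twisted_conv M \<Omega> f g)),
      astar = (\<lambda>X. \<Union>f\<in>X. cls (twisted_star \<Omega> f)),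
      anorm = (\<lambda>X. enn2real (SUP f\<in>X. weighted_orlicz_norm M \<Psi> \<omega> f))\<rparr>)"

text \<open>The Bochner integral of a non-integrable function is \<open>0\<close>, so the existence (almost
  everywhere) of the integrals defining the twisted convolution is demanded separately.\<close>

definition twisted_orlicz_algebra ::
    "'a::group_add measure \<Rightarrow> (real \<Rightarrow> ennreal) \<Rightarrow> (real \<Rightarrow> ennreal) \<Rightarrow> ('a \<Rightarrow> 'a \<Rightarrow> complex) \<Rightarrow>
     ('a \<Rightarrow> real) \<Rightarrow> bool"
where
  "twisted_orlicz_algebra M \<Phi> \<Psi> \<Omega> \<omega> \<longleftrightarrow>
     (\<exists>K>0. \<forall>f\<in>weighted_orlicz_space M \<Phi> \<omega>. \<forall>g\<in>weighted_orlicz_space M \<Phi> \<omega>.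
        (AE t in M. integrable M (\<lambda>s. f s * g (- s + t) * \<Omega> s (- s + t))) \<and>
        twisted_conv M \<Omega> f g \<in> weighted_orlicz_space M \<Phi> \<omega> \<and>
        weighted_orlicz_norm M \<Psi> \<omega> (twisted_conv M \<Omega> f g)
          \<le> ennreal K * weighted_orlicz_norm M \<Psi> \<omega> f * weighted_orlicz_norm M \<Psi> \<omega> g)"

definition symmetric_twisted_orlicz_algebra ::
    "'a::group_add measure \<Rightarrow> (real \<Rightarrow> ennreal) \<Rightarrow> (real \<Rightarrow> ennreal) \<Rightarrow> ('a \<Rightarrow> 'a \<Rightarrow> complex) \<Rightarrow>
     ('a \<Rightarrow> real) \<Rightarrow> bool"
where
  "symmetric_twisted_orlicz_algebra M \<Phi> \<Psi> \<Omega> \<omega> \<longleftrightarrow>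
     twisted_orlicz_algebra M \<Phi> \<Psi> \<Omega> \<omega> \<and>
     banach_star_algebra (twisted_orlicz_star_alg M \<Phi> \<Psi> \<Omega> \<omega>) \<and>
     symmetric_algebra (twisted_orlicz_star_alg M \<Phi> \<Psi> \<Omega> \<omega>)"

end

theory Submission
  imports Defs "HOL-Real_Asymp.Real_Asymp"
begin

text \<open>
  Why the twisted Orlicz algebras are Banach \<open>*\<close>-algebras. Both families of weights have the
  form \<open>\<omega> = exp (h \<circ> \<tau>)\<close> with \<open>h\<close> so concave that adding a shorter element to a longer one gains
  a factor: \<open>\<omega> (s + t) \<le> K0 \<omega> s \<omega> t ((w s)\<^sup>2 + (w t)\<^sup>2)\<close> for a function \<open>w \<le> 1\<close> that decays
  faster than every power of \<open>\<tau>\<close> and is therefore integrable, by polynomial growth. For \<open>F, G \<ge>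
  0\<close> this gives \<open>(F * G) \<omega> \<le> K0 ((F \<omega> w\<^sup>2) * (G \<omega>) + (F \<omega>) * (G \<omega> w\<^sup>2))\<close>, and translation
  invariance (on both sides, since polynomial growth forces unimodularity) turns it into \<open>\<parallel>F *
  G\<parallel> \<le> K0 (core F \<parallel>G\<parallel> + \<parallel>F\<parallel> core G)\<close>, where \<open>core F\<close> is the integral of \<open>F \<omega> w\<^sup>2\<close> (lemma
  \<open>wnorm_nn_conv\<close>). Small multiples of \<open>w\<close> lie in the dual ball, so \<open>core\<close> is dominated by the
  norm and the norm is submultiplicative up to a constant.

  Why they are symmetric. Let \<open>I\<close> be the square-integrable elements of the algebra. It is a left
  ideal, it carries the inner product of \<open>L\<^sup>2\<close>, and the algebra acts on it by bounded operators
  that respect the involution. If \<open>c\<close> is not a nonnegative real, \<open>c - a\<^sup>* a\<close> is bounded below on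
  \<open>I\<close>, because \<open>a\<^sup>* a\<close> acts as a positive operator. What must be shown is that inverting \<open>c -
  a\<^sup>* a\<close> does not lead out of the algebra. Truncating \<open>a\<close> to \<open>g \<in> I\<close> splits \<open>a\<^sup>* a = h + b\<close> with
  \<open>h = (a - g)\<^sup>* (a - g)\<close> of small norm and \<open>b \<in> I\<close>; then \<open>c - a\<^sup>* a = (c - h) (1 - x)\<close> with \<open>x
  \<in> I\<close>, the first factor is invertible by a Neumann series, and the question becomes whether \<open>S
  = (1 - x)\<^sup>* (1 - x)\<close>, of the form \<open>1 + y\<close> with \<open>y \<in> I\<close> and bounded below, has a left inverse.

  For small \<open>t > 0\<close> the element \<open>z = 1 - t S\<close> is a strict contraction in \<open>L\<^sup>2\<close>, so the component
  \<open>Y k\<close> of \<open>z ^ 2 ^ k\<close> in \<open>I\<close> is doubly exponentially small in \<open>L\<^sup>2\<close>. To pass from \<open>L\<^sup>2\<close> to the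
  weighted norm one splits the group at a radius depending on \<open>k\<close>: inside it \<open>\<omega>\<close> is at most \<open>exp
  (\<kappa> 2 ^ k)\<close>, which the decay in \<open>L\<^sup>2\<close> pays for, and outside it the gain \<open>w\<close> is at most some \<open>\<delta>
  k\<close>. The outcome is \<open>\<parallel>Y (k + 1)\<parallel> \<le> K (\<delta> k) \<parallel>Y k\<parallel>\<^sup>2\<close> as long as \<open>\<parallel>Y k\<parallel>\<close> is not small. Taking
  logarithms and dividing by powers of two, such a sequence must become small as soon as \<open>\<Sum> ln
  (1 / \<delta> k) / 2 ^ k\<close> diverges (lemma \<open>doubling_recursion_becomes_small\<close>). For \<open>exp (C \<tau>\<^sup>\<alpha>)\<close> the
  terms of this series are eventually bounded below by a positive constant; for \<open>exp (C \<tau> / (ln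
  (e + \<tau>))\<^sup>\<gamma>)\<close> they behave like the harmonic series. Once \<open>Y k\<close> is small, \<open>1 - z ^ 2 ^ k\<close> has a
  left inverse, and the factorization \<open>1 - u\<^sup>2 = (1 + u) (1 - u)\<close>, applied \<open>k\<close> times, yields one
  for \<open>1 - z = t S\<close> (lemma \<open>linv_of_bounded_below\<close>).

  The group need not be second countable, so the Borel sets of \<open>G \<times> G\<close> may properly contain the
  product \<open>\<sigma>\<close>-algebra. Interchanging integrals of continuous-times-Borel kernels therefore rests
  on the regularity of Haar measure (theorem \<open>Tonelli_borel\<close>).
\<close>

section \<open>Iterated integrals of Borel functions on a product\<close>

lemma SUP_sum_directed_ennreal:
  fixes f :: "'b \<Rightarrow> 'c \<Rightarrow> ennreal"
  assumes "finite J" and "I \<noteq> {}"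
    and directed: "\<And>i k. i \<in> I \<Longrightarrow> k \<in> I \<Longrightarrow> \<exists>l\<in>I. \<forall>j\<in>J. f i j \<le> f l j \<and> f k j \<le> f l j"
  shows "(SUP i\<in>I. \<Sum>j\<in>J. f i j) = (\<Sum>j\<in>J. SUP i\<in>I. f i j)"
  using assms(1) directed
proof (induction J rule: finite_induct)
  case empty
  then show ?case using \<open>I \<noteq> {}\<close> by simp
next
  case (insert j J)
  have "(SUP i\<in>I. f i j + (\<Sum>j\<in>J. f i j)) = (SUP i\<in>I. f i j) + (SUP i\<in>I. \<Sum>j\<in>J. f i j)"
  proof (rule SUP_add_directed_ennreal)
    fix i k assume "i \<in> I" "k \<in> I"
    then obtain l where l: "l \<in> I" "\<forall>j'\<in>insert j J. f i j' \<le> f l j' \<and> f k j' \<le> f l j'"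
      using insert.prems by blast
    then show "\<exists>l\<in>I. f i j + (\<Sum>j\<in>J. f k j) \<le> f l j + (\<Sum>j\<in>J. f l j)"
      by (intro bexI[of _ l] add_mono sum_mono) auto
  qed
  moreover have "(SUP i\<in>I. \<Sum>j\<in>J. f i j) = (\<Sum>j\<in>J. SUP i\<in>I. f i j)"
    by (rule insert.IH) (use insert.prems in blast)
  ultimately show ?case using insert.hyps by simp
qed

text \<open>A measure that is regular on open sets and for which countably many open sets of finite
  measure cover the space. The sets \<open>W n\<close> are kept as parameters because truncation to \<open>W n \<times> W
  n\<close> is what makes complements of Borel sets tractable in the Tonelli theorem below.\<close>

locale sigma_finite_radon =
  fixes M :: "'a::t2_space measure" and W :: "nat \<Rightarrow> 'a set"
  assumes sets_M [measurable_cong, simp]: "sets M = sets borel"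
    and inner_regular:
      "open V \<Longrightarrow> emeasure M V = (SUP K\<in>{K. compact K \<and> K \<subseteq> V}. emeasure M K)"
    and open_W: "open (W n)"
    and incseq_W: "incseq W"
    and Union_W: "(\<Union>n. W n) = UNIV"
    and finite_W: "emeasure M (W n) < \<infinity>"
begin

lemma space_M [simp]: "space M = UNIV"
  using sets_eq_imp_space_eq[OF sets_M] by simp

sublocale sigma_finite_measure M
proof
  show "\<exists>A. countable A \<and> A \<subseteq> sets M \<and> \<Union> A = space M \<and> (\<forall>a\<in>A. emeasure M a \<noteq> \<infinity>)"
    using open_W Union_W finite_W by (intro exI[of _ "range W"]) (auto simp: less_top)
qed

sublocale pair: pair_sigma_finite M M ..

lemma slice_borel [measurable]:
  fixes E :: "('a \<times> 'b::topological_space) set"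
  assumes "E \<in> sets borel" shows "{t. (s, t) \<in> E} \<in> sets borel"
proof -
  have "(\<lambda>t. (s, t)) -` E \<inter> space borel \<in> sets borel"
    by (rule measurable_sets[OF borel_measurable_continuous_onI assms]) (intro continuous_intros)
  then show ?thesis by (simp add: vimage_def)
qed

lemma slice_borel2 [measurable]:
  fixes E :: "('b::topological_space \<times> 'a) set"
  assumes "E \<in> sets borel" shows "{s. (s, t) \<in> E} \<in> sets borel"
proof -
  have "(\<lambda>s. (s, t)) -` E \<inter> space borel \<in> sets borel"
    by (rule measurable_sets[OF borel_measurable_continuous_onI assms]) (intro continuous_intros)
  then show ?thesis by (simp add: vimage_def)
qed

text \<open>Slices of an open set are open, hence exhausted by compact sets; by the tube lemma a
  compact part of one slice is contained in all neighbouring slices. This makes the measure of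
  the slice lower semicontinuous.\<close>

lemma open_slice_tube:
  fixes V :: "('a \<times> 'a) set"
  assumes V: "open V" and c: "c < emeasure M {t. (s, t) \<in> V}"
  obtains A K where "open A" "s \<in> A" "compact K" "A \<times> K \<subseteq> V" "c < emeasure M K"
proof -
  have "open ((\<lambda>t. (s, t)) -` V)" using V by (intro open_vimage continuous_intros)
  then have "open {t. (s, t) \<in> V}" by (simp add: vimage_def)
  from c[unfolded inner_regular[OF this] less_SUP_iff] obtain K
    where K: "compact K" "K \<subseteq> {t. (s, t) \<in> V}" "c < emeasure M K" by auto
  then show ?thesis
    using Elementary_Topology.tube_lemma[OF K(1) V, of s] that by auto
qed

lemma open_slice_superlevel:
  fixes V :: "('a \<times> 'a) set"
  assumes V: "open V" shows "open {s. c < emeasure M {t. (s, t) \<in> V}}"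
proof (subst open_subopen, safe)
  fix s assume "c < emeasure M {t. (s, t) \<in> V}"
  then obtain A K where A: "open A" "s \<in> A" "compact K" "A \<times> K \<subseteq> V" "c < emeasure M K"
    using open_slice_tube[OF V] by blast
  have "c < emeasure M {t. (r, t) \<in> V}" if "r \<in> A" for r
  proof -
    have "emeasure M K \<le> emeasure M {t. (r, t) \<in> V}"
      using A(4) that V by (intro emeasure_mono) auto
    then show ?thesis using A by simp
  qed
  with A show "\<exists>T. open T \<and> s \<in> T \<and> T \<subseteq> {s. c < emeasure M {t. (s, t) \<in> V}}" by blast
qed

lemma borel_measurable_open_slice:
  fixes V :: "('a \<times> 'a) set"
  assumes "open V" shows "(\<lambda>s. emeasure M {t. (s, t) \<in> V}) \<in> borel_measurable M"
  using open_slice_superlevel[OF assms] by (intro borel_measurableI_greater) simp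

text \<open>Finite unions of Borel rectangles belong to the product \<open>\<sigma>\<close>-algebra, where Tonelli's
  theorem for product measures applies; open sets of the topological product need not belong to
  it.\<close>

definition rectangle_unions :: "('a \<times> 'a) set \<Rightarrow> ('a \<times> 'a) set set" where
  "rectangle_unions V = {R. R \<subseteq> V \<and> (\<exists>F. finite F \<and> F \<subseteq> sets borel \<times> sets borel \<and>
      R = (\<Union>(A, B)\<in>F. A \<times> B))}"

lemma rectangle_unions_Un:
  assumes "R \<in> rectangle_unions V" "S \<in> rectangle_unions V" shows "R \<union> S \<in> rectangle_unions V"
proof -
  obtain F G where "finite F" "F \<subseteq> sets borel \<times> sets borel" "R = (\<Union>(A, B)\<in>F. A \<times> B)"
    "finite G" "G \<subseteq> sets borel \<times> sets borel" "S = (\<Union>(A, B)\<in>G. A \<times> B)"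
    using assms by (auto simp: rectangle_unions_def)
  then show ?thesis using assms unfolding rectangle_unions_def
    by (auto intro!: exI[of _ "F \<union> G"])
qed

lemma rectangle_unions_sets: "R \<in> rectangle_unions V \<Longrightarrow> R \<in> sets (M \<Otimes>\<^sub>M M)"
  unfolding rectangle_unions_def by (auto intro!: sets.finite_UN pair_measureI simp: subset_eq)

text \<open>A compact subset of the superlevel set is covered by finitely many of the tubes of
  \<open>open_slice_tube\<close>, whose union already has slices of measure above \<open>c\<close> over that compact set.\<close>

lemma rectangle_unions_superlevel:
  assumes V: "open V"
  shows "emeasure M {s. c < emeasure M {t. (s, t) \<in> V}}
    \<le> (SUP R\<in>rectangle_unions V. emeasure M {s. c < emeasure M {t. (s, t) \<in> R}})"
  unfolding inner_regular[OF open_slice_superlevel[OF V]]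
proof (rule SUP_least, safe)
  fix K assume K: "compact K" "K \<subseteq> {s. c < emeasure M {t. (s, t) \<in> V}}"
  have "\<forall>s\<in>K. \<exists>A L. open A \<and> s \<in> A \<and> compact L \<and> A \<times> L \<subseteq> V \<and> c < emeasure M L"
  proof
    fix s assume "s \<in> K"
    with K(2) have "c < emeasure M {t. (s, t) \<in> V}" by auto
    from open_slice_tube[OF V this] obtain A L
      where "open A" "s \<in> A" "compact L" "A \<times> L \<subseteq> V" "c < emeasure M L" .
    then show "\<exists>A L. open A \<and> s \<in> A \<and> compact L \<and> A \<times> L \<subseteq> V \<and> c < emeasure M L" by blast
  qed
  then obtain A L where AL: "\<And>s. s \<in> K \<Longrightarrow> open (A s) \<and> s \<in> A s \<and> compact (L s) \<and>
      A s \<times> L s \<subseteq> V \<and> c < emeasure M (L s)" by metis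
  obtain D where D: "D \<subseteq> K" "finite D" "K \<subseteq> (\<Union>s\<in>D. A s)"
    using compactE_image[OF K(1), of K A] AL by (metis UN_I subsetI)
  define R where "R = (\<Union>(A, B)\<in>(\<lambda>s. (A s, L s)) ` D. A \<times> B)"
  have R: "R \<in> rectangle_unions V"
    unfolding rectangle_unions_def
  proof (intro CollectI conjI exI)
    show "R \<subseteq> V" using D(1) AL by (auto simp: R_def)
    show "(\<lambda>s. (A s, L s)) ` D \<subseteq> sets borel \<times> sets borel"
      using D(1) AL by (auto intro: borel_open borel_compact)
  qed (use D(2) R_def in auto)
  have [measurable]: "R \<in> sets (M \<Otimes>\<^sub>M M)" using rectangle_unions_sets[OF R] .
  have [measurable]: "(\<lambda>s. emeasure M {t. (s, t) \<in> R}) \<in> borel_measurable M"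
    using measurable_emeasure_Pair[of R M] by (simp add: vimage_def)
  have "c < emeasure M {t. (s, t) \<in> R}" if "s \<in> K" for s
  proof -
    obtain r where r: "r \<in> D" "s \<in> A r" using D(3) \<open>s \<in> K\<close> by auto
    have "{t. (s, t) \<in> R} \<in> sets M" using sets_Pair1[OF \<open>R \<in> sets (M \<Otimes>\<^sub>M M)\<close>, of s]
      by (simp add: vimage_def)
    then have "emeasure M (L r) \<le> emeasure M {t. (s, t) \<in> R}"
      using r by (intro emeasure_mono) (auto simp: R_def)
    then show ?thesis using AL r D by (meson less_le_trans subsetD)
  qed
  then have "emeasure M K \<le> emeasure M {s. c < emeasure M {t. (s, t) \<in> R}}"
    by (intro emeasure_mono) (auto simp del: sets_M)
  then show "emeasure M K \<le> (SUP R\<in>rectangle_unions V. emeasure M {s. c < emeasure M {t. (s, t) \<in> R}})"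
    using R by (rule_tac SUP_upper2)
qed

text \<open>The sum of steps of height \<open>d\<close> at the multiples of \<open>d\<close> below \<open>x\<close> is a lower approximation
  of \<open>x\<close>. It expresses a function through its superlevel sets, which are open for slices of open
  sets.\<close>

lemma step_sum_le:
  fixes x :: ennreal and d :: real
  assumes "0 < d"
  shows "(\<Sum>j\<in>{1..m::nat}. ennreal d * indicator {ennreal (j * d)<..} x) \<le> x"
proof (cases x)
  case (real r)
  have "(\<Sum>j\<in>{1..m::nat}. ennreal d * indicator {ennreal (j * d)<..} x)
      = (\<Sum>j\<in>{j\<in>{1..m}. j * d < r}. ennreal d)"
    using assms real
    by (subst sum.inter_filter[OF finite_atLeastAtMost])
      (intro sum.cong refl, simp add: indicator_def ennreal_less_iff)
  also have "\<dots> = ennreal (card {j\<in>{1..m}. j * d < r} * d)"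
    using assms by (simp add: ennreal_of_nat_eq_real_of_nat ennreal_mult'')
  also have "\<dots> \<le> ennreal r"
  proof (rule ennreal_leI)
    have "j \<le> nat \<lfloor>r / d\<rfloor>" if "j * d < r" for j :: nat
      using that assms by (simp add: le_nat_floor pos_le_divide_eq)
    then have "{j\<in>{1..m}. j * d < r} \<subseteq> {1..nat \<lfloor>r / d\<rfloor>}" by auto
    from card_mono[OF _ this] have "card {j\<in>{1..m}. j * d < r} \<le> nat \<lfloor>r / d\<rfloor>" by simp
    then have "card {j\<in>{1..m}. j * d < r} \<le> r / d" using real assms
      by (meson divide_nonneg_pos of_nat_floor of_nat_mono order_trans)
    then show "card {j\<in>{1..m}. j * d < r} * d \<le> r" using assms by (simp add: pos_le_divide_eq)
  qed
  finally show ?thesis using real by simp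
qed simp

lemma le_liminf_step_sum:
  fixes x :: ennreal
  shows "x \<le> liminf (\<lambda>n. \<Sum>j\<in>{1..(n+1)^2}.
     ennreal (1 / real (n+1)) * indicator {ennreal (j * (1 / real (n+1)))<..} x)"
  unfolding le_Liminf_iff
proof safe
  fix y assume "y < x"
  then obtain z where z: "y < z" "z < x" using dense by blast
  then obtain y' z' where yz: "y = ennreal y'" "0 \<le> y'" "z = ennreal z'" "0 \<le> z'"
    by (metis ennreal_cases not_less top_greatest)
  have yz': "y' < z'" using z yz by (simp add: ennreal_less_iff)
  obtain N :: nat where N: "1 / (z' - y') < real N" "z' < real N"
    using reals_Archimedean2[of "max (1 / (z' - y')) z'"] by auto
  show "\<forall>\<^sub>F n in sequentially. y < (\<Sum>j\<in>{1..(n+1)^2}.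
     ennreal (1 / real (n+1)) * indicator {ennreal (j * (1 / real (n+1)))<..} x)"
  proof (rule eventually_sequentiallyI)
    fix n assume n: "N \<le> n"
    define d where "d = 1 / real (n+1)"
    have d: "0 < d" by (simp add: d_def)
    have dlt: "d < z' - y'"
    proof -
      have "1 / (z' - y') < real (n+1)" using N n by simp
      then show ?thesis using yz' by (simp add: d_def field_simps)
    qed
    define k where "k = nat \<lfloor>z' / d\<rfloor>"
    have kle: "real k * d \<le> z'"
      using yz(4) d by (simp add: k_def pos_le_divide_eq[symmetric])
    have kgt: "z' - d < real k * d"
    proof -
      have "z' / d < real k + 1" using yz(4) d unfolding k_def by linarith
      then have "z' < (real k + 1) * d" using d by (simp add: pos_divide_less_eq)
      then show ?thesis by (simp add: algebra_simps)
    qed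
    have "real k \<le> z' * real (n+1)" using kle by (simp add: d_def field_simps)
    also have "\<dots> \<le> real (n+1) * real (n+1)" using N n by (intro mult_right_mono) auto
    finally have km: "k \<le> (n+1)^2"
      by (metis of_nat_le_iff of_nat_mult power2_eq_square)
    have "y < ennreal (real k * d)"
      using yz dlt kgt by (simp add: ennreal_less_iff)
    also have "\<dots> = (\<Sum>j\<in>{1..k}. ennreal d)"
      using d by (simp add: ennreal_of_nat_eq_real_of_nat ennreal_mult'')
    also have "\<dots> = (\<Sum>j\<in>{1..k}. ennreal d * indicator {ennreal (j * d)<..} x)"
    proof (rule sum.cong[OF refl])
      fix j assume "j \<in> {1..k}"
      then have "real j * d \<le> real k * d" using d by (intro mult_right_mono) auto
      then have "ennreal (j * d) \<le> z" using kle yz by (auto intro!: ennreal_leI)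
      then show "ennreal d = ennreal d * indicator {ennreal (j * d)<..} x"
        using z(2) by auto
    qed
    also have "\<dots> \<le> (\<Sum>j\<in>{1..(n+1)^2}. ennreal d * indicator {ennreal (j * d)<..} x)"
      using km by (intro sum_mono2) auto
    finally show "y < (\<Sum>j\<in>{1..(n+1)^2}.
      ennreal (1 / real (n+1)) * indicator {ennreal (j * (1 / real (n+1)))<..} x)"
      by (simp add: d_def)
  qed
qed

text \<open>The family of rectangle unions inside an open set is directed but uncountable, so monotone
  convergence is not available. Instead the slice function is approximated by finitely many
  superlevel sets; the measure of each of them is the supremum over rectangle unions by inner
  regularity, and directed suprema commute with finite sums.\<close>

lemma nn_integral_open_slice_le_SUP:
  assumes V: "open V"
  shows "(\<integral>\<^sup>+s. emeasure M {t. (s, t) \<in> V} \<partial>M)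
    \<le> (SUP R\<in>rectangle_unions V. \<integral>\<^sup>+s. emeasure M {t. (s, t) \<in> R} \<partial>M)" (is "_ \<le> ?S")
proof -
  define h where "h R s = emeasure M {t. (s, t) \<in> R}" for R :: "('a \<times> 'a) set" and s
  have [measurable]: "h V \<in> borel_measurable M"
    unfolding h_def[abs_def] by (rule borel_measurable_open_slice[OF V])
  have hR: "h R \<in> borel_measurable M" if "R \<in> rectangle_unions V" for R
    using measurable_emeasure_Pair[OF rectangle_unions_sets[OF that]]
    by (simp add: vimage_def h_def[abs_def])
  have h_mono: "h R s \<le> h S s" if "R \<subseteq> S" "S \<in> rectangle_unions V" for R S s
    unfolding h_def using that(1) sets_Pair1[OF rectangle_unions_sets[OF that(2)], of s]
    by (intro emeasure_mono) (auto simp: vimage_def)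
  define u where "u R n s = (\<Sum>j\<in>{1..(n+1)^2}. ennreal (1 / real (n+1)) *
      indicator {ennreal (real j * (1 / real (n+1)))<..} (h R s))" for R n s
  have int_u: "(\<integral>\<^sup>+s. u R n s \<partial>M) = (\<Sum>j\<in>{1..(n+1)^2}. ennreal (1 / real (n+1)) *
      emeasure M {s. ennreal (real j * (1 / real (n+1))) < h R s})"
    if [measurable]: "h R \<in> borel_measurable M" for R n
  proof -
    have "(\<integral>\<^sup>+s. indicator {c<..} (h R s) \<partial>M) = emeasure M {s. c < h R s}" for c
    proof -
      have "{s. c < h R s} = {s \<in> space M. c < h R s}" by simp
      also have "\<dots> \<in> sets M" by measurable
      finally have "emeasure M {s. c < h R s} = (\<integral>\<^sup>+s. indicator {s. c < h R s} s \<partial>M)"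
        by (rule nn_integral_indicator[symmetric])
      then show ?thesis by (simp add: indicator_def)
    qed
    then show ?thesis unfolding u_def
      by (subst nn_integral_sum) (auto simp: nn_integral_cmult)
  qed
  have ne: "rectangle_unions V \<noteq> {}"
    unfolding rectangle_unions_def by (auto intro!: exI[of _ "{}"])
  have dir: "\<exists>T\<in>rectangle_unions V. \<forall>j\<in>J. b R j \<le> b T j \<and> b S j \<le> b T j"
    if "R \<in> rectangle_unions V" "S \<in> rectangle_unions V"
      "\<And>R T j. R \<subseteq> T \<Longrightarrow> T \<in> rectangle_unions V \<Longrightarrow> b R j \<le> b T j" for R S and b :: "_ \<Rightarrow> nat \<Rightarrow> ennreal" and J
    using rectangle_unions_Un[OF that(1,2)] that(3)[of R "R \<union> S"] that(3)[of S "R \<union> S"]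
    by (intro bexI[of _ "R \<union> S"]) auto
  have "(\<integral>\<^sup>+s. u V n s \<partial>M) \<le> ?S" for n
  proof -
    define b where "b R j = ennreal (1 / real (n+1)) *
      emeasure M {s. ennreal (real j * (1 / real (n+1))) < h R s}" for R and j :: nat
    have b_mono: "b R j \<le> b T j" if "R \<subseteq> T" "T \<in> rectangle_unions V" for R T j
    proof -
      have "{s \<in> space M. ennreal (real j * (1 / real (n+1))) < h T s} \<in> sets M"
        using hR[OF that(2)] by measurable
      then show ?thesis unfolding b_def using h_mono[OF that]
        by (intro mult_left_mono emeasure_mono) (auto intro: less_le_trans)
    qed
    have "(\<integral>\<^sup>+s. u V n s \<partial>M) \<le> (\<Sum>j\<in>{1..(n+1)^2}. SUP R\<in>rectangle_unions V. b R j)"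
      unfolding int_u[OF \<open>h V \<in> borel_measurable M\<close>] b_def SUP_mult_left_ennreal[symmetric]
      by (intro sum_mono mult_left_mono) (use rectangle_unions_superlevel[OF V] in \<open>auto simp: h_def\<close>)
    also have "\<dots> = (SUP R\<in>rectangle_unions V. \<Sum>j\<in>{1..(n+1)^2}. b R j)"
      by (rule SUP_sum_directed_ennreal[symmetric]) (use dir b_mono ne in auto)
    also have "\<dots> = (SUP R\<in>rectangle_unions V. \<integral>\<^sup>+s. u R n s \<partial>M)"
      by (intro SUP_cong) (simp_all only: int_u hR b_def)
    also have "\<dots> \<le> ?S"
      unfolding u_def
      by (intro SUP_mono' nn_integral_mono) (simp only: h_def[symmetric], rule step_sum_le, simp)
    finally show ?thesis .
  qed
  then have "liminf (\<lambda>n. \<integral>\<^sup>+s. u V n s \<partial>M) \<le> ?S"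
    by (intro Liminf_le) auto
  have "(\<integral>\<^sup>+s. h V s \<partial>M) \<le> (\<integral>\<^sup>+s. liminf (\<lambda>n. u V n s) \<partial>M)"
    unfolding u_def by (intro nn_integral_mono le_liminf_step_sum)
  also have "\<dots> \<le> liminf (\<lambda>n. \<integral>\<^sup>+s. u V n s \<partial>M)"
    by (rule nn_integral_liminf) (simp add: u_def[abs_def])
  also have "\<dots> \<le> ?S" by fact
  finally show ?thesis by (simp add: h_def)
qed

lemma open_swap: "open (prod.swap -` V)" if "open V" for V :: "('a \<times> 'a) set"
  using that by (intro open_vimage continuous_intros) (auto simp: prod.swap_def intro!: continuous_intros)

text \<open>For rectangle unions both iterated integrals are the product measure, so each of them is
  below the other iterated integral of the open set.\<close>

lemma nn_integral_open_slice_le_swap: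
  assumes V: "open V"
  shows "(\<integral>\<^sup>+s. emeasure M {t. (s, t) \<in> V} \<partial>M) \<le> (\<integral>\<^sup>+t. emeasure M {s. (s, t) \<in> V} \<partial>M)"
proof -
  have "(\<integral>\<^sup>+s. emeasure M {t. (s, t) \<in> R} \<partial>M) \<le> (\<integral>\<^sup>+t. emeasure M {s. (s, t) \<in> V} \<partial>M)"
    if R: "R \<in> rectangle_unions V" for R
  proof -
    have "(\<integral>\<^sup>+s. emeasure M {t. (s, t) \<in> R} \<partial>M) = emeasure (M \<Otimes>\<^sub>M M) R"
      using emeasure_pair_measure_alt[OF rectangle_unions_sets[OF R]] by (simp add: vimage_def)
    also have "\<dots> = (\<integral>\<^sup>+t. emeasure M {s. (s, t) \<in> R} \<partial>M)"
      using pair.emeasure_pair_measure_alt2[OF rectangle_unions_sets[OF R]] by (simp add: vimage_def)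
    also have "\<dots> \<le> (\<integral>\<^sup>+t. emeasure M {s. (s, t) \<in> V} \<partial>M)"
      using R V by (intro nn_integral_mono emeasure_mono) (auto simp: rectangle_unions_def)
    finally show ?thesis .
  qed
  then show ?thesis
    by (intro order_trans[OF nn_integral_open_slice_le_SUP[OF V]] SUP_least)
qed

lemma nn_integral_open_slice_swap:
  assumes V: "open V"
  shows "(\<integral>\<^sup>+s. emeasure M {t. (s, t) \<in> V} \<partial>M) = (\<integral>\<^sup>+t. emeasure M {s. (s, t) \<in> V} \<partial>M)"
  using nn_integral_open_slice_le_swap[OF V] nn_integral_open_slice_le_swap[OF open_swap[OF V]]
  by (intro antisym) auto

definition tonelli :: "('a \<times> 'a \<Rightarrow> ennreal) \<Rightarrow> bool" where
  "tonelli F \<longleftrightarrow> (\<lambda>s. \<integral>\<^sup>+t. F (s, t) \<partial>M) \<in> borel_measurable M \<and>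
     (\<lambda>t. \<integral>\<^sup>+s. F (s, t) \<partial>M) \<in> borel_measurable M \<and>
     (\<integral>\<^sup>+s. \<integral>\<^sup>+t. F (s, t) \<partial>M \<partial>M) = (\<integral>\<^sup>+t. \<integral>\<^sup>+s. F (s, t) \<partial>M \<partial>M)"

lemma measurable_slices:
  fixes F :: "'a \<times> 'a \<Rightarrow> 'c::topological_space"
  assumes "F \<in> borel_measurable borel"
  shows "(\<lambda>t. F (s, t)) \<in> borel_measurable M" "(\<lambda>s. F (s, t)) \<in> borel_measurable M"
proof -
  have "(\<lambda>t. (s, t)) \<in> measurable borel (borel :: ('a \<times> 'a) measure)"
    "(\<lambda>s. (s, t)) \<in> measurable borel (borel :: ('a \<times> 'a) measure)"
    by (intro borel_measurable_continuous_onI continuous_intros)+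
  from this[THEN measurable_compose, OF assms]
  show "(\<lambda>t. F (s, t)) \<in> borel_measurable M" "(\<lambda>s. F (s, t)) \<in> borel_measurable M"
    by (simp_all add: measurable_cong_sets[OF sets_M refl])
qed

lemma tonelli_SUP:
  assumes F: "\<And>i. F i \<in> borel_measurable borel" "\<And>i. tonelli (F i)" "incseq F"
  shows "tonelli (\<lambda>x. SUP i. F i x)"
proof -
  note [measurable] = measurable_slices[OF F(1)]
  have T: "(\<lambda>s. \<integral>\<^sup>+t. F i (s, t) \<partial>M) \<in> borel_measurable M"
    "(\<lambda>t. \<integral>\<^sup>+s. F i (s, t) \<partial>M) \<in> borel_measurable M" for i
    using F(2)[of i] by (simp_all add: tonelli_def)
  note [measurable] = T
  have 1: "(\<integral>\<^sup>+t. (SUP i. F i (s, t)) \<partial>M) = (SUP i. \<integral>\<^sup>+t. F i (s, t) \<partial>M)" for s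
    using F(3) by (intro nn_integral_monotone_convergence_SUP) (auto simp: incseq_def le_fun_def)
  have 2: "(\<integral>\<^sup>+s. (SUP i. F i (s, t)) \<partial>M) = (SUP i. \<integral>\<^sup>+s. F i (s, t) \<partial>M)" for t
    using F(3) by (intro nn_integral_monotone_convergence_SUP) (auto simp: incseq_def le_fun_def)
  have "(\<integral>\<^sup>+s. (SUP i. \<integral>\<^sup>+t. F i (s, t) \<partial>M) \<partial>M) = (SUP i. \<integral>\<^sup>+s. \<integral>\<^sup>+t. F i (s, t) \<partial>M \<partial>M)"
    using F(3) by (intro nn_integral_monotone_convergence_SUP)
      (auto simp: incseq_def le_fun_def intro!: nn_integral_mono)
  also have "\<dots> = (SUP i. \<integral>\<^sup>+t. \<integral>\<^sup>+s. F i (s, t) \<partial>M \<partial>M)"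
    using F(2) by (simp add: tonelli_def)
  also have "\<dots> = (\<integral>\<^sup>+t. (SUP i. \<integral>\<^sup>+s. F i (s, t) \<partial>M) \<partial>M)"
    using F(3) by (intro nn_integral_monotone_convergence_SUP[symmetric])
      (auto simp: incseq_def le_fun_def intro!: nn_integral_mono)
  finally show ?thesis unfolding tonelli_def 1 2 by simp
qed

lemma tonelli_add:
  assumes F: "F \<in> borel_measurable borel" "tonelli F" and G: "G \<in> borel_measurable borel" "tonelli G"
  shows "tonelli (\<lambda>x. F x + G x)"
proof -
  note [measurable] = measurable_slices[OF F(1)] measurable_slices[OF G(1)]
  show ?thesis using F(2) G(2) unfolding tonelli_def by (auto simp: nn_integral_add)
qed

lemma tonelli_cmult:
  assumes F: "F \<in> borel_measurable borel" "tonelli F"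
  shows "tonelli (\<lambda>x. c * F x)"
proof -
  note [measurable] = measurable_slices[OF F(1)]
  show ?thesis using F(2) unfolding tonelli_def by (auto simp: nn_integral_cmult)
qed

text \<open>Induction over the Borel \<open>\<sigma>\<close>-algebra, starting from open sets. Inside \<open>W n \<times> W n\<close> all
  integrals are finite, which the step to complements needs in order to subtract.\<close>

lemma tonelli_indicator_window:
  assumes E: "E \<in> sets (borel :: ('a \<times> 'a) measure)"
  shows "tonelli (indicator (E \<inter> W n \<times> W n))"
proof -
  have sl: "(\<integral>\<^sup>+t. indicator E (s, t) \<partial>M) = emeasure M {t. (s, t) \<in> E}"
       "(\<integral>\<^sup>+s. indicator E (s, t) \<partial>M) = emeasure M {s. (s, t) \<in> E}"
      if "E \<in> sets borel" for E :: "('a \<times> 'a) set" and s t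
  proof -
    have "(\<integral>\<^sup>+t. indicator E (s, t) \<partial>M) = (\<integral>\<^sup>+t. indicator {t. (s, t) \<in> E} t \<partial>M)"
      by (simp add: indicator_def)
    also have "\<dots> = emeasure M {t. (s, t) \<in> E}" using that by (subst nn_integral_indicator) auto
    finally show "(\<integral>\<^sup>+t. indicator E (s, t) \<partial>M) = emeasure M {t. (s, t) \<in> E}" .
    have "(\<integral>\<^sup>+s. indicator E (s, t) \<partial>M) = (\<integral>\<^sup>+s. indicator {s. (s, t) \<in> E} s \<partial>M)"
      by (simp add: indicator_def)
    also have "\<dots> = emeasure M {s. (s, t) \<in> E}" using that by (subst nn_integral_indicator) auto
    finally show "(\<integral>\<^sup>+s. indicator E (s, t) \<partial>M) = emeasure M {s. (s, t) \<in> E}" .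
  qed
  have opn: "tonelli (indicator V)" if V: "open V" for V
  proof -
    have "(\<lambda>t. emeasure M {s. (s, t) \<in> V}) \<in> borel_measurable M"
      using borel_measurable_open_slice[OF open_swap[OF V]] by simp
    then show ?thesis
    using borel_measurable_open_slice[OF V]
      nn_integral_open_slice_swap[OF V] V
    by (simp add: tonelli_def sl borel_open)
  qed
  let ?Q = "W n \<times> W n"
  have Q: "open ?Q" using open_W by (intro open_Times)
  have "Int_stable {S :: ('a \<times> 'a) set. open S}" "{S :: ('a \<times> 'a) set. open S} \<subseteq> Pow UNIV"
    "E \<in> sigma_sets UNIV {S. open S}" using E by (auto simp: borel_def Int_stable_def)
  then show ?thesis
  proof (induction E rule: sigma_sets_induct_disjoint)
    case (basic A)
    then show ?case using Q by (intro opn) auto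
  next
    case empty
    show ?case by (simp only: Int_empty_left opn open_empty)
  next
    case (compl A)
    then have A: "A \<in> sets borel" by (simp add: borel_def)
    have AQ: "A \<inter> ?Q \<in> sets borel" "(UNIV - A) \<inter> ?Q \<in> sets borel" using A Q by auto
    define a where "a s = (\<integral>\<^sup>+t. indicator (A \<inter> ?Q) (s, t) \<partial>M)" for s
    define a' where "a' t = (\<integral>\<^sup>+s. indicator (A \<inter> ?Q) (s, t) \<partial>M)" for t
    have [measurable]: "a \<in> borel_measurable M" "a' \<in> borel_measurable M"
      and aa: "(\<integral>\<^sup>+s. a s \<partial>M) = (\<integral>\<^sup>+t. a' t \<partial>M)"
      using compl by (simp_all add: tonelli_def a_def[abs_def] a'_def[abs_def])
    define q where "q s = indicator (W n) s * emeasure M (W n)" for s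
    have [measurable]: "W n \<in> sets M" using open_W by auto
    have [measurable]: "q \<in> borel_measurable M" unfolding q_def[abs_def] by measurable
    have q: "(\<integral>\<^sup>+t. indicator ?Q (s, t) \<partial>M) = q s" "(\<integral>\<^sup>+t. indicator ?Q (t, s) \<partial>M) = q s" for s
      using open_W by (auto simp: q_def indicator_times nn_integral_cmult nn_integral_multc mult.commute)
    have qfin: "q s < \<infinity>" for s using finite_W by (auto simp: q_def indicator_def less_top)
    have fin: "a s \<le> q s" "a' s \<le> q s" for s
      unfolding a_def a'_def q[symmetric] by (auto intro!: nn_integral_mono simp: indicator_def)
    have dec: "indicator ((UNIV - A) \<inter> ?Q) x = indicator ?Q x - (indicator (A \<inter> ?Q) x :: ennreal)" for x
      by (auto simp: indicator_def)
    note mm = borel_measurable_indicator[OF borel_open[OF Q]] borel_measurable_indicator[OF AQ(1)]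
    have 1: "(\<integral>\<^sup>+t. indicator ((UNIV - A) \<inter> ?Q) (s, t) \<partial>M) = q s - a s" for s
      unfolding dec q(1)[symmetric] a_def
    proof (intro nn_integral_diff measurable_slices mm)
      show "(\<integral>\<^sup>+t. indicator (A \<inter> ?Q) (s, t) \<partial>M) \<noteq> \<infinity>"
        using le_less_trans[OF fin(1)[of s] qfin] unfolding a_def by auto
    qed (auto simp: indicator_def)
    have 2: "(\<integral>\<^sup>+t. indicator ((UNIV - A) \<inter> ?Q) (t, s) \<partial>M) = q s - a' s" for s
      unfolding dec q(2)[symmetric] a'_def
    proof (intro nn_integral_diff measurable_slices mm)
      show "(\<integral>\<^sup>+t. indicator (A \<inter> ?Q) (t, s) \<partial>M) \<noteq> \<infinity>"
        using le_less_trans[OF fin(2)[of s] qfin] unfolding a'_def by auto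
    qed (auto simp: indicator_def)
    have iq: "(\<integral>\<^sup>+s. q s \<partial>M) = emeasure M (W n) * emeasure M (W n)"
      unfolding q_def by (simp add: nn_integral_multc borel_open open_W)
    have ia: "(\<integral>\<^sup>+s. a s \<partial>M) < \<infinity>"
    proof -
      have "(\<integral>\<^sup>+s. a s \<partial>M) \<le> emeasure M (W n) * emeasure M (W n)"
        unfolding iq[symmetric] using fin(1) by (rule nn_integral_mono)
      also have "\<dots> < \<infinity>" using finite_W[of n] by (simp add: ennreal_mult_less_top)
      finally show ?thesis .
    qed
    have 3: "(\<integral>\<^sup>+s. q s - a s \<partial>M) = (\<integral>\<^sup>+s. q s - a' s \<partial>M)"
      using ia fin aa by (subst (1 2) nn_integral_diff) auto
    show ?case unfolding tonelli_def 1 2 using 3 by simp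
  next
    case (union A)
    then have A: "A i \<in> sets borel" for i by (auto simp: borel_def)
    define F where "F k x = (\<Sum>i<k. indicator (A i \<inter> ?Q) x :: ennreal)" for k x
    have [measurable]: "indicator (A i \<inter> ?Q) \<in> borel_measurable borel" for i
      using A Q by (intro borel_measurable_indicator) auto
    have Fm: "F k \<in> borel_measurable borel" for k
      unfolding F_def[abs_def] by measurable
    have "tonelli (F k)" for k
    proof (induction k)
      case 0
      have "F 0 = indicator {}" by (simp add: F_def fun_eq_iff)
      then show ?case by (simp only: opn open_empty)
    next
      case (Suc k)
      have "F (Suc k) = (\<lambda>x. F k x + indicator (A k \<inter> ?Q) x)" by (simp add: F_def fun_eq_iff)
      then show ?case using tonelli_add[OF Fm Suc _ union.IH[of k]] by simp
    qed
    moreover have "incseq F"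
      by (auto simp: F_def incseq_def le_fun_def intro!: sum_mono2)
    ultimately have "tonelli (\<lambda>x. SUP k. F k x)"
      by (rule tonelli_SUP[OF Fm])
    moreover have "(SUP k. F k x) = indicator (\<Union> (range A) \<inter> ?Q) x" for x
    proof -
      have "disjoint_family (\<lambda>i. A i \<inter> ?Q)" using union by (auto simp: disjoint_family_on_def)
      then have "indicator (\<Union>i. A i \<inter> ?Q) x = (\<Sum>i. indicator (A i \<inter> ?Q) x :: ennreal)"
        by (rule suminf_indicator[symmetric])
      then show ?thesis by (simp add: F_def suminf_eq_SUP)
    qed
    ultimately show ?case by simp
  qed
qed

lemma tonelli_indicator:
  assumes E: "E \<in> sets (borel :: ('a \<times> 'a) measure)"
  shows "tonelli (indicator E)"
proof -
  have "tonelli (\<lambda>x. SUP n. indicator (E \<inter> W n \<times> W n) x)"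
  proof (intro tonelli_SUP tonelli_indicator_window borel_measurable_indicator E)
    show "E \<inter> W n \<times> W n \<in> sets borel" for n
      by (rule sets.Int[OF E borel_open[OF open_Times[OF open_W open_W]]])
    show "incseq (\<lambda>n. indicator (E \<inter> W n \<times> W n) :: _ \<Rightarrow> ennreal)"
    proof (rule incseq_SucI, rule le_funI)
      fix n x
      have "W n \<subseteq> W (Suc n)" using incseq_W by (simp add: incseq_Suc_iff)
      then show "indicator (E \<inter> W n \<times> W n) x \<le> (indicator (E \<inter> W (Suc n) \<times> W (Suc n)) x :: ennreal)"
        by (auto simp: indicator_def)
    qed
  qed
  moreover have "(SUP n. indicator (E \<inter> W n \<times> W n) x) = (indicator E x :: ennreal)" for x
  proof -
    obtain m k where "fst x \<in> W m" "snd x \<in> W k" using Union_W by blast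
    then have "x \<in> W (max m k) \<times> W (max m k)"
      using incseq_W by (metis incseqD max.cobounded1 max.cobounded2 mem_Times_iff subsetD)
    then have "indicator E x \<le> (SUP n. indicator (E \<inter> W n \<times> W n) x :: ennreal)"
      by (intro SUP_upper2[of "max m k"]) (auto simp: indicator_def)
    moreover have "(SUP n. indicator (E \<inter> W n \<times> W n) x :: ennreal) \<le> indicator E x"
      by (intro SUP_least) (auto simp: indicator_def)
    ultimately show ?thesis by simp
  qed
  ultimately show ?thesis by simp
qed

lemma tonelli_borel:
  assumes "F \<in> borel_measurable borel" shows "tonelli F"
  using assms
proof (induction F rule: borel_measurable_induct)
  case (cong f g)
  then have "f = g" by (intro ext) simp
  with cong show ?case by simp
next
  case (set A)
  then show ?case by (rule tonelli_indicator)
next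
  case (mult u c)
  then show ?case by (intro tonelli_cmult)
next
  case (add u v)
  then show ?case by (intro tonelli_add)
next
  case (seq U)
  have "Sup (range U) = (\<lambda>x. SUP i. U i x)" by (intro ext) (simp add: SUP_apply image_comp)
  with seq tonelli_SUP[of U] show ?case by simp
qed

theorem Tonelli_borel:
  assumes F: "(\<lambda>(s, t). F s t) \<in> borel_measurable borel"
  shows "(\<integral>\<^sup>+s. \<integral>\<^sup>+t. F s t \<partial>M \<partial>M) = (\<integral>\<^sup>+t. \<integral>\<^sup>+s. F s t \<partial>M \<partial>M)"
    and "(\<lambda>s. \<integral>\<^sup>+t. F s t \<partial>M) \<in> borel_measurable M"
    and "(\<lambda>t. \<integral>\<^sup>+s. F s t \<partial>M) \<in> borel_measurable M"
  using tonelli_borel[OF F] by (simp_all add: tonelli_def)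

end

section \<open>Powers of the generating neighbourhood and the word length\<close>

lemma set_pow_0 [simp]: "set_pow U 0 = {0}"
  by (auto simp: set_pow_def)

lemma set_pow_Suc: "set_pow U (Suc n) = (\<lambda>(x, y). x + y) ` (U \<times> set_pow U n)"
proof safe
  fix x assume "x \<in> set_pow U (Suc n)"
  then obtain us where "length us = Suc n" "set us \<subseteq> U" "x = sum_list us"
    by (auto simp: set_pow_def)
  then obtain v vs where "us = v # vs" "length vs = n" "set vs \<subseteq> U" "v \<in> U" "x = v + sum_list vs"
    by (cases us) auto
  then show "x \<in> (\<lambda>(x, y). x + y) ` (U \<times> set_pow U n)"
    by (auto simp: set_pow_def intro!: image_eqI[of _ _ "(v, sum_list vs)"])
next
  fix x y assume "x \<in> U" "y \<in> set_pow U n"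
  then obtain us where "length us = n" "set us \<subseteq> U" "y = sum_list us" by (auto simp: set_pow_def)
  with \<open>x \<in> U\<close> show "x + y \<in> set_pow U (Suc n)"
    by (auto simp: set_pow_def intro!: exI[of _ "x # us"])
qed

lemma set_pow_add: "x \<in> set_pow U m \<Longrightarrow> y \<in> set_pow U n \<Longrightarrow> x + y \<in> set_pow U (m + n)"
proof -
  assume "x \<in> set_pow U m" "y \<in> set_pow U n"
  then obtain us vs where "length us = m" "set us \<subseteq> U" "x = sum_list us"
    "length vs = n" "set vs \<subseteq> U" "y = sum_list vs" by (auto simp: set_pow_def)
  then show ?thesis by (auto simp: set_pow_def intro!: exI[of _ "us @ vs"])
qed

lemma set_pow_mono: "0 \<in> U \<Longrightarrow> m \<le> n \<Longrightarrow> set_pow U m \<subseteq> set_pow U n"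
proof
  fix x assume "0 \<in> U" "m \<le> n" "x \<in> set_pow U m"
  moreover have "(0::'a) \<in> set_pow U k" if "0 \<in> U" for k
  proof -
    have "sum_list (replicate k (0::'a)) = 0" by (induction k) auto
    then show ?thesis using that by (auto simp: set_pow_def intro!: exI[of _ "replicate k 0"])
  qed
  ultimately show "x \<in> set_pow U n" using set_pow_add[of x U m 0 "n - m"] by simp
qed

lemma uminus_sum_list: "- sum_list us = sum_list (rev (map uminus us))" for us :: "'a::group_add list"
  by (induction us) (auto simp: minus_add)

lemma set_pow_uminus:
  fixes U :: "'a::group_add set"
  assumes "uminus ` U = U" "x \<in> set_pow U n" shows "- x \<in> set_pow U n"
proof -
  obtain us where "length us = n" "set us \<subseteq> U" "x = sum_list us" using assms by (auto simp: set_pow_def)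
  then have "length (rev (map uminus us)) = n" "set (rev (map uminus us)) \<subseteq> U"
    "- x = sum_list (rev (map uminus us))"
    using assms(1) by (auto simp: uminus_sum_list)
  then show ?thesis unfolding set_pow_def by blast
qed

lemma compact_set_pow:
  fixes U :: "'a::topological_monoid_add set"
  assumes "compact U" shows "compact (set_pow U n)"
proof (induction n)
  case (Suc n)
  then show ?case unfolding set_pow_Suc using assms
    by (intro compact_continuous_image compact_Times)
      (auto intro!: continuous_intros simp: case_prod_unfold)
qed simp

locale haar_growth =
  fixes M :: "'a::{topological_group_add, t2_space} measure" and U :: "'a set"
  assumes haar: "left_haar_measure M"
    and nbhd: "compact_symmetric_generating_nbhd U"
    and growth: "polynomial_growth M U"
begin

lemma zero_in_U: "0 \<in> U" and compact_U: "compact U" and sym_U: "uminus ` U = U"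
  using nbhd interior_subset by (auto simp: compact_symmetric_generating_nbhd_def)

lemma Union_set_pow: "(\<Union>n. set_pow U n) = UNIV"
proof -
  have "U \<subseteq> (\<Union>n. set_pow U n)"
    by (auto simp: set_pow_def intro!: exI[of _ "[_]"] exI[of _ "1::nat"])
  moreover have "is_subgroup (\<Union>n. set_pow U n)"
    unfolding is_subgroup_def
  proof (intro conjI ballI)
    show "0 \<in> (\<Union>n. set_pow U n)" by (auto intro!: exI[of _ "0::nat"])
  next
    fix x y assume "x \<in> (\<Union>n. set_pow U n)" "y \<in> (\<Union>n. set_pow U n)"
    then obtain m n where "x \<in> set_pow U m" "y \<in> set_pow U n" by auto
    then have "x + y \<in> set_pow U (m + n)" by (rule set_pow_add)
    then show "x + y \<in> (\<Union>n. set_pow U n)" by auto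
  next
    fix x assume "x \<in> (\<Union>n. set_pow U n)"
    then show "- x \<in> (\<Union>n. set_pow U n)" using set_pow_uminus[OF sym_U] by auto
  qed
  ultimately have "is_subgroup hull U \<subseteq> (\<Union>n. set_pow U n)" by (rule hull_minimal)
  then show ?thesis using nbhd by (auto simp: compact_symmetric_generating_nbhd_def)
qed

text \<open>Every \<open>x\<close> in the \<open>n\<close>-th power has the neighbourhood \<open>x + interior U\<close> inside the next one.
  Hence the interiors of the powers cover the group; they serve as the exhausting open sets of
  finite measure.\<close>

lemma set_pow_subset_interior: "set_pow U n \<subseteq> interior (set_pow U (Suc n))"
proof
  fix x assume x: "x \<in> set_pow U n"
  have o: "open ((\<lambda>y. - x + y) -` interior U)"
    by (intro open_vimage continuous_intros) simp
  have "(\<lambda>y. - x + y) -` interior U \<subseteq> set_pow U (Suc n)"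
  proof
    fix y assume "y \<in> (\<lambda>y. - x + y) -` interior U"
    then have "- x + y \<in> set_pow U 1" using interior_subset[of U] by (auto simp: set_pow_Suc intro!: image_eqI[of _ _ "(- x + y, 0)"])
    from set_pow_add[OF x this] show "y \<in> set_pow U (Suc n)" by (simp add: add.assoc[symmetric])
  qed
  with o have "(\<lambda>y. - x + y) -` interior U \<subseteq> interior (set_pow U (Suc n))"
    by (simp add: interior_maximal)
  moreover have "x \<in> (\<lambda>y. - x + y) -` interior U"
    using nbhd by (simp add: compact_symmetric_generating_nbhd_def)
  ultimately show "x \<in> interior (set_pow U (Suc n))" by blast
qed

lemmas haar_conj = haar[unfolded left_haar_measure_def]
lemmas haar_sets = haar_conj[THEN conjunct1]
  and emeasure_UNIV = haar_conj[THEN conjunct2, THEN conjunct1]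
  and haar_compact = haar_conj[THEN conjunct2, THEN conjunct2, THEN conjunct1]
  and haar_outer = haar_conj[THEN conjunct2, THEN conjunct2, THEN conjunct2, THEN conjunct1]
  and haar_inner = haar_conj[THEN conjunct2, THEN conjunct2, THEN conjunct2, THEN conjunct2,
      THEN conjunct1]
  and haar_left = haar_conj[THEN conjunct2, THEN conjunct2, THEN conjunct2, THEN conjunct2,
      THEN conjunct2]

sublocale sigma_finite_radon M "\<lambda>n. interior (set_pow U n)"
proof
  show sets: "sets M = sets borel" by (rule haar_sets)
  show "emeasure M V = (SUP K\<in>{K. compact K \<and> K \<subseteq> V}. emeasure M K)" if "open V" for V
    using haar_inner that by blast
  show "incseq (\<lambda>n. interior (set_pow U n))"
    using set_pow_mono[OF zero_in_U] by (auto simp: incseq_def intro!: interior_mono)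
  show "(\<Union>n. interior (set_pow U n)) = UNIV"
  proof (intro set_eqI iffI UNIV_I)
    fix x
    obtain n where "x \<in> set_pow U n" using Union_set_pow by auto
    then show "x \<in> (\<Union>n. interior (set_pow U n))"
      using set_pow_subset_interior by (intro UN_I[of "Suc n"]) auto
  qed
  show "emeasure M (interior (set_pow U n)) < \<infinity>" for n
  proof -
    have "emeasure M (interior (set_pow U n)) \<le> emeasure M (set_pow U n)"
      using borel_compact[OF compact_set_pow[OF compact_U]] sets
      by (intro emeasure_mono interior_subset) auto
    also have "\<dots> < \<infinity>" using haar_compact compact_set_pow[OF compact_U] by blast
    finally show ?thesis .
  qed
qed simp

lemma emeasure_compact: "compact K \<Longrightarrow> emeasure M K < \<infinity>"
  and outer_regular: "A \<in> sets borel \<Longrightarrow> emeasure M A = (INF V\<in>{V. open V \<and> A \<subseteq> V}. emeasure M V)"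
  and emeasure_left: "A \<in> sets borel \<Longrightarrow> emeasure M ((\<lambda>x. s + x) ` A) = emeasure M A"
  using haar_compact haar_outer[rule_format, of A] haar_left by auto

lemma set_pow_borel [measurable]: "set_pow U n \<in> sets borel"
  using compact_set_pow[OF compact_U] by (rule borel_compact)

lemma len_eq: "len U x = real (LEAST n. x \<in> set_pow U n)"
  unfolding len_def Inf_nat_def by (simp add: Least_equality)

lemma len_le_iff: "len U x \<le> real n \<longleftrightarrow> x \<in> set_pow U n"
proof -
  obtain k where "x \<in> set_pow U k" using Union_set_pow by auto
  then have "x \<in> set_pow U (LEAST n. x \<in> set_pow U n)" by (rule LeastI)
  then show ?thesis unfolding len_eq using set_pow_mono[OF zero_in_U]
    by (auto intro: Least_le)
qed

lemma len_in_Nats: obtains n where "len U x = real n" "x \<in> set_pow U n"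
  using len_le_iff[of x "LEAST n. x \<in> set_pow U n"] len_eq[of x] by auto

lemma len_nonneg: "0 \<le> len U x"
  by (simp add: len_eq)

lemma len_add: "len U (x + y) \<le> len U x + len U y"
proof -
  obtain m where m: "len U x = real m" "x \<in> set_pow U m" by (rule len_in_Nats)
  obtain n where n: "len U y = real n" "y \<in> set_pow U n" by (rule len_in_Nats)
  have "len U (x + y) \<le> real (m + n)" unfolding len_le_iff by (rule set_pow_add[OF m(2) n(2)])
  then show ?thesis using m n by simp
qed

lemma len_uminus [simp]: "len U (- x) = len U x"
proof -
  have "- x \<in> set_pow U n \<longleftrightarrow> x \<in> set_pow U n" for n
    using set_pow_uminus[OF sym_U, of x n] set_pow_uminus[OF sym_U, of "- x" n] by auto
  then show ?thesis by (simp add: len_eq)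
qed

lemma len_measurable [measurable]: "len U \<in> borel_measurable M"
proof (subst borel_measurable_iff_le, safe)
  fix a :: real
  show "{w \<in> space M. len U w \<le> a} \<in> sets M"
  proof (cases "a < 0")
    case True
    then have "{w \<in> space M. len U w \<le> a} = {}" using len_nonneg by (auto simp: not_le intro: less_le_trans)
    then show ?thesis by simp
  next
    case False
    have "len U w \<le> a \<longleftrightarrow> len U w \<le> real (nat \<lfloor>a\<rfloor>)" for w
    proof -
      obtain k where "len U w = real k" by (rule len_in_Nats)
      moreover have "real k \<le> a \<longleftrightarrow> real k \<le> real (nat \<lfloor>a\<rfloor>)"
        using False by (metis le_nat_floor not_less of_nat_floor of_nat_le_iff order_trans)
      ultimately show ?thesis by simp
    qed
    then have "{w \<in> space M. len U w \<le> a} = set_pow U (nat \<lfloor>a\<rfloor>)" by (auto simp: len_le_iff)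
    then show ?thesis by simp
  qed
qed

section \<open>Polynomial growth forces unimodularity\<close>

lemma borel_measurable_continuous_M:
  "continuous_on UNIV f \<Longrightarrow> f \<in> measurable M (borel :: 'b::topological_space measure)"
  by (metis borel_measurable_continuous_onI measurable_cong_sets sets_M)

lemma translations_measurable [measurable]:
  "(\<lambda>x. s + x) \<in> measurable M M" "(\<lambda>x. x + s) \<in> measurable M M" "(uminus :: 'a \<Rightarrow> 'a) \<in> measurable M M"
  using measurable_cong_sets[OF refl sets_M, of M]
  by (auto intro!: borel_measurable_continuous_M continuous_intros)

lemma distr_left: "distr M M (\<lambda>x. s + x) = M"
proof (rule measure_eqI)
  fix A assume "A \<in> sets (distr M M (\<lambda>x. s + x))"
  then have A: "A \<in> sets borel" by simp
  have "(\<lambda>x. s + x) -` A = (\<lambda>x. - s + x) ` A"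
    by (auto simp: add.assoc[symmetric] intro!: image_eqI[of _ _ "s + _"])
  then show "emeasure (distr M M (\<lambda>x. s + x)) A = emeasure M A"
    using A emeasure_left[OF A, of "- s"] by (simp add: emeasure_distr)
qed simp

lemma nn_integral_left:
  assumes [measurable]: "f \<in> borel_measurable M"
  shows "(\<integral>\<^sup>+x. f (s + x) \<partial>M) = (\<integral>\<^sup>+x. f x \<partial>M)"
proof -
  have "(\<integral>\<^sup>+x. f x \<partial>M) = (\<integral>\<^sup>+x. f x \<partial>distr M M (\<lambda>x. s + x))" by (simp add: distr_left)
  also have "\<dots> = (\<integral>\<^sup>+x. f (s + x) \<partial>M)" by (rule nn_integral_distr) auto
  finally show ?thesis by simp
qed

lemma measurable_M_iff: "f \<in> borel_measurable M \<longleftrightarrow> f \<in> borel_measurable borel"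
  by (rule arg_cong[where f="\<lambda>S. f \<in> S"]) (rule measurable_cong_sets, simp_all)

lemma borel_prod_compose:
  fixes g :: "'b::topological_space \<Rightarrow> 'a" and f :: "'a \<Rightarrow> 'c::topological_space"
  assumes "f \<in> borel_measurable M" "continuous_on UNIV g"
  shows "(\<lambda>x. f (g x)) \<in> borel_measurable (borel :: 'b measure)"
  using assms by (auto simp: measurable_M_iff intro: measurable_compose[OF borel_measurable_continuous_onI])

text \<open>The reflection is moved from \<open>g\<close> to a right translate of \<open>f\<close> by two left translations with
  an exchange of integrals in between. This identity carries all information about right
  translations and inversion used below.\<close>

lemma nn_integral_times_reflected:
  assumes f: "f \<in> borel_measurable M" and g: "g \<in> borel_measurable M"
  shows "(\<integral>\<^sup>+x. f x \<partial>M) * (\<integral>\<^sup>+y. g (- y) \<partial>M) = (\<integral>\<^sup>+x. g x * (\<integral>\<^sup>+y. f (y + x) \<partial>M) \<partial>M)"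
proof -
  note [measurable] = f g
  have "(\<integral>\<^sup>+x. f x \<partial>M) * (\<integral>\<^sup>+y. g (- y) \<partial>M) = (\<integral>\<^sup>+x. \<integral>\<^sup>+y. f x * g (- y) \<partial>M \<partial>M)"
    by (simp add: nn_integral_cmult nn_integral_multc)
  also have "\<dots> = (\<integral>\<^sup>+x. \<integral>\<^sup>+y. f x * g (- y + x) \<partial>M \<partial>M)"
  proof (rule nn_integral_cong)
    fix x
    show "(\<integral>\<^sup>+y. f x * g (- y) \<partial>M) = (\<integral>\<^sup>+y. f x * g (- y + x) \<partial>M)"
      by (subst nn_integral_left[where s="- x", symmetric]) (auto simp: minus_add)
  qed
  also have "\<dots> = (\<integral>\<^sup>+y. \<integral>\<^sup>+x. f x * g (- y + x) \<partial>M \<partial>M)"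
    by (rule Tonelli_borel(1)) (auto simp: case_prod_unfold intro!: borel_measurable_times_ennreal borel_prod_compose f g continuous_intros)
  also have "\<dots> = (\<integral>\<^sup>+y. \<integral>\<^sup>+x. f (y + x) * g x \<partial>M \<partial>M)"
  proof (rule nn_integral_cong)
    fix y
    show "(\<integral>\<^sup>+x. f x * g (- y + x) \<partial>M) = (\<integral>\<^sup>+x. f (y + x) * g x \<partial>M)"
      by (subst nn_integral_left[where s=y, symmetric]) (auto simp: add.assoc[symmetric])
  qed
  also have "\<dots> = (\<integral>\<^sup>+x. \<integral>\<^sup>+y. f (y + x) * g x \<partial>M \<partial>M)"
    by (rule Tonelli_borel(1)) (auto simp: case_prod_unfold intro!: borel_measurable_times_ennreal borel_prod_compose f g continuous_intros)
  also have "\<dots> = (\<integral>\<^sup>+x. g x * (\<integral>\<^sup>+y. f (y + x) \<partial>M) \<partial>M)"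
    by (simp add: nn_integral_multc) (simp add: mult.commute)
  finally show ?thesis .
qed

text \<open>Finitely many translates of a null open set would cover any compact set, and inner
  regularity would make the whole group a null set.\<close>

lemma emeasure_open_pos:
  assumes "open V" "V \<noteq> {}" shows "emeasure M V \<noteq> 0"
proof
  assume V0: "emeasure M V = 0"
  obtain v where v: "v \<in> V" using assms by auto
  have tr: "open ((\<lambda>x. v - s + x) -` V)" "emeasure M ((\<lambda>x. v - s + x) -` V) = 0" for s
  proof -
    show "open ((\<lambda>x. v - s + x) -` V)" using assms by (intro open_vimage continuous_intros)
    have "emeasure (distr M M (\<lambda>x. v - s + x)) V = 0" using V0 by (simp add: distr_left)
    then show "emeasure M ((\<lambda>x. v - s + x) -` V) = 0"
      using assms(1) by (simp add: emeasure_distr borel_open)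
  qed
  have "emeasure M K = 0" if "compact K" for K
  proof -
    obtain D where D: "D \<subseteq> K" "finite D" "K \<subseteq> (\<Union>s\<in>D. (\<lambda>x. v - s + x) -` V)"
    proof (rule compactE_image[OF \<open>compact K\<close>, of K "\<lambda>s. (\<lambda>x. v - s + x) -` V"])
      show "K \<subseteq> (\<Union>s\<in>K. (\<lambda>x. v - s + x) -` V)"
      proof
        fix x assume "x \<in> K"
        then show "x \<in> (\<Union>s\<in>K. (\<lambda>x. v - s + x) -` V)" using v by (intro UN_I[of x]) simp_all
      qed
    qed (use tr in auto)
    have "emeasure M K \<le> emeasure M (\<Union>s\<in>D. (\<lambda>x. v - s + x) -` V)"
      using D tr by (intro emeasure_mono) (auto intro!: borel_open open_UN)
    also have "\<dots> \<le> (\<Sum>s\<in>D. emeasure M ((\<lambda>x. v - s + x) -` V))"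
      using D tr by (intro emeasure_subadditive_finite) (auto intro: borel_open)
    also have "\<dots> = 0" using tr by simp
    finally show ?thesis by simp
  qed
  then have "emeasure M UNIV = 0" unfolding inner_regular[OF open_UNIV]
    by (auto intro!: antisym SUP_least)
  then show False using emeasure_UNIV by simp
qed

text \<open>A fixed open set of positive finite measure, used to cancel a common factor.\<close>

definition window :: "'a set" where "window = interior (set_pow U 1)"

lemma window: "open window" "emeasure M window \<noteq> 0" "emeasure M window \<noteq> \<infinity>" "window \<in> sets M"
proof -
  show "open window" by (simp add: window_def)
  moreover have "window \<noteq> {}" using set_pow_subset_interior[of 0] by (auto simp: window_def)
  ultimately show "emeasure M window \<noteq> 0" by (rule emeasure_open_pos)
  show "emeasure M window \<noteq> \<infinity>" using finite_W[of 1] by (auto simp: window_def)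
qed (auto simp: window_def)

text \<open>Null sets are reflected to null sets: \<open>nn_integral_times_reflected\<close> expresses the measure
  of the reflected set, times that of the window, as an integral over the set itself. This holds
  before unimodularity is known.\<close>

lemma AE_uminus:
  assumes "AE x in M. P x" shows "AE x in M. P (- x)"
proof -
  obtain N where N: "N \<in> sets M" "emeasure M N = 0" "{x \<in> space M. \<not> P x} \<subseteq> N"
    using assms by (auto elim: AE_E)
  have "emeasure M window * (\<integral>\<^sup>+y. indicator N (- y) \<partial>M)
      = (\<integral>\<^sup>+x. indicator N x * (\<integral>\<^sup>+y. indicator window (y + x) \<partial>M) \<partial>M)"
    using nn_integral_times_reflected[of "indicator window" "indicator N"] N window by simp
  also have "\<dots> = (\<integral>\<^sup>+x. 0 \<partial>M)"
    using AE_not_in[OF null_setsI[OF N(2,1)]] by (intro nn_integral_cong_AE) auto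
  finally have "(\<integral>\<^sup>+y. indicator N (- y) \<partial>M) = 0" using window by simp
  then have "AE y in M. indicator N (- y) = (0::ennreal)"
    using N measurable_compose[OF translations_measurable(3) borel_measurable_indicator[OF N(1)]]
    by (subst (asm) nn_integral_0_iff_AE) auto
  then show ?thesis using N(3) by (auto simp: indicator_def split: if_splits)
qed

lemma AE_left:
  assumes "AE x in M. P x" shows "AE x in M. P (s + x)"
proof -
  have "AE x in distr M M (\<lambda>x. s + x). P x" unfolding distr_left by (rule assms)
  then show ?thesis by (rule AE_distrD[OF translations_measurable(1)])
qed

lemma AE_right:
  assumes "AE x in M. P x" shows "AE x in M. P (x + s)"
  using AE_uminus[OF AE_left[OF AE_uminus[OF assms], of "- s"]] by (simp add: minus_add)

lemma AE_ex: "AE x in M. P x \<Longrightarrow> \<exists>x. P x"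
proof (rule ccontr)
  assume "AE x in M. P x" "\<nexists>x. P x"
  then have "AE x in M. False" by simp
  then have "emeasure M (space M) = 0" by (subst (asm) AE_iff_measurable[OF _ refl]) auto
  then show False using emeasure_UNIV by simp
qed

text \<open>Nonempty open sets of positive finite measure; containment in a power of \<open>U\<close> is the form
  of relative compactness that polynomial growth can be applied to.\<close>

definition rel_compact_open :: "'a set \<Rightarrow> bool" where
  "rel_compact_open A \<longleftrightarrow> open A \<and> A \<noteq> {} \<and> (\<exists>m. A \<subseteq> set_pow U m)"

lemma rel_compact_open_right:
  assumes "rel_compact_open A" shows "rel_compact_open {y. y + x \<in> A}"
proof -
  obtain m a where A: "open A" "a \<in> A" "A \<subseteq> set_pow U m"
    using assms by (auto simp: rel_compact_open_def)
  obtain n where n: "- x \<in> set_pow U n" using Union_set_pow by auto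
  have "open ((\<lambda>y. y + x) -` A)" using A by (intro open_vimage continuous_intros)
  moreover have "a - x \<in> {y. y + x \<in> A}" using A by simp
  moreover have "{y. y + x \<in> A} \<subseteq> set_pow U (m + n)"
  proof
    fix y assume "y \<in> {y. y + x \<in> A}"
    then have "y + x \<in> set_pow U m" using A by auto
    from set_pow_add[OF this n] show "y \<in> set_pow U (m + n)" by (simp add: add.assoc)
  qed
  ultimately show ?thesis unfolding rel_compact_open_def vimage_def by blast
qed

lemma rel_compact_open_emeasure:
  assumes "rel_compact_open A" shows "A \<in> sets borel" "emeasure M A \<noteq> 0" "emeasure M A < \<infinity>"
proof -
  obtain m where A: "open A" "A \<noteq> {}" "A \<subseteq> set_pow U m"
    using assms by (auto simp: rel_compact_open_def)
  show "A \<in> sets borel" using A by auto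
  show "emeasure M A \<noteq> 0" using A by (intro emeasure_open_pos)
  have "emeasure M A \<le> emeasure M (set_pow U m)" using A by (intro emeasure_mono) auto
  also have "\<dots> < \<infinity>" by (intro emeasure_compact compact_set_pow compact_U)
  finally show "emeasure M A < \<infinity>" .
qed

lemma emeasure_right_slice_measurable:
  assumes "rel_compact_open A"
  shows "(\<lambda>x. emeasure M {y. y + x \<in> A}) \<in> borel_measurable M"
proof -
  have "open ((\<lambda>(x, y). y + x) -` A)" using assms
    by (intro open_vimage) (auto simp: rel_compact_open_def case_prod_unfold intro!: continuous_intros)
  from borel_measurable_open_slice[OF this] show ?thesis by simp
qed

lemma emeasure_times_reflected:
  assumes A: "rel_compact_open A" and B: "B \<in> sets borel"
  shows "emeasure M A * emeasure M (uminus -` B) =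
    (\<integral>\<^sup>+x. emeasure M {y. y + x \<in> A} * indicator B x \<partial>M)"
proof -
  have 1: "(\<integral>\<^sup>+x. indicator A x \<partial>M) = emeasure M A"
    using rel_compact_open_emeasure(1)[OF A] by (intro nn_integral_indicator) simp
  have "uminus -` B \<inter> space M \<in> sets M"
    using B by (intro measurable_sets[OF translations_measurable(3)]) simp
  then have "uminus -` B \<in> sets M" by simp
  then have "(\<integral>\<^sup>+x. indicator (uminus -` B) x \<partial>M) = emeasure M (uminus -` B)"
    by (rule nn_integral_indicator)
  then have 2: "(\<integral>\<^sup>+x. indicator B (- x) \<partial>M) = emeasure M (uminus -` B)"
    by (simp add: indicator_def)
  have 3: "(\<integral>\<^sup>+y. indicator A (y + x) \<partial>M) = emeasure M {y. y + x \<in> A}" for x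
  proof -
    have "(\<integral>\<^sup>+y. indicator {y. y + x \<in> A} y \<partial>M) = emeasure M {y. y + x \<in> A}"
      using rel_compact_open_emeasure(1)[OF rel_compact_open_right[OF A, of x]]
      by (intro nn_integral_indicator) simp
    then show ?thesis by (simp add: indicator_def)
  qed
  show ?thesis
    using nn_integral_times_reflected[of "indicator A" "indicator B"]
      rel_compact_open_emeasure(1)[OF A] B
    by (simp add: 1 2 3 mult.commute)
qed

text \<open>In terms of the modular function this is its multiplicativity. For a Borel set \<open>B\<close>,
  integrating the measure of the right translates of \<open>A\<close> over \<open>B\<close> gives the measure of \<open>A\<close> times
  that of the reflection of \<open>B\<close>. Hence the functions on both sides have the same integral over
  every \<open>B\<close>, and densities are unique almost everywhere.\<close>

lemma right_slice_multiplicative: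
  assumes A: "rel_compact_open A"
  shows "AE x in M. emeasure M {y. y + s \<in> A} * emeasure M {y. y + x \<in> A}
    = emeasure M A * emeasure M {y. y + (x + s) \<in> A}"
proof -
  define A' where "A' = {y. y + s \<in> A}"
  have A': "rel_compact_open A'" unfolding A'_def by (rule rel_compact_open_right[OF A])
  define f where "f x = emeasure M A' * emeasure M {y. y + x \<in> A}" for x
  define g where "g x = emeasure M A * emeasure M {y. y + x \<in> A'}" for x
  note [measurable] = emeasure_right_slice_measurable[OF A] emeasure_right_slice_measurable[OF A']
  have [measurable]: "f \<in> borel_measurable M" "g \<in> borel_measurable M"
    unfolding f_def[abs_def] g_def[abs_def] by measurable
  have "density M f = density M g"
  proof (rule measure_eqI)
    fix B assume "B \<in> sets (density M f)"
    then have B [measurable]: "B \<in> sets borel" by simp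
    have "emeasure (density M f) B = emeasure M A' * (emeasure M A * emeasure M (uminus -` B))"
      unfolding emeasure_times_reflected[OF A B]
      by (simp add: emeasure_density f_def mult.assoc nn_integral_cmult)
    also have "\<dots> = emeasure M A * (emeasure M A' * emeasure M (uminus -` B))"
      by (simp add: ac_simps)
    also have "\<dots> = emeasure (density M g) B"
      unfolding emeasure_times_reflected[OF A' B]
      by (simp add: emeasure_density g_def mult.assoc nn_integral_cmult)
    finally show "emeasure (density M f) B = emeasure (density M g) B" .
  qed simp
  then have "AE x in M. f x = g x" by (intro density_unique) auto
  then show ?thesis by (simp add: f_def g_def A'_def add.assoc)
qed

lemma growth_bound:
  assumes "A \<subseteq> set_pow U m"
  obtains K d where "0 < K" "\<And>x. emeasure M {y. y + x \<in> A} \<le> ennreal (K * (1 + len U x) ^ d)"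
proof -
  obtain K d where K: "0 < K" "\<And>n. 1 \<le> n \<Longrightarrow> emeasure M (set_pow U n) \<le> ennreal (K * real n ^ d)"
    using growth unfolding polynomial_growth_def by auto
  have "emeasure M {y. y + x \<in> A} \<le> ennreal (K * (1 + real m) ^ d * (1 + len U x) ^ d)" for x
  proof -
    obtain n where n: "len U (- x) = real n" "- x \<in> set_pow U n" by (rule len_in_Nats)
    have "{y. y + x \<in> A} \<subseteq> set_pow U (m + n + 1)"
    proof
      fix y assume "y \<in> {y. y + x \<in> A}"
      then have "y + x \<in> set_pow U m" using assms by auto
      from set_pow_add[OF this n(2)] have "y \<in> set_pow U (m + n)" by (simp add: add.assoc)
      then show "y \<in> set_pow U (m + n + 1)"
        using set_pow_mono[OF zero_in_U, of "m + n" "m + n + 1"] by auto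
    qed
    then have "emeasure M {y. y + x \<in> A} \<le> emeasure M (set_pow U (m + n + 1))"
      by (intro emeasure_mono) simp_all
    also have "\<dots> \<le> ennreal (K * real (m + n + 1) ^ d)" by (intro K) simp
    also have "\<dots> \<le> ennreal (K * (1 + real m) ^ d * (1 + len U x) ^ d)"
    proof (rule ennreal_leI)
      have "real (m + n + 1) \<le> (1 + real m) * (1 + len U x)" using n by (simp add: algebra_simps)
      then have "real (m + n + 1) ^ d \<le> ((1 + real m) * (1 + len U x)) ^ d" by (intro power_mono) auto
      then show "K * real (m + n + 1) ^ d \<le> K * (1 + real m) ^ d * (1 + len U x) ^ d"
        using K(1) by (simp add: power_mult_distrib mult.assoc)
    qed
    finally show ?thesis .
  qed
  then show ?thesis using that[of "K * (1 + real m) ^ d" d] K(1) by simp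
qed

text \<open>If the right translation by \<open>s\<close> enlarged \<open>A\<close> by a factor \<open>q > 1\<close>, multiplicativity along
  \<open>x + n s\<close> would make the measure of the translates grow like \<open>q ^ n\<close>, while polynomial growth
  bounds it by a power of \<open>n\<close>. The exceptional null sets of countably many \<open>n\<close> are avoided by a
  single good \<open>x\<close>.\<close>

lemma emeasure_right_le:
  assumes A: "rel_compact_open A"
  shows "emeasure M {y. y + s \<in> A} \<le> emeasure M A"
proof (rule ccontr)
  assume neg: "\<not> ?thesis"
  define D where "D x = measure M {y. y + x \<in> A}" for x
  have D: "emeasure M {y. y + x \<in> A} = ennreal (D x)" "0 < D x" for x
  proof -
    note fin = rel_compact_open_emeasure[OF rel_compact_open_right[OF A, of x]]
    show *: "emeasure M {y. y + x \<in> A} = ennreal (D x)"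
      unfolding D_def using fin by (intro emeasure_eq_ennreal_measure) auto
    show "0 < D x" using fin(2) unfolding * by (metis ennreal_neg not_less)
  qed
  define q where "q = D s / D 0"
  have D0: "emeasure M A = ennreal (D 0)" using D(1)[of 0] by simp
  have q: "1 < q"
    using neg D(2)[of 0] D(2)[of s] unfolding D(1) D0 q_def by (simp add: not_le ennreal_less_iff)
  have mult: "AE x in M. D (x + s) = q * D x"
    using right_slice_multiplicative[OF A, of s]
  proof eventually_elim
    case (elim x)
    then have "ennreal (D s * D x) = ennreal (D 0 * D (x + s))"
      using D(2) unfolding D(1) D0 by (simp add: ennreal_mult less_imp_le)
    then have "D s * D x = D 0 * D (x + s)"
      using D(2) by (simp add: less_imp_le)
    then show ?case using D(2)[of 0] by (simp add: q_def field_simps)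
  qed
  have pow: "AE x in M. D (((\<lambda>x. x + s) ^^ n) x) = q ^ n * D x" for n
  proof (induction n)
    case (Suc n)
    from AE_right[OF Suc, of s] mult show ?case
      by eventually_elim (simp add: funpow_Suc_right ac_simps del: funpow.simps)
  qed simp
  then have "AE x in M. \<forall>n. D (((\<lambda>x. x + s) ^^ n) x) = q ^ n * D x" by (simp add: AE_all_countable)
  then obtain x where x: "\<And>n. D (((\<lambda>x. x + s) ^^ n) x) = q ^ n * D x" using AE_ex by blast
  have len_pow: "len U (((\<lambda>x. x + s) ^^ n) x) \<le> len U x + n * len U s" for n
  proof (induction n)
    case (Suc n)
    then show ?case using len_add[of "((\<lambda>x. x + s) ^^ n) x" s] by (simp add: algebra_simps)
  qed simp
  obtain m where "A \<subseteq> set_pow U m" using A by (auto simp: rel_compact_open_def)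
  then obtain K d where K: "0 < K" "\<And>x. emeasure M {y. y + x \<in> A} \<le> ennreal (K * (1 + len U x) ^ d)"
    using growth_bound by blast
  have "q ^ n * D x \<le> K * (1 + len U x + n * len U s) ^ d" for n
  proof -
    have "q ^ n * D x \<le> K * (1 + len U (((\<lambda>x. x + s) ^^ n) x)) ^ d"
      using K(2)[of "((\<lambda>x. x + s) ^^ n) x"] K(1) len_nonneg unfolding D(1) x
      by (subst (asm) ennreal_le_iff) auto
    also have "\<dots> \<le> K * (1 + len U x + n * len U s) ^ d"
      using K(1) len_nonneg len_pow[of n] by (intro mult_left_mono power_mono) (auto simp: add.assoc)
    finally show ?thesis .
  qed
  then have bound: "D x \<le> K * (1 + len U x + n * len U s) ^ d / q ^ n" for n
    using q by (simp add: pos_le_divide_eq mult.commute)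
  have "(\<lambda>n. K * (1 + len U x + real n * len U s) ^ d / q ^ n) \<longlonglongrightarrow> 0"
  proof -
    have "(\<lambda>n. (real n + 1) ^ d / q ^ n) \<longlonglongrightarrow> 0"
      using q by real_asymp
    then have "(\<lambda>n. K * (1 + len U x + len U s) ^ d * ((real n + 1) ^ d / q ^ n)) \<longlonglongrightarrow> 0"
      by (rule tendsto_mult_right_zero)
    then show ?thesis
    proof (rule Lim_null_comparison[rotated], intro always_eventually allI)
      fix n
      have "1 + len U x + real n * len U s \<le> (1 + len U x + len U s) * (real n + 1)"
        using len_nonneg[of x] len_nonneg[of s] by (simp add: algebra_simps)
      then have "(1 + len U x + real n * len U s) ^ d \<le> (1 + len U x + len U s) ^ d * (real n + 1) ^ d"
        using len_nonneg[of x] len_nonneg[of s] by (subst power_mult_distrib[symmetric]) (intro power_mono, auto)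
      then show "norm (K * (1 + len U x + real n * len U s) ^ d / q ^ n)
          \<le> K * (1 + len U x + len U s) ^ d * ((real n + 1) ^ d / q ^ n)"
        using K(1) q len_nonneg[of x] len_nonneg[of s]
        by (simp add: abs_mult divide_right_mono mult.assoc)
    qed
  qed
  then have "D x \<le> 0" using bound by (intro tendsto_lowerbound[of _ 0 sequentially]) auto
  then show False using D(2)[of x] by simp
qed

lemma emeasure_right_open:
  assumes V: "open V" shows "emeasure M {y. y + s \<in> V} = emeasure M V"
proof -
  have 1: "emeasure M {y. y + s \<in> A} = emeasure M A" if A: "rel_compact_open A" for A
    using emeasure_right_le[OF A, of s] emeasure_right_le[OF rel_compact_open_right[OF A, of s], of "- s"]
    by (intro antisym) (simp_all add: add.assoc)
  define A where "A n = V \<inter> interior (set_pow U n)" for n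
  have oA: "open (A n)" for n using V by (auto simp: A_def)
  have 2: "emeasure M {y. y + s \<in> A n} = emeasure M (A n)" for n
  proof (cases "A n = {}")
    case False
    then have "rel_compact_open (A n)"
      using oA[of n] interior_subset[of "set_pow U n"] unfolding rel_compact_open_def A_def by blast
    then show ?thesis by (rule 1)
  qed simp
  have inc: "incseq A" using incseq_W by (auto simp: A_def incseq_def)
  have UA: "(\<Union>n. A n) = V" using Union_W by (auto simp: A_def)
  have o: "open {y. y + s \<in> A n}" for n
  proof -
    have "open ((\<lambda>y. y + s) -` A n)" using oA by (intro open_vimage continuous_intros)
    then show ?thesis by (simp add: vimage_def)
  qed
  have "emeasure M V = (SUP n. emeasure M (A n))"
    unfolding UA[symmetric] using oA inc by (intro SUP_emeasure_incseq[symmetric]) auto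
  also have "\<dots> = (SUP n. emeasure M {y. y + s \<in> A n})" by (simp add: 2)
  also have "\<dots> = emeasure M (\<Union>n. {y. y + s \<in> A n})"
    using inc o by (intro SUP_emeasure_incseq) (auto simp: incseq_def)
  also have "(\<Union>n. {y. y + s \<in> A n}) = {y. y + s \<in> V}" using UA by auto
  finally show ?thesis by simp
qed

lemma emeasure_right:
  assumes B: "B \<in> sets borel" shows "emeasure M ((\<lambda>y. y + s) -` B) = emeasure M B"
proof -
  have le: "emeasure M ((\<lambda>y. y + s) -` B) \<le> emeasure M B" if B: "B \<in> sets borel" for B s
    unfolding outer_regular[OF B]
  proof (rule INF_greatest, safe)
    fix V assume V: "open V" "B \<subseteq> V"
    have "open ((\<lambda>y. y + s) -` V)" using V by (intro open_vimage continuous_intros)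
    then have "emeasure M ((\<lambda>y. y + s) -` B) \<le> emeasure M ((\<lambda>y. y + s) -` V)"
      using V by (intro emeasure_mono) auto
    also have "\<dots> = emeasure M V" using emeasure_right_open[OF V(1), of s] by (simp add: vimage_def)
    finally show "emeasure M ((\<lambda>y. y + s) -` B) \<le> emeasure M V" .
  qed
  have "(\<lambda>y. y + s) -` B \<inter> space M \<in> sets M"
    using B by (intro measurable_sets[OF translations_measurable(2)]) simp
  then have "(\<lambda>y. y + s) -` B \<in> sets borel" by simp
  from le[OF B, of s] le[OF this, of "- s"] show ?thesis
    by (intro antisym) (simp_all add: vimage_def add.assoc)
qed

theorem distr_right: "distr M M (\<lambda>x. x + s) = M"
proof (rule measure_eqI)
  fix A assume "A \<in> sets (distr M M (\<lambda>x. x + s))"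
  then show "emeasure (distr M M (\<lambda>x. x + s)) A = emeasure M A"
    using emeasure_right[of A s] by (simp add: emeasure_distr)
qed simp

lemma nn_integral_right:
  assumes [measurable]: "f \<in> borel_measurable M"
  shows "(\<integral>\<^sup>+x. f (x + s) \<partial>M) = (\<integral>\<^sup>+x. f x \<partial>M)"
proof -
  have "(\<integral>\<^sup>+x. f x \<partial>M) = (\<integral>\<^sup>+x. f x \<partial>distr M M (\<lambda>x. x + s))" by (simp add: distr_right)
  also have "\<dots> = (\<integral>\<^sup>+x. f (x + s) \<partial>M)" by (rule nn_integral_distr) auto
  finally show ?thesis by simp
qed

text \<open>Once right translations preserve the measure, the inner integral in
  \<open>nn_integral_times_reflected\<close> for the window is constant.\<close>

lemma nn_integral_uminus:
  assumes g: "g \<in> borel_measurable M"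
  shows "(\<integral>\<^sup>+x. g (- x) \<partial>M) = (\<integral>\<^sup>+x. g x \<partial>M)"
proof -
  have "emeasure M window * (\<integral>\<^sup>+y. g (- y) \<partial>M)
      = (\<integral>\<^sup>+x. g x * (\<integral>\<^sup>+y. indicator window (y + x) \<partial>M) \<partial>M)"
    using nn_integral_times_reflected[of "indicator window" g] g window by simp
  also have "\<dots> = (\<integral>\<^sup>+x. g x * emeasure M window \<partial>M)"
    using nn_integral_right[of "indicator window"] window by simp
  also have "\<dots> = emeasure M window * (\<integral>\<^sup>+y. g y \<partial>M)"
    using g by (simp add: nn_integral_multc mult.commute)
  finally show ?thesis using window by (simp add: ennreal_mult_cancel_left)
qed

theorem distr_uminus: "distr M M uminus = M"
proof (rule measure_eqI)
  fix A assume "A \<in> sets (distr M M uminus)"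
  then have A: "A \<in> sets M" by simp
  have "emeasure (distr M M uminus) A = (\<integral>\<^sup>+x. indicator A x \<partial>distr M M uminus)" using A by simp
  also have "\<dots> = (\<integral>\<^sup>+x. indicator A (- x) \<partial>M)"
    using A by (intro nn_integral_distr) auto
  also have "\<dots> = emeasure M A" using A by (subst nn_integral_uminus) auto
  finally show "emeasure (distr M M uminus) A = emeasure M A" .
qed simp

end

section \<open>Subexponential weights with a gain in submultiplicativity\<close>

context haar_growth begin

text \<open>A function of the length is constant on each sphere, the sphere of radius \<open>n\<close> has at most
  polynomial measure, and the decay of \<open>\<phi>\<close> outweighs every power of \<open>n\<close>.\<close>

lemma nn_integral_len_finite:
  fixes \<phi> :: "real \<Rightarrow> real"
  assumes \<phi>: "\<And>x. 0 \<le> \<phi> x" "\<And>k::nat. (\<lambda>n. \<phi> (real n) * real n ^ k) \<in> O(\<lambda>n. 1 / real n ^ 2)"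
  shows "(\<integral>\<^sup>+x. ennreal (\<phi> (len U x)) \<partial>M) < \<infinity>"
proof -
  obtain K d where K: "0 < K" "\<And>n. 1 \<le> n \<Longrightarrow> emeasure M (set_pow U n) \<le> ennreal (K * real n ^ d)"
    using growth unfolding polynomial_growth_def by auto
  define S where "S n = {x. len U x = real n}" for n :: nat
  have [measurable]: "S n \<in> sets M" for n
  proof -
    have "S n = {x \<in> space M. len U x = real n}" by (simp add: S_def)
    also have "\<dots> \<in> sets M" by measurable
    finally show ?thesis .
  qed
  have S: "S n \<subseteq> set_pow U n" for n by (auto simp: S_def len_le_iff[symmetric])
  have eq: "ennreal (\<phi> (len U x)) = (\<Sum>n. ennreal (\<phi> (real n)) * indicator (S n) x)" for x
  proof -
    obtain m where m: "len U x = real m" by (rule len_in_Nats)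
    have "(\<Sum>n. ennreal (\<phi> (real n)) * indicator (S n) x) = (\<Sum>n\<in>{m}. ennreal (\<phi> (real n)) * indicator (S n) x)"
      by (rule suminf_finite) (auto simp: S_def m)
    then show ?thesis by (simp add: S_def m)
  qed
  have bnd: "ennreal (\<phi> (real n)) * emeasure M (S n) \<le> ennreal (K * (\<phi> (real n) * real n ^ d))" if "1 \<le> n" for n
  proof -
    have "emeasure M (S n) \<le> emeasure M (set_pow U n)" using S by (intro emeasure_mono) auto
    also have "\<dots> \<le> ennreal (K * real n ^ d)" using K(2) that .
    finally have "ennreal (\<phi> (real n)) * emeasure M (S n) \<le> ennreal (\<phi> (real n)) * ennreal (K * real n ^ d)"
      by (rule mult_left_mono) simp
    also have "\<dots> = ennreal (K * (\<phi> (real n) * real n ^ d))"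
      using \<phi>(1) K(1) by (simp add: ennreal_mult[symmetric] ac_simps)
    finally show ?thesis .
  qed
  have summ: "summable (\<lambda>n. K * (\<phi> (real n) * real n ^ d))"
    by (intro summable_mult summable_comparison_test_bigo[OF _ \<phi>(2)]) (simp add: inverse_power_summable norm_divide divide_inverse)
  have "(\<integral>\<^sup>+x. ennreal (\<phi> (len U x)) \<partial>M) = (\<Sum>n. ennreal (\<phi> (real n)) * emeasure M (S n))"
    unfolding eq using \<open>\<And>n. S n \<in> sets M\<close>
    by (subst nn_integral_suminf) (auto simp: nn_integral_cmult_indicator simp del: sets_M)
  also have "\<dots> = (\<Sum>n. ennreal (\<phi> (real (Suc n))) * emeasure M (S (Suc n))) + ennreal (\<phi> (real 0)) * emeasure M (S 0)"
    by (subst suminf_offset[of _ 1]) (auto simp: add.commute)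
  also have "\<dots> < \<infinity>"
  proof -
    have "(\<Sum>n. ennreal (\<phi> (real (Suc n))) * emeasure M (S (Suc n)))
        \<le> (\<Sum>n. ennreal (K * (\<phi> (real (Suc n)) * real (Suc n) ^ d)))"
      by (intro suminf_le summableI bnd) simp
    also have "\<dots> < \<infinity>"
    proof -
      have "summable (\<lambda>n. K * (\<phi> (real (Suc n)) * real (Suc n) ^ d))"
        using summ by (subst summable_Suc_iff)
      then show ?thesis
        using K(1) \<phi>(1) by (subst suminf_ennreal2) auto
    qed
    finally have 1: "(\<Sum>n. ennreal (\<phi> (real (Suc n))) * emeasure M (S (Suc n))) < \<infinity>" .
    have "emeasure M (S 0) \<le> emeasure M (set_pow U 0)" using S by (intro emeasure_mono) (auto simp del: set_pow_0)
    also have "\<dots> < \<infinity>" by (intro emeasure_compact compact_set_pow compact_U)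
    finally show ?thesis using 1 by (simp add: ennreal_mult_less_top)
  qed
  finally show ?thesis .
qed

end

text \<open>The two properties of a weight on which everything rests. The function \<open>w\<close> measures the
  gain in the submultiplicativity of \<open>\<omega>\<close>; it enters squared so that one factor \<open>w\<close> can be spent
  on integrability and the other one on smallness far out. The condition \<open>spread\<close> quantifies
  this smallness at the scale \<open>2 ^ n\<close>: its inequality holds if \<open>w \<le> \<delta> n\<close> wherever \<open>\<omega> > exp (\<kappa> 2
  ^ n)\<close>, and the \<open>\<delta> n\<close> are small enough for the series to diverge. The lower bound on \<open>\<delta> n\<close> is a
  normalization: errors of size \<open>exp (- \<kappa> 2 ^ n)\<close> are absorbed by \<open>\<delta> n\<close>.\<close>

locale gainful_weight = haar_growth M U
  for M :: "'a::{topological_group_add, t2_space} measure" and U +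
  fixes \<omega> w :: "'a \<Rightarrow> real" and K0 :: real
  assumes \<omega>_measurable [measurable]: "\<omega> \<in> borel_measurable M"
    and w_measurable [measurable]: "w \<in> borel_measurable M"
    and w_pos: "0 < w s" and w_le_1: "w s \<le> 1"
    and \<omega>_pos: "0 < \<omega> s"
    and one_le_\<omega>_w: "1 \<le> \<omega> s * w s"
    and \<omega>_uminus: "\<omega> (- s) = \<omega> s"
    and K0_pos: "0 < K0"
    and \<omega>_add: "\<omega> (s + t) \<le> K0 * \<omega> s * \<omega> t * ((w s)\<^sup>2 + (w t)\<^sup>2)"
    and w_integrable: "(\<integral>\<^sup>+s. ennreal (w s) \<partial>M) < \<infinity>"
    and spread: "0 < \<kappa> \<Longrightarrow> \<exists>\<delta>. (\<forall>n. exp (- \<kappa> * 2 ^ n) \<le> \<delta> n \<and> \<delta> n \<le> 1) \<and>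
      \<not> summable (\<lambda>n. ln (1 / \<delta> n) / 2 ^ n) \<and>
      (\<forall>n s. \<omega> s * w s \<le> exp (\<kappa> * 2 ^ n) + \<delta> n * \<omega> s)"

context haar_growth begin

text \<open>For \<open>\<omega> = exp (h \<circ> \<tau>)\<close> and a lower bound \<open>k\<close>, taken at the smaller argument, for the defect
  of additivity of \<open>h\<close>, the gain is \<open>w = exp (- k / 2)\<close>. Elements of length at most \<open>R n\<close>
  satisfy \<open>\<omega> \<le> exp (\<kappa> 2 ^ n)\<close> for large \<open>n\<close>; for longer ones the gain is at most \<open>exp (- (k (R
  n) - c) / 2)\<close>, so \<open>ln (1 / \<delta> n)\<close> is comparable to \<open>k (R n)\<close>. The constant \<open>c\<close> allows \<open>h\<close> and
  \<open>k\<close> to be monotone only up to a bounded error.\<close>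

lemma gainful_weight_exp_len:
  fixes h k :: "real \<Rightarrow> real"
  assumes [measurable]: "h \<in> borel_measurable borel" "k \<in> borel_measurable borel"
    and k: "\<And>x. 0 \<le> x \<Longrightarrow> 0 \<le> k x" "\<And>x. 0 \<le> x \<Longrightarrow> k x \<le> h x"
    and c: "0 \<le> c"
    and mono_h: "\<And>x y. 0 \<le> x \<Longrightarrow> x \<le> y \<Longrightarrow> h x \<le> h y + c"
    and mono_k: "\<And>x y. 0 \<le> x \<Longrightarrow> x \<le> y \<Longrightarrow> k x \<le> k y + c"
    and gain: "\<And>x y. 0 \<le> y \<Longrightarrow> y \<le> x \<Longrightarrow> h (x + y) \<le> h x + h y - k y + c"
    and decay: "\<And>j::nat. (\<lambda>n. exp (- (k (real n) / 2)) * real n ^ j) \<in> O(\<lambda>n. 1 / real n ^ 2)"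
    and radii: "\<And>\<kappa>. 0 < \<kappa> \<Longrightarrow> \<exists>R. (\<forall>n. 0 \<le> R n) \<and> (\<forall>\<^sub>F n in sequentially. h (R n) + c \<le> \<kappa> * 2 ^ n) \<and>
      \<not> summable (\<lambda>n. k (R n) / 2 ^ n)"
  shows "gainful_weight M U (\<lambda>s. exp (h (len U s))) (\<lambda>s. exp (- (k (len U s) / 2))) (exp (2 * c))"
proof unfold_locales
  fix s t
  have w2: "(exp (- (x / 2)))\<^sup>2 = exp (- x)" for x :: real
    by (simp add: power2_eq_square exp_add[symmetric])
  show w1: "exp (- (k (len U s) / 2)) \<le> 1" for s using k(1) len_nonneg[of s] by simp
  show "1 \<le> exp (h (len U s)) * exp (- (k (len U s) / 2))"
    using k[OF len_nonneg[of s]] by (simp add: exp_add[symmetric])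
  have *: "exp (h (len U (s + t))) \<le> exp (2 * c) * exp (h x) * exp (h y) * exp (- k y)"
    if "0 \<le> y" "y \<le> x" "len U (s + t) \<le> x + y" for x y
  proof -
    have "h (len U (s + t)) \<le> h (x + y) + c" using len_nonneg that by (intro mono_h)
    also have "h (x + y) \<le> h x + h y - k y + c"
      using that by (intro gain)
    finally have "h (len U (s + t)) \<le> 2 * c + h x + h y + - k y" by simp
    then show ?thesis by (simp only: exp_add[symmetric] exp_le_cancel_iff)
  qed
  show "exp (h (len U (s + t))) \<le> exp (2 * c) * exp (h (len U s)) * exp (h (len U t)) *
      ((exp (- (k (len U s) / 2)))\<^sup>2 + (exp (- (k (len U t) / 2)))\<^sup>2)"
    unfolding w2
  proof (cases "len U t \<le> len U s")
    case True
    have "exp (h (len U (s + t))) \<le> exp (2 * c) * exp (h (len U s)) * exp (h (len U t)) * exp (- k (len U t))"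
      using True len_add len_nonneg by (intro *)
    also have "\<dots> \<le> exp (2 * c) * exp (h (len U s)) * exp (h (len U t)) * (exp (- k (len U s)) + exp (- k (len U t)))"
      by (intro mult_left_mono) auto
    finally show "exp (h (len U (s + t))) \<le> \<dots>" .
  next
    case False
    have "exp (h (len U (s + t))) \<le> exp (2 * c) * exp (h (len U t)) * exp (h (len U s)) * exp (- k (len U s))"
      using False len_add[of s t] len_nonneg by (intro *) (auto simp: add.commute)
    also have "\<dots> \<le> exp (2 * c) * exp (h (len U t)) * exp (h (len U s)) * (exp (- k (len U s)) + exp (- k (len U t)))"
      by (intro mult_left_mono) auto
    finally show "exp (h (len U (s + t))) \<le> exp (2 * c) * exp (h (len U s)) * exp (h (len U t)) *
        (exp (- k (len U s)) + exp (- k (len U t)))" by (simp add: ac_simps)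
  qed
  show "(\<integral>\<^sup>+s. ennreal (exp (- (k (len U s) / 2))) \<partial>M) < \<infinity>"
    using decay by (intro nn_integral_len_finite) auto
next
  fix \<kappa> :: real assume \<kappa>: "0 < \<kappa>"
  obtain R N where R: "\<And>n. 0 \<le> R n" "\<And>n. N \<le> n \<Longrightarrow> h (R n) + c \<le> \<kappa> * 2 ^ n"
    "\<not> summable (\<lambda>n. k (R n) / 2 ^ n)"
    using radii[OF \<kappa>] by (auto simp: eventually_sequentially)
  \<comment> \<open>For \<open>n < N\<close> the radius may be too large, and the trivial bound \<open>w \<le> 1\<close> is used.\<close>
  define \<delta> where "\<delta> n = (if n < N then 1 else min 1 (exp (- ((k (R n) - c) / 2))))" for n
  show "\<exists>\<delta>. (\<forall>n. exp (- \<kappa> * 2 ^ n) \<le> \<delta> n \<and> \<delta> n \<le> 1) \<and>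
      \<not> summable (\<lambda>n. ln (1 / \<delta> n) / 2 ^ n) \<and>
      (\<forall>n s. exp (h (len U s)) * exp (- (k (len U s) / 2)) \<le> exp (\<kappa> * 2 ^ n) + \<delta> n * exp (h (len U s)))"
  proof (intro exI[of _ \<delta>] conjI allI notI)
    fix n
    show "\<delta> n \<le> 1" by (simp add: \<delta>_def)
    show "exp (- \<kappa> * 2 ^ n) \<le> \<delta> n"
    proof (cases "n < N")
      case True
      then show ?thesis using \<kappa> by (simp add: \<delta>_def)
    next
      case False
      have "k (R n) \<le> \<kappa> * 2 ^ n" using k(2)[OF R(1), of n] R(2)[of n] False c by simp
      moreover have "0 \<le> \<kappa> * 2 ^ n" using \<kappa> by simp
      ultimately have "- (\<kappa> * 2 ^ n) \<le> - ((k (R n) - c) / 2)" using c by (simp add: field_simps)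
      then show ?thesis using False \<kappa> by (simp add: \<delta>_def)
    qed
    fix s
    show "exp (h (len U s)) * exp (- (k (len U s) / 2)) \<le> exp (\<kappa> * 2 ^ n) + \<delta> n * exp (h (len U s))"
    proof (cases "n < N")
      case True
      have "exp (h (len U s)) * exp (- (k (len U s) / 2)) \<le> exp (h (len U s)) * 1"
        using k(1)[OF len_nonneg[of s]] by (intro mult_left_mono) auto
      then show ?thesis using True by (simp add: \<delta>_def add_increasing)
    next
      case F: False
      show ?thesis
      proof (cases "len U s \<le> R n")
        case True
        have "h (len U s) + - (k (len U s) / 2) \<le> h (len U s)" using k(1)[OF len_nonneg[of s]] by simp
        also have "\<dots> \<le> h (R n) + c" using True len_nonneg by (intro mono_h)
        also have "\<dots> \<le> \<kappa> * 2 ^ n" using F R(2) by simp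
        finally have "exp (h (len U s)) * exp (- (k (len U s) / 2)) \<le> exp (\<kappa> * 2 ^ n)"
          by (simp only: exp_add[symmetric] exp_le_cancel_iff)
        then show ?thesis using F by (simp add: \<delta>_def add_increasing2)
      next
        case False
        have "k (R n) \<le> k (len U s) + c" using False R(1) by (intro mono_k) auto
        then have "exp (- (k (len U s) / 2)) \<le> \<delta> n"
          using F k(1)[OF len_nonneg[of s]] by (simp add: \<delta>_def)
        then have "exp (h (len U s)) * exp (- (k (len U s) / 2)) \<le> \<delta> n * exp (h (len U s))"
          by (subst mult.commute) (intro mult_right_mono, auto)
        then show ?thesis by (rule add_increasing[rotated]) simp
      qed
    qed
  next
    assume "summable (\<lambda>n. ln (1 / \<delta> n) / 2 ^ n)"
    then have "summable (\<lambda>n. 2 * (ln (1 / \<delta> n) / 2 ^ n) + c * (1 / 2) ^ n)"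
      by (intro summable_add summable_mult) auto
    moreover have "\<forall>\<^sub>F n in sequentially. norm (k (R n) / 2 ^ n) \<le> 2 * (ln (1 / \<delta> n) / 2 ^ n) + c * (1 / 2) ^ n"
    proof (rule eventually_sequentiallyI)
      fix n assume n: "N \<le> n"
      have "\<delta> n \<le> exp (- ((k (R n) - c) / 2))" "0 < \<delta> n" using n by (auto simp: \<delta>_def)
      then have "ln (\<delta> n) \<le> ln (exp (- ((k (R n) - c) / 2)))" by (subst ln_le_cancel_iff) auto
      then have "ln (\<delta> n) \<le> - ((k (R n) - c) / 2)" by simp
      then have "k (R n) \<le> c - 2 * ln (\<delta> n)" by argo
      then have "k (R n) \<le> 2 * ln (1 / \<delta> n) + c" using \<open>0 < \<delta> n\<close> by (simp add: ln_div)
      then have "k (R n) / 2 ^ n \<le> (2 * ln (1 / \<delta> n) + c) / 2 ^ n" by (intro divide_right_mono) auto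
      also have "\<dots> = 2 * (ln (1 / \<delta> n) / 2 ^ n) + c * (1 / 2) ^ n"
        by (simp add: add_divide_distrib power_divide)
      finally show "norm (k (R n) / 2 ^ n) \<le> 2 * (ln (1 / \<delta> n) / 2 ^ n) + c * (1 / 2) ^ n"
        using k(1)[OF R(1)] by simp
    qed
    ultimately have "summable (\<lambda>n. k (R n) / 2 ^ n)"
      by (rule summable_comparison_test_ev[rotated])
    then show False using R(3) by simp
  qed
qed auto

text \<open>The slope of \<open>x powr \<alpha>\<close> beyond \<open>x\<close> is at most \<open>\<alpha> x powr (\<alpha> - 1)\<close>; multiplied with \<open>y \<le> x\<close>
  it is at most \<open>\<alpha> y powr \<alpha>\<close>, so a fraction \<open>1 - \<alpha>\<close> of \<open>y powr \<alpha>\<close> is gained.\<close>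

lemma powr_add_le:
  fixes x y :: real
  assumes \<alpha>: "0 < \<alpha>" "\<alpha> < 1" and xy: "0 < y" "y \<le> x"
  shows "(x + y) powr \<alpha> \<le> x powr \<alpha> + \<alpha> * y powr \<alpha>"
proof -
  have x: "0 < x" using xy by simp
  \<comment> \<open>Bernoulli for an exponent below \<open>1\<close>, from \<open>ln u \<le> u - 1\<close> at \<open>u = t / A\<close> and \<open>u = 1 / A\<close>.\<close>
  have bern: "(1 + y / x) powr \<alpha> \<le> 1 + \<alpha> * (y / x)"
  proof -
    define t A where "t = 1 + y / x" and "A = 1 + \<alpha> * (y / x)"
    have pos: "0 < t" "0 < A" using xy \<alpha> by (simp_all add: t_def A_def add_pos_nonneg)
    have "\<alpha> * ln (t / A) + (1 - \<alpha>) * ln (1 / A) \<le> \<alpha> * (t / A - 1) + (1 - \<alpha>) * (1 / A - 1)"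
      using pos \<alpha> by (intro add_mono mult_left_mono ln_le_minus_one) auto
    also have "\<dots> = (\<alpha> * t + 1 - \<alpha>) / A - 1"
      by (simp add: algebra_simps add_divide_distrib diff_divide_distrib)
    also have "\<alpha> * t + 1 - \<alpha> = A" by (simp add: t_def A_def algebra_simps)
    finally have "\<alpha> * ln t \<le> ln A" using pos by (simp add: ln_div algebra_simps)
    then have "exp (\<alpha> * ln t) \<le> exp (ln A)" by (subst exp_le_cancel_iff)
    then have "t powr \<alpha> \<le> A" using pos by (simp add: powr_def)
    then show ?thesis by (simp add: t_def A_def)
  qed
  have "x + y = x * (1 + y / x)" using x by (simp add: field_simps)
  then have "(x + y) powr \<alpha> = x powr \<alpha> * (1 + y / x) powr \<alpha>"
    using xy x by (simp add: powr_mult)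
  also have "\<dots> \<le> x powr \<alpha> * (1 + \<alpha> * (y / x))"
    by (intro mult_left_mono bern) simp
  also have "\<dots> = x powr \<alpha> + \<alpha> * (y * x powr (\<alpha> - 1))"
    using x by (simp add: powr_diff field_simps)
  also have "\<dots> \<le> x powr \<alpha> + \<alpha> * (y * y powr (\<alpha> - 1))"
    using xy \<alpha> by (intro add_left_mono mult_left_mono powr_mono2') auto
  also have "\<dots> = x powr \<alpha> + \<alpha> * y powr \<alpha>"
    using xy by (simp add: powr_diff)
  finally show ?thesis .
qed

lemma not_summable_const:
  fixes f :: "nat \<Rightarrow> real"
  assumes "0 < c" "\<And>n. f n = c" shows "\<not> summable f"
proof -
  have "f = (\<lambda>_. c)" using assms(2) by (intro ext)
  then show ?thesis using assms(1) by (auto dest!: summable_LIMSEQ_zero simp: LIMSEQ_const_iff)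
qed

text \<open>Here \<open>k = (1 - \<alpha>) h\<close>, and the radius at which \<open>h (R n) = \<kappa> 2 ^ n\<close> makes the terms \<open>k (R n)
  / 2 ^ n\<close> constant.\<close>

lemma gainful_sigma_weight:
  assumes \<alpha>: "0 < \<alpha>" "\<alpha> < 1" and C: "0 < C"
  shows "\<exists>w K. gainful_weight M U (sigma_weight U \<alpha> C) w K"
proof -
  define h where "h x = C * x powr \<alpha>" for x :: real
  define k where "k x = C * (1 - \<alpha>) * x powr \<alpha>" for x :: real
  have C\<alpha>: "0 < C * (1 - \<alpha>)" using C \<alpha> by simp
  have "gainful_weight M U (\<lambda>s. exp (h (len U s))) (\<lambda>s. exp (- (k (len U s) / 2))) (exp (2 * 0))"
  proof (rule gainful_weight_exp_len)
    show "h \<in> borel_measurable borel" "k \<in> borel_measurable borel"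
      unfolding h_def[abs_def] k_def[abs_def] by measurable
    show "0 \<le> k x" "k x \<le> h x" for x
      using C \<alpha> by (auto simp: k_def h_def mult.assoc mult_left_le_one_le)
    show "h x \<le> h y + 0" if "0 \<le> x" "x \<le> y" for x y
      using that C \<alpha> by (simp add: h_def powr_mono2)
    show "k x \<le> k y + 0" if "0 \<le> x" "x \<le> y" for x y
      using that C \<alpha> by (simp add: k_def powr_mono2)
    show "h (x + y) \<le> h x + h y - k y + 0" if "0 \<le> y" "y \<le> x" for x y
    proof (cases "y = 0")
      case True
      then show ?thesis using \<alpha> by (simp add: h_def k_def)
    next
      case False
      then have "C * (x + y) powr \<alpha> \<le> C * (x powr \<alpha> + \<alpha> * y powr \<alpha>)"
        using C that \<alpha> by (intro mult_left_mono powr_add_le) auto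
      then show ?thesis by (simp add: h_def k_def algebra_simps)
    qed
    show "(\<lambda>n. exp (- (k (real n) / 2)) * real n ^ j) \<in> O(\<lambda>n. 1 / real n ^ 2)" for j :: nat
    proof -
      have "(\<lambda>n. exp (- (D * real n powr \<alpha> / 2)) * real n ^ j) \<in> O(\<lambda>n. 1 / real n ^ 2)"
        if "0 < D" for D :: real
        using that \<alpha> by real_asymp
      from this[OF C\<alpha>] show ?thesis by (simp add: k_def)
    qed
    fix \<kappa> :: real assume \<kappa>: "0 < \<kappa>"
    define R where "R n = (\<kappa> / C * 2 ^ n) powr (1 / \<alpha>)" for n :: nat
    have R\<alpha>: "R n powr \<alpha> = \<kappa> / C * 2 ^ n" for n using \<alpha> \<kappa> C by (simp add: R_def powr_powr)
    show "\<exists>R. (\<forall>n. 0 \<le> R n) \<and> (\<forall>\<^sub>F n in sequentially. h (R n) + 0 \<le> \<kappa> * 2 ^ n) \<and>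
      \<not> summable (\<lambda>n. k (R n) / 2 ^ n)"
    proof (intro exI[of _ R] conjI allI)
      show "0 \<le> R n" for n by (simp add: R_def)
      show "\<forall>\<^sub>F n in sequentially. h (R n) + 0 \<le> \<kappa> * 2 ^ n" using C by (simp add: h_def R\<alpha>)
      show "\<not> summable (\<lambda>n. k (R n) / 2 ^ n)"
        using \<kappa> \<alpha> C by (intro not_summable_const[of "(1 - \<alpha>) * \<kappa>"]) (auto simp: k_def R\<alpha>)
    qed
  qed simp
  then show ?thesis unfolding sigma_weight_def[abs_def] h_def by blast
qed

text \<open>For large \<open>\<gamma>\<close> the function \<open>x / (ln (e + x))\<^sup>\<gamma>\<close> decreases on a bounded interval, but it is
  increasing from some point on, which costs an additive constant.\<close>

lemma log_weight_quasi_mono: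
  fixes \<gamma> C :: real
  assumes \<gamma>: "0 < \<gamma>" and C: "0 < C"
  shows "\<exists>c\<ge>0. \<forall>x y. 0 \<le> x \<longrightarrow> x \<le> y \<longrightarrow>
    C * x / ln (exp 1 + x) powr \<gamma> \<le> C * y / ln (exp 1 + y) powr \<gamma> + c"
proof -
  define L where "L x = ln (exp 1 + x)" for x :: real
  define h where "h x = C * x / L x powr \<gamma>" for x :: real
  have L1: "1 \<le> L x" if "0 \<le> x" for x
    using that by (simp add: L_def ln_ge_iff add_pos_nonneg)
  have Lpow: "1 \<le> L x powr \<gamma>" if "0 \<le> x" for x
    using L1[OF that] \<gamma> by (auto simp: ge_one_powr_ge_zero)
  have "eventually (\<lambda>x. 0 < L x powr (- \<gamma>) - x * (\<gamma> * L x powr (- \<gamma> - 1) / (exp 1 + x))) at_top"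
    unfolding L_def using \<gamma> by real_asymp
  then obtain x0 where x0: "\<And>x. x0 \<le> x \<Longrightarrow> 0 < L x powr (- \<gamma>) - x * (\<gamma> * L x powr (- \<gamma> - 1) / (exp 1 + x))"
    by (auto simp: eventually_at_top_linorder)
  define x1 where "x1 = max x0 0"
  have inc: "h x \<le> h y" if "x1 \<le> x" "x \<le> y" for x y
  proof (rule DERIV_nonneg_imp_nondecreasing[OF that(2)])
    fix z assume z: "x \<le> z" "z \<le> y"
    then have z0: "0 \<le> z" "x0 \<le> z" using that by (auto simp: x1_def)
    have ez: "1 < exp 1 + z" using z0 exp_gt_one[of "1::real"] by linarith
    have "((\<lambda>x. C * (x * L x powr (- \<gamma>))) has_real_derivative
        C * (L z powr (- \<gamma>) - z * (\<gamma> * L z powr (- \<gamma> - 1) / (exp 1 + z)))) (at z)"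
      unfolding L_def using z0 L1[OF z0(1)] ez
      by (auto intro!: derivative_eq_intros simp: L_def powr_diff divide_simps)
    moreover have "h = (\<lambda>x. C * (x * L x powr (- \<gamma>)))"
      by (simp add: h_def fun_eq_iff powr_minus divide_inverse)
    ultimately show "\<exists>D. (h has_real_derivative D) (at z) \<and> 0 \<le> D"
      using x0[OF z0(2)] C by (auto simp: zero_le_mult_iff less_imp_le)
  qed
  have "h x \<le> h y + C * x1" if "0 \<le> x" "x \<le> y" for x y
  proof (cases "x1 \<le> x")
    case True
    moreover have "0 \<le> C * x1" using C by (simp add: x1_def)
    ultimately show ?thesis using inc[of x y] that by simp
  next
    case False
    have "h x \<le> C * x / 1"
      unfolding h_def using that C Lpow[of x] by (intro divide_left_mono) auto
    also have "\<dots> \<le> C * x1" using False C by simp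
    moreover have "0 \<le> h y" using that C by (simp add: h_def)
    ultimately show ?thesis by simp
  qed
  moreover have "0 \<le> C * x1" using C by (simp add: x1_def)
  ultimately show ?thesis unfolding h_def L_def by blast
qed

text \<open>The gain comes from the logarithm only: replacing \<open>ln (e + y)\<close> by \<open>ln (e + 2 y)\<close> in the
  denominator lowers \<open>h y\<close> by about \<open>\<gamma> ln 2 C y / ln (e + y) powr (\<gamma> + 1)\<close>, and at most half of
  this is taken as \<open>k\<close>. The radius at which \<open>h\<close> is of order \<open>2 ^ n\<close> is of order \<open>2 ^ n n\<^sup>\<gamma>\<close>, and
  there \<open>k (R n) / 2 ^ n\<close> is of order \<open>1 / n\<close>, so the series just diverges.\<close>

lemma gainful_rho_weight:
  assumes \<gamma>: "0 < \<gamma>" and C: "0 < C"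
  shows "\<exists>w K. gainful_weight M U (rho_weight U \<gamma> C) w K"
proof -
  define L where "L x = ln (exp 1 + x)" for x :: real
  \<comment> \<open>The minimum with \<open>1\<close> ensures \<open>k \<le> h\<close>.\<close>
  define c0 where "c0 = C * min 1 (\<gamma> * ln 2 / 2)"
  have c0: "0 < c0" "c0 \<le> C" "c0 \<le> C * (\<gamma> * ln 2 / 2)" using C \<gamma> by (auto simp: c0_def mult_left_mono)
  define h where "h x = C * x / L x powr \<gamma>" for x :: real
  define k where "k x = c0 * x / L x powr (\<gamma> + 1)" for x :: real
  have L1: "1 \<le> L x" if "0 \<le> x" for x
    using that by (simp add: L_def ln_ge_iff add_pos_nonneg)
  have Lpow: "1 \<le> L x powr \<gamma>" "1 \<le> L x powr (\<gamma> + 1)" "L x powr \<gamma> \<le> L x powr (\<gamma> + 1)"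
    if "0 \<le> x" for x
    using L1[OF that] \<gamma> by (auto simp: ge_one_powr_ge_zero intro!: powr_mono)
  have Lpmono: "L x powr \<gamma> \<le> L y powr \<gamma>" if "0 \<le> x" "x \<le> y" for x y
  proof -
    have "L x \<le> L y" using that by (simp add: L_def add_pos_nonneg)
    then show ?thesis using L1[of x] that \<gamma> by (intro powr_mono2) auto
  qed
  have anti: "C * z / L y powr \<gamma> \<le> C * z / L x powr \<gamma>" if "0 \<le> x" "x \<le> y" "0 \<le> z" for x y z
    using that C less_le_trans[OF zero_less_one Lpow(1), of x] less_le_trans[OF zero_less_one Lpow(1), of y]
      Lpmono[of x y]
    by (intro divide_left_mono mult_pos_pos mult_nonneg_nonneg) auto
  obtain c1 where c1: "0 \<le> c1" "\<And>x y. 0 \<le> x \<Longrightarrow> x \<le> y \<Longrightarrow> h x \<le> h y + c1"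
    using log_weight_quasi_mono[OF \<gamma> C] unfolding h_def L_def by blast
  obtain c2 where c2: "0 \<le> c2" "\<And>x y. 0 \<le> x \<Longrightarrow> x \<le> y \<Longrightarrow> k x \<le> k y + c2"
    using log_weight_quasi_mono[of "\<gamma> + 1" c0] \<gamma> c0 unfolding k_def L_def by auto
  have "\<forall>\<^sub>F y in at_top. C * (\<gamma> * ln 2 / 2) * y / L y powr (\<gamma> + 1) \<le> C * y / L y powr \<gamma> - C * y / L (2 * y) powr \<gamma>"
    unfolding L_def using \<gamma> C by real_asymp
  then obtain y0 where y0: "\<And>y. y0 \<le> y \<Longrightarrow>
      C * (\<gamma> * ln 2 / 2) * y / L y powr (\<gamma> + 1) \<le> C * y / L y powr \<gamma> - C * y / L (2 * y) powr \<gamma>"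
    by (auto simp: eventually_at_top_linorder)
  define c where "c = max (max c1 c2) (c0 * \<bar>y0\<bar>)"
  have k_gain: "k y \<le> C * y / L y powr \<gamma> - C * y / L (2 * y) powr \<gamma> + c" if "0 \<le> y" for y
  proof (cases "y0 \<le> y")
    case True
    have "k y \<le> C * (\<gamma> * ln 2 / 2) * y / L y powr (\<gamma> + 1)"
      unfolding k_def using c0 that by (intro divide_right_mono mult_right_mono) auto
    moreover have "0 \<le> c" using c1 by (simp add: c_def)
    ultimately show ?thesis using y0[OF True] by linarith
  next
    case False
    have "k y \<le> c0 * y / 1" unfolding k_def using that c0 Lpow[of y] by (intro divide_left_mono) auto
    also have "\<dots> \<le> c" using False c0 that by (auto simp: c_def intro!: max.coboundedI2 mult_left_mono)
    finally show ?thesis using anti[of y "2 * y" y] that by simp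
  qed
  have "gainful_weight M U (\<lambda>s. exp (h (len U s))) (\<lambda>s. exp (- (k (len U s) / 2))) (exp (2 * c))"
  proof (rule gainful_weight_exp_len)
    show "h \<in> borel_measurable borel" "k \<in> borel_measurable borel"
      unfolding h_def[abs_def] k_def[abs_def] L_def[abs_def] by measurable
    show "0 \<le> k x" if "0 \<le> x" for x
      using that c0 by (simp add: k_def)
    show "k x \<le> h x" if "0 \<le> x" for x
      unfolding k_def h_def using that c0 C Lpow[OF that] by (intro frac_le mult_right_mono) auto
    show "0 \<le> c" using c1 by (simp add: c_def)
    show "h x \<le> h y + c" if "0 \<le> x" "x \<le> y" for x y
      using c1(2)[OF that] by (simp add: c_def)
    show "k x \<le> k y + c" if "0 \<le> x" "x \<le> y" for x y
      using c2(2)[OF that] by (simp add: c_def)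
    show "h (x + y) \<le> h x + h y - k y + c" if "0 \<le> y" "y \<le> x" for x y
    proof -
      have "h (x + y) = C * x / L (x + y) powr \<gamma> + C * y / L (x + y) powr \<gamma>"
        by (simp add: h_def add_divide_distrib distrib_left)
      also have "\<dots> \<le> C * x / L x powr \<gamma> + C * y / L (2 * y) powr \<gamma>"
        using that by (intro add_mono anti) auto
      finally show ?thesis using k_gain[OF that(1)] by (simp add: h_def)
    qed
    show "(\<lambda>n. exp (- (k (real n) / 2)) * real n ^ j) \<in> O(\<lambda>n. 1 / real n ^ 2)" for j :: nat
      unfolding k_def L_def using \<gamma> c0 by real_asymp
    fix \<kappa> :: real assume \<kappa>: "0 < \<kappa>"
    \<comment> \<open>Since \<open>ln (R n)\<close> is asymptotic to \<open>n ln 2\<close>, this factor makes \<open>h (R n) / 2 ^ n\<close> tend to \<open>\<kappa> / 2\<close>.\<close>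
    define \<eta> where "\<eta> = \<kappa> * ln 2 powr \<gamma> / (2 * C)"
    have \<eta>: "0 < \<eta>" using \<kappa> C by (simp add: \<eta>_def)
    define R where "R n = \<eta> * (2 ^ n * real n powr \<gamma>)" for n :: nat
    show "\<exists>R. (\<forall>n. 0 \<le> R n) \<and> (\<forall>\<^sub>F n in sequentially. h (R n) + c \<le> \<kappa> * 2 ^ n) \<and>
      \<not> summable (\<lambda>n. k (R n) / 2 ^ n)"
    proof (intro exI[of _ R] conjI allI notI)
      show "0 \<le> R n" for n using \<eta> by (simp add: R_def)
      have "(\<lambda>n. h (R n) / 2 ^ n) \<longlonglongrightarrow> C * \<eta> * inverse (ln 2 powr \<gamma>)"
        unfolding h_def R_def L_def using \<eta> \<gamma> C by real_asymp
      also have "C * \<eta> * inverse (ln 2 powr \<gamma>) = \<kappa> / 2" using C by (simp add: \<eta>_def divide_simps)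
      finally have lim: "(\<lambda>n. h (R n) / 2 ^ n) \<longlonglongrightarrow> \<kappa> / 2" .
      have "(\<lambda>n. c / 2 ^ n) \<longlonglongrightarrow> 0" by real_asymp
      from tendsto_add[OF lim this] have "(\<lambda>n. (h (R n) + c) / 2 ^ n) \<longlonglongrightarrow> \<kappa> / 2"
        by (simp add: add_divide_distrib)
      then have "\<forall>\<^sub>F n in sequentially. (h (R n) + c) / 2 ^ n < \<kappa>"
        by (rule order_tendstoD(2)) (use \<kappa> in simp)
      then show "\<forall>\<^sub>F n in sequentially. h (R n) + c \<le> \<kappa> * 2 ^ n"
        by eventually_elim (simp add: divide_less_eq)
      assume S: "summable (\<lambda>n. k (R n) / 2 ^ n)"
      have O: "(\<lambda>n. 1 / real n) \<in> O(\<lambda>n. k (R n) / 2 ^ n)"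
        unfolding k_def R_def L_def using \<eta> \<gamma> c0 by real_asymp
      have "0 \<le> k (R n) / 2 ^ n" for n using c0 \<eta> by (simp add: k_def R_def)
      then have "norm (k (R n) / 2 ^ n) = k (R n) / 2 ^ n" for n
        unfolding real_norm_def by (rule abs_of_nonneg)
      then have "summable (\<lambda>n. norm (k (R n) / 2 ^ n))" using S by (simp only:)
      from summable_comparison_test_bigo[OF this O] have "summable (\<lambda>n. inverse (real n))"
        by (simp only: inverse_eq_divide)
      then show False by (rule notE[OF not_summable_harmonic])
    qed
  qed
  then show ?thesis unfolding rho_weight_def[abs_def] h_def L_def by blast
qed

end

section \<open>Complementary Young functions and the Orlicz norm\<close>

locale young_pair =
  fixes \<Phi> \<Psi> :: "real \<Rightarrow> ennreal"
  assumes pair: "complementary_young_pair \<Phi> \<Psi>"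
    and \<Phi>_finite: "\<And>x. 0 \<le> x \<Longrightarrow> \<Phi> x < \<infinity>"
    and \<Phi>_continuous: "continuous_on {0..} \<Phi>"
begin

lemma \<Phi>_0: "\<Phi> 0 = 0" and \<Psi>_0: "\<Psi> 0 = 0"
  and \<Psi>_eq: "0 \<le> y \<Longrightarrow> \<Psi> y = (SUP x\<in>{0..}. ennreal (x * y) - \<Phi> x)"
  using pair by (simp_all add: complementary_young_pair_def young_function_def)

lemma \<Phi>_convex:
  "0 \<le> x \<Longrightarrow> 0 \<le> y \<Longrightarrow> 0 \<le> t \<Longrightarrow> t \<le> 1 \<Longrightarrow>
    \<Phi> ((1 - t) * x + t * y) \<le> ennreal (1 - t) * \<Phi> x + ennreal t * \<Phi> y"
  using pair by (simp add: complementary_young_pair_def young_function_def)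

lemma \<Phi>_scale: "0 \<le> y \<Longrightarrow> 0 \<le> t \<Longrightarrow> t \<le> 1 \<Longrightarrow> \<Phi> (t * y) \<le> ennreal t * \<Phi> y"
  using \<Phi>_convex[of 0 y t] by (simp add: \<Phi>_0)

lemma \<Psi>_scale: "0 \<le> y \<Longrightarrow> 0 \<le> t \<Longrightarrow> t \<le> 1 \<Longrightarrow> \<Psi> (t * y) \<le> ennreal t * \<Psi> y"
proof -
  assume y: "0 \<le> y" and t: "0 \<le> t" "t \<le> 1"
  have "\<forall>x\<ge>0. \<forall>y\<ge>0. \<forall>t\<in>{0..1}.
        \<Psi> ((1 - t) * x + t * y) \<le> ennreal (1 - t) * \<Psi> x + ennreal t * \<Psi> y"
    using pair unfolding complementary_young_pair_def young_function_def by (elim conjE)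
  from this[rule_format, of 0 y t] y t show ?thesis by (simp add: \<Psi>_0)
qed

lemma \<Psi>_mono: "0 \<le> x \<Longrightarrow> x \<le> y \<Longrightarrow> \<Psi> x \<le> \<Psi> y"
  by (simp add: \<Psi>_eq) (rule SUP_mono, auto intro!: ennreal_minus_mono ennreal_leI mult_left_mono)

lemma young_inequality: "0 \<le> x \<Longrightarrow> 0 \<le> y \<Longrightarrow> ennreal (x * y) \<le> \<Phi> x + \<Psi> y"
proof -
  assume "0 \<le> x" "0 \<le> y"
  then have "ennreal (x * y) - \<Phi> x \<le> \<Psi> y" by (simp add: \<Psi>_eq) (intro SUP_upper, simp)
  then show ?thesis by (simp add: ennreal_minus_le_iff)
qed

text \<open>Convexity makes \<open>\<Phi>\<close> grow at least linearly beyond a point \<open>x0\<close> with \<open>\<Phi> x0 > 0\<close>; for small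
  \<open>y\<close> only arguments up to \<open>x0\<close> then contribute to the supremum defining \<open>\<Psi> y\<close>.\<close>

lemma \<Psi>_linear_near_0:
  obtains a b where "0 < a" "0 < b" "\<And>y. 0 \<le> y \<Longrightarrow> y \<le> a \<Longrightarrow> \<Psi> y \<le> ennreal (b * y)"
proof -
  obtain x0 where x0: "0 \<le> x0" "\<Phi> x0 \<noteq> 0"
    using pair by (auto simp: complementary_young_pair_def young_function_def)
  then have x0': "0 < x0" using \<Phi>_0 by (cases "x0 = 0") auto
  obtain p where p: "\<Phi> x0 = ennreal p" "0 < p"
    using \<Phi>_finite[OF x0(1)] x0(2) by (cases "\<Phi> x0") (auto simp: less_le)
  have "\<Psi> y \<le> ennreal (x0 * y)" if y: "0 \<le> y" "y \<le> p / x0" for y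
    unfolding \<Psi>_eq[OF y(1)]
  proof (rule SUP_least)
    fix x :: real assume "x \<in> {0..}"
    then have x: "0 \<le> x" by simp
    show "ennreal (x * y) - \<Phi> x \<le> ennreal (x0 * y)"
    proof (cases "x \<le> x0")
      case True
      then have "x * y \<le> x0 * y" using y by (intro mult_right_mono)
      then show ?thesis by (meson diff_le_self_ennreal ennreal_leI order_trans)
    next
      case False
      obtain r where r: "\<Phi> x = ennreal r" "0 \<le> r" using \<Phi>_finite[OF x] by (cases "\<Phi> x") auto
      have "\<Phi> (x0 / x * x) \<le> ennreal (x0 / x) * \<Phi> x" using False x x0' by (intro \<Phi>_scale) auto
      moreover have "x0 / x * x = x0" using False x0' by simp
      ultimately have "ennreal p \<le> ennreal (x0 / x * r)"
        using False x0' r p by (simp only: ennreal_mult) (simp add: ennreal_mult del: times_divide_eq_left)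
      then have "p \<le> x0 / x * r" using False x x0' r by (subst (asm) ennreal_le_iff) auto
      then have "x * (p / x0) \<le> r" using False x x0' by (simp add: field_simps)
      moreover have "x * y \<le> x * (p / x0)" using y x by (intro mult_left_mono)
      ultimately have "x * y - r \<le> 0" by simp
      then show ?thesis using r by (simp add: ennreal_minus ennreal_neg)
    qed
  qed
  then show ?thesis using that[of "p / x0" x0] x0' p by simp
qed

text \<open>The slope of a supporting line of \<open>\<Phi>\<close> at \<open>x\<close> is a point of equality in Young's inequality.
  The value \<open>y = 0\<close> at \<open>x = 0\<close> keeps supports from growing.\<close>

lemma young_equality:
  assumes x: "0 \<le> x"
  shows "\<exists>y\<ge>0. \<Phi> x + \<Psi> y = ennreal (x * y) \<and> (x = 0 \<longrightarrow> y = 0)"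
proof (cases "x = 0")
  case True
  then show ?thesis by (intro exI[of _ 0]) (simp add: \<Phi>_0 \<Psi>_0)
next
  case False
  define p where "p z = enn2real (\<Phi> z)" for z
  have p: "\<Phi> z = ennreal (p z)" "0 \<le> p z" if "0 \<le> z" for z
    using \<Phi>_finite[OF that] by (auto simp: p_def less_top)
  have "convex_on {0..} p"
  proof (rule convex_onI)
    fix t u v :: real assume *: "0 < t" "t < 1" "u \<in> {0..}" "v \<in> {0..}"
    then have nn: "0 \<le> (1 - t) * u + t * v" by simp
    have "ennreal (p ((1 - t) * u + t * v)) \<le> ennreal ((1 - t) * p u + t * p v)"
      using \<Phi>_convex[of u v t] * nn by (simp add: p ennreal_mult[symmetric] ennreal_plus[symmetric] del: ennreal_plus)
    then have "p ((1 - t) * u + t * v) \<le> (1 - t) * p u + t * p v"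
      using * p by (subst (asm) ennreal_le_iff) auto
    then show "p ((1 - t) *\<^sub>R u + t *\<^sub>R v) \<le> (1 - t) * p u + t * p v" by simp
  qed simp
  moreover have "x \<in> interior {0..}" using x False by simp
  ultimately obtain m where m: "\<And>z. 0 \<le> z \<Longrightarrow> p x + m * (z - x) \<le> p z"
    using convex_le_Inf_differential[of "{0..}" p x] by (metis atLeast_iff)
  have "0 \<le> p x" "p 0 = 0" using p(2)[OF x] by (simp_all add: p_def \<Phi>_0)
  with m[of 0] have "0 \<le> m * x" by simp
  then have m0: "0 \<le> m" using x False by (simp add: zero_le_mult_iff)
  have "\<Psi> m = ennreal (x * m - p x)"
    unfolding \<Psi>_eq[OF m0]
  proof (rule antisym)
    show "(SUP z\<in>{0..}. ennreal (z * m) - \<Phi> z) \<le> ennreal (x * m - p x)"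
    proof (rule SUP_least)
      fix z :: real assume "z \<in> {0..}"
      then have "ennreal (z * m) - \<Phi> z = ennreal (z * m - p z)"
        by (simp add: p ennreal_minus)
      also have "\<dots> \<le> ennreal (x * m - p x)"
        using m[of z] \<open>z \<in> {0..}\<close> by (intro ennreal_leI) (simp add: algebra_simps)
      finally show "ennreal (z * m) - \<Phi> z \<le> ennreal (x * m - p x)" .
    qed
    show "ennreal (x * m - p x) \<le> (SUP z\<in>{0..}. ennreal (z * m) - \<Phi> z)"
      using x by (intro SUP_upper2[of x]) (simp_all add: p ennreal_minus)
  qed
  moreover have "0 \<le> x * m - p x" using m[of 0] \<open>p 0 = 0\<close> by (simp add: algebra_simps)
  ultimately have "\<Phi> x + \<Psi> m = ennreal (x * m)"
    using p[OF x] by (simp add: ennreal_plus[symmetric] del: ennreal_plus)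
  then show ?thesis using m0 False by blast
qed

lemma \<Phi>_measurable [measurable (raw)]:
  assumes f: "f \<in> borel_measurable M" and nn: "\<And>s. 0 \<le> f s"
  shows "(\<lambda>s. \<Phi> (f s)) \<in> borel_measurable M"
proof -
  have "continuous_on UNIV (\<lambda>x. \<Phi> (max 0 x))"
    by (rule continuous_on_compose2[OF \<Phi>_continuous]) (auto intro!: continuous_intros)
  then have "(\<lambda>x. \<Phi> (max 0 x)) \<in> borel_measurable borel" by (rule borel_measurable_continuous_onI)
  from measurable_compose[OF f this] show ?thesis using nn by (simp add: max_absorb2)
qed

lemma \<Psi>_measurable [measurable (raw)]:
  assumes f: "f \<in> borel_measurable M" and nn: "\<And>s. 0 \<le> f s"
  shows "(\<lambda>s. \<Psi> (f s)) \<in> borel_measurable M"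
proof -
  have "(\<lambda>x. \<Psi> (max 0 x)) \<in> borel_measurable borel"
  proof (rule borel_measurableI_greater)
    fix c
    have "is_interval {x. c < \<Psi> (max 0 x)}"
      unfolding is_interval_1
    proof (intro ballI allI impI)
      fix a b x assume "a \<in> {x. c < \<Psi> (max 0 x)}" "a \<le> x \<and> x \<le> b"
      moreover from this have "\<Psi> (max 0 a) \<le> \<Psi> (max 0 x)" by (intro \<Psi>_mono) auto
      ultimately show "x \<in> {x. c < \<Psi> (max 0 x)}" by auto
    qed
    then show "{x \<in> space borel. c < \<Psi> (max 0 x)} \<in> sets borel"
      by (simp add: real_interval_borel_measurable)
  qed
  from measurable_compose[OF f this] show ?thesis using nn by (simp add: max_absorb2)
qed

end

locale orlicz = young_pair \<Phi> \<Psi> + sigma_finite_measure M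
  for \<Phi> \<Psi> :: "real \<Rightarrow> ennreal" and M :: "'a measure"
begin

definition dual_ball :: "('a \<Rightarrow> complex) set" where
  "dual_ball = {v \<in> borel_measurable M. (\<integral>\<^sup>+ s. \<Psi> (norm (v s)) \<partial>M) \<le> 1}"

text \<open>The Orlicz norm on nonnegative extended functions, where sums, suprema and convolutions
  exist without finiteness conditions.\<close>

definition gauge_norm :: "('a \<Rightarrow> ennreal) \<Rightarrow> ennreal" where
  "gauge_norm F = (SUP v\<in>dual_ball. \<integral>\<^sup>+ s. F s * ennreal (norm (v s)) \<partial>M)"

lemma orlicz_norm_eq: "orlicz_norm M \<Psi> f = gauge_norm (\<lambda>s. ennreal (norm (f s)))"
  by (simp add: orlicz_norm_def gauge_norm_def dual_ball_def norm_mult ennreal_mult)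

lemma gauge_norm_upper: "v \<in> dual_ball \<Longrightarrow> (\<integral>\<^sup>+ s. F s * ennreal (norm (v s)) \<partial>M) \<le> gauge_norm F"
  unfolding gauge_norm_def by (rule SUP_upper)

lemma gauge_norm_least:
  "(\<And>v. v \<in> dual_ball \<Longrightarrow> (\<integral>\<^sup>+ s. F s * ennreal (norm (v s)) \<partial>M) \<le> c) \<Longrightarrow> gauge_norm F \<le> c"
  unfolding gauge_norm_def by (rule SUP_least)

lemma gauge_norm_mono_AE: "AE s in M. F s \<le> G s \<Longrightarrow> gauge_norm F \<le> gauge_norm G"
  unfolding gauge_norm_def
  by (intro SUP_mono' nn_integral_mono_AE) (auto elim!: eventually_mono intro: mult_right_mono)

lemma gauge_norm_mono: "(\<And>s. F s \<le> G s) \<Longrightarrow> gauge_norm F \<le> gauge_norm G"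
  by (intro gauge_norm_mono_AE) auto

lemma dual_ball_measurable: "v \<in> dual_ball \<Longrightarrow> v \<in> borel_measurable M"
  by (simp add: dual_ball_def)

lemma gauge_norm_cmult:
  assumes F: "F \<in> borel_measurable M"
  shows "gauge_norm (\<lambda>s. c * F s) = c * gauge_norm F"
  unfolding gauge_norm_def SUP_mult_left_ennreal
  by (intro SUP_cong refl) (use F in \<open>auto simp: dual_ball_def mult.assoc intro!: nn_integral_cmult\<close>)

lemma gauge_norm_add:
  assumes F: "F \<in> borel_measurable M" and G: "G \<in> borel_measurable M"
  shows "gauge_norm (\<lambda>s. F s + G s) \<le> gauge_norm F + gauge_norm G"
proof (rule gauge_norm_least)
  fix v assume v: "v \<in> dual_ball"
  note [measurable] = F G dual_ball_measurable[OF v]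
  have "(\<integral>\<^sup>+ s. (F s + G s) * ennreal (norm (v s)) \<partial>M) =
      (\<integral>\<^sup>+ s. F s * ennreal (norm (v s)) \<partial>M) + (\<integral>\<^sup>+ s. G s * ennreal (norm (v s)) \<partial>M)"
    by (simp add: distrib_right nn_integral_add)
  also have "\<dots> \<le> gauge_norm F + gauge_norm G"
    by (intro add_mono gauge_norm_upper v)
  finally show "(\<integral>\<^sup>+ s. (F s + G s) * ennreal (norm (v s)) \<partial>M) \<le> gauge_norm F + gauge_norm G" .
qed

lemma gauge_norm_suminf:
  assumes F: "\<And>i. F i \<in> borel_measurable M"
  shows "gauge_norm (\<lambda>s. \<Sum>i. F i s) \<le> (\<Sum>i. gauge_norm (F i))"
proof (rule gauge_norm_least)
  fix v assume v: "v \<in> dual_ball"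
  note [measurable] = F dual_ball_measurable[OF v]
  have "(\<integral>\<^sup>+ s. (\<Sum>i. F i s) * ennreal (norm (v s)) \<partial>M) =
      (\<integral>\<^sup>+ s. (\<Sum>i. F i s * ennreal (norm (v s))) \<partial>M)" by simp
  also have "\<dots> = (\<Sum>i. \<integral>\<^sup>+ s. F i s * ennreal (norm (v s)) \<partial>M)"
    by (rule nn_integral_suminf) measurable
  also have "\<dots> \<le> (\<Sum>i. gauge_norm (F i))"
    by (intro suminf_le gauge_norm_upper v summableI)
  finally show "(\<integral>\<^sup>+ s. (\<Sum>i. F i s) * ennreal (norm (v s)) \<partial>M) \<le> (\<Sum>i. gauge_norm (F i))" .
qed

lemma gauge_norm_liminf:
  assumes F: "\<And>i. F i \<in> borel_measurable M"
  shows "gauge_norm (\<lambda>s. liminf (\<lambda>i. F i s)) \<le> liminf (\<lambda>i. gauge_norm (F i))"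
proof (rule gauge_norm_least)
  fix v assume v: "v \<in> dual_ball"
  note [measurable] = F dual_ball_measurable[OF v]
  have "liminf (\<lambda>i. F i s) * ennreal (norm (v s)) \<le> liminf (\<lambda>i. F i s * ennreal (norm (v s)))" for s
    unfolding liminf_SUP_INF SUP_mult_right_ennreal
    by (intro SUP_mono' INF_greatest mult_right_mono INF_lower) auto
  then have "(\<integral>\<^sup>+ s. liminf (\<lambda>i. F i s) * ennreal (norm (v s)) \<partial>M)
      \<le> (\<integral>\<^sup>+ s. liminf (\<lambda>i. F i s * ennreal (norm (v s))) \<partial>M)" by (intro nn_integral_mono)
  also have "\<dots> \<le> liminf (\<lambda>i. \<integral>\<^sup>+ s. F i s * ennreal (norm (v s)) \<partial>M)"
    by (rule nn_integral_liminf) measurable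
  also have "\<dots> \<le> liminf (\<lambda>i. gauge_norm (F i))"
    by (intro Liminf_mono always_eventually allI gauge_norm_upper v)
  finally show "(\<integral>\<^sup>+ s. liminf (\<lambda>i. F i s) * ennreal (norm (v s)) \<partial>M) \<le> liminf (\<lambda>i. gauge_norm (F i))" .
qed

text \<open>A small multiple of \<open>w\<close> lies in the dual ball, because \<open>\<Psi>\<close> is at most linear near \<open>0\<close> and
  \<open>w\<close> is bounded and integrable.\<close>

lemma nn_integral_le_gauge_norm:
  assumes w [measurable]: "w \<in> borel_measurable M" and w01: "\<And>s. 0 \<le> w s" "\<And>s. w s \<le> 1"
    and fin: "(\<integral>\<^sup>+ s. ennreal (w s) \<partial>M) < \<infinity>"
  shows "\<exists>c>0. \<forall>F\<in>borel_measurable M. (\<integral>\<^sup>+ s. F s * ennreal (w s) \<partial>M) \<le> ennreal c * gauge_norm F"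
proof -
  obtain a b where ab: "0 < a" "0 < b" "\<And>y. 0 \<le> y \<Longrightarrow> y \<le> a \<Longrightarrow> \<Psi> y \<le> ennreal (b * y)"
    by (rule \<Psi>_linear_near_0) blast
  obtain I where I: "(\<integral>\<^sup>+ s. ennreal (w s) \<partial>M) = ennreal I" "0 \<le> I"
    using fin by (metis ennreal_cases infinity_ennreal_def less_irrefl)
  \<comment> \<open>The bound by \<open>a\<close> keeps \<open>k w\<close> where \<open>\<Psi>\<close> is at most linear; the other one makes the dual modular at most \<open>1\<close>.\<close>
  define k where "k = min a (1 / (b * (1 + I)))"
  have k: "0 < k" "k \<le> a" "b * k * I \<le> 1"
  proof -
    show "0 < k" "k \<le> a" using ab I by (auto simp: k_def)
    have "b * k * I \<le> b * (1 / (b * (1 + I))) * (1 + I)"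
      using ab I by (intro mult_mono mult_left_mono) (auto simp: k_def)
    also have "\<dots> = 1" using ab I by simp
    finally show "b * k * I \<le> 1" .
  qed
  define v where "v s = complex_of_real (k * w s)" for s
  have [measurable]: "v \<in> borel_measurable M" unfolding v_def[abs_def] by measurable
  have nv: "norm (v s) = k * w s" for s using k w01 by (simp add: v_def norm_mult)
  have "(\<integral>\<^sup>+ s. \<Psi> (norm (v s)) \<partial>M) \<le> (\<integral>\<^sup>+ s. ennreal (b * k) * ennreal (w s) \<partial>M)"
  proof (rule nn_integral_mono)
    fix s
    have "k * w s \<le> k * 1" using k w01 by (intro mult_left_mono) auto
    then have "k * w s \<le> a" using k(2) by simp
    then have "\<Psi> (k * w s) \<le> ennreal (b * (k * w s))" using k w01 by (intro ab) auto
    then show "\<Psi> (norm (v s)) \<le> ennreal (b * k) * ennreal (w s)"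
      using ab k w01 by (simp add: nv ennreal_mult[symmetric] mult.assoc)
  qed
  also have "\<dots> = ennreal (b * k * I)" using ab k I by (simp add: nn_integral_cmult ennreal_mult)
  also have "\<dots> \<le> 1" using k(3) by simp
  finally have v: "v \<in> dual_ball" by (simp add: dual_ball_def)
  have "(\<integral>\<^sup>+ s. F s * ennreal (w s) \<partial>M) \<le> ennreal (1 / k) * gauge_norm F"
    if [measurable]: "F \<in> borel_measurable M" for F
  proof -
    have "ennreal (1 / k) * ennreal (k * w s) = ennreal (w s)" for s
      using k w01 by (simp add: ennreal_mult[symmetric])
    then have "(\<integral>\<^sup>+ s. F s * ennreal (w s) \<partial>M) = (\<integral>\<^sup>+ s. ennreal (1 / k) * (F s * ennreal (norm (v s))) \<partial>M)"
      by (simp add: nv mult.left_commute)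
    also have "\<dots> = ennreal (1 / k) * (\<integral>\<^sup>+ s. F s * ennreal (norm (v s)) \<partial>M)"
      by (rule nn_integral_cmult) measurable
    also have "\<dots> \<le> ennreal (1 / k) * gauge_norm F" by (intro mult_left_mono gauge_norm_upper v) auto
    finally show ?thesis .
  qed
  then show ?thesis using k by (intro exI[of _ "1 / k"]) auto
qed

lemma gauge_norm_finite_AE:
  assumes F: "F \<in> borel_measurable M" and fin: "gauge_norm F < \<infinity>"
  shows "AE s in M. F s < \<infinity>"
proof -
  obtain A :: "nat \<Rightarrow> 'a set" where A: "range A \<subseteq> sets M" "\<Union> (range A) = space M" "\<And>i. emeasure M (A i) \<noteq> \<infinity>"
    using sigma_finite by metis
  have "AE s in M. s \<in> A i \<longrightarrow> F s < \<infinity>" for i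
  proof -
    note [measurable] = F
    have [measurable]: "A i \<in> sets M" using A by auto
    have "(\<integral>\<^sup>+ s. ennreal (indicator (A i) s) \<partial>M) < \<infinity>"
      using A(3)[of i] nn_integral_indicator[of "A i" M] \<open>A i \<in> sets M\<close>
      by (simp add: less_top ennreal_indicator)
    then obtain c where "0 < c" "(\<integral>\<^sup>+ s. F s * ennreal (indicator (A i) s) \<partial>M) \<le> ennreal c * gauge_norm F"
      using nn_integral_le_gauge_norm[of "indicator (A i)"] F by (auto simp: indicator_def)
    then have "(\<integral>\<^sup>+ s. F s * ennreal (indicator (A i) s) \<partial>M) \<noteq> \<infinity>"
      using fin by (auto simp: top_unique ennreal_mult_eq_top_iff)
    then have "AE s in M. F s * ennreal (indicator (A i) s) \<noteq> \<infinity>"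
      by (intro nn_integral_PInf_AE) auto
    then show ?thesis by eventually_elim (auto simp: less_top)
  qed
  then have "AE s in M. \<forall>i. s \<in> A i \<longrightarrow> F s < \<infinity>" by (subst AE_all_countable) blast
  then show ?thesis using AE_space
  proof eventually_elim
    case (elim s)
    then show ?case using A(2) by blast
  qed
qed

text \<open>Multiplying with \<open>\<infinity>\<close> preserves norm \<open>0\<close>, and a function of finite norm is finite almost
  everywhere.\<close>

lemma gauge_norm_eq_0_AE:
  assumes F: "F \<in> borel_measurable M" and 0: "gauge_norm F = 0"
  shows "AE s in M. F s = 0"
proof -
  have "gauge_norm (\<lambda>s. \<infinity> * F s) = 0" using gauge_norm_cmult[OF F] 0 by simp
  then have "AE s in M. \<infinity> * F s < \<infinity>" using F by (intro gauge_norm_finite_AE) auto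
  then show ?thesis by eventually_elim (auto simp: ennreal_mult_less_top)
qed

lemma gauge_norm_finite:
  assumes "f \<in> orlicz_space M \<Phi>"
  shows "gauge_norm (\<lambda>s. ennreal (norm (f s))) < \<infinity>"
proof -
  obtain \<alpha> where [measurable]: "f \<in> borel_measurable M"
    and \<alpha>: "0 < \<alpha>" "(\<integral>\<^sup>+ s. \<Phi> (\<alpha> * norm (f s)) \<partial>M) < \<infinity>"
    using assms by (auto simp: orlicz_space_def)
  have "gauge_norm (\<lambda>s. ennreal \<alpha> * ennreal (norm (f s))) \<le> (\<integral>\<^sup>+ s. \<Phi> (\<alpha> * norm (f s)) \<partial>M) + 1"
  proof (rule gauge_norm_least)
    fix v assume v: "v \<in> dual_ball"
    note [measurable] = dual_ball_measurable[OF v]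
    have "(\<integral>\<^sup>+ s. ennreal \<alpha> * ennreal (norm (f s)) * ennreal (norm (v s)) \<partial>M)
        \<le> (\<integral>\<^sup>+ s. \<Phi> (\<alpha> * norm (f s)) + \<Psi> (norm (v s)) \<partial>M)"
      using \<alpha>(1) young_inequality
      by (intro nn_integral_mono) (simp add: ennreal_mult[symmetric])
    also have "\<dots> = (\<integral>\<^sup>+ s. \<Phi> (\<alpha> * norm (f s)) \<partial>M) + (\<integral>\<^sup>+ s. \<Psi> (norm (v s)) \<partial>M)"
      using \<alpha>(1) by (intro nn_integral_add) auto
    also have "\<dots> \<le> (\<integral>\<^sup>+ s. \<Phi> (\<alpha> * norm (f s)) \<partial>M) + 1"
      using v by (intro add_left_mono) (simp add: dual_ball_def)
    finally show "(\<integral>\<^sup>+ s. ennreal \<alpha> * ennreal (norm (f s)) * ennreal (norm (v s)) \<partial>M)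
        \<le> (\<integral>\<^sup>+ s. \<Phi> (\<alpha> * norm (f s)) \<partial>M) + 1" .
  qed
  also have "\<dots> < \<infinity>" using \<alpha>(2) by (simp add: less_top[symmetric] ennreal_add_eq_top)
  finally have "ennreal \<alpha> * gauge_norm (\<lambda>s. ennreal (norm (f s))) < \<infinity>"
    by (subst (asm) gauge_norm_cmult) auto
  then show ?thesis using \<alpha>(1) by (auto simp: ennreal_mult_less_top)
qed

text \<open>The test function \<open>u = y \<circ> g\<close> attains equality in Young's inequality, so the pairing of
  \<open>g\<close> and \<open>u\<close> is the modular of \<open>g\<close> plus the dual modular \<open>R\<close> of \<open>u\<close>. Dividing \<open>u\<close> by \<open>max 1 R\<close>
  brings it into the dual ball, which bounds the pairing by \<open>max 1 R\<close>. Cancelling \<open>R\<close> requires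
  it to be finite; this is why \<open>g\<close> is simple and supported on a set of finite measure.\<close>

lemma modular_simple_le_1:
  fixes g :: "'a \<Rightarrow> real"
  assumes g: "simple_function M g" and nn: "\<And>s. 0 \<le> g s"
    and supp: "A \<in> sets M" "emeasure M A < \<infinity>" "\<And>s. s \<notin> A \<Longrightarrow> g s = 0"
    and norm: "gauge_norm (\<lambda>s. ennreal (g s)) \<le> 1"
  shows "(\<integral>\<^sup>+ s. \<Phi> (g s) \<partial>M) \<le> 1"
proof -
  have "\<exists>y. \<forall>x\<ge>0. 0 \<le> y x \<and> \<Phi> x + \<Psi> (y x) = ennreal (x * y x) \<and> (x = 0 \<longrightarrow> y x = 0)"
    using young_equality by metis
  then obtain y where y: "\<And>x. 0 \<le> x \<Longrightarrow> 0 \<le> y x" "\<And>x. 0 \<le> x \<Longrightarrow> \<Phi> x + \<Psi> (y x) = ennreal (x * y x)"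
    "y 0 = 0" by (metis order_refl)
  define u where "u s = y (g s)" for s
  have su: "simple_function M u" unfolding u_def[abs_def] by (rule simple_function_compose1[OF g])
  have u0: "0 \<le> u s" for s using y(1) nn by (simp add: u_def)
  note [measurable] = borel_measurable_simple_function[OF g] borel_measurable_simple_function[OF su] supp(1)
  define R where "R = (\<integral>\<^sup>+ s. \<Psi> (u s) \<partial>M)"
  have "R < \<infinity>"
  proof -
    have "finite (u ` space M)" using su by (rule simple_functionD)
    then have fin: "finite ((\<lambda>x. \<Psi> x) ` u ` space M)" by simp
    have \<Psi>_fin: "\<Psi> (u s) < \<infinity>" for s
    proof -
      have "\<Psi> (u s) \<le> \<Phi> (g s) + \<Psi> (u s)" by simp
      also have "\<dots> = ennreal (g s * u s)" unfolding u_def by (rule y) (rule nn)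
      finally show ?thesis using le_less_trans[OF _ ennreal_less_top] by auto
    qed
    define B where "B = Max (insert 0 ((\<lambda>x. \<Psi> x) ` u ` space M))"
    have "B \<in> insert 0 ((\<lambda>x. \<Psi> x) ` u ` space M)" unfolding B_def using fin by (intro Max_in) auto
    then have Bfin: "B < \<infinity>" using \<Psi>_fin by auto
    have "R \<le> (\<integral>\<^sup>+ s. B * indicator A s \<partial>M)" unfolding R_def
    proof (rule nn_integral_mono)
      fix s assume s: "s \<in> space M"
      show "\<Psi> (u s) \<le> B * indicator A s"
      proof (cases "s \<in> A")
        case True
        then show ?thesis using s fin by (auto simp: B_def)
      next
        case False
        then show ?thesis using supp(3) y(3) by (simp add: u_def \<Psi>_0)
      qed
    qed
    also have "\<dots> = B * emeasure M A" by (simp add: nn_integral_cmult_indicator)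
    also have "\<dots> < \<infinity>" using Bfin supp(2) by (simp add: ennreal_mult_less_top)
    finally show ?thesis .
  qed
  then obtain r where r: "R = ennreal r" "0 \<le> r" by (cases R) auto
  have eq: "(\<integral>\<^sup>+ s. \<Phi> (g s) \<partial>M) + R = (\<integral>\<^sup>+ s. ennreal (g s * u s) \<partial>M)"
    unfolding R_def using nn u0
    by (subst nn_integral_add[symmetric]) (auto simp: y(2)[folded u_def] intro!: nn_integral_cong, auto simp: u_def y(2))
  have int: "(\<integral>\<^sup>+ s. ennreal (g s) * ennreal (norm (complex_of_real (c * u s))) \<partial>M) =
      ennreal c * (\<integral>\<^sup>+ s. ennreal (g s * u s) \<partial>M)" if "0 \<le> c" for c
    using that nn u0 by (subst nn_integral_cmult[symmetric])
      (auto simp: ennreal_mult[symmetric] norm_mult mult.left_commute)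
  show ?thesis
  proof (cases "r \<le> 1")
    case True
    have "(\<lambda>s. complex_of_real (1 * u s)) \<in> dual_ball"
      using True u0 r by (simp add: dual_ball_def R_def[symmetric])
    from gauge_norm_upper[OF this, of "\<lambda>s. ennreal (g s)"] norm
    have "(\<integral>\<^sup>+ s. ennreal (g s * u s) \<partial>M) \<le> 1" by (simp only: int) simp
    then have "(\<integral>\<^sup>+ s. \<Phi> (g s) \<partial>M) + R \<le> 1" by (simp only: eq)
    then show ?thesis by (rule order_trans[rotated]) simp
  next
    case False
    then have r1: "1 < r" by simp
    have "(\<integral>\<^sup>+ s. \<Psi> (1 / r * u s) \<partial>M) \<le> (\<integral>\<^sup>+ s. ennreal (1 / r) * \<Psi> (u s) \<partial>M)"
      using r1 u0 by (intro nn_integral_mono \<Psi>_scale) auto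
    also have "\<dots> = ennreal (1 / r) * R" unfolding R_def using u0 by (intro nn_integral_cmult) auto
    also have "\<dots> = 1" using r r1 by (simp add: ennreal_mult[symmetric])
    finally have "(\<lambda>s. complex_of_real (1 / r * u s)) \<in> dual_ball"
      using r1 u0 by (simp add: dual_ball_def norm_mult norm_divide)
    from gauge_norm_upper[OF this, of "\<lambda>s. ennreal (g s)"] norm r1
    have "ennreal (1 / r) * (\<integral>\<^sup>+ s. ennreal (g s * u s) \<partial>M) \<le> 1" by (subst (asm) int) auto
    then have "ennreal r * (ennreal (1 / r) * (\<integral>\<^sup>+ s. ennreal (g s * u s) \<partial>M)) \<le> ennreal r * 1"
      by (rule mult_left_mono) simp
    then have "(\<integral>\<^sup>+ s. ennreal (g s * u s) \<partial>M) \<le> ennreal r"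
      using r1 by (simp add: mult.assoc[symmetric] ennreal_mult[symmetric])
    then have "ennreal r + (\<integral>\<^sup>+ s. \<Phi> (g s) \<partial>M) \<le> ennreal r + 0"
      unfolding eq[symmetric] r by (simp add: add.commute)
    then show ?thesis by (simp only: ennreal_add_left_cancel_le) auto
  qed
qed

text \<open>In one direction Young's inequality bounds the norm. For the converse \<open>f\<close> is scaled to
  norm at most \<open>1\<close> and approximated from below by simple functions on sets of finite measure;
  \<open>modular_simple_le_1\<close> and Fatou's lemma bound the modular of \<open>f\<close>.\<close>

lemma orlicz_space_iff:
  "f \<in> orlicz_space M \<Phi> \<longleftrightarrow> f \<in> borel_measurable M \<and> gauge_norm (\<lambda>s. ennreal (norm (f s))) < \<infinity>"
proof safe
  assume [measurable]: "f \<in> borel_measurable M" and fin: "gauge_norm (\<lambda>s. ennreal (norm (f s))) < \<infinity>"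
  obtain c where c: "gauge_norm (\<lambda>s. ennreal (norm (f s))) = ennreal c" "0 \<le> c"
    using fin by (cases "gauge_norm (\<lambda>s. ennreal (norm (f s)))") auto
  define \<alpha> where "\<alpha> = 1 / (1 + c)"
  have \<alpha>: "0 < \<alpha>" "\<alpha> * c \<le> 1" using c by (auto simp: \<alpha>_def)
  have norm1: "gauge_norm (\<lambda>s. ennreal (\<alpha> * norm (f s))) \<le> 1"
    using \<alpha> c gauge_norm_cmult[of "\<lambda>s. ennreal (norm (f s))" "ennreal \<alpha>"]
    by (simp add: ennreal_mult[symmetric])
  obtain A :: "nat \<Rightarrow> 'a set" where A: "range A \<subseteq> sets M" "\<Union> (range A) = space M"
    "\<And>i. emeasure M (A i) \<noteq> \<infinity>" "incseq A"
    using sigma_finite_incseq by blast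
  obtain u where u: "\<And>i. simple_function M (u i)" "incseq u" "\<And>i s. 0 \<le> u i s"
    "\<And>i s. u i s \<le> \<alpha> * norm (f s)" "\<And>s. (\<lambda>i. u i s) \<longlonglongrightarrow> \<alpha> * norm (f s)"
  proof -
    have "(\<lambda>s. \<alpha> * norm (f s)) \<in> borel_measurable M" "\<And>s. 0 \<le> \<alpha> * norm (f s)" using \<alpha> by auto
    from borel_measurable_implies_simple_function_sequence_real[OF this]
    obtain u where u: "\<And>i. simple_function M (u i)" "incseq u" "\<And>s. bdd_above (range (\<lambda>i. u i s))"
      "\<And>i s. 0 \<le> u i s" "(\<lambda>s. \<alpha> * norm (f s)) = (SUP i. u i)" by blast
    have *: "\<alpha> * norm (f s) = (SUP i. u i s)" for s using fun_cong[OF u(5), of s] by (simp add: image_comp)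
    show ?thesis
    proof (rule that[OF u(1,2,4)])
      show "u i s \<le> \<alpha> * norm (f s)" for i s unfolding * using u(3) by (intro cSUP_upper) auto
      show "(\<lambda>i. u i s) \<longlonglongrightarrow> \<alpha> * norm (f s)" for s
        unfolding * using u(2,3) by (intro LIMSEQ_incseq_SUP) (auto simp: incseq_def le_fun_def)
    qed
  qed
  define g where "g i s = u i s * indicator (A i) s" for i s
  have g: "(\<integral>\<^sup>+ s. \<Phi> (g i s) \<partial>M) \<le> 1" for i
  proof (rule modular_simple_le_1[where A="A i"])
    show "simple_function M (g i)" unfolding g_def[abs_def] using u(1) A(1)
      by (intro simple_function_mult simple_function_indicator) auto
    have "gauge_norm (\<lambda>s. ennreal (g i s)) \<le> gauge_norm (\<lambda>s. ennreal (\<alpha> * norm (f s)))"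
      using u(3,4) \<alpha> by (intro gauge_norm_mono ennreal_leI) (auto simp: g_def indicator_def)
    also note norm1
    finally show "gauge_norm (\<lambda>s. ennreal (g i s)) \<le> 1" .
  qed (use A u(3) in \<open>auto simp: g_def less_top\<close>)
  have gm [measurable]: "g i \<in> borel_measurable M" for i
    unfolding g_def[abs_def] using A(1) borel_measurable_simple_function[OF u(1)] by auto
  have gn: "0 \<le> g i s" for i s using u(3) by (simp add: g_def)
  have lim: "\<Phi> (\<alpha> * norm (f s)) = liminf (\<lambda>i. \<Phi> (g i s))" if "s \<in> space M" for s
  proof -
    have "s \<in> \<Union> (range A)" unfolding A(2) by (rule that)
    then obtain n where n: "s \<in> A n" by (elim UnionE rangeE) simp
    have ev: "eventually (\<lambda>i. g i s = u i s) sequentially"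
      using n A(4) by (intro eventually_sequentiallyI[of n]) (auto simp: g_def incseq_def indicator_def)
    have "(\<lambda>i. g i s) \<longlonglongrightarrow> \<alpha> * norm (f s)"
      by (rule Lim_transform_eventually[OF u(5)]) (rule eventually_mono[OF ev], simp)
    then have "(\<lambda>i. \<Phi> (g i s)) \<longlonglongrightarrow> \<Phi> (\<alpha> * norm (f s))"
      using \<Phi>_continuous gn \<alpha> by (intro continuous_on_tendsto_compose[OF \<Phi>_continuous]) auto
    from lim_imp_Liminf[OF _ this] show ?thesis by simp
  qed
  have "(\<integral>\<^sup>+ s. \<Phi> (\<alpha> * norm (f s)) \<partial>M) = (\<integral>\<^sup>+ s. liminf (\<lambda>i. \<Phi> (g i s)) \<partial>M)"
    by (intro nn_integral_cong lim)
  also have "\<dots> \<le> liminf (\<lambda>i. \<integral>\<^sup>+ s. \<Phi> (g i s) \<partial>M)"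
    by (rule nn_integral_liminf) (use gn in measurable)
  also have "\<dots> \<le> 1" using g by (intro Liminf_le) auto
  finally have "(\<integral>\<^sup>+ s. \<Phi> (\<alpha> * norm (f s)) \<partial>M) < \<infinity>" by (auto intro: le_less_trans)
  then show "f \<in> orlicz_space M \<Phi>" using \<alpha> by (auto simp: orlicz_space_def)
qed (use gauge_norm_finite in \<open>auto simp: orlicz_space_def\<close>)

text \<open>The Riesz--Fischer argument: a rapidly Cauchy subsequence converges almost everywhere
  because its increments are summable in norm, and Fatou's lemma for the norm identifies the
  pointwise limit as the limit in norm.\<close>

lemma orlicz_complete:
  fixes X :: "nat \<Rightarrow> 'a \<Rightarrow> complex"
  assumes X: "\<And>n. X n \<in> borel_measurable M"
    and cauchy: "\<And>e. 0 < e \<Longrightarrow> \<exists>N. \<forall>m\<ge>N. \<forall>n\<ge>N.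
      gauge_norm (\<lambda>s. ennreal (norm (X m s - X n s))) < ennreal e"
  shows "\<exists>f\<in>borel_measurable M. \<forall>e>0. \<exists>N. \<forall>n\<ge>N.
      gauge_norm (\<lambda>s. ennreal (norm (X n s - f s))) \<le> ennreal e"
proof -
  note [measurable] = X
  have "\<exists>k. strict_mono k \<and> (\<forall>j. \<forall>m\<ge>k j. \<forall>n\<ge>k j.
      gauge_norm (\<lambda>s. ennreal (norm (X m s - X n s))) < ennreal ((1/2) ^ j))"
  proof -
    have "\<forall>j. \<exists>N. \<forall>m\<ge>N. \<forall>n\<ge>N. gauge_norm (\<lambda>s. ennreal (norm (X m s - X n s))) < ennreal ((1/2) ^ j)"
      by (intro allI cauchy) simp
    then obtain N where N: "\<And>j m n. m \<ge> N j \<Longrightarrow> n \<ge> N j \<Longrightarrow>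
        gauge_norm (\<lambda>s. ennreal (norm (X m s - X n s))) < ennreal ((1/2) ^ j)" by metis
    define k where "k j = (\<Sum>i\<le>j. N i + 1)" for j
    have "strict_mono k" by (rule strict_monoI_Suc) (simp add: k_def)
    moreover have "N j \<le> k j" for j
    proof -
      have "N j + 1 \<le> (\<Sum>i\<le>j. N i + 1)" by (rule member_le_sum[where f="\<lambda>i. N i + 1"]) auto
      then show ?thesis by (simp add: k_def)
    qed
    ultimately have "\<forall>j. \<forall>m\<ge>k j. \<forall>n\<ge>k j.
      gauge_norm (\<lambda>s. ennreal (norm (X m s - X n s))) < ennreal ((1/2) ^ j)"
      by (intro allI impI N) (erule order_trans[rotated], blast)+
    with \<open>strict_mono k\<close> show ?thesis by blast
  qed
  then obtain k where k: "strict_mono k" "\<And>j m n. m \<ge> k j \<Longrightarrow> n \<ge> k j \<Longrightarrow>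
      gauge_norm (\<lambda>s. ennreal (norm (X m s - X n s))) < ennreal ((1/2) ^ j)" by blast
  define D where "D j s = norm (X (k (Suc j)) s - X (k j) s)" for j s
  have [measurable]: "D j \<in> borel_measurable M" for j unfolding D_def[abs_def] by measurable
  have "gauge_norm (\<lambda>s. \<Sum>j. ennreal (D j s)) \<le> (\<Sum>j. gauge_norm (\<lambda>s. ennreal (D j s)))"
    by (rule gauge_norm_suminf) measurable
  also have "\<dots> \<le> (\<Sum>j. ennreal ((1/2) ^ j))"
    unfolding D_def using k(1)
    by (intro suminf_le summableI less_imp_le[OF k(2)]) (auto simp: strict_mono_less_eq)
  also have "\<dots> < \<infinity>" by (subst suminf_ennreal2) (auto simp: summable_geometric)
  finally have "AE s in M. (\<Sum>j. ennreal (D j s)) < \<infinity>"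
    by (rule gauge_norm_finite_AE[rotated]) measurable
  then have conv: "AE s in M. convergent (\<lambda>j. X (k j) s)"
  proof eventually_elim
    case (elim s)
    then have "summable (\<lambda>j. D j s)"
      by (intro summable_suminf_not_top) (auto simp: D_def less_top)
    then have "summable (\<lambda>j. X (k (Suc j)) s - X (k j) s)"
      unfolding D_def by (rule summable_norm_cancel)
    then have "convergent (\<lambda>n. \<Sum>j<n. X (k (Suc j)) s - X (k j) s)"
      by (simp add: summable_iff_convergent)
    then have "convergent (\<lambda>n. X (k n) s - X (k 0) s)"
      by (simp only: sum_lessThan_telescope[where f="\<lambda>j. X (k j) s"])
    then have "convergent (\<lambda>n. (X (k n) s - X (k 0) s) + X (k 0) s)" by (intro convergent_add convergent_const)
    then show ?case by simp
  qed
  define f where "f s = lim (\<lambda>j. X (k j) s)" for s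
  have [measurable]: "f \<in> borel_measurable M" unfolding f_def[abs_def] by measurable
  have "gauge_norm (\<lambda>s. ennreal (norm (X n s - f s))) \<le> ennreal ((1/2) ^ j)" if n: "n \<ge> k j" for n j
  proof -
    have "gauge_norm (\<lambda>s. ennreal (norm (X n s - f s)))
        \<le> gauge_norm (\<lambda>s. liminf (\<lambda>i. ennreal (norm (X n s - X (k i) s))))"
    proof (rule gauge_norm_mono_AE)
      show "AE s in M. ennreal (norm (X n s - f s)) \<le> liminf (\<lambda>i. ennreal (norm (X n s - X (k i) s)))"
        using conv
      proof eventually_elim
        case (elim s)
        then have "(\<lambda>i. X (k i) s) \<longlonglongrightarrow> f s" unfolding f_def by (rule convergent_LIMSEQ_iff[THEN iffD1])
        then have "(\<lambda>i. ennreal (norm (X n s - X (k i) s))) \<longlonglongrightarrow> ennreal (norm (X n s - f s))"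
          by (intro tendsto_intros)
        from lim_imp_Liminf[OF _ this] show ?case by simp
      qed
    qed
    also have "\<dots> \<le> liminf (\<lambda>i. gauge_norm (\<lambda>s. ennreal (norm (X n s - X (k i) s))))"
      by (rule gauge_norm_liminf) measurable
    also have "\<dots> \<le> ennreal ((1/2) ^ j)"
    proof (rule Liminf_le)
      show "\<forall>\<^sub>F i in sequentially. gauge_norm (\<lambda>s. ennreal (norm (X n s - X (k i) s))) \<le> ennreal ((1/2) ^ j)"
        using n k(1)
        by (intro eventually_sequentiallyI[of j] less_imp_le[OF k(2)]) (auto simp: strict_mono_less_eq)
    qed simp
    finally show ?thesis .
  qed
  note * = this
  show ?thesis
  proof (intro bexI[of _ f] allI impI)
    fix e :: real assume "0 < e"
    then obtain j where j: "(1/2) ^ j < e" using real_arch_pow_inv[of e "1/2"] by auto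
    then have "ennreal ((1/2) ^ j) \<le> ennreal e" by (intro ennreal_leI) simp
    then show "\<exists>N. \<forall>n\<ge>N. gauge_norm (\<lambda>s. ennreal (norm (X n s - f s))) \<le> ennreal e"
      by (intro exI[of _ "k j"] allI impI) (rule order_trans[OF *])
  qed simp
qed

end

section \<open>Convolution of nonnegative functions\<close>

context haar_growth begin

abbreviation nn_borel :: "('a \<Rightarrow> ennreal) set" where "nn_borel \<equiv> borel_measurable M"

definition nn_conv :: "('a \<Rightarrow> ennreal) \<Rightarrow> ('a \<Rightarrow> ennreal) \<Rightarrow> 'a \<Rightarrow> ennreal" where
  "nn_conv F G t = (\<integral>\<^sup>+s. F s * G (- s + t) \<partial>M)"

lemma nn_conv_kernel_measurable:
  fixes F G :: "'a \<Rightarrow> ennreal"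
  assumes F: "F \<in> borel_measurable M" and G: "G \<in> borel_measurable M"
  shows "(\<lambda>(s, t). F s * G (- s + t)) \<in> borel_measurable borel"
  unfolding case_prod_unfold
  by (intro borel_measurable_times_ennreal borel_prod_compose F G continuous_intros)

lemma nn_conv_measurable [measurable (raw)]:
  assumes "F \<in> borel_measurable M" "G \<in> borel_measurable M"
  shows "nn_conv F G \<in> borel_measurable M"
  unfolding nn_conv_def[abs_def] by (rule Tonelli_borel(3)[OF nn_conv_kernel_measurable[OF assms]])

lemma translate_measurable [measurable (raw)]:
  assumes "F \<in> borel_measurable M"
  shows "(\<lambda>x. F (s + x)) \<in> borel_measurable M" "(\<lambda>x. F (x + s)) \<in> borel_measurable M"
    "(\<lambda>x. F (- x)) \<in> borel_measurable M" "(\<lambda>x. F (- x + s)) \<in> borel_measurable M"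
    "(\<lambda>x. F (s - x)) \<in> borel_measurable M"
  unfolding measurable_M_iff by (intro borel_prod_compose assms continuous_intros | simp add: diff_conv_add_uminus del: add_uminus_conv_diff)+

lemma nn_conv_commute:
  assumes F [measurable]: "F \<in> borel_measurable M" and G [measurable]: "G \<in> borel_measurable M"
  shows "nn_conv F G t = (\<integral>\<^sup>+r. F (t - r) * G r \<partial>M)"
proof -
  have "nn_conv F G t = (\<integral>\<^sup>+s. F (t + s) * G (- (t + s) + t) \<partial>M)"
    unfolding nn_conv_def by (rule nn_integral_left[symmetric]) measurable
  also have "\<dots> = (\<integral>\<^sup>+s. F (t + s) * G (- s) \<partial>M)" by (simp add: minus_add add.assoc)
  also have "\<dots> = (\<integral>\<^sup>+s. F (t + - s) * G (- (- s)) \<partial>M)"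
    by (rule nn_integral_uminus[symmetric]) measurable
  finally show ?thesis by simp
qed

text \<open>Pairing a convolution with a test function amounts to pairing one factor with translates
  of the test function. The left factor translates from the left, and in \<open>pairing_nn_conv_right\<close>
  the right factor translates from the right; the latter is where unimodularity enters.\<close>

lemma pairing_nn_conv_left:
  assumes F [measurable]: "F \<in> borel_measurable M" and G [measurable]: "G \<in> borel_measurable M"
    and V [measurable]: "V \<in> borel_measurable M"
  shows "(\<integral>\<^sup>+t. nn_conv F G t * V t \<partial>M) = (\<integral>\<^sup>+s. F s * (\<integral>\<^sup>+t. G t * V (s + t) \<partial>M) \<partial>M)"
proof -
  have "(\<integral>\<^sup>+t. nn_conv F G t * V t \<partial>M) = (\<integral>\<^sup>+t. \<integral>\<^sup>+s. F s * G (- s + t) * V t \<partial>M \<partial>M)"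
    unfolding nn_conv_def by (simp add: nn_integral_multc)
  also have "\<dots> = (\<integral>\<^sup>+s. \<integral>\<^sup>+t. F s * G (- s + t) * V t \<partial>M \<partial>M)"
    by (rule Tonelli_borel(1)[symmetric])
      (auto simp: case_prod_unfold intro!: borel_measurable_times_ennreal borel_prod_compose F G V continuous_intros)
  also have "\<dots> = (\<integral>\<^sup>+s. F s * (\<integral>\<^sup>+t. G t * V (s + t) \<partial>M) \<partial>M)"
  proof (rule nn_integral_cong)
    fix s
    have "(\<integral>\<^sup>+t. F s * G (- s + t) * V t \<partial>M) = (\<integral>\<^sup>+t. F s * G (- s + (s + t)) * V (s + t) \<partial>M)"
      by (rule nn_integral_left[symmetric]) measurable
    also have "\<dots> = (\<integral>\<^sup>+t. F s * (G t * V (s + t)) \<partial>M)"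
      by (simp add: add.assoc[symmetric] mult.assoc)
    also have "\<dots> = F s * (\<integral>\<^sup>+t. G t * V (s + t) \<partial>M)"
      by (rule nn_integral_cmult) measurable
    finally show "(\<integral>\<^sup>+t. F s * G (- s + t) * V t \<partial>M) = F s * (\<integral>\<^sup>+t. G t * V (s + t) \<partial>M)" .
  qed
  finally show ?thesis .
qed

lemma pairing_nn_conv_right:
  assumes F [measurable]: "F \<in> borel_measurable M" and G [measurable]: "G \<in> borel_measurable M"
    and V [measurable]: "V \<in> borel_measurable M"
  shows "(\<integral>\<^sup>+t. nn_conv F G t * V t \<partial>M) = (\<integral>\<^sup>+r. G r * (\<integral>\<^sup>+t. F t * V (t + r) \<partial>M) \<partial>M)"
proof -
  have "(\<integral>\<^sup>+t. nn_conv F G t * V t \<partial>M) = (\<integral>\<^sup>+t. \<integral>\<^sup>+r. F (t - r) * G r * V t \<partial>M \<partial>M)"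
    unfolding nn_conv_commute[OF F G] by (simp add: nn_integral_multc)
  also have "\<dots> = (\<integral>\<^sup>+r. \<integral>\<^sup>+t. F (t - r) * G r * V t \<partial>M \<partial>M)"
    by (rule Tonelli_borel(1))
      (auto simp: case_prod_unfold diff_conv_add_uminus simp del: add_uminus_conv_diff
        intro!: borel_measurable_times_ennreal borel_prod_compose F G V continuous_intros)
  also have "\<dots> = (\<integral>\<^sup>+r. G r * (\<integral>\<^sup>+t. F t * V (t + r) \<partial>M) \<partial>M)"
  proof (rule nn_integral_cong)
    fix r
    have [measurable]: "(\<lambda>t. F (t - r)) \<in> borel_measurable M"
      using translate_measurable(2)[OF F, of "- r"] by simp
    have "(\<integral>\<^sup>+t. F (t - r) * G r * V t \<partial>M) = (\<integral>\<^sup>+t. F (t + r - r) * G r * V (t + r) \<partial>M)"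
      by (rule nn_integral_right[symmetric]) measurable
    also have "\<dots> = (\<integral>\<^sup>+t. G r * (F t * V (t + r)) \<partial>M)"
      by (simp add: add.assoc[symmetric] ac_simps)
    also have "\<dots> = G r * (\<integral>\<^sup>+t. F t * V (t + r) \<partial>M)"
      by (rule nn_integral_cmult) measurable
    finally show "(\<integral>\<^sup>+t. F (t - r) * G r * V t \<partial>M) = G r * (\<integral>\<^sup>+t. F t * V (t + r) \<partial>M)" .
  qed
  finally show ?thesis .
qed

lemma nn_integral_nn_conv:
  assumes F [measurable]: "F \<in> borel_measurable M" and G [measurable]: "G \<in> borel_measurable M"
  shows "(\<integral>\<^sup>+t. nn_conv F G t \<partial>M) = (\<integral>\<^sup>+s. F s \<partial>M) * (\<integral>\<^sup>+s. G s \<partial>M)"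
  using pairing_nn_conv_left[OF F G, of "\<lambda>_. 1"] by (simp add: nn_integral_multc)

lemma nn_conv_power2_le:
  assumes F [measurable]: "F \<in> borel_measurable M" and G [measurable]: "G \<in> borel_measurable M"
  shows "(nn_conv F G t)\<^sup>2 \<le> (\<integral>\<^sup>+s. F s \<partial>M) * nn_conv F (\<lambda>x. (G x)\<^sup>2) t"
proof -
  have "(\<integral>\<^sup>+s. 1 * G (- s + t) \<partial>density M F)\<^sup>2
      \<le> (\<integral>\<^sup>+s. 1\<^sup>2 \<partial>density M F) * (\<integral>\<^sup>+s. (G (- s + t))\<^sup>2 \<partial>density M F)"
    by (rule Cauchy_Schwarz_nn_integral) auto
  then show ?thesis
    by (simp add: nn_integral_density nn_conv_def emeasure_density)
qed

lemma nn_integral_nn_conv_power2_le: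
  assumes F [measurable]: "F \<in> borel_measurable M" and G [measurable]: "G \<in> borel_measurable M"
  shows "(\<integral>\<^sup>+t. (nn_conv F G t)\<^sup>2 \<partial>M) \<le> (\<integral>\<^sup>+s. F s \<partial>M)\<^sup>2 * (\<integral>\<^sup>+s. (G s)\<^sup>2 \<partial>M)"
proof -
  have "(\<integral>\<^sup>+t. (nn_conv F G t)\<^sup>2 \<partial>M)
      \<le> (\<integral>\<^sup>+t. (\<integral>\<^sup>+s. F s \<partial>M) * nn_conv F (\<lambda>x. (G x)\<^sup>2) t \<partial>M)"
    by (intro nn_integral_mono nn_conv_power2_le F G)
  also have "\<dots> = (\<integral>\<^sup>+s. F s \<partial>M) * ((\<integral>\<^sup>+s. F s \<partial>M) * (\<integral>\<^sup>+s. (G s)\<^sup>2 \<partial>M))"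
    by (subst nn_integral_cmult) (auto simp: nn_integral_nn_conv)
  finally show ?thesis by (simp add: power2_eq_square mult.assoc)
qed

lemma nn_conv_assoc:
  assumes F [measurable]: "F \<in> borel_measurable M" and G [measurable]: "G \<in> borel_measurable M"
    and H [measurable]: "H \<in> borel_measurable M"
  shows "nn_conv F (nn_conv G H) t = (\<integral>\<^sup>+s. \<integral>\<^sup>+r. F s * G (- s + r) * H (- r + t) \<partial>M \<partial>M)"
  unfolding nn_conv_def
proof (rule nn_integral_cong)
  fix s
  have "F s * (\<integral>\<^sup>+r. G r * H (- r + (- s + t)) \<partial>M) = F s * (\<integral>\<^sup>+r. G (- s + r) * H (- (- s + r) + (- s + t)) \<partial>M)"
    by (subst nn_integral_left[where s="- s", symmetric]) auto
  also have "\<dots> = F s * (\<integral>\<^sup>+r. G (- s + r) * H (- r + t) \<partial>M)"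
    by (simp add: minus_add add.assoc)
  also have "\<dots> = (\<integral>\<^sup>+r. F s * G (- s + r) * H (- r + t) \<partial>M)"
    by (subst nn_integral_cmult[symmetric]) (auto simp: mult.assoc)
  finally show "F s * (\<integral>\<^sup>+r. G r * H (- r + (- s + t)) \<partial>M) = (\<integral>\<^sup>+r. F s * G (- s + r) * H (- r + t) \<partial>M)" .
qed

end

lemma ennreal_le_of_power2_le:
  fixes x :: ennreal
  assumes "x\<^sup>2 \<le> (ennreal z)\<^sup>2" "0 \<le> z" shows "x \<le> ennreal z"
proof (cases x)
  case (real r)
  then have "ennreal (r\<^sup>2) \<le> ennreal (z\<^sup>2)" using assms by (simp add: ennreal_power)
  then have "r\<^sup>2 \<le> z\<^sup>2" by (subst (asm) ennreal_le_iff) auto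
  then show ?thesis using real assms(2) by (auto intro!: ennreal_leI power2_le_imp_le)
next
  case top
  then show ?thesis using assms by (simp add: ennreal_power top_unique)
qed

section \<open>Weighted Orlicz estimates for convolution\<close>

locale weighted_orlicz = gainful_weight M U \<omega> w K0 + young_pair \<Phi> \<Psi>
  for M :: "'a::{topological_group_add, t2_space} measure" and U \<omega> w K0 \<Phi> \<Psi>
begin

sublocale orlicz \<Phi> \<Psi> M ..

lemma dual_ball_translate:
  assumes v: "v \<in> dual_ball"
  shows "(\<lambda>t. v (s + t)) \<in> dual_ball" "(\<lambda>t. v (t + s)) \<in> dual_ball"
proof -
  have [measurable]: "v \<in> borel_measurable M" using v by (rule dual_ball_measurable)
  have [measurable]: "(\<lambda>t. \<Psi> (norm (v t))) \<in> borel_measurable M" by measurable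
  show "(\<lambda>t. v (s + t)) \<in> dual_ball"
    using v nn_integral_left[of "\<lambda>t. \<Psi> (norm (v t))" s] by (simp add: dual_ball_def translate_measurable)
  show "(\<lambda>t. v (t + s)) \<in> dual_ball"
    using v nn_integral_right[of "\<lambda>t. \<Psi> (norm (v t))" s] by (simp add: dual_ball_def translate_measurable)
qed

text \<open>Translates of elements of the dual ball stay in the dual ball.\<close>

lemma gauge_norm_conv:
  assumes F [measurable]: "F \<in> borel_measurable M" and G [measurable]: "G \<in> borel_measurable M"
  shows "gauge_norm (nn_conv F G) \<le> (\<integral>\<^sup>+s. F s \<partial>M) * gauge_norm G"
    and "gauge_norm (nn_conv F G) \<le> gauge_norm F * (\<integral>\<^sup>+s. G s \<partial>M)"
proof -
  show "gauge_norm (nn_conv F G) \<le> (\<integral>\<^sup>+s. F s \<partial>M) * gauge_norm G"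
  proof (rule gauge_norm_least)
    fix v assume v: "v \<in> dual_ball"
    then have [measurable]: "v \<in> borel_measurable M" by (rule dual_ball_measurable)
    have "(\<integral>\<^sup>+ s. nn_conv F G s * ennreal (norm (v s)) \<partial>M)
        = (\<integral>\<^sup>+s. F s * (\<integral>\<^sup>+t. G t * ennreal (norm (v (s + t))) \<partial>M) \<partial>M)"
      by (rule pairing_nn_conv_left) measurable
    also have "\<dots> \<le> (\<integral>\<^sup>+s. F s * gauge_norm G \<partial>M)"
      by (intro nn_integral_mono mult_left_mono gauge_norm_upper dual_ball_translate v) auto
    also have "\<dots> = (\<integral>\<^sup>+s. F s \<partial>M) * gauge_norm G" by (simp add: nn_integral_multc)
    finally show "(\<integral>\<^sup>+ s. nn_conv F G s * ennreal (norm (v s)) \<partial>M) \<le> (\<integral>\<^sup>+s. F s \<partial>M) * gauge_norm G" .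
  qed
  show "gauge_norm (nn_conv F G) \<le> gauge_norm F * (\<integral>\<^sup>+s. G s \<partial>M)"
  proof (rule gauge_norm_least)
    fix v assume v: "v \<in> dual_ball"
    then have [measurable]: "v \<in> borel_measurable M" by (rule dual_ball_measurable)
    have "(\<integral>\<^sup>+ s. nn_conv F G s * ennreal (norm (v s)) \<partial>M)
        = (\<integral>\<^sup>+r. G r * (\<integral>\<^sup>+t. F t * ennreal (norm (v (t + r))) \<partial>M) \<partial>M)"
      by (rule pairing_nn_conv_right) measurable
    also have "\<dots> \<le> (\<integral>\<^sup>+r. G r * gauge_norm F \<partial>M)"
      by (intro nn_integral_mono mult_left_mono gauge_norm_upper dual_ball_translate v) auto
    also have "\<dots> = gauge_norm F * (\<integral>\<^sup>+s. G s \<partial>M)" by (simp add: nn_integral_multc mult.commute)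
    finally show "(\<integral>\<^sup>+ s. nn_conv F G s * ennreal (norm (v s)) \<partial>M) \<le> gauge_norm F * (\<integral>\<^sup>+s. G s \<partial>M)" .
  qed
qed

lemma w_power2_le: "(w s)\<^sup>2 \<le> w s"
  using w_pos[of s] w_le_1[of s] by (simp add: power2_eq_square mult_left_le_one_le less_imp_le)

definition wnorm :: "('a \<Rightarrow> ennreal) \<Rightarrow> ennreal" where
  "wnorm F = gauge_norm (\<lambda>s. F s * ennreal (\<omega> s))"

text \<open>The weaker norm that the gain leaves for one of the two factors of a convolution.\<close>

definition core :: "('a \<Rightarrow> ennreal) \<Rightarrow> ennreal" where
  "core F = (\<integral>\<^sup>+s. F s * ennreal (\<omega> s * (w s)\<^sup>2) \<partial>M)"

lemma wnorm_mono_AE: "AE s in M. F s \<le> G s \<Longrightarrow> wnorm F \<le> wnorm G"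
  unfolding wnorm_def by (intro gauge_norm_mono_AE) (auto elim!: eventually_mono intro: mult_right_mono)

lemma wnorm_add:
  assumes [measurable]: "F \<in> borel_measurable M" "G \<in> borel_measurable M"
  shows "wnorm (\<lambda>s. F s + G s) \<le> wnorm F + wnorm G"
  unfolding wnorm_def distrib_right by (intro gauge_norm_add) measurable

lemma wnorm_cmult:
  assumes [measurable]: "F \<in> borel_measurable M" shows "wnorm (\<lambda>s. c * F s) = c * wnorm F"
  unfolding wnorm_def mult.assoc by (intro gauge_norm_cmult) measurable

text \<open>The submultiplicativity with gain splits the weighted convolution pointwise into two
  convolutions, in each of which one factor carries \<open>\<omega> w\<^sup>2\<close> and is measured by its integral.\<close>

theorem wnorm_nn_conv:
  assumes F [measurable]: "F \<in> borel_measurable M" and G [measurable]: "G \<in> borel_measurable M"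
  shows "wnorm (nn_conv F G) \<le> ennreal K0 * (core F * wnorm G + wnorm F * core G)"
proof -
  define F1 where "F1 s = F s * ennreal (\<omega> s)" for s
  define G1 where "G1 s = G s * ennreal (\<omega> s)" for s
  define F2 where "F2 s = F s * ennreal (\<omega> s * (w s)\<^sup>2)" for s
  define G2 where "G2 s = G s * ennreal (\<omega> s * (w s)\<^sup>2)" for s
  have [measurable]: "F1 \<in> borel_measurable M" "G1 \<in> borel_measurable M"
    "F2 \<in> borel_measurable M" "G2 \<in> borel_measurable M"
    unfolding F1_def[abs_def] G1_def[abs_def] F2_def[abs_def] G2_def[abs_def] by measurable
  have pt: "nn_conv F G t * ennreal (\<omega> t) \<le> ennreal K0 * (nn_conv F2 G1 t + nn_conv F1 G2 t)" for t
  proof -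
    have "nn_conv F G t * ennreal (\<omega> t) = (\<integral>\<^sup>+s. F s * G (- s + t) * ennreal (\<omega> t) \<partial>M)"
      unfolding nn_conv_def by (rule nn_integral_multc[symmetric]) measurable
    also have "\<dots> \<le> (\<integral>\<^sup>+s. ennreal K0 * (F2 s * G1 (- s + t) + F1 s * G2 (- s + t)) \<partial>M)"
    proof (rule nn_integral_mono)
      fix s
      have "ennreal (\<omega> t) \<le> ennreal (K0 * (\<omega> s * (w s)\<^sup>2 * \<omega> (- s + t) + \<omega> s * (\<omega> (- s + t) * (w (- s + t))\<^sup>2)))"
        using \<omega>_add[of s "- s + t"] by (intro ennreal_leI) (simp add: add.assoc[symmetric] algebra_simps)
      also have "\<dots> = ennreal K0 * (ennreal (\<omega> s * (w s)\<^sup>2) * ennreal (\<omega> (- s + t)) +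
          ennreal (\<omega> s) * ennreal (\<omega> (- s + t) * (w (- s + t))\<^sup>2))"
        using K0_pos \<omega>_pos[of s] \<omega>_pos[of "- s + t"]
        by (simp add: ennreal_mult less_imp_le ennreal_plus)
      finally have "F s * G (- s + t) * ennreal (\<omega> t) \<le> F s * G (- s + t) * \<dots>"
        by (rule mult_left_mono) simp
      also have "\<dots> = ennreal K0 * (F2 s * G1 (- s + t) + F1 s * G2 (- s + t))"
        by (simp add: F1_def F2_def G1_def G2_def distrib_left ac_simps)
      finally show "F s * G (- s + t) * ennreal (\<omega> t) \<le> ennreal K0 * (F2 s * G1 (- s + t) + F1 s * G2 (- s + t))" .
    qed
    also have "\<dots> = ennreal K0 * (nn_conv F2 G1 t + nn_conv F1 G2 t)"
      unfolding nn_conv_def by (subst nn_integral_cmult) (auto simp: nn_integral_add)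
    finally show ?thesis .
  qed
  have "wnorm (nn_conv F G) \<le> gauge_norm (\<lambda>t. ennreal K0 * (nn_conv F2 G1 t + nn_conv F1 G2 t))"
    unfolding wnorm_def by (intro gauge_norm_mono pt)
  also have "\<dots> = ennreal K0 * gauge_norm (\<lambda>t. nn_conv F2 G1 t + nn_conv F1 G2 t)"
    by (rule gauge_norm_cmult) measurable
  also have "\<dots> \<le> ennreal K0 * (gauge_norm (nn_conv F2 G1) + gauge_norm (nn_conv F1 G2))"
    by (intro mult_left_mono gauge_norm_add) auto
  also have "\<dots> \<le> ennreal K0 * ((\<integral>\<^sup>+s. F2 s \<partial>M) * gauge_norm G1 + gauge_norm F1 * (\<integral>\<^sup>+s. G2 s \<partial>M))"
    by (intro mult_left_mono add_mono gauge_norm_conv) auto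
  finally show ?thesis
    unfolding core_def wnorm_def F1_def[abs_def] F2_def G1_def[abs_def] G2_def .
qed

lemma nn_integral_weighted_le:
  "\<exists>c>0. \<forall>F\<in>nn_borel. (\<integral>\<^sup>+s. F s * ennreal (\<omega> s) * ennreal (w s) \<partial>M) \<le> ennreal c * wnorm F"
proof -
  obtain c where c: "0 < c" "\<And>F. F \<in> borel_measurable M \<Longrightarrow> (\<integral>\<^sup>+ s. F s * ennreal (w s) \<partial>M) \<le> ennreal c * gauge_norm F"
    using nn_integral_le_gauge_norm[of w] w_pos w_le_1 w_integrable w_measurable by (metis less_imp_le)
  show ?thesis
  proof (intro exI[of _ c] conjI ballI c(1))
    fix F assume [measurable]: "F \<in> nn_borel"
    show "(\<integral>\<^sup>+s. F s * ennreal (\<omega> s) * ennreal (w s) \<partial>M) \<le> ennreal c * wnorm F"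
      unfolding wnorm_def by (rule c(2)) measurable
  qed
qed

lemma core_le: "\<exists>c>0. \<forall>F\<in>nn_borel. core F \<le> ennreal c * wnorm F"
proof -
  obtain c where c: "0 < c" "\<And>F. F \<in> borel_measurable M \<Longrightarrow>
      (\<integral>\<^sup>+s. F s * ennreal (\<omega> s) * ennreal (w s) \<partial>M) \<le> ennreal c * wnorm F"
    using nn_integral_weighted_le by blast
  have "core F \<le> (\<integral>\<^sup>+s. F s * ennreal (\<omega> s) * ennreal (w s) \<partial>M)" for F
    unfolding core_def
  proof (rule nn_integral_mono)
    fix s
    have "\<omega> s * (w s)\<^sup>2 \<le> \<omega> s * w s"
      using \<omega>_pos[of s] by (intro mult_left_mono w_power2_le less_imp_le)
    then have "F s * ennreal (\<omega> s * (w s)\<^sup>2) \<le> F s * ennreal (\<omega> s * w s)"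
      by (rule mult_left_mono[OF ennreal_leI]) simp
    then show "F s * ennreal (\<omega> s * (w s)\<^sup>2) \<le> F s * ennreal (\<omega> s) * ennreal (w s)"
      using w_pos[of s] \<omega>_pos[of s] by (simp add: ennreal_mult less_imp_le mult.assoc)
  qed
  then show ?thesis using c by (meson order_trans)
qed

lemma nn_integral_le_wnorm: "\<exists>c>0. \<forall>F\<in>nn_borel. (\<integral>\<^sup>+s. F s \<partial>M) \<le> ennreal c * wnorm F"
proof -
  obtain c where c: "0 < c" "\<And>F. F \<in> borel_measurable M \<Longrightarrow>
      (\<integral>\<^sup>+s. F s * ennreal (\<omega> s) * ennreal (w s) \<partial>M) \<le> ennreal c * wnorm F"
    using nn_integral_weighted_le by blast
  have "(\<integral>\<^sup>+s. F s \<partial>M) \<le> (\<integral>\<^sup>+s. F s * ennreal (\<omega> s) * ennreal (w s) \<partial>M)" for F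
  proof (rule nn_integral_mono)
    fix s
    have "F s * 1 \<le> F s * ennreal (\<omega> s * w s)"
      using one_le_\<omega>_w[of s] by (intro mult_left_mono) auto
    then show "F s \<le> F s * ennreal (\<omega> s) * ennreal (w s)"
      using w_pos[of s] \<omega>_pos[of s] by (simp add: ennreal_mult less_imp_le mult.assoc)
  qed
  then show ?thesis using c by (meson order_trans)
qed

theorem wnorm_nn_conv_le:
  "\<exists>K>0. \<forall>F\<in>nn_borel. \<forall>G\<in>nn_borel. wnorm (nn_conv F G) \<le> ennreal K * wnorm F * wnorm G"
proof -
  obtain c where c: "0 < c" "\<And>F. F \<in> borel_measurable M \<Longrightarrow> core F \<le> ennreal c * wnorm F"
    using core_le by blast
  show ?thesis
  proof (intro exI[of _ "K0 * (2 * c)"] conjI ballI)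
    show "0 < K0 * (2 * c)" using c K0_pos by simp
    fix F G :: "'a \<Rightarrow> ennreal" assume F: "F \<in> borel_measurable M" and G: "G \<in> borel_measurable M"
    have "wnorm (nn_conv F G) \<le> ennreal K0 * (core F * wnorm G + wnorm F * core G)"
      by (rule wnorm_nn_conv[OF F G])
    also have "\<dots> \<le> ennreal K0 * ((ennreal c * wnorm F) * wnorm G + wnorm F * (ennreal c * wnorm G))"
      by (intro mult_left_mono add_mono mult_right_mono c F G) auto
    also have "\<dots> = ennreal K0 * (ennreal c + ennreal c) * wnorm F * wnorm G"
      by (simp add: distrib_left distrib_right ac_simps)
    also have "ennreal K0 * (ennreal c + ennreal c) = ennreal (K0 * (2 * c))"
      using c K0_pos by (simp add: ennreal_mult ennreal_plus[symmetric] del: ennreal_plus)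
    finally show "wnorm (nn_conv F G) \<le> ennreal (K0 * (2 * c)) * wnorm F * wnorm G" .
  qed
qed

text \<open>One factor \<open>w\<close> of \<open>\<omega> w\<^sup>2 = (\<omega> w) w\<close> is used in \<open>\<omega> w \<le> exp (\<kappa> 2 ^ n) + \<delta> n \<omega>\<close>. In the first
  summand the remaining \<open>w\<close> is square-integrable and Cauchy--Schwarz yields the norm in \<open>L\<^sup>2\<close>;
  in the second one it is paired with \<open>F \<omega>\<close> and yields the weighted norm.\<close>

lemma core_le_spread:
  assumes \<kappa>: "0 < \<kappa>"
  shows "\<exists>\<delta> c. 0 < c \<and> (\<forall>n. exp (- \<kappa> * 2 ^ n) \<le> \<delta> n \<and> \<delta> n \<le> 1) \<and>
      \<not> summable (\<lambda>n. ln (1 / \<delta> n) / 2 ^ n) \<and>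
      (\<forall>n. \<forall>F\<in>nn_borel. \<forall>b\<ge>0. (\<integral>\<^sup>+s. (F s)\<^sup>2 \<partial>M) \<le> ennreal (b\<^sup>2) \<longrightarrow>
         core F \<le> ennreal c * (ennreal (exp (\<kappa> * 2 ^ n) * b) + ennreal (\<delta> n) * wnorm F))"
proof -
  obtain \<delta> where \<delta>: "\<And>n. exp (- \<kappa> * 2 ^ n) \<le> \<delta> n" "\<And>n. \<delta> n \<le> 1"
      "\<not> summable (\<lambda>n. ln (1 / \<delta> n) / 2 ^ n)"
      "\<And>n s. \<omega> s * w s \<le> exp (\<kappa> * 2 ^ n) + \<delta> n * \<omega> s"
    using spread[OF \<kappa>] by blast
  have \<delta>_pos: "0 < \<delta> n" for n by (rule less_le_trans[OF _ \<delta>(1)]) simp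
  obtain c1 where c1: "0 < c1" "\<And>F. F \<in> borel_measurable M \<Longrightarrow>
      (\<integral>\<^sup>+s. F s * ennreal (\<omega> s) * ennreal (w s) \<partial>M) \<le> ennreal c1 * wnorm F"
    using nn_integral_weighted_le by blast
  obtain I where I: "(\<integral>\<^sup>+s. ennreal (w s) \<partial>M) = ennreal I" "0 \<le> I"
    using w_integrable by (metis ennreal_cases infinity_ennreal_def less_irrefl)
  define c where "c = c1 + sqrt I"
  have c: "0 < c" "c1 \<le> c" "sqrt I \<le> c" using c1 I by (auto simp: c_def add_pos_nonneg)
  have L2: "(\<integral>\<^sup>+s. F s * ennreal (w s) \<partial>M) \<le> ennreal (sqrt I * b)"
    if [measurable]: "F \<in> borel_measurable M" and b: "0 \<le> b" "(\<integral>\<^sup>+s. (F s)\<^sup>2 \<partial>M) \<le> ennreal (b\<^sup>2)" for F b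
  proof -
    have w2: "(\<integral>\<^sup>+s. (ennreal (w s))\<^sup>2 \<partial>M) \<le> ennreal I"
      unfolding I(1)[symmetric]
    proof (rule nn_integral_mono)
      fix s
      show "(ennreal (w s))\<^sup>2 \<le> ennreal (w s)"
        using w_pos[of s] w_power2_le[of s] by (simp add: ennreal_power less_imp_le ennreal_leI)
    qed
    have "(\<integral>\<^sup>+s. F s * ennreal (w s) \<partial>M)\<^sup>2 \<le> (\<integral>\<^sup>+s. (F s)\<^sup>2 \<partial>M) * (\<integral>\<^sup>+s. (ennreal (w s))\<^sup>2 \<partial>M)"
      by (rule Cauchy_Schwarz_nn_integral) measurable
    also have "\<dots> \<le> ennreal (b\<^sup>2) * ennreal I" by (intro mult_mono b w2) auto
    also have "\<dots> = (ennreal (sqrt I * b))\<^sup>2"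
      using I b by (simp add: ennreal_mult[symmetric] ennreal_power power_mult_distrib mult.commute)
    finally show ?thesis by (rule ennreal_le_of_power2_le) (use I b in simp)
  qed
  have "core F \<le> ennreal c * (ennreal (exp (\<kappa> * 2 ^ n) * b) + ennreal (\<delta> n) * wnorm F)"
    if F [measurable]: "F \<in> borel_measurable M" and b: "0 \<le> b" "(\<integral>\<^sup>+s. (F s)\<^sup>2 \<partial>M) \<le> ennreal (b\<^sup>2)" for n F b
  proof -
    define E where "E = exp (\<kappa> * 2 ^ n)"
    have "core F \<le> (\<integral>\<^sup>+s. ennreal E * (F s * ennreal (w s)) + ennreal (\<delta> n) * (F s * ennreal (\<omega> s) * ennreal (w s)) \<partial>M)"
      unfolding core_def
    proof (rule nn_integral_mono)
      fix s
      have "\<omega> s * (w s)\<^sup>2 \<le> (E + \<delta> n * \<omega> s) * w s"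
        using mult_right_mono[OF \<delta>(4)[of s n], of "w s"] w_pos[of s] by (simp add: power2_eq_square E_def)
      then have "ennreal (\<omega> s * (w s)\<^sup>2) \<le> ennreal (E * w s + \<delta> n * (\<omega> s * w s))"
        by (intro ennreal_leI) (simp add: algebra_simps)
      also have "\<dots> = ennreal E * ennreal (w s) + ennreal (\<delta> n) * (ennreal (\<omega> s) * ennreal (w s))"
        using \<delta>_pos[of n] w_pos[of s] \<omega>_pos[of s] by (simp add: E_def ennreal_mult ennreal_plus less_imp_le)
      finally have "F s * ennreal (\<omega> s * (w s)\<^sup>2) \<le> F s * \<dots>" by (rule mult_left_mono) simp
      then show "F s * ennreal (\<omega> s * (w s)\<^sup>2)
          \<le> ennreal E * (F s * ennreal (w s)) + ennreal (\<delta> n) * (F s * ennreal (\<omega> s) * ennreal (w s))"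
        by (simp add: distrib_left ac_simps)
    qed
    also have "\<dots> = ennreal E * (\<integral>\<^sup>+s. F s * ennreal (w s) \<partial>M) +
        ennreal (\<delta> n) * (\<integral>\<^sup>+s. F s * ennreal (\<omega> s) * ennreal (w s) \<partial>M)"
      by (subst nn_integral_add) (auto simp: nn_integral_cmult)
    also have "\<dots> \<le> ennreal E * (ennreal c * ennreal b) + ennreal (\<delta> n) * (ennreal c * wnorm F)"
    proof (intro add_mono mult_left_mono)
      show "(\<integral>\<^sup>+s. F s * ennreal (w s) \<partial>M) \<le> ennreal c * ennreal b"
        using L2[OF F b] c b mult_right_mono[OF c(3) b(1)]
        by (simp add: ennreal_mult[symmetric] less_imp_le) (meson ennreal_leI order_trans)
      have "(\<integral>\<^sup>+s. F s * ennreal (\<omega> s) * ennreal (w s) \<partial>M) \<le> ennreal c1 * wnorm F" by (rule c1(2)[OF F])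
      also have "\<dots> \<le> ennreal c * wnorm F" using c by (intro mult_right_mono ennreal_leI) auto
      finally show "(\<integral>\<^sup>+s. F s * ennreal (\<omega> s) * ennreal (w s) \<partial>M) \<le> ennreal c * wnorm F" .
    qed auto
    also have "\<dots> = ennreal c * (ennreal (E * b) + ennreal (\<delta> n) * wnorm F)"
      using b by (simp add: E_def ennreal_mult distrib_left ac_simps)
    finally show ?thesis by (simp add: E_def)
  qed
  then show ?thesis using \<delta>(1,2,3) c(1) by blast
qed

end

section \<open>Fubini for Borel functions on the product\<close>

lemma borel_measurable_cnj:
  "f \<in> borel_measurable N \<Longrightarrow> (\<lambda>x. cnj (f x)) \<in> borel_measurable N"
  by (rule measurable_compose[OF _ borel_measurable_continuous_onI[OF continuous_on_cnj[OF continuous_on_id]]])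

context sigma_finite_radon begin

lemma integral_nonneg_slice:
  fixes F :: "'a \<Rightarrow> 'a \<Rightarrow> real"
  assumes F: "(\<lambda>(s, t). F s t) \<in> borel_measurable borel" and nn: "\<And>s t. 0 \<le> F s t"
    and fin: "(\<integral>\<^sup>+s. \<integral>\<^sup>+t. ennreal (F s t) \<partial>M \<partial>M) < \<infinity>"
  shows "AE s in M. integrable M (F s)"
    and "integrable M (\<lambda>s. \<integral>t. F s t \<partial>M)"
    and "(\<integral>s. \<integral>t. F s t \<partial>M \<partial>M) = enn2real (\<integral>\<^sup>+s. \<integral>\<^sup>+t. ennreal (F s t) \<partial>M \<partial>M)"
proof -
  have Fe: "(\<lambda>(s, t). ennreal (F s t)) \<in> borel_measurable borel"
    using measurable_compose[OF F measurable_ennreal] by (simp add: case_prod_unfold)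
  have slice: "F s \<in> borel_measurable M" for s using measurable_slices(1)[OF F, of s] by simp
  define n where "n s = (\<integral>\<^sup>+t. ennreal (F s t) \<partial>M)" for s
  have [measurable]: "n \<in> borel_measurable M" unfolding n_def[abs_def] by (rule Tonelli_borel(2)[OF Fe])
  have fin': "(\<integral>\<^sup>+s. n s \<partial>M) < \<infinity>" using fin by (simp add: n_def)
  have n_AE: "AE s in M. n s \<noteq> \<infinity>" using fin' by (intro nn_integral_PInf_AE) auto
  show "AE s in M. integrable M (F s)"
    using n_AE
  proof eventually_elim
    case (elim s)
    then show ?case using slice nn by (intro integrableI_bounded) (auto simp: n_def less_top)
  qed
  have eq: "(\<integral>t. F s t \<partial>M) = enn2real (n s)" for s
    unfolding n_def using slice nn by (intro integral_eq_nn_integral) auto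
  have "(\<integral>\<^sup>+s. ennreal (enn2real (n s)) \<partial>M) = (\<integral>\<^sup>+s. n s \<partial>M)"
    using n_AE by (intro nn_integral_cong_AE) (auto simp: less_top)
  then show "integrable M (\<lambda>s. \<integral>t. F s t \<partial>M)"
    unfolding eq using fin' by (intro integrableI_bounded) auto
  show "(\<integral>s. \<integral>t. F s t \<partial>M \<partial>M) = enn2real (\<integral>\<^sup>+s. \<integral>\<^sup>+t. ennreal (F s t) \<partial>M \<partial>M)"
    unfolding eq using \<open>(\<integral>\<^sup>+s. ennreal (enn2real (n s)) \<partial>M) = _\<close>
    by (subst integral_eq_nn_integral) (auto simp: n_def[symmetric])
qed

lemma swap_borel:
  fixes F :: "'a \<Rightarrow> 'a \<Rightarrow> 'c::topological_space"
  assumes "(\<lambda>(s, t). F s t) \<in> borel_measurable borel"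
  shows "(\<lambda>(s, t). F t s) \<in> borel_measurable borel"
proof -
  have "(\<lambda>p. (snd p, fst p)) \<in> measurable borel (borel :: ('a \<times> 'a) measure)"
    by (intro borel_measurable_continuous_onI continuous_intros)
  from measurable_compose[OF this assms] show ?thesis by (simp add: case_prod_unfold)
qed

lemma Fubini_borel_real:
  fixes F :: "'a \<Rightarrow> 'a \<Rightarrow> real"
  assumes F: "(\<lambda>(s, t). F s t) \<in> borel_measurable borel"
    and fin: "(\<integral>\<^sup>+s. \<integral>\<^sup>+t. ennreal \<bar>F s t\<bar> \<partial>M \<partial>M) < \<infinity>"
  shows "(\<integral>s. \<integral>t. F s t \<partial>M \<partial>M) = (\<integral>t. \<integral>s. F s t \<partial>M \<partial>M)"
proof -
  have part: "(\<integral>s. \<integral>t. F s t \<partial>M \<partial>M) =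
      enn2real (\<integral>\<^sup>+s. \<integral>\<^sup>+t. ennreal (F s t) \<partial>M \<partial>M) - enn2real (\<integral>\<^sup>+s. \<integral>\<^sup>+t. ennreal (- F s t) \<partial>M \<partial>M)"
    if F: "(\<lambda>(s, t). F s t) \<in> borel_measurable borel"
      and fin: "(\<integral>\<^sup>+s. \<integral>\<^sup>+t. ennreal \<bar>F s t\<bar> \<partial>M \<partial>M) < \<infinity>" for F :: "'a \<Rightarrow> 'a \<Rightarrow> real"
  proof -
    define P where "P s t = max 0 (F s t)" for s t
    define Q where "Q s t = max 0 (- F s t)" for s t
    have F': "(\<lambda>x. F (fst x) (snd x)) \<in> borel_measurable borel" using F by (simp add: case_prod_unfold)
    have PQ: "(\<lambda>(s, t). P s t) \<in> borel_measurable borel" "(\<lambda>(s, t). Q s t) \<in> borel_measurable borel"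
      unfolding P_def Q_def case_prod_unfold using F' by measurable
    have P_fin: "(\<integral>\<^sup>+s. \<integral>\<^sup>+t. ennreal (P s t) \<partial>M \<partial>M) < \<infinity>"
      by (rule le_less_trans[OF _ fin]) (intro nn_integral_mono ennreal_leI, simp add: P_def)
    have Q_fin: "(\<integral>\<^sup>+s. \<integral>\<^sup>+t. ennreal (Q s t) \<partial>M \<partial>M) < \<infinity>"
      by (rule le_less_trans[OF _ fin]) (intro nn_integral_mono ennreal_leI, simp add: Q_def)
    note P = integral_nonneg_slice[OF PQ(1) _ P_fin] and Q = integral_nonneg_slice[OF PQ(2) _ Q_fin]
    have P0: "0 \<le> P s t" "0 \<le> Q s t" for s t by (simp_all add: P_def Q_def)
    have "(\<integral>s. \<integral>t. F s t \<partial>M \<partial>M) = (\<integral>s. (\<integral>t. P s t \<partial>M) - (\<integral>t. Q s t \<partial>M) \<partial>M)"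
    proof (rule integral_cong_AE)
      show "AE s in M. (\<integral>t. F s t \<partial>M) = (\<integral>t. P s t \<partial>M) - (\<integral>t. Q s t \<partial>M)"
        using P(1)[OF P0(1)] Q(1)[OF P0(2)]
      proof eventually_elim
        case (elim s)
        have "(\<integral>t. F s t \<partial>M) = (\<integral>t. P s t - Q s t \<partial>M)"
          by (intro Bochner_Integration.integral_cong) (auto simp: P_def Q_def)
        then show ?case using elim by simp
      qed
      show m: "(\<lambda>s. (\<integral>t. P s t \<partial>M) - (\<integral>t. Q s t \<partial>M)) \<in> borel_measurable M"
        using P(2)[OF P0(1)] Q(2)[OF P0(2)] by auto
      have meas: "(\<lambda>s. \<integral>\<^sup>+t. ennreal (F s t) \<partial>M) \<in> borel_measurable M"
          "(\<lambda>s. \<integral>\<^sup>+t. ennreal (- F s t) \<partial>M) \<in> borel_measurable M"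
          "(\<lambda>s. \<integral>\<^sup>+t. ennreal \<bar>F s t\<bar> \<partial>M) \<in> borel_measurable M"
        using F' by (auto intro!: Tonelli_borel(2) simp: case_prod_unfold)
      have "(\<integral>t. F s t \<partial>M) = (if (\<integral>\<^sup>+t. ennreal \<bar>F s t\<bar> \<partial>M) < \<infinity>
          then enn2real (\<integral>\<^sup>+t. ennreal (F s t) \<partial>M) - enn2real (\<integral>\<^sup>+t. ennreal (- F s t) \<partial>M) else 0)" for s
      proof -
        have "F s \<in> borel_measurable M" using measurable_slices(1)[OF F, of s] by simp
        then have "integrable M (F s) \<longleftrightarrow> (\<integral>\<^sup>+t. ennreal \<bar>F s t\<bar> \<partial>M) < \<infinity>"
          by (simp add: integrable_iff_bounded)
        then show ?thesis by (auto simp: real_lebesgue_integral_def not_integrable_integral_eq)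
      qed
      then show "(\<lambda>s. \<integral>t. F s t \<partial>M) \<in> borel_measurable M"
        using meas by simp
    qed
    also have "\<dots> = (\<integral>s. \<integral>t. P s t \<partial>M \<partial>M) - (\<integral>s. \<integral>t. Q s t \<partial>M \<partial>M)"
      by (rule Bochner_Integration.integral_diff[OF P(2)[OF P0(1)] Q(2)[OF P0(2)]])
    also have "\<dots> = enn2real (\<integral>\<^sup>+s. \<integral>\<^sup>+t. ennreal (P s t) \<partial>M \<partial>M) - enn2real (\<integral>\<^sup>+s. \<integral>\<^sup>+t. ennreal (Q s t) \<partial>M \<partial>M)"
      by (simp only: P(3)[OF P0(1)] Q(3)[OF P0(2)])
    also have "(\<lambda>s t. ennreal (P s t)) = (\<lambda>s t. ennreal (F s t))"
      by (intro ext) (auto simp: P_def max_def ennreal_neg)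
    also have "(\<lambda>s t. ennreal (Q s t)) = (\<lambda>s t. ennreal (- F s t))"
      by (intro ext) (auto simp: Q_def max_def ennreal_neg)
    finally show ?thesis .
  qed
  have F': "(\<lambda>x. F (fst x) (snd x)) \<in> borel_measurable borel" using F by (simp add: case_prod_unfold)
  have sw: "(\<integral>\<^sup>+s. \<integral>\<^sup>+t. ennreal (G (F s t)) \<partial>M \<partial>M) = (\<integral>\<^sup>+t. \<integral>\<^sup>+s. ennreal (G (F s t)) \<partial>M \<partial>M)"
    if "G \<in> borel_measurable borel" for G :: "real \<Rightarrow> real"
    using that F' by (intro Tonelli_borel(1)) (simp add: case_prod_unfold)
  have fin2: "(\<integral>\<^sup>+t. \<integral>\<^sup>+s. ennreal \<bar>F s t\<bar> \<partial>M \<partial>M) < \<infinity>" using fin sw[of abs] by simp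
  show ?thesis
    using part[OF F fin] part[OF swap_borel[OF F] fin2] sw[of "\<lambda>x. x"] sw[of uminus] by simp
qed

text \<open>The integral is assembled from the four nonnegative integrals of the positive and negative
  parts of real and imaginary part, each of which is measurable by \<open>Tonelli_borel\<close>. Where the
  slice is not integrable the integral is \<open>0\<close>, which is the last case.\<close>

lemma integral_slice_measurable:
  fixes F :: "'a \<Rightarrow> 'a \<Rightarrow> complex"
  assumes F: "(\<lambda>(s, t). F s t) \<in> borel_measurable borel"
  shows "(\<lambda>s. \<integral>t. F s t \<partial>M) \<in> borel_measurable M"
proof -
  have F': "(\<lambda>x. F (fst x) (snd x)) \<in> borel_measurable borel" using F by (simp add: case_prod_unfold)
  have meas: "(\<lambda>s. \<integral>\<^sup>+t. ennreal (G (F s t)) \<partial>M) \<in> borel_measurable M"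
    if [measurable]: "G \<in> borel_measurable borel" for G :: "complex \<Rightarrow> real"
    using F' by (intro Tonelli_borel(2)) (simp add: case_prod_unfold)
  have "(\<integral>t. F s t \<partial>M) = (if (\<integral>\<^sup>+t. ennreal (norm (F s t)) \<partial>M) < \<infinity>
      then complex_of_real (enn2real (\<integral>\<^sup>+t. ennreal (Re (F s t)) \<partial>M) - enn2real (\<integral>\<^sup>+t. ennreal (- Re (F s t)) \<partial>M))
        + \<i> * complex_of_real (enn2real (\<integral>\<^sup>+t. ennreal (Im (F s t)) \<partial>M) - enn2real (\<integral>\<^sup>+t. ennreal (- Im (F s t)) \<partial>M))
      else 0)" for s
  proof -
    have m: "F s \<in> borel_measurable M" using measurable_slices(1)[OF F, of s] by simp
    then have iff: "integrable M (F s) \<longleftrightarrow> (\<integral>\<^sup>+t. ennreal (norm (F s t)) \<partial>M) < \<infinity>"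
      by (simp add: integrable_iff_bounded)
    show ?thesis
    proof (cases "integrable M (F s)")
      case True
      then have "integrable M (\<lambda>t. Re (F s t))" "integrable M (\<lambda>t. Im (F s t))" by auto
      note re_im = this[THEN real_lebesgue_integral_def]
      have "(\<integral>t. F s t \<partial>M) = complex_of_real (\<integral>t. Re (F s t) \<partial>M) + \<i> * complex_of_real (\<integral>t. Im (F s t) \<partial>M)"
        using True by (simp add: complex_eq_iff)
      also have "\<dots> = complex_of_real (enn2real (\<integral>\<^sup>+t. ennreal (Re (F s t)) \<partial>M) - enn2real (\<integral>\<^sup>+t. ennreal (- Re (F s t)) \<partial>M))
        + \<i> * complex_of_real (enn2real (\<integral>\<^sup>+t. ennreal (Im (F s t)) \<partial>M) - enn2real (\<integral>\<^sup>+t. ennreal (- Im (F s t)) \<partial>M))"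
        by (simp only: re_im)
      finally show ?thesis using True unfolding iff by (simp only: if_True)
    next
      case False
      then have "\<not> (\<integral>\<^sup>+t. ennreal (norm (F s t)) \<partial>M) < \<infinity>" unfolding iff .
      then show ?thesis by (simp only: if_False not_integrable_integral_eq[OF False])
    qed
  qed
  moreover have "(\<lambda>s. if (\<integral>\<^sup>+t. ennreal (norm (F s t)) \<partial>M) < \<infinity>
      then complex_of_real (enn2real (\<integral>\<^sup>+t. ennreal (Re (F s t)) \<partial>M) - enn2real (\<integral>\<^sup>+t. ennreal (- Re (F s t)) \<partial>M))
        + \<i> * complex_of_real (enn2real (\<integral>\<^sup>+t. ennreal (Im (F s t)) \<partial>M) - enn2real (\<integral>\<^sup>+t. ennreal (- Im (F s t)) \<partial>M))
      else 0) \<in> borel_measurable M"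
    using meas[of norm] meas[of Re] meas[of "\<lambda>x. - Re x"] meas[of Im] meas[of "\<lambda>x. - Im x"] by simp
  ultimately show ?thesis by simp
qed

theorem Fubini_borel:
  fixes F :: "'a \<Rightarrow> 'a \<Rightarrow> complex"
  assumes F: "(\<lambda>(s, t). F s t) \<in> borel_measurable borel"
    and fin: "(\<integral>\<^sup>+s. \<integral>\<^sup>+t. ennreal (norm (F s t)) \<partial>M \<partial>M) < \<infinity>"
  shows "(\<integral>s. \<integral>t. F s t \<partial>M \<partial>M) = (\<integral>t. \<integral>s. F s t \<partial>M \<partial>M)"
proof -
  have parts: "(\<integral>s. \<integral>t. F s t \<partial>M \<partial>M) =
      complex_of_real (\<integral>s. \<integral>t. Re (F s t) \<partial>M \<partial>M) + \<i> * complex_of_real (\<integral>s. \<integral>t. Im (F s t) \<partial>M \<partial>M)"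
    if F: "(\<lambda>(s, t). F s t) \<in> borel_measurable borel"
      and fin: "(\<integral>\<^sup>+s. \<integral>\<^sup>+t. ennreal (norm (F s t)) \<partial>M \<partial>M) < \<infinity>" for F :: "'a \<Rightarrow> 'a \<Rightarrow> complex"
  proof -
    have F': "(\<lambda>x. F (fst x) (snd x)) \<in> borel_measurable borel" using F by (simp add: case_prod_unfold)
    have nF: "(\<lambda>(s, t). norm (F s t)) \<in> borel_measurable borel" using F' by (simp add: case_prod_unfold)
    have slice: "F s \<in> borel_measurable M" for s using measurable_slices(1)[OF F, of s] by simp
    have AE_int: "AE s in M. integrable M (F s)"
      using integral_nonneg_slice(1)[OF nF _ fin] slice by (auto elim!: eventually_mono simp: integrable_norm_iff)
    have int: "integrable M (\<lambda>s. \<integral>t. F s t \<partial>M)"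
    proof (rule Bochner_Integration.integrable_bound[OF integral_nonneg_slice(2)[OF nF _ fin]])
      show "AE s in M. norm (\<integral>t. F s t \<partial>M) \<le> norm (\<integral>t. norm (F s t) \<partial>M)"
        by (intro AE_I2 order_trans[OF integral_norm_bound]) auto
      show "(\<lambda>s. \<integral>t. F s t \<partial>M) \<in> borel_measurable M" by (rule integral_slice_measurable[OF F])
    qed simp
    have cF: "(\<lambda>(s, t). complex_of_real (Re (F s t))) \<in> borel_measurable borel"
      "(\<lambda>(s, t). complex_of_real (Im (F s t))) \<in> borel_measurable borel"
      using F' by (simp_all add: case_prod_unfold)
    have m: "(\<lambda>s. \<integral>t. Re (F s t) \<partial>M) \<in> borel_measurable M" "(\<lambda>s. \<integral>t. Im (F s t) \<partial>M) \<in> borel_measurable M"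
      using borel_measurable_Re[THEN measurable_compose[OF integral_slice_measurable[OF cF(1)]]]
        borel_measurable_Re[THEN measurable_compose[OF integral_slice_measurable[OF cF(2)]]]
      by simp_all
    have re: "Re (\<integral>s. \<integral>t. F s t \<partial>M \<partial>M) = (\<integral>s. \<integral>t. Re (F s t) \<partial>M \<partial>M)"
      unfolding integral_Re[OF int, symmetric] using AE_int int m
      by (intro integral_cong_AE) (auto elim!: eventually_mono)
    have im: "Im (\<integral>s. \<integral>t. F s t \<partial>M \<partial>M) = (\<integral>s. \<integral>t. Im (F s t) \<partial>M \<partial>M)"
      unfolding integral_Im[OF int, symmetric] using AE_int int m
      by (intro integral_cong_AE) (auto elim!: eventually_mono)
    show ?thesis by (simp add: complex_eq_iff re im)
  qed
  have F': "(\<lambda>x. F (fst x) (snd x)) \<in> borel_measurable borel" using F by (simp add: case_prod_unfold)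
  have sw: "(\<integral>\<^sup>+s. \<integral>\<^sup>+t. ennreal (norm (F s t)) \<partial>M \<partial>M) = (\<integral>\<^sup>+t. \<integral>\<^sup>+s. ennreal (norm (F s t)) \<partial>M \<partial>M)"
    using F' by (intro Tonelli_borel(1)) (simp add: case_prod_unfold)
  have fin2: "(\<integral>\<^sup>+t. \<integral>\<^sup>+s. ennreal (norm (F s t)) \<partial>M \<partial>M) < \<infinity>" using fin sw by simp
  have "(\<integral>\<^sup>+s. \<integral>\<^sup>+t. ennreal \<bar>Re (F s t)\<bar> \<partial>M \<partial>M) < \<infinity>" "(\<integral>\<^sup>+s. \<integral>\<^sup>+t. ennreal \<bar>Im (F s t)\<bar> \<partial>M \<partial>M) < \<infinity>"
    by (rule le_less_trans[OF _ fin], intro nn_integral_mono ennreal_leI abs_Re_le_cmod abs_Im_le_cmod)+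
  then have "(\<integral>s. \<integral>t. Re (F s t) \<partial>M \<partial>M) = (\<integral>t. \<integral>s. Re (F s t) \<partial>M \<partial>M)"
      "(\<integral>s. \<integral>t. Im (F s t) \<partial>M \<partial>M) = (\<integral>t. \<integral>s. Im (F s t) \<partial>M \<partial>M)"
    using F' by (auto intro!: Fubini_borel_real simp: case_prod_unfold)
  then show ?thesis
    using parts[OF F fin] parts[OF swap_borel[OF F] fin2] by simp
qed

end

section \<open>Twisted convolution of functions\<close>

context haar_growth begin

lemma integral_left:
  fixes f :: "'a \<Rightarrow> complex"
  assumes "f \<in> borel_measurable M" shows "(\<integral>x. f (s + x) \<partial>M) = (\<integral>x. f x \<partial>M)"
proof -
  have "(\<integral>x. f x \<partial>M) = (\<integral>x. f x \<partial>distr M M (\<lambda>x. s + x))" by (simp only: distr_left)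
  also have "\<dots> = (\<integral>x. f (s + x) \<partial>M)" using assms by (intro integral_distr) auto
  finally show ?thesis by simp
qed

lemma integral_uminus:
  fixes f :: "'a \<Rightarrow> complex"
  assumes "f \<in> borel_measurable M" shows "(\<integral>x. f (- x) \<partial>M) = (\<integral>x. f x \<partial>M)"
proof -
  have "(\<integral>x. f x \<partial>M) = (\<integral>x. f x \<partial>distr M M uminus)" by (simp only: distr_uminus)
  also have "\<dots> = (\<integral>x. f (- x) \<partial>M)" using assms by (intro integral_distr) auto
  finally show ?thesis by simp
qed

end

locale twisted_orlicz = weighted_orlicz M U \<omega> w K0 \<Phi> \<Psi>
  for M :: "'a::{topological_group_add, t2_space} measure" and U \<omega> w K0 \<Phi> \<Psi> +
  fixes \<Omega> :: "'a \<Rightarrow> 'a \<Rightarrow> complex"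
  assumes cocycle: "\<Omega> \<in> circle_cocycles"
begin

abbreviation mag :: "('a \<Rightarrow> complex) \<Rightarrow> 'a \<Rightarrow> ennreal" where
  "mag f \<equiv> (\<lambda>s. ennreal (norm (f s)))"

abbreviation conv (infixl "\<circledast>" 70) where "f \<circledast> g \<equiv> twisted_conv M \<Omega> f g"
abbreviation invol where "invol f \<equiv> twisted_star \<Omega> f"
abbreviation space_A where "space_A \<equiv> weighted_orlicz_space M \<Phi> \<omega>"

lemma \<Omega>_norm [simp]: "norm (\<Omega> r s) = 1"
  and \<Omega>_cocycle: "\<Omega> r s * \<Omega> (r + s) t = \<Omega> s t * \<Omega> r (s + t)"
  and \<Omega>_zero [simp]: "\<Omega> r 0 = 1" "\<Omega> 0 r = 1"
  and \<Omega>_continuous: "continuous_on UNIV (\<lambda>(r, s). \<Omega> r s)"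
  using cocycle unfolding circle_cocycles_def by blast+

lemma \<Omega>_cnj [simp]: "\<Omega> r s * cnj (\<Omega> r s) = 1" "cnj (\<Omega> r s) * \<Omega> r s = 1"
  using complex_norm_square[of "\<Omega> r s"] by (simp_all add: mult.commute)

lemma \<Omega>_borel:
  fixes p q :: "'b::topological_space \<Rightarrow> 'a"
  assumes "continuous_on UNIV p" "continuous_on UNIV q"
  shows "(\<lambda>x. \<Omega> (p x) (q x)) \<in> borel_measurable (borel :: 'b measure)"
proof (rule borel_measurable_continuous_onI)
  have "continuous_on UNIV (\<lambda>x. (p x, q x))" using assms by (intro continuous_intros)
  from continuous_on_compose2[OF \<Omega>_continuous this] show "continuous_on UNIV (\<lambda>x. \<Omega> (p x) (q x))" by simp
qed

lemma \<Omega>_inverse: "\<Omega> s (- s) = \<Omega> (- s) s"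
  using \<Omega>_cocycle[of s "- s" s] by simp

lemma space_A_iff: "f \<in> space_A \<longleftrightarrow> f \<in> borel_measurable M \<and> wnorm (mag f) < \<infinity>"
proof -
  have "ennreal (norm (f s * complex_of_real (\<omega> s))) = mag f s * ennreal (\<omega> s)" for s
    using \<omega>_pos[of s] by (simp add: norm_mult ennreal_mult less_imp_le)
  then show ?thesis
    unfolding weighted_orlicz_space_def orlicz_space_iff wnorm_def by auto
qed

lemma space_A_measurable [measurable_dest]: "f \<in> space_A \<Longrightarrow> f \<in> borel_measurable M"
  by (simp add: space_A_iff)

lemma weighted_orlicz_norm_eq: "weighted_orlicz_norm M \<Psi> \<omega> f = wnorm (mag f)"
proof -
  have "ennreal (norm (f s * complex_of_real (\<omega> s))) = mag f s * ennreal (\<omega> s)" for s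
    using \<omega>_pos[of s] by (simp add: norm_mult ennreal_mult less_imp_le)
  then show ?thesis unfolding weighted_orlicz_norm_def orlicz_norm_eq wnorm_def by simp
qed

lemma space_A_dominated:
  assumes "g \<in> space_A" "f \<in> borel_measurable M" "\<And>s. norm (f s) \<le> norm (g s)"
  shows "f \<in> space_A"
proof -
  have "wnorm (mag f) \<le> wnorm (mag g)" using assms(3) by (intro wnorm_mono_AE AE_I2 ennreal_leI)
  moreover have "wnorm (mag g) < \<infinity>" using assms(1) by (simp add: space_A_iff)
  ultimately show ?thesis using assms(2) by (simp add: space_A_iff le_less_trans)
qed

lemma space_A_add: "f \<in> space_A \<Longrightarrow> g \<in> space_A \<Longrightarrow> (\<lambda>s. f s + g s) \<in> space_A"
  and wnorm_triangle: "f \<in> borel_measurable M \<Longrightarrow> g \<in> borel_measurable M \<Longrightarrow>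
    wnorm (mag (\<lambda>s. f s + g s)) \<le> wnorm (mag f) + wnorm (mag g)"
proof -
  show *: "wnorm (mag (\<lambda>s. f s + g s)) \<le> wnorm (mag f) + wnorm (mag g)"
    if [measurable]: "f \<in> borel_measurable M" "g \<in> borel_measurable M" for f g
  proof -
    have "wnorm (mag (\<lambda>s. f s + g s)) \<le> wnorm (\<lambda>s. mag f s + mag g s)"
      by (intro wnorm_mono_AE AE_I2) (simp add: ennreal_plus[symmetric] ennreal_leI norm_triangle_ineq del: ennreal_plus)
    also have "\<dots> \<le> wnorm (mag f) + wnorm (mag g)" by (rule wnorm_add) measurable
    finally show ?thesis .
  qed
  show "(\<lambda>s. f s + g s) \<in> space_A" if "f \<in> space_A" "g \<in> space_A"
  proof -
    have "f \<in> borel_measurable M" "g \<in> borel_measurable M" "wnorm (mag f) + wnorm (mag g) < \<infinity>"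
      using that by (simp_all add: space_A_iff)
    then show ?thesis using *[of f g] by (simp add: space_A_iff le_less_trans)
  qed
qed

lemma wnorm_scale: "f \<in> borel_measurable M \<Longrightarrow> wnorm (mag (\<lambda>s. c * f s)) = ennreal (norm c) * wnorm (mag f)"
  using wnorm_cmult[of "mag f" "ennreal (norm c)"] by (simp add: norm_mult ennreal_mult)

lemma space_A_scale: "f \<in> space_A \<Longrightarrow> (\<lambda>s. c * f s) \<in> space_A"
proof -
  assume f: "f \<in> space_A"
  then have "f \<in> borel_measurable M" "wnorm (mag f) < \<infinity>" unfolding space_A_iff by blast+
  moreover from this have "wnorm (mag (\<lambda>s. c * f s)) < \<infinity>"
    unfolding wnorm_scale[OF calculation(1)] by (simp add: ennreal_mult_less_top)
  ultimately show ?thesis unfolding space_A_iff by (intro conjI borel_measurable_times) auto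
qed

lemma space_A_zero: "(\<lambda>_. 0) \<in> space_A"
proof -
  have "wnorm (mag (\<lambda>s. 0 * 0)) = ennreal (norm (0 :: complex)) * wnorm (mag (\<lambda>s. 0 :: complex))"
    by (rule wnorm_scale) measurable
  then have "wnorm (mag (\<lambda>_. 0)) = 0" by (simp only: mult_zero_left norm_zero ennreal_0)
  then have "wnorm (mag (\<lambda>_. 0)) < \<infinity>" by (simp only:) (simp only: infinity_ennreal_def ennreal_zero_less_top)
  then show ?thesis unfolding space_A_iff by (intro conjI borel_measurable_const)
qed

lemma invol_measurable: "f \<in> borel_measurable M \<Longrightarrow> invol f \<in> borel_measurable M"
  unfolding twisted_star_def[abs_def] measurable_M_iff
  by (intro borel_measurable_times borel_measurable_cnj \<Omega>_borel continuous_intros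
      translate_measurable(3)[unfolded measurable_M_iff])

lemma norm_invol: "norm (invol f s) = norm (f (- s))"
  by (simp add: twisted_star_def norm_mult)

lemma wnorm_invol:
  assumes [measurable]: "f \<in> borel_measurable M"
  shows "wnorm (mag (invol f)) = wnorm (mag f)"
proof -
  have le: "wnorm (\<lambda>s. F (- s)) \<le> wnorm F" if [measurable]: "F \<in> borel_measurable M" for F
    unfolding wnorm_def
  proof (rule gauge_norm_least)
    fix v assume v: "v \<in> dual_ball"
    then have [measurable]: "v \<in> borel_measurable M" by (rule dual_ball_measurable)
    have v': "(\<lambda>s. v (- s)) \<in> dual_ball"
      using v nn_integral_uminus[of "\<lambda>s. \<Psi> (norm (v s))"] by (simp add: dual_ball_def)
    have "(\<integral>\<^sup>+s. F (- s) * ennreal (\<omega> s) * ennreal (norm (v s)) \<partial>M)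
        = (\<integral>\<^sup>+s. F (- (- s)) * ennreal (\<omega> (- s)) * ennreal (norm (v (- s))) \<partial>M)"
      by (rule nn_integral_uminus[symmetric]) measurable
    also have "\<dots> = (\<integral>\<^sup>+s. F s * ennreal (\<omega> s) * ennreal (norm (v (- s))) \<partial>M)"
      by (simp add: \<omega>_uminus)
    also have "\<dots> \<le> gauge_norm (\<lambda>s. F s * ennreal (\<omega> s))" by (rule gauge_norm_upper[OF v'])
    finally show "(\<integral>\<^sup>+s. F (- s) * ennreal (\<omega> s) * ennreal (norm (v s)) \<partial>M) \<le> gauge_norm (\<lambda>s. F s * ennreal (\<omega> s))" .
  qed
  have "wnorm (mag (invol f)) = wnorm (\<lambda>s. mag f (- s))" by (simp add: norm_invol)
  moreover have "wnorm (\<lambda>s. mag f (- s)) \<le> wnorm (mag f)" by (rule le) measurable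
  moreover have "wnorm (mag f) \<le> wnorm (\<lambda>s. mag f (- s))"
    using le[of "\<lambda>s. mag f (- s)"] by simp
  ultimately show ?thesis by simp
qed

lemma space_A_invol: "f \<in> space_A \<Longrightarrow> invol f \<in> space_A"
  by (simp add: space_A_iff wnorm_invol invol_measurable)

lemma invol_invol: "invol (invol f) = f"
  by (rule ext) (simp add: twisted_star_def \<Omega>_inverse mult.assoc)

lemma kernel_borel:
  assumes f: "f \<in> borel_measurable M" and g: "g \<in> borel_measurable M"
  shows "(\<lambda>(s, t). f s * g (- s + t) * \<Omega> s (- s + t)) \<in> borel_measurable borel"
  unfolding case_prod_unfold
  by (intro borel_measurable_times borel_prod_compose \<Omega>_borel f g continuous_intros)

lemma conv_measurable:
  assumes "f \<in> borel_measurable M" "g \<in> borel_measurable M"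
  shows "f \<circledast> g \<in> borel_measurable M"
  unfolding twisted_conv_def[abs_def]
  by (rule integral_slice_measurable) (rule swap_borel[OF kernel_borel[OF assms]])

lemma kernel_measurable:
  assumes "f \<in> borel_measurable M" "g \<in> borel_measurable M"
  shows "(\<lambda>s. f s * g (- s + t) * \<Omega> s (- s + t)) \<in> borel_measurable M"
  using measurable_slices(2)[OF kernel_borel[OF assms], of t] by simp

lemma kernel_nn_integral:
  "(\<integral>\<^sup>+s. ennreal (norm (f s * g (- s + t) * \<Omega> s (- s + t))) \<partial>M) = nn_conv (mag f) (mag g) t"
  unfolding nn_conv_def by (simp add: norm_mult ennreal_mult)

lemma norm_conv_le:
  assumes "f \<in> borel_measurable M" "g \<in> borel_measurable M"
  shows "mag (f \<circledast> g) t \<le> nn_conv (mag f) (mag g) t"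
  unfolding twisted_conv_def kernel_nn_integral[symmetric]
proof (cases "integrable M (\<lambda>s. f s * g (- s + t) * \<Omega> s (- s + t))")
  case True
  then show "ennreal (norm (\<integral>s. f s * g (- s + t) * \<Omega> s (- s + t) \<partial>M))
      \<le> (\<integral>\<^sup>+s. ennreal (norm (f s * g (- s + t) * \<Omega> s (- s + t))) \<partial>M)"
    by (rule integral_norm_bound_ennreal)
qed (simp add: not_integrable_integral_eq)

lemma wnorm_finite_AE:
  assumes [measurable]: "F \<in> borel_measurable M" and "wnorm F < \<infinity>"
  shows "AE t in M. F t < \<infinity>"
proof -
  have "AE t in M. F t * ennreal (\<omega> t) < \<infinity>"
    using assms(2) unfolding wnorm_def by (intro gauge_norm_finite_AE) auto
  then show ?thesis
  proof eventually_elim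
    case (elim t)
    then show ?case using \<omega>_pos[of t] by (auto simp: ennreal_mult_less_top)
  qed
qed

lemma wnorm_eq_0_AE:
  assumes [measurable]: "f \<in> borel_measurable M"
  shows "wnorm (mag f) = 0 \<longleftrightarrow> (AE t in M. f t = 0)"
proof
  assume "wnorm (mag f) = 0"
  then have "AE t in M. mag f t * ennreal (\<omega> t) = 0"
    unfolding wnorm_def by (intro gauge_norm_eq_0_AE) auto
  then show "AE t in M. f t = 0"
  proof eventually_elim
    case (elim t)
    then show ?case using \<omega>_pos[of t] by (auto simp: ennreal_eq_0_iff not_le)
  qed
next
  assume "AE t in M. f t = 0"
  then have "wnorm (mag f) \<le> wnorm (\<lambda>s. 0 * mag f s)" by (intro wnorm_mono_AE) auto
  also have "\<dots> = 0" by (subst wnorm_cmult) auto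
  finally show "wnorm (mag f) = 0" by simp
qed

lemma wnorm_nn_conv_finite:
  assumes [measurable]: "F \<in> nn_borel" "G \<in> nn_borel" and "wnorm F < \<infinity>" "wnorm G < \<infinity>"
  shows "wnorm (nn_conv F G) < \<infinity>"
proof -
  obtain K where "wnorm (nn_conv F G) \<le> ennreal K * wnorm F * wnorm G"
    using wnorm_nn_conv_le assms(1,2) by blast
  also have "\<dots> < \<infinity>" using assms(3,4) by (simp add: ennreal_mult_less_top)
  finally show ?thesis .
qed

lemma mag_measurable [measurable]: "f \<in> borel_measurable M \<Longrightarrow> mag f \<in> nn_borel"
  by simp

lemma space_A_conv:
  assumes "f \<in> space_A" "g \<in> space_A" shows "f \<circledast> g \<in> space_A"
proof -
  have m: "f \<in> borel_measurable M" "g \<in> borel_measurable M" using assms by (auto simp: space_A_iff)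
  have "wnorm (mag (f \<circledast> g)) \<le> wnorm (nn_conv (mag f) (mag g))"
    by (intro wnorm_mono_AE AE_I2 norm_conv_le m)
  also have "\<dots> < \<infinity>" using assms m by (intro wnorm_nn_conv_finite) (auto simp: space_A_iff)
  finally show ?thesis using m by (simp add: space_A_iff conv_measurable)
qed

lemma AE_integrable_kernel:
  assumes "f \<in> space_A" "g \<in> space_A"
  shows "AE t in M. integrable M (\<lambda>s. f s * g (- s + t) * \<Omega> s (- s + t))"
proof -
  have m: "f \<in> borel_measurable M" "g \<in> borel_measurable M" using assms by (auto simp: space_A_iff)
  have "AE t in M. nn_conv (mag f) (mag g) t < \<infinity>"
    using assms m by (intro wnorm_finite_AE wnorm_nn_conv_finite nn_conv_measurable) (auto simp: space_A_iff)
  then show ?thesis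
  proof eventually_elim
    case (elim t)
    then show ?case using kernel_measurable[OF m, of t] kernel_nn_integral[of f g t]
      by (intro integrableI_bounded) auto
  qed
qed

theorem twisted_orlicz_algebra: "twisted_orlicz_algebra M \<Phi> \<Psi> \<Omega> \<omega>"
proof -
  obtain K where K: "0 < K" "\<And>F G. F \<in> nn_borel \<Longrightarrow> G \<in> nn_borel \<Longrightarrow>
      wnorm (nn_conv F G) \<le> ennreal K * wnorm F * wnorm G"
    using wnorm_nn_conv_le by blast
  show ?thesis unfolding twisted_orlicz_algebra_def
  proof (intro exI[of _ K] conjI ballI K(1))
    fix f g assume fg: "f \<in> space_A" "g \<in> space_A"
    then have m: "f \<in> borel_measurable M" "g \<in> borel_measurable M" by (auto simp: space_A_iff)
    show "AE t in M. integrable M (\<lambda>s. f s * g (- s + t) * \<Omega> s (- s + t))" by (rule AE_integrable_kernel[OF fg])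
    show "f \<circledast> g \<in> space_A" by (rule space_A_conv[OF fg])
    have "wnorm (mag (f \<circledast> g)) \<le> wnorm (nn_conv (mag f) (mag g))"
      by (intro wnorm_mono_AE AE_I2 norm_conv_le m)
    also have "\<dots> \<le> ennreal K * wnorm (mag f) * wnorm (mag g)" using m by (intro K) auto
    finally show "weighted_orlicz_norm M \<Psi> \<omega> (f \<circledast> g)
        \<le> ennreal K * weighted_orlicz_norm M \<Psi> \<omega> f * weighted_orlicz_norm M \<Psi> \<omega> g"
      by (simp add: weighted_orlicz_norm_eq)
  qed
qed

text \<open>The values agree at every point, not only almost everywhere: for fixed \<open>t\<close> the map \<open>s \<mapsto> -
  s + t\<close> preserves null sets.\<close>

lemma conv_cong_AE:
  assumes m: "f \<in> borel_measurable M" "g \<in> borel_measurable M" "f' \<in> borel_measurable M" "g' \<in> borel_measurable M"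
    and f: "AE s in M. f s = f' s" and g: "AE s in M. g s = g' s"
  shows "f \<circledast> g = f' \<circledast> g'"
proof
  fix t
  have "AE s in M. g (- s + t) = g' (- s + t)"
    using AE_uminus[OF AE_right[OF g, of t]] by simp
  then show "(f \<circledast> g) t = (f' \<circledast> g') t"
    unfolding twisted_conv_def using f
    by (intro integral_cong_AE kernel_measurable m) (auto elim!: eventually_elim2)
qed

lemma conv_add_left:
  assumes "f \<in> space_A" "g \<in> space_A" "h \<in> space_A"
  shows "AE t in M. ((\<lambda>s. f s + g s) \<circledast> h) t = (f \<circledast> h) t + (g \<circledast> h) t"
  using AE_integrable_kernel[OF assms(1,3)] AE_integrable_kernel[OF assms(2,3)]
  by eventually_elim (simp add: twisted_conv_def distrib_right)

lemma conv_add_right: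
  assumes "f \<in> space_A" "g \<in> space_A" "h \<in> space_A"
  shows "AE t in M. (f \<circledast> (\<lambda>s. g s + h s)) t = (f \<circledast> g) t + (f \<circledast> h) t"
  using AE_integrable_kernel[OF assms(1,2)] AE_integrable_kernel[OF assms(1,3)]
  by eventually_elim (simp add: twisted_conv_def distrib_right distrib_left)

lemma conv_scale_left: "((\<lambda>s. c * f s) \<circledast> g) t = c * (f \<circledast> g) t"
  unfolding twisted_conv_def by (simp add: mult.assoc)

lemma conv_scale_right: "(f \<circledast> (\<lambda>s. c * g s)) t = c * (f \<circledast> g) t"
proof -
  have "(f \<circledast> (\<lambda>s. c * g s)) t = (\<integral>s. c * (f s * g (- s + t) * \<Omega> s (- s + t)) \<partial>M)"
    unfolding twisted_conv_def by (simp add: ac_simps)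
  then show ?thesis by (simp add: twisted_conv_def)
qed

text \<open>Fubini applies at every \<open>t\<close> at which the threefold convolution of the absolute values is
  finite, which is almost everywhere; the cocycle identity matches the two integrands.\<close>

theorem conv_assoc:
  assumes "f \<in> space_A" "g \<in> space_A" "h \<in> space_A"
  shows "AE t in M. ((f \<circledast> g) \<circledast> h) t = (f \<circledast> (g \<circledast> h)) t"
proof -
  have m: "f \<in> borel_measurable M" "g \<in> borel_measurable M" "h \<in> borel_measurable M"
    using assms by (auto simp: space_A_iff)
  have fin: "wnorm (mag f) < \<infinity>" "wnorm (mag g) < \<infinity>" "wnorm (mag h) < \<infinity>" using assms by (auto simp: space_A_iff)
  have gh: "nn_conv (mag g) (mag h) \<in> nn_borel" using m by (intro nn_conv_measurable) auto
  have "AE t in M. nn_conv (mag f) (nn_conv (mag g) (mag h)) t < \<infinity>"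
    using m gh fin by (intro wnorm_finite_AE wnorm_nn_conv_finite nn_conv_measurable) auto
  then show ?thesis
  proof eventually_elim
    case (elim t)
    define F where "F s r = f s * g (- s + r) * \<Omega> s (- s + r) * (h (- r + t) * \<Omega> r (- r + t))" for s r
    have Fm: "(\<lambda>(s, r). F s r) \<in> borel_measurable borel"
      unfolding F_def case_prod_unfold
      by (intro borel_measurable_times borel_prod_compose \<Omega>_borel m continuous_intros)
    have "(\<integral>\<^sup>+s. \<integral>\<^sup>+r. ennreal (norm (F s r)) \<partial>M \<partial>M) = nn_conv (mag f) (nn_conv (mag g) (mag h)) t"
      using m by (subst nn_conv_assoc) (auto simp: F_def norm_mult ennreal_mult)
    then have Ffin: "(\<integral>\<^sup>+s. \<integral>\<^sup>+r. ennreal (norm (F s r)) \<partial>M \<partial>M) < \<infinity>" using elim by simp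
    have "(\<integral>s. F s r \<partial>M) = (\<integral>s. f s * g (- s + r) * \<Omega> s (- s + r) \<partial>M) * (h (- r + t) * \<Omega> r (- r + t))" for r
      unfolding F_def by (rule integral_mult_left_zero)
    then have "((f \<circledast> g) \<circledast> h) t = (\<integral>r. \<integral>s. F s r \<partial>M \<partial>M)"
      unfolding twisted_conv_def by (simp only: mult.assoc)
    also have "\<dots> = (\<integral>s. \<integral>r. F s r \<partial>M \<partial>M)" by (rule Fubini_borel[OF Fm Ffin, symmetric])
    also have "\<dots> = (f \<circledast> (g \<circledast> h)) t"
      unfolding twisted_conv_def
    proof (rule Bochner_Integration.integral_cong[OF refl])
      fix s
      have "(\<integral>r. g r * h (- r + (- s + t)) * \<Omega> r (- r + (- s + t)) \<partial>M) =
          (\<integral>r. g (- s + r) * h (- (- s + r) + (- s + t)) * \<Omega> (- s + r) (- (- s + r) + (- s + t)) \<partial>M)"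
        by (rule integral_left[symmetric]) (rule kernel_measurable[OF m(2,3)])
      also have "\<dots> = (\<integral>r. g (- s + r) * h (- r + t) * \<Omega> (- s + r) (- r + t) \<partial>M)"
        by (simp add: minus_add add.assoc)
      finally have "f s * (\<integral>r. g r * h (- r + (- s + t)) * \<Omega> r (- r + (- s + t)) \<partial>M) * \<Omega> s (- s + t)
          = (\<integral>r. f s * (g (- s + r) * h (- r + t) * \<Omega> (- s + r) (- r + t)) * \<Omega> s (- s + t) \<partial>M)"
        by simp
      also have "\<dots> = (\<integral>r. F s r \<partial>M)"
      proof (rule Bochner_Integration.integral_cong[OF refl])
        fix r
        have "\<Omega> s (- s + r) * \<Omega> r (- r + t) = \<Omega> (- s + r) (- r + t) * \<Omega> s (- s + t)"
          using \<Omega>_cocycle[of s "- s + r" "- r + t"] by (simp add: add.assoc)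
        then show "f s * (g (- s + r) * h (- r + t) * \<Omega> (- s + r) (- r + t)) * \<Omega> s (- s + t) = F s r"
          by (simp add: F_def mult.assoc mult.left_commute)
      qed
      finally show "(\<integral>r. F s r \<partial>M) = f s * (\<integral>r. g r * h (- r + (- s + t)) * \<Omega> r (- r + (- s + t)) \<partial>M) * \<Omega> s (- s + t)"
        by simp
    qed
    finally show ?case .
  qed
qed

text \<open>After the substitution \<open>s \<mapsto> t + s\<close> the integrands are conjugate to each other up to the
  constant \<open>cnj (\<Omega> t (- t))\<close>, by two instances of the cocycle identity.\<close>

lemma invol_conv:
  assumes m: "f \<in> borel_measurable M" "g \<in> borel_measurable M"
  shows "invol (f \<circledast> g) = invol g \<circledast> invol f"
proof
  fix t
  have k: "(\<lambda>s. invol g s * invol f (- s + t) * \<Omega> s (- s + t)) \<in> borel_measurable M"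
    by (intro kernel_measurable invol_measurable m)
  have "(invol g \<circledast> invol f) t = (\<integral>s. invol g (t + s) * invol f (- (t + s) + t) * \<Omega> (t + s) (- (t + s) + t) \<partial>M)"
    unfolding twisted_conv_def by (rule integral_left[OF k, symmetric])
  also have "\<dots> = (\<integral>s. cnj (f s * g (- s + - t) * \<Omega> s (- s + - t)) * cnj (\<Omega> t (- t)) \<partial>M)"
  proof (rule Bochner_Integration.integral_cong[OF refl])
    fix s
    have 1: "- (t + s) + t = - s" "- (t + s) = - s + - t" by (simp_all add: minus_add add.assoc)
    have c1: "\<Omega> t s * \<Omega> (t + s) (- s + - t) = \<Omega> s (- s + - t) * \<Omega> t (- t)"
    proof -
      have "s + (- s + - t) = - t" by (simp only: add.assoc[symmetric] right_minus add_0)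
      then show ?thesis using \<Omega>_cocycle[of t s "- s + - t"] by (simp only:)
    qed
    have c2: "\<Omega> t s * \<Omega> (t + s) (- s) = \<Omega> (- s) s"
      using \<Omega>_cocycle[of t s "- s"] by (simp add: \<Omega>_inverse)
    have "cnj (\<Omega> (t + s) (- s + - t)) * cnj (\<Omega> (- s) s) * \<Omega> (t + s) (- s)
        = cnj (\<Omega> t s * \<Omega> (t + s) (- s + - t)) * (cnj (\<Omega> (t + s) (- s)) * \<Omega> (t + s) (- s))"
      unfolding c2[symmetric] by (simp only: complex_cnj_mult ac_simps)
    also have "\<dots> = cnj (\<Omega> s (- s + - t)) * cnj (\<Omega> t (- t))" by (simp only: c1 complex_cnj_mult \<Omega>_cnj mult_1_right)
    finally show "invol g (t + s) * invol f (- (t + s) + t) * \<Omega> (t + s) (- (t + s) + t)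
        = cnj (f s * g (- s + - t) * \<Omega> s (- s + - t)) * cnj (\<Omega> t (- t))"
      unfolding 1 twisted_star_def minus_minus complex_cnj_mult by (simp add: 1 ac_simps)
  qed
  also have "\<dots> = (\<integral>s. cnj (f s * g (- s + - t) * \<Omega> s (- s + - t)) \<partial>M) * cnj (\<Omega> t (- t))"
    by simp
  also have "(\<integral>s. cnj (f s * g (- s + - t) * \<Omega> s (- s + - t)) \<partial>M) = cnj ((f \<circledast> g) (- t))"
    unfolding twisted_conv_def by (rule Bochner_Integration.integral_cnj)
  finally have E: "(invol g \<circledast> invol f) t = cnj ((f \<circledast> g) (- t)) * cnj (\<Omega> t (- t))" .
  show "invol (f \<circledast> g) t = (invol g \<circledast> invol f) t" unfolding E by (simp add: twisted_star_def)
qed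

section \<open>Action on square-integrable functions\<close>

definition sq_integrable :: "('a \<Rightarrow> complex) \<Rightarrow> bool" where
  "sq_integrable f \<longleftrightarrow> f \<in> borel_measurable M \<and> (\<integral>\<^sup>+s. (mag f s)\<^sup>2 \<partial>M) < \<infinity>"

definition inner2 :: "('a \<Rightarrow> complex) \<Rightarrow> ('a \<Rightarrow> complex) \<Rightarrow> complex" where
  "inner2 f g = (\<integral>s. f s * cnj (g s) \<partial>M)"

lemma nn_integral_product_power2_le:
  assumes "sq_integrable f" "sq_integrable g"
  shows "(\<integral>\<^sup>+s. mag f s * mag g s \<partial>M)\<^sup>2 \<le> (\<integral>\<^sup>+s. (mag f s)\<^sup>2 \<partial>M) * (\<integral>\<^sup>+s. (mag g s)\<^sup>2 \<partial>M)"
proof -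
  have "mag f \<in> nn_borel" "mag g \<in> nn_borel"
    using assms unfolding sq_integrable_def by (blast intro: mag_measurable)+
  then show ?thesis by (rule Cauchy_Schwarz_nn_integral)
qed

lemma inner2_integrable:
  assumes "sq_integrable f" "sq_integrable g" shows "integrable M (\<lambda>s. f s * cnj (g s))"
proof (rule integrableI_bounded)
  show "(\<lambda>s. f s * cnj (g s)) \<in> borel_measurable M"
    using assms by (auto simp: sq_integrable_def intro!: borel_measurable_times borel_measurable_cnj)
  have "(\<integral>\<^sup>+s. mag f s * mag g s \<partial>M)\<^sup>2 < \<infinity>"
    using nn_integral_product_power2_le[OF assms] assms
    by (auto simp: sq_integrable_def ennreal_mult_less_top intro: le_less_trans)
  then have "(\<integral>\<^sup>+s. mag f s * mag g s \<partial>M) < \<infinity>"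
    by (auto simp: power2_eq_square ennreal_mult_less_top)
  then show "(\<integral>\<^sup>+s. ennreal (norm (f s * cnj (g s))) \<partial>M) < \<infinity>"
    by (simp add: norm_mult ennreal_mult)
qed

lemma inner2_self:
  assumes "sq_integrable f"
  shows "ennreal (Re (inner2 f f)) = (\<integral>\<^sup>+s. (mag f s)\<^sup>2 \<partial>M)" "0 \<le> Re (inner2 f f)"
proof -
  have eq: "f s * cnj (f s) = complex_of_real ((norm (f s))\<^sup>2)" for s by (rule complex_norm_square[symmetric])
  have "integrable M (\<lambda>s. Re (f s * cnj (f s)))" using inner2_integrable[OF assms assms] by (rule integrable_Re)
  then have int: "integrable M (\<lambda>s. (norm (f s))\<^sup>2)" unfolding eq Re_complex_of_real .
  have re: "Re (inner2 f f) = (\<integral>s. (norm (f s))\<^sup>2 \<partial>M)"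
    unfolding inner2_def eq by (subst integral_complex_of_real) simp
  show "ennreal (Re (inner2 f f)) = (\<integral>\<^sup>+s. (mag f s)\<^sup>2 \<partial>M)"
    unfolding re using int by (subst nn_integral_eq_integral[symmetric]) (auto simp: ennreal_power)
  show "0 \<le> Re (inner2 f f)" unfolding re by (rule integral_nonneg_AE) simp
qed

lemma nn_integral_space_A_finite:
  assumes "f \<in> space_A" shows "(\<integral>\<^sup>+s. mag f s \<partial>M) < \<infinity>"
proof -
  obtain c where c: "\<forall>F\<in>nn_borel. (\<integral>\<^sup>+s. F s \<partial>M) \<le> ennreal c * wnorm F"
    using nn_integral_le_wnorm by blast
  have "f \<in> borel_measurable M" using assms by (simp add: space_A_iff)
  then have "mag f \<in> nn_borel" by (rule mag_measurable)
  from bspec[OF c this] have "(\<integral>\<^sup>+s. mag f s \<partial>M) \<le> ennreal c * wnorm (mag f)" .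
  also have "\<dots> < \<infinity>" using assms by (simp add: space_A_iff ennreal_mult_less_top)
  finally show ?thesis .
qed

lemma sq_norm_conv_le:
  assumes "f \<in> borel_measurable M" "x \<in> borel_measurable M"
  shows "(\<integral>\<^sup>+s. (mag (f \<circledast> x) s)\<^sup>2 \<partial>M) \<le> (\<integral>\<^sup>+s. mag f s \<partial>M)\<^sup>2 * (\<integral>\<^sup>+s. (mag x s)\<^sup>2 \<partial>M)"
proof -
  have "(\<integral>\<^sup>+s. (mag (f \<circledast> x) s)\<^sup>2 \<partial>M) \<le> (\<integral>\<^sup>+s. (nn_conv (mag f) (mag x) s)\<^sup>2 \<partial>M)"
    by (intro nn_integral_mono power_mono norm_conv_le assms) auto
  also have "\<dots> \<le> (\<integral>\<^sup>+s. mag f s \<partial>M)\<^sup>2 * (\<integral>\<^sup>+s. (mag x s)\<^sup>2 \<partial>M)"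
    using assms by (intro nn_integral_nn_conv_power2_le) auto
  finally show ?thesis .
qed

lemma sq_integrable_conv:
  assumes "f \<in> space_A" "sq_integrable x" shows "sq_integrable (f \<circledast> x)"
proof -
  have m: "f \<in> borel_measurable M" "x \<in> borel_measurable M" using assms by (auto simp: space_A_iff sq_integrable_def)
  have "(\<integral>\<^sup>+s. (mag (f \<circledast> x) s)\<^sup>2 \<partial>M) \<le> (\<integral>\<^sup>+s. mag f s \<partial>M)\<^sup>2 * (\<integral>\<^sup>+s. (mag x s)\<^sup>2 \<partial>M)"
    by (rule sq_norm_conv_le[OF m])
  also have "\<dots> < \<infinity>" using assms nn_integral_space_A_finite[OF assms(1)]
    by (auto simp: sq_integrable_def ennreal_mult_less_top power2_eq_square)
  finally show ?thesis using m by (simp add: sq_integrable_def conv_measurable)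
qed

lemma sq_integrable_invol: "sq_integrable f \<Longrightarrow> sq_integrable (invol f)"
proof -
  assume f: "sq_integrable f"
  then have m: "f \<in> borel_measurable M" by (simp add: sq_integrable_def)
  then have "(\<integral>\<^sup>+s. (mag f (- s))\<^sup>2 \<partial>M) = (\<integral>\<^sup>+s. (mag f s)\<^sup>2 \<partial>M)"
    by (intro nn_integral_uminus[of "\<lambda>s. (mag f s)\<^sup>2"] borel_measurable_power_ennreal mag_measurable)
  then show ?thesis using f m by (simp add: sq_integrable_def invol_measurable norm_invol)
qed

lemma sq_integrable_scale: "sq_integrable f \<Longrightarrow> sq_integrable (\<lambda>s. c * f s)"
proof -
  assume f: "sq_integrable f"
  then have m [measurable]: "f \<in> borel_measurable M" by (simp only: sq_integrable_def)
  have "(mag (\<lambda>s. c * f s) s)\<^sup>2 = (ennreal (norm c))\<^sup>2 * (mag f s)\<^sup>2" for s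
    by (simp only: norm_mult ennreal_mult norm_ge_zero power_mult_distrib)
  then have "(\<integral>\<^sup>+s. (mag (\<lambda>s. c * f s) s)\<^sup>2 \<partial>M) = (ennreal (norm c))\<^sup>2 * (\<integral>\<^sup>+s. (mag f s)\<^sup>2 \<partial>M)"
    by (simp only:) (rule nn_integral_cmult, measurable)
  moreover have "(\<integral>\<^sup>+s. (mag f s)\<^sup>2 \<partial>M) < \<infinity>" using f by (simp only: sq_integrable_def)
  ultimately have "(\<integral>\<^sup>+s. (mag (\<lambda>s. c * f s) s)\<^sup>2 \<partial>M) < \<infinity>"
    by (simp add: ennreal_mult_less_top power2_eq_square)
  then show ?thesis unfolding sq_integrable_def using m by (intro conjI borel_measurable_times) auto
qed

lemma sq_integrable_add:
  assumes "sq_integrable f" "sq_integrable g" shows "sq_integrable (\<lambda>s. f s + g s)"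
proof -
  have m [measurable]: "f \<in> borel_measurable M" "g \<in> borel_measurable M"
    using assms by (simp_all add: sq_integrable_def)
  have "(\<integral>\<^sup>+s. (mag (\<lambda>s. f s + g s) s)\<^sup>2 \<partial>M) \<le> (\<integral>\<^sup>+s. 2 * (mag f s)\<^sup>2 + 2 * (mag g s)\<^sup>2 \<partial>M)"
  proof (rule nn_integral_mono)
    fix s
    have "(norm (f s + g s))\<^sup>2 \<le> (norm (f s) + norm (g s))\<^sup>2"
      by (rule power_mono[OF norm_triangle_ineq norm_ge_zero])
    moreover have "(norm (f s) + norm (g s))\<^sup>2 \<le> 2 * (norm (f s))\<^sup>2 + 2 * (norm (g s))\<^sup>2"
      using sum_squares_bound[of "norm (f s)" "norm (g s)"] unfolding power2_sum by linarith
    ultimately have "(norm (f s + g s))\<^sup>2 \<le> 2 * (norm (f s))\<^sup>2 + 2 * (norm (g s))\<^sup>2" by linarith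
    then have "ennreal ((norm (f s + g s))\<^sup>2) \<le> ennreal (2 * (norm (f s))\<^sup>2 + 2 * (norm (g s))\<^sup>2)"
      by (rule ennreal_leI)
    then show "(mag (\<lambda>s. f s + g s) s)\<^sup>2 \<le> 2 * (mag f s)\<^sup>2 + 2 * (mag g s)\<^sup>2"
      by (simp add: ennreal_power ennreal_plus ennreal_mult)
  qed
  also have "\<dots> = 2 * (\<integral>\<^sup>+s. (mag f s)\<^sup>2 \<partial>M) + 2 * (\<integral>\<^sup>+s. (mag g s)\<^sup>2 \<partial>M)"
    by (subst nn_integral_add) (auto simp: nn_integral_cmult)
  also have "\<dots> < \<infinity>"
  proof -
    have "(\<integral>\<^sup>+s. (mag f s)\<^sup>2 \<partial>M) < \<infinity>" "(\<integral>\<^sup>+s. (mag g s)\<^sup>2 \<partial>M) < \<infinity>"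
      using assms by (simp_all add: sq_integrable_def)
    then show ?thesis by (simp add: ennreal_mult_less_top)
  qed
  finally show ?thesis using m by (simp add: sq_integrable_def)
qed

text \<open>Both sides equal the double integral of \<open>f s x t \<Omega> s t\<close> times the conjugate of \<open>y (s +
  t)\<close>. It converges absolutely because \<open>f\<close> is integrable and the translates of \<open>y\<close> have constant
  norm in \<open>L\<^sup>2\<close>.\<close>

theorem inner2_conv:
  assumes f: "f \<in> space_A" and x: "sq_integrable x" and y: "sq_integrable y"
  shows "inner2 (f \<circledast> x) y = inner2 x (invol f \<circledast> y)"
proof -
  have m: "f \<in> borel_measurable M" "x \<in> borel_measurable M" "y \<in> borel_measurable M"
    using assms by (auto simp: space_A_iff sq_integrable_def)
  define A where "A s t = f s * x (- s + t) * \<Omega> s (- s + t) * cnj (y t)" for s t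
  define B where "B s t = f s * (x t * \<Omega> s t * cnj (y (s + t)))" for s t
  have Am: "(\<lambda>(s, t). A s t) \<in> borel_measurable borel"
    unfolding A_def case_prod_unfold
    by (intro borel_measurable_times borel_measurable_cnj borel_prod_compose \<Omega>_borel m continuous_intros)
  have Bm: "(\<lambda>(s, t). B s t) \<in> borel_measurable borel"
    unfolding B_def case_prod_unfold
    by (intro borel_measurable_times borel_measurable_cnj borel_prod_compose \<Omega>_borel m continuous_intros)
  have AB: "A s (s + t) = B s t" for s t by (simp add: A_def B_def add.assoc[symmetric] mult.assoc)
  have As: "(\<lambda>t. A s t) \<in> borel_measurable M" for s using measurable_slices(1)[OF Am, of s] by simp
  have shift: "sq_integrable (\<lambda>t. y (s + t))" "(\<integral>\<^sup>+t. (mag y (s + t))\<^sup>2 \<partial>M) = (\<integral>\<^sup>+t. (mag y t)\<^sup>2 \<partial>M)" for s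
    using y nn_integral_left[of "\<lambda>t. (mag y t)\<^sup>2" s] by (auto simp: sq_integrable_def translate_measurable)
  have Bfin: "(\<integral>\<^sup>+s. \<integral>\<^sup>+t. ennreal (norm (B s t)) \<partial>M \<partial>M) < \<infinity>"
  proof -
    obtain p where p: "(\<integral>\<^sup>+t. (mag x t)\<^sup>2 \<partial>M) = ennreal p" "0 \<le> p"
      using x unfolding sq_integrable_def by (metis ennreal_cases infinity_ennreal_def less_irrefl)
    obtain q where q: "(\<integral>\<^sup>+t. (mag y t)\<^sup>2 \<partial>M) = ennreal q" "0 \<le> q"
      using y unfolding sq_integrable_def by (metis ennreal_cases infinity_ennreal_def less_irrefl)
    have inner: "(\<integral>\<^sup>+t. mag x t * mag y (s + t) \<partial>M) \<le> ennreal (sqrt (p * q))" for s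
    proof (rule ennreal_le_of_power2_le)
      have "(\<integral>\<^sup>+t. mag x t * mag y (s + t) \<partial>M)\<^sup>2 \<le> ennreal p * ennreal q"
        using nn_integral_product_power2_le[OF x shift(1)[of s]] shift(2)[of s] by (simp add: p q)
      then show "(\<integral>\<^sup>+t. mag x t * mag y (s + t) \<partial>M)\<^sup>2 \<le> (ennreal (sqrt (p * q)))\<^sup>2"
        using p q by (simp add: ennreal_power ennreal_mult[symmetric])
    qed (use p q in simp)
    have "(\<integral>\<^sup>+s. \<integral>\<^sup>+t. ennreal (norm (B s t)) \<partial>M \<partial>M) = (\<integral>\<^sup>+s. mag f s * (\<integral>\<^sup>+t. mag x t * mag y (s + t) \<partial>M) \<partial>M)"
    proof (rule nn_integral_cong)
      fix s
      have [measurable]: "x \<in> borel_measurable M" "(\<lambda>t. y (s + t)) \<in> borel_measurable M"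
        using m by (auto intro: translate_measurable)
      show "(\<integral>\<^sup>+t. ennreal (norm (B s t)) \<partial>M) = mag f s * (\<integral>\<^sup>+t. mag x t * mag y (s + t) \<partial>M)"
        by (subst nn_integral_cmult[symmetric]) (auto simp: B_def norm_mult ennreal_mult)
    qed
    also have "\<dots> \<le> (\<integral>\<^sup>+s. mag f s * ennreal (sqrt (p * q)) \<partial>M)"
      by (intro nn_integral_mono mult_left_mono inner) auto
    also have "\<dots> = (\<integral>\<^sup>+s. mag f s \<partial>M) * ennreal (sqrt (p * q))" using m by (intro nn_integral_multc) auto
    also have "\<dots> < \<infinity>" using nn_integral_space_A_finite[OF f] by (simp add: ennreal_mult_less_top)
    finally show ?thesis .
  qed
  have "(\<integral>\<^sup>+t. ennreal (norm (A s t)) \<partial>M) = (\<integral>\<^sup>+t. ennreal (norm (B s t)) \<partial>M)" for s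
    unfolding AB[symmetric] using As by (intro nn_integral_left[symmetric]) auto
  then have Afin: "(\<integral>\<^sup>+s. \<integral>\<^sup>+t. ennreal (norm (A s t)) \<partial>M \<partial>M) < \<infinity>" using Bfin by simp
  have "inner2 (f \<circledast> x) y = (\<integral>t. \<integral>s. A s t \<partial>M \<partial>M)"
    unfolding inner2_def twisted_conv_def A_def by simp
  also have "\<dots> = (\<integral>s. \<integral>t. A s t \<partial>M \<partial>M)" by (rule Fubini_borel[OF Am Afin, symmetric])
  also have "\<dots> = (\<integral>s. \<integral>t. B s t \<partial>M \<partial>M)"
    unfolding AB[symmetric] by (subst integral_left[OF As]) simp
  also have "\<dots> = (\<integral>t. \<integral>s. B s t \<partial>M \<partial>M)" by (rule Fubini_borel[OF Bm Bfin])
  also have "\<dots> = inner2 x (invol f \<circledast> y)"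
    unfolding inner2_def
  proof (rule Bochner_Integration.integral_cong[OF refl])
    fix t
    have k: "(\<lambda>s. invol f s * y (- s + t) * \<Omega> s (- s + t)) \<in> borel_measurable M"
      by (intro kernel_measurable invol_measurable m)
    have "(invol f \<circledast> y) t = (\<integral>s. invol f (- s) * y (- (- s) + t) * \<Omega> (- s) (- (- s) + t) \<partial>M)"
      unfolding twisted_conv_def by (rule integral_uminus[OF k, symmetric])
    also have "\<dots> = (\<integral>s. cnj (f s * \<Omega> s t * cnj (y (s + t))) \<partial>M)"
    proof (rule Bochner_Integration.integral_cong[OF refl])
      fix s
      have "\<Omega> (- s) s = \<Omega> s t * \<Omega> (- s) (s + t)" using \<Omega>_cocycle[of "- s" s t] by simp
      then have "cnj (\<Omega> (- s) s) * \<Omega> (- s) (s + t) = cnj (\<Omega> s t)"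
        by (simp add: mult.assoc)
      then show "invol f (- s) * y (- (- s) + t) * \<Omega> (- s) (- (- s) + t) = cnj (f s * \<Omega> s t * cnj (y (s + t)))"
        by (simp add: twisted_star_def ac_simps)
    qed
    also have "\<dots> = cnj (\<integral>s. f s * \<Omega> s t * cnj (y (s + t)) \<partial>M)" by (rule Bochner_Integration.integral_cnj)
    finally have "x t * cnj ((invol f \<circledast> y) t) = x t * (\<integral>s. f s * \<Omega> s t * cnj (y (s + t)) \<partial>M)" by simp
    also have "\<dots> = (\<integral>s. x t * (f s * \<Omega> s t * cnj (y (s + t))) \<partial>M)" by simp
    also have "\<dots> = (\<integral>s. B s t \<partial>M)"
      by (rule Bochner_Integration.integral_cong) (simp_all add: B_def ac_simps)
    finally show "(\<integral>s. B s t \<partial>M) = x t * cnj ((invol f \<circledast> y) t)" by simp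
  qed
  finally show ?thesis .
qed

end

section \<open>Unitization of a star-algebra with explicit carrier\<close>

context complex_star_algebra begin

abbreviation plus (infixl "\<boxplus>" 65) where "x \<boxplus> y \<equiv> aadd A x y"
abbreviation times (infixl "\<boxtimes>" 70) where "x \<boxtimes> y \<equiv> amult A x y"
abbreviation scale (infixr "\<odot>" 75) where "c \<odot> x \<equiv> ascale A c x"
abbreviation star where "star x \<equiv> astar A x"
abbreviation zero ("\<zero>") where "\<zero> \<equiv> azero A"
abbreviation carr where "carr \<equiv> acarrier A"

lemmas closed [simp, intro] = zero_closed add_closed scale_closed mult_closed star_closed

lemma add_left_commute:
  "x \<in> carr \<Longrightarrow> y \<in> carr \<Longrightarrow> z \<in> carr \<Longrightarrow> x \<boxplus> (y \<boxplus> z) = y \<boxplus> (x \<boxplus> z)"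
  by (metis add_assoc add_commute)

lemma zero_add: "x \<in> carr \<Longrightarrow> \<zero> \<boxplus> x = x"
  by (metis add_commute add_zero zero_closed)

lemma add_minus: "x \<in> carr \<Longrightarrow> x \<boxplus> (-1) \<odot> x = \<zero>"
  using diff_self by (simp add: adiff_def)

lemma minus_add: "x \<in> carr \<Longrightarrow> (-1) \<odot> x \<boxplus> x = \<zero>"
  by (metis add_commute add_minus scale_closed)

lemma add_minus_cancel: "x \<in> carr \<Longrightarrow> z \<in> carr \<Longrightarrow> x \<boxplus> ((-1) \<odot> x \<boxplus> z) = z"
  by (simp add: add_assoc[symmetric] add_minus zero_add)

lemma eq_of_diff_zero:
  assumes "x \<in> carr" "y \<in> carr" "adiff A x y = \<zero>" shows "x = y"
proof -
  have "x = x \<boxplus> ((-1) \<odot> y \<boxplus> y)" using assms(1,2) by (simp add: minus_add add_zero)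
  also have "\<dots> = adiff A x y \<boxplus> y" using assms(1,2) by (simp add: adiff_def add_assoc)
  also have "\<dots> = y" using assms by (simp add: zero_add)
  finally show ?thesis .
qed

lemma scale_0 [simp]: "x \<in> carr \<Longrightarrow> 0 \<odot> x = \<zero>"
  using scale_add_left[of x 1 "-1"] add_minus[of x] scale_one[of x] by simp

lemma scale_zero [simp]: "c \<odot> \<zero> = \<zero>"
proof -
  have "c \<odot> \<zero> = c \<odot> (0 \<odot> \<zero>)" by simp
  also have "\<dots> = \<zero>" unfolding scale_scale[OF zero_closed] by simp
  finally show ?thesis .
qed

lemma mult_zero [simp]: "x \<in> carr \<Longrightarrow> x \<boxtimes> \<zero> = \<zero>" "x \<in> carr \<Longrightarrow> \<zero> \<boxtimes> x = \<zero>"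
  using mult_scale_right[of x \<zero> 0] mult_scale_left[of \<zero> x 0] by simp_all

lemma star_zero [simp]: "star \<zero> = \<zero>"
  using star_scale[of \<zero> 0] by simp

lemmas expand = add_assoc add_commute add_left_commute mult_add_left mult_add_right mult_assoc
  mult_scale_left mult_scale_right scale_add_right scale_scale scale_one zero_add add_zero
  star_add star_scale star_mult star_star

lemma unitization_star_algebra: "complex_star_algebra (unitization A)"
proof (unfold_locales, goal_cases)
  case 1
  then show ?case by (simp add: unitization_def)
qed (auto simp: unitization_def adiff_def expand scale_add_left add_minus algebra_simps mult.commute)

definition uone :: "'b \<times> complex" where "uone = (\<zero>, 1)"

lemma uone_closed [simp]: "uone \<in> acarrier (unitization A)"
  by (simp add: uone_def unitization_def)

lemma uone_mult [simp]:
  "x \<in> acarrier (unitization A) \<Longrightarrow> amult (unitization A) uone x = x"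
  "x \<in> acarrier (unitization A) \<Longrightarrow> amult (unitization A) x uone = x"
  by (auto simp: uone_def unitization_def expand)

lemma uone_star [simp]: "astar (unitization A) uone = uone"
  by (simp add: uone_def unitization_def)

lemma aone_unitization: "aone (unitization A) = uone"
  unfolding aone_def
proof (rule the_equality)
  show "is_unit_of (unitization A) uone" by (simp add: is_unit_of_def)
  show "e = uone" if "is_unit_of (unitization A) e" for e
    using that unfolding is_unit_of_def by (metis uone_closed uone_mult(1))
qed

end

locale unital_complex_star_algebra = complex_star_algebra A for A :: "'b star_alg" +
  fixes one :: 'b ("\<one>")
  assumes one_closed [simp, intro]: "\<one> \<in> acarrier A"
    and one_left [simp]: "x \<in> acarrier A \<Longrightarrow> amult A \<one> x = x"
    and one_right [simp]: "x \<in> acarrier A \<Longrightarrow> amult A x \<one> = x"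
begin

definition linv :: "'b \<Rightarrow> bool" where
  "linv x \<longleftrightarrow> (\<exists>v\<in>carr. v \<boxtimes> x = \<one>)"

lemma linv_mult: "x \<in> carr \<Longrightarrow> y \<in> carr \<Longrightarrow> linv x \<Longrightarrow> linv y \<Longrightarrow> linv (x \<boxtimes> y)"
proof -
  assume x: "x \<in> carr" and y: "y \<in> carr" and "linv x" "linv y"
  then obtain v u where v: "v \<in> carr" "v \<boxtimes> x = \<one>" and u: "u \<in> carr" "u \<boxtimes> y = \<one>"
    by (auto simp: linv_def)
  have "(u \<boxtimes> v) \<boxtimes> (x \<boxtimes> y) = u \<boxtimes> ((v \<boxtimes> x) \<boxtimes> y)" using x y u(1) v(1) by (simp add: mult_assoc)
  then show ?thesis using x y u v by (auto simp: linv_def)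
qed

lemma linv_right_factor: "x \<in> carr \<Longrightarrow> y \<in> carr \<Longrightarrow> linv (x \<boxtimes> y) \<Longrightarrow> linv y"
  unfolding linv_def by (metis mult_assoc mult_closed)

lemma difference_of_squares:
  "x \<in> carr \<Longrightarrow> (\<one> \<boxplus> x) \<boxtimes> (\<one> \<boxplus> (-1) \<odot> x) = \<one> \<boxplus> (-1) \<odot> (x \<boxtimes> x)"
  by (simp add: mult_add_left mult_add_right add_assoc mult_scale_right scale_add_right add_minus_cancel)

lemma linv_sq:
  assumes x: "x \<in> carr" and l: "linv (\<one> \<boxplus> (-1) \<odot> (x \<boxtimes> x))"
  shows "linv (\<one> \<boxplus> (-1) \<odot> x)"
proof (rule linv_right_factor)
  show "linv ((\<one> \<boxplus> x) \<boxtimes> (\<one> \<boxplus> (-1) \<odot> x))" unfolding difference_of_squares[OF x] by (rule l)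
qed (use x in simp_all)

end

section \<open>A symmetry criterion\<close>

text \<open>If \<open>a k\<close> never dropped below \<open>\<eta>\<close>, then \<open>ln (a k) / 2 ^ k\<close> would be bounded below, while
  the recursion makes it decrease in each step by half of \<open>ln (1 / \<delta> k) / 2 ^ k\<close>, up to a
  summable error.\<close>

lemma doubling_recursion_becomes_small:
  fixes a \<delta> :: "nat \<Rightarrow> real"
  assumes \<eta>: "0 < \<eta>" and K: "0 < K" and a: "\<And>k. 0 \<le> a k"
    and \<delta>: "\<And>k. 0 < \<delta> k" "\<And>k. \<delta> k \<le> 1" and div: "\<not> summable (\<lambda>k. ln (1 / \<delta> k) / 2 ^ k)"
    and step: "\<And>k. \<eta> \<le> a k \<Longrightarrow> a (Suc k) \<le> K * \<delta> k * (a k)\<^sup>2"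
  shows "\<exists>k. a k < \<eta>"
proof (rule ccontr)
  assume "\<nexists>k. a k < \<eta>"
  then have big: "\<eta> \<le> a k" for k by (simp add: not_less)
  have pos: "0 < a k" for k using big[of k] \<eta> by linarith
  define l where "l k = ln (a k) / 2 ^ k" for k
  define x where "x k = ln (1 / \<delta> k) / 2 ^ k" for k
  have x0: "0 \<le> x k" for k using \<delta>[of k] by (simp add: x_def)
  have l_step: "x k \<le> 2 * (l k - l (Suc k)) + \<bar>ln K\<bar> * (1/2) ^ k" for k
  proof -
    have "ln (a (Suc k)) \<le> ln (K * \<delta> k * (a k)\<^sup>2)"
      using step[OF big[of k]] pos \<delta>(1)[of k] K
      by (subst ln_le_cancel_iff) (auto intro!: mult_pos_pos zero_less_power)
    also have "\<dots> = ln K - ln (1 / \<delta> k) + 2 * ln (a k)"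
      using pos[of k] \<delta>(1)[of k] K by (simp add: ln_mult ln_div ln_realpow)
    finally have "ln (1 / \<delta> k) \<le> 2 * ln (a k) - ln (a (Suc k)) + \<bar>ln K\<bar>" by linarith
    then have "x k \<le> (2 * ln (a k) - ln (a (Suc k)) + \<bar>ln K\<bar>) / 2 ^ k"
      unfolding x_def by (rule divide_right_mono) simp
    also have "\<dots> = 2 * (l k - l (Suc k)) + \<bar>ln K\<bar> * (1/2) ^ k"
      by (simp add: l_def add_divide_distrib diff_divide_distrib power_divide)
    finally show ?thesis .
  qed
  have sum_le: "(\<Sum>k<n. x k) \<le> 2 * (l 0 - l n) + 2 * \<bar>ln K\<bar>" for n
  proof -
    have "(\<Sum>k<n. x k) \<le> (\<Sum>k<n. 2 * (l k - l (Suc k)) + \<bar>ln K\<bar> * (1/2) ^ k)"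
      by (intro sum_mono l_step)
    also have "\<dots> = 2 * (l 0 - l n) + \<bar>ln K\<bar> * (\<Sum>k<n. (1/2) ^ k)"
      by (simp only: sum.distrib sum_distrib_left[symmetric] sum_lessThan_telescope')
    also have "\<dots> \<le> 2 * (l 0 - l n) + \<bar>ln K\<bar> * 2"
    proof -
      have "(\<Sum>k<n. (1/2::real) ^ k) = 2 - 2 * (1/2) ^ n" by (induction n) auto
      also have "\<dots> \<le> 2" by simp
      finally show ?thesis by (intro add_left_mono mult_left_mono) auto
    qed
    finally show ?thesis by simp
  qed
  have l_lower: "- \<bar>ln \<eta>\<bar> \<le> l n" for n
  proof -
    have "ln \<eta> \<le> ln (a n)" using big[of n] \<eta> pos by simp
    then have "- \<bar>ln \<eta>\<bar> \<le> ln (a n)" by linarith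
    then have "- \<bar>ln \<eta>\<bar> / 2 ^ n \<le> l n" unfolding l_def by (rule divide_right_mono) simp
    moreover have "\<bar>ln \<eta>\<bar> / 2 ^ n \<le> \<bar>ln \<eta>\<bar> / 1" by (intro divide_left_mono) auto
    ultimately show ?thesis by simp
  qed
  have "summable x"
  proof (rule bounded_imp_summable)
    fix n
    have "(\<Sum>k\<le>n. x k) = (\<Sum>k<Suc n. x k)" by (simp add: lessThan_Suc_atMost)
    also have "\<dots> \<le> 2 * (l 0 - l (Suc n)) + 2 * \<bar>ln K\<bar>" by (rule sum_le)
    also have "\<dots> \<le> 2 * (l 0 + \<bar>ln \<eta>\<bar>) + 2 * \<bar>ln K\<bar>" using l_lower[of "Suc n"] by simp
    finally show "(\<Sum>k\<le>n. x k) \<le> 2 * (l 0 + \<bar>ln \<eta>\<bar>) + 2 * \<bar>ln K\<bar>" .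
  qed (rule x0)
  then show False using div by (simp add: x_def[abs_def])
qed

context banach_star_algebra begin

abbreviation nrm where "nrm x \<equiv> anorm A x"

lemma norm_diff_add: "x \<in> carr \<Longrightarrow> y \<in> carr \<Longrightarrow> z \<in> carr \<Longrightarrow>
  nrm (adiff A x z) \<le> nrm (adiff A x y) + nrm (adiff A y z)"
proof -
  assume *: "x \<in> carr" "y \<in> carr" "z \<in> carr"
  have "adiff A x z = adiff A x y \<boxplus> adiff A y z"
  proof -
    have "adiff A x y \<boxplus> adiff A y z = x \<boxplus> (((-1) \<odot> y \<boxplus> y) \<boxplus> (-1) \<odot> z)"
      using * by (simp add: adiff_def add_assoc)
    then show ?thesis using * by (simp add: minus_add zero_add adiff_def)
  qed
  then show ?thesis using norm_triangle[of "adiff A x y" "adiff A y z"] * by (simp add: adiff_def)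
qed

lemma norm_diff_commute: "x \<in> carr \<Longrightarrow> y \<in> carr \<Longrightarrow> nrm (adiff A x y) = nrm (adiff A y x)"
proof -
  assume *: "x \<in> carr" "y \<in> carr"
  have "adiff A x y = (-1) \<odot> adiff A y x"
    using * by (simp add: adiff_def scale_add_right scale_scale scale_one add_commute)
  then show ?thesis using * norm_scale[of "adiff A y x" "-1"] by (simp add: adiff_def)
qed

text \<open>The equation \<open>(s, 1 / c) (c - h) = 1\<close> reads \<open>c s = s h + h / c\<close>. Since the norm is
  submultiplicative only up to the constant \<open>K\<close>, it is solved as a fixed point of a map that
  contracts by \<open>K \<parallel>h\<parallel> / \<bar>c\<bar>\<close>, instead of by summing powers of \<open>h\<close>.\<close>

lemma neumann_left_inverse:
  assumes K: "0 < K" "\<And>x y. x \<in> carr \<Longrightarrow> y \<in> carr \<Longrightarrow> nrm (x \<boxtimes> y) \<le> K * nrm x * nrm y"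
    and h: "h \<in> carr" and small: "K * nrm h < cmod c"
  shows "\<exists>s\<in>carr. amult (unitization A) (s, 1 / c) ((-1) \<odot> h, c) = uone"
proof -
  have "0 \<le> K * nrm h" using K(1) norm_nonneg[OF h] by simp
  then have c0: "c \<noteq> 0" using small by auto
  define f where "f s = (1 / c) \<odot> (s \<boxtimes> h \<boxplus> (1 / c) \<odot> h)" for s
  define q where "q = K * nrm h / cmod c"
  have q: "0 \<le> q" "q < 1" using K(1) norm_nonneg[OF h] small c0 by (auto simp: q_def)
  have f_closed: "f s \<in> carr" if "s \<in> carr" for s using that h by (simp add: f_def)
  have f_diff: "nrm (adiff A (f s) (f t)) \<le> q * nrm (adiff A s t)" if s: "s \<in> carr" and t: "t \<in> carr" for s t
  proof -
    define k where "k = (1 / c) \<odot> h"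
    have k: "k \<in> carr" using h by (simp add: k_def)
    have "adiff A (f s) (f t) = (1 / c) \<odot> ((s \<boxtimes> h \<boxplus> k) \<boxplus> (-1) \<odot> (t \<boxtimes> h \<boxplus> k))"
      using s t h k by (simp add: f_def k_def[symmetric] adiff_def scale_add_right scale_scale mult.commute)
    also have "(s \<boxtimes> h \<boxplus> k) \<boxplus> (-1) \<odot> (t \<boxtimes> h \<boxplus> k) = s \<boxtimes> h \<boxplus> ((-1) \<odot> (t \<boxtimes> h) \<boxplus> (k \<boxplus> (-1) \<odot> k))"
      using s t h k by (simp add: scale_add_right expand)
    also have "\<dots> = (adiff A s t) \<boxtimes> h"
      using s t h k by (simp add: add_minus add_zero adiff_def mult_add_left mult_scale_left)
    finally have eq: "adiff A (f s) (f t) = (1 / c) \<odot> (adiff A s t \<boxtimes> h)" .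
    have st: "adiff A s t \<in> carr" using s t by (simp add: adiff_def)
    have "nrm (adiff A (f s) (f t)) = 1 / cmod c * nrm (adiff A s t \<boxtimes> h)"
      unfolding eq using st h by (subst norm_scale) (auto simp: norm_divide)
    also have "\<dots> \<le> 1 / cmod c * (K * nrm (adiff A s t) * nrm h)"
      using st h by (intro mult_left_mono K) auto
    also have "\<dots> = q * nrm (adiff A s t)" by (simp add: q_def)
    finally show ?thesis .
  qed
  define X where "X n = (f ^^ n) \<zero>" for n
  have X: "X n \<in> carr" for n by (induction n) (auto simp: X_def f_closed)
  have X_Suc: "X (Suc n) = f (X n)" for n by (simp add: X_def)
  define D where "D = nrm (adiff A (X 1) (X 0))"
  have D: "0 \<le> D" using X by (simp add: D_def adiff_def norm_nonneg)
  have step: "nrm (adiff A (X (Suc n)) (X n)) \<le> q ^ n * D" for n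
  proof (induction n)
    case (Suc n)
    have "nrm (adiff A (X (Suc (Suc n))) (X (Suc n))) \<le> q * nrm (adiff A (X (Suc n)) (X n))"
      using f_diff[OF X X, of "Suc n" n] unfolding X_Suc .
    also have "\<dots> \<le> q * (q ^ n * D)" using q by (intro mult_left_mono Suc)
    finally show ?case by simp
  qed (simp add: D_def)
  have dist: "nrm (adiff A (X (n + k)) (X n)) \<le> q ^ n * D / (1 - q)" for n k
  proof -
    have "nrm (adiff A (X (n + k)) (X n)) \<le> (\<Sum>i<k. q ^ (n + i) * D)"
    proof (induction k)
      case 0
      have "adiff A (X n) (X n) = \<zero>" using X by (rule diff_self)
      then show ?case using norm_eq_zero[of \<zero>] by simp
    next
      case (Suc k)
      have "nrm (adiff A (X (n + Suc k)) (X n))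
          \<le> nrm (adiff A (X (Suc (n + k))) (X (n + k))) + nrm (adiff A (X (n + k)) (X n))"
        using norm_diff_add[OF X X X] by simp
      also have "\<dots> \<le> q ^ (n + k) * D + (\<Sum>i<k. q ^ (n + i) * D)" by (intro add_mono step Suc)
      finally show ?case by simp
    qed
    also have "\<dots> = q ^ n * D * (\<Sum>i<k. q ^ i)" by (simp add: power_add sum_distrib_left ac_simps)
    also have "\<dots> \<le> q ^ n * D * (1 / (1 - q))"
    proof (rule mult_left_mono)
      have "(\<Sum>i<k. q ^ i) * (1 - q) = 1 - q ^ k"
        by (simp add: one_diff_power_eq mult.commute)
      also have "\<dots> \<le> 1" using q by simp
      finally show "(\<Sum>i<k. q ^ i) \<le> 1 / (1 - q)" using q by (simp add: pos_le_divide_eq)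
    qed (use D q in simp)
    finally show ?thesis by simp
  qed
  have lim0: "(\<lambda>n. q ^ n * D / (1 - q)) \<longlonglongrightarrow> 0"
    using q by (intro tendsto_divide_zero tendsto_mult_left_zero LIMSEQ_power_zero) auto
  have "\<exists>x\<in>carr. (\<lambda>n. nrm (adiff A (X n) x)) \<longlonglongrightarrow> 0"
  proof (rule complete[OF X])
    fix e :: real assume "0 < e"
    then obtain N where N: "\<And>n. N \<le> n \<Longrightarrow> q ^ n * D / (1 - q) < e"
      using order_tendstoD(2)[OF lim0] by (auto simp: eventually_sequentially)
    have "nrm (adiff A (X m) (X n)) < e" if "m \<ge> N" "n \<ge> N" for m n
    proof (cases "n \<le> m")
      case True
      then show ?thesis using dist[of n "m - n"] N[OF that(2)] by simp
    next
      case False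
      then show ?thesis using dist[of m "n - m"] N[OF that(1)] norm_diff_commute[OF X X, of m n] by simp
    qed
    then show "\<exists>N. \<forall>m\<ge>N. \<forall>n\<ge>N. nrm (adiff A (X m) (X n)) < e" by blast
  qed
  then obtain s where s: "s \<in> carr" "(\<lambda>n. nrm (adiff A (X n) s)) \<longlonglongrightarrow> 0" by blast
  have "nrm (adiff A (f s) s) \<le> q * nrm (adiff A (X n) s) + nrm (adiff A (X (Suc n)) s)" for n
  proof -
    have "nrm (adiff A (f s) s) \<le> nrm (adiff A (f s) (X (Suc n))) + nrm (adiff A (X (Suc n)) s)"
      using s X f_closed by (intro norm_diff_add) auto
    also have "nrm (adiff A (f s) (X (Suc n))) \<le> q * nrm (adiff A s (X n))"
      unfolding X_Suc using s X by (intro f_diff) auto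
    also have "nrm (adiff A s (X n)) = nrm (adiff A (X n) s)"
      using s X by (intro norm_diff_commute) auto
    finally show ?thesis by simp
  qed
  moreover have "(\<lambda>n. q * nrm (adiff A (X n) s) + nrm (adiff A (X (Suc n)) s)) \<longlonglongrightarrow> q * 0 + 0"
    using s(2) by (intro tendsto_intros LIMSEQ_Suc)
  ultimately have "nrm (adiff A (f s) s) \<le> q * 0 + 0"
    by (intro LIMSEQ_le_const) auto
  then have "nrm (adiff A (f s) s) = 0"
    using norm_nonneg[of "adiff A (f s) s"] s(1) f_closed by (simp add: adiff_def)
  then have "adiff A (f s) s = \<zero>"
    using norm_eq_zero[of "adiff A (f s) s"] s(1) f_closed by (simp add: adiff_def)
  then have "f s = s" by (rule eq_of_diff_zero[OF f_closed[OF s(1)] s(1)])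
  have "c \<odot> f s = s \<boxtimes> h \<boxplus> (1 / c) \<odot> h"
    using s h c0 by (simp add: f_def scale_scale scale_one)
  then have cs: "c \<odot> s = s \<boxtimes> h \<boxplus> (1 / c) \<odot> h" unfolding \<open>f s = s\<close> .
  have "s \<boxtimes> ((-1) \<odot> h) \<boxplus> ((1 / c) \<odot> ((-1) \<odot> h) \<boxplus> c \<odot> s) = (-1) \<odot> (s \<boxtimes> h \<boxplus> (1 / c) \<odot> h) \<boxplus> (s \<boxtimes> h \<boxplus> (1 / c) \<odot> h)"
    using s h by (simp only: cs) (simp add: mult_scale_right scale_add_right scale_scale add_assoc mult.commute)
  also have "\<dots> = \<zero>" using s h by (intro minus_add) auto
  finally show ?thesis using s c0 by (intro bexI[of _ s]) (auto simp: unitization_def uone_def)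
qed

end

text \<open>The abstract situation in which symmetry holds: a left ideal \<open>I\<close> with an inner product on
  which the algebra acts by bounded operators compatible with the involution. Condition
  \<open>spread_mult\<close> bounds the norm of a square by the Hilbert space norm, at the price \<open>exp (\<kappa> 2 ^
  n)\<close>, plus a small multiple \<open>\<delta> n\<close> of the usual quadratic bound. Condition \<open>approx\<close> replaces
  density of \<open>I\<close>, which may fail in norms that are not absolutely continuous: only the product
  of the remainder with its adjoint has to be small.\<close>

locale spread_star_algebra = banach_star_algebra A for A :: "'b star_alg" +
  fixes I :: "'b set" and ip :: "'b \<Rightarrow> 'b \<Rightarrow> complex"
  assumes I_carrier: "x \<in> I \<Longrightarrow> x \<in> acarrier A"
    and I_add: "x \<in> I \<Longrightarrow> y \<in> I \<Longrightarrow> aadd A x y \<in> I"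
    and I_scale: "x \<in> I \<Longrightarrow> ascale A c x \<in> I"
    and I_mult: "a \<in> acarrier A \<Longrightarrow> x \<in> I \<Longrightarrow> amult A a x \<in> I"
    and I_star: "x \<in> I \<Longrightarrow> astar A x \<in> I"
    and ip_add: "x \<in> I \<Longrightarrow> y \<in> I \<Longrightarrow> z \<in> I \<Longrightarrow> ip (aadd A x y) z = ip x z + ip y z"
    and ip_scale: "x \<in> I \<Longrightarrow> y \<in> I \<Longrightarrow> ip (ascale A c x) y = c * ip x y"
    and ip_cnj: "x \<in> I \<Longrightarrow> y \<in> I \<Longrightarrow> ip y x = cnj (ip x y)"
    and ip_nonneg: "x \<in> I \<Longrightarrow> 0 \<le> Re (ip x x)"
    and ip_mult: "a \<in> acarrier A \<Longrightarrow> x \<in> I \<Longrightarrow> y \<in> I \<Longrightarrow>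
        ip (amult A a x) y = ip x (amult A (astar A a) y)"
    and ip_bounded: "a \<in> acarrier A \<Longrightarrow>
        \<exists>B. \<forall>x\<in>I. Re (ip (amult A a x) (amult A a x)) \<le> B * Re (ip x x)"
    and spread_mult: "0 < \<kappa> \<Longrightarrow> \<exists>\<delta> K. (\<forall>n. exp (- \<kappa> * 2 ^ n) \<le> \<delta> n \<and> \<delta> n \<le> 1) \<and>
        \<not> summable (\<lambda>n. ln (1 / \<delta> n) / 2 ^ n) \<and> 0 < K \<and>
        (\<forall>n. \<forall>x\<in>I. anorm A (amult A x x) \<le>
           K * anorm A x * (exp (\<kappa> * 2 ^ n) * sqrt (Re (ip x x)) + \<delta> n * anorm A x))"
    and approx: "a \<in> acarrier A \<Longrightarrow> 0 < e \<Longrightarrow>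
        \<exists>g\<in>I. anorm A (amult A (astar A (adiff A a g)) (adiff A a g)) < e"
begin

definition sqnorm :: "'b \<Rightarrow> real" where "sqnorm x = Re (ip x x)"

lemma ip_add_right: "x \<in> I \<Longrightarrow> y \<in> I \<Longrightarrow> z \<in> I \<Longrightarrow> ip z (x \<boxplus> y) = ip z x + ip z y"
  using ip_cnj[of z "x \<boxplus> y"] ip_cnj[of z x] ip_cnj[of z y] ip_add[of x y z]
  by (metis I_add complex_cnj_add complex_cnj_cnj)

lemma ip_scale_right: "x \<in> I \<Longrightarrow> y \<in> I \<Longrightarrow> ip x (c \<odot> y) = cnj c * ip x y"
  using ip_cnj[of x "c \<odot> y"] ip_cnj[of x y] ip_scale[of y x c]
  by (metis I_scale complex_cnj_cnj complex_cnj_mult)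

lemma sqnorm_nonneg: "x \<in> I \<Longrightarrow> 0 \<le> sqnorm x"
  by (simp add: sqnorm_def ip_nonneg)

lemma ip_self: "x \<in> I \<Longrightarrow> ip x x = complex_of_real (sqnorm x)"
proof -
  assume "x \<in> I"
  then have "ip x x = cnj (ip x x)" by (intro ip_cnj)
  then have "Im (ip x x) = 0" by (metis cnj.simps(2) equal_neg_zero)
  then show ?thesis by (simp add: sqnorm_def complex_eq_iff)
qed

lemma sqnorm_scale: "x \<in> I \<Longrightarrow> sqnorm (c \<odot> x) = (cmod c)\<^sup>2 * sqnorm x"
proof -
  assume x: "x \<in> I"
  have "ip (c \<odot> x) (c \<odot> x) = (c * cnj c) * ip x x"
    using x by (simp add: ip_scale ip_scale_right I_scale)
  also have "\<dots> = complex_of_real ((cmod c)\<^sup>2 * sqnorm x)"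
    using x by (simp add: complex_norm_square[symmetric] ip_self)
  finally show ?thesis by (simp add: sqnorm_def)
qed

lemma sqnorm_add: "x \<in> I \<Longrightarrow> y \<in> I \<Longrightarrow> sqnorm (x \<boxplus> y) = sqnorm x + 2 * Re (ip x y) + sqnorm y"
proof -
  assume xy: "x \<in> I" "y \<in> I"
  have "Re (ip y x) = Re (ip x y)" using ip_cnj[OF xy] by simp
  then show ?thesis using xy by (simp add: sqnorm_def ip_add ip_add_right I_add)
qed

lemma sqnorm_add_le: "x \<in> I \<Longrightarrow> y \<in> I \<Longrightarrow> sqnorm (x \<boxplus> y) \<le> 2 * sqnorm x + 2 * sqnorm y"
proof -
  assume xy: "x \<in> I" "y \<in> I"
  have "0 \<le> sqnorm (x \<boxplus> (-1) \<odot> y)" using xy by (intro sqnorm_nonneg I_add I_scale)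
  also have "\<dots> = sqnorm x - 2 * Re (ip x y) + sqnorm y"
    using xy by (simp add: sqnorm_add I_scale ip_scale_right sqnorm_scale)
  finally show ?thesis using xy by (simp add: sqnorm_add)
qed

abbreviation umult where "umult \<equiv> amult (unitization A)"
abbreviation ustar where "ustar \<equiv> astar (unitization A)"
abbreviation ucarr where "ucarr \<equiv> acarrier (unitization A)"

definition act :: "'b \<times> complex \<Rightarrow> 'b \<Rightarrow> 'b" where
  "act X x = fst X \<boxtimes> x \<boxplus> snd X \<odot> x"

lemma ucarr_iff: "X \<in> ucarr \<longleftrightarrow> fst X \<in> carr"
  by (cases X) (simp add: unitization_def)

lemma act_closed: "X \<in> ucarr \<Longrightarrow> x \<in> I \<Longrightarrow> act X x \<in> I"
  by (simp add: act_def ucarr_iff I_add I_mult I_scale)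

lemma act_umult: "X \<in> ucarr \<Longrightarrow> Y \<in> ucarr \<Longrightarrow> x \<in> I \<Longrightarrow> act (umult X Y) x = act X (act Y x)"
  using I_carrier[of x]
  by (cases X; cases Y) (simp add: act_def unitization_def expand scale_add_left)

lemma ip_act: "X \<in> ucarr \<Longrightarrow> x \<in> I \<Longrightarrow> y \<in> I \<Longrightarrow> ip (act X x) y = ip x (act (ustar X) y)"
  by (cases X)
    (simp add: act_def unitization_def ip_add ip_add_right ip_mult ip_scale ip_scale_right I_mult I_scale)

lemma sqnorm_act_bounded:
  assumes X: "X \<in> ucarr" shows "\<exists>B\<ge>1. \<forall>x\<in>I. sqnorm (act X x) \<le> B * sqnorm x"
proof -
  obtain B where B: "\<And>x. x \<in> I \<Longrightarrow> sqnorm (fst X \<boxtimes> x) \<le> B * sqnorm x"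
    using ip_bounded[of "fst X"] X by (auto simp: ucarr_iff sqnorm_def)
  define B' where "B' = max 1 (2 * B + 2 * (cmod (snd X))\<^sup>2)"
  have "sqnorm (act X x) \<le> B' * sqnorm x" if x: "x \<in> I" for x
  proof -
    have "sqnorm (act X x) \<le> 2 * sqnorm (fst X \<boxtimes> x) + 2 * sqnorm (snd X \<odot> x)"
      unfolding act_def using X x by (intro sqnorm_add_le I_mult I_scale) (auto simp: ucarr_iff)
    also have "\<dots> \<le> (2 * B + 2 * (cmod (snd X))\<^sup>2) * sqnorm x"
      using B[OF x] sqnorm_scale[OF x, of "snd X"] by (simp add: algebra_simps)
    also have "\<dots> \<le> B' * sqnorm x" using sqnorm_nonneg[OF x] by (intro mult_right_mono) (auto simp: B'_def)
    finally show ?thesis .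
  qed
  then show ?thesis by (intro exI[of _ B']) (auto simp: B'_def)
qed

text \<open>Left invertibility of \<open>S = 1 + y\<close> in the algebra follows from a lower bound in the Hilbert
  space. Repeated squaring of \<open>z = 1 - t S\<close> is carried out in the unitization, with \<open>Y k\<close> the
  component in \<open>I\<close> and \<open>c ^ 2 ^ k\<close> the scalar component. The operator norm of \<open>z\<close> on \<open>I\<close> being
  less than \<open>1\<close>, \<open>spread_mult\<close> with the scale \<open>2 ^ k\<close> turns the decay in the Hilbert space into
  the recursion of \<open>doubling_recursion_becomes_small\<close>.\<close>

lemma linv_of_bounded_below:
  assumes y: "y \<in> I" and \<delta>: "0 < \<delta>"
    and below: "\<And>x. x \<in> I \<Longrightarrow> \<delta> * sqnorm x \<le> Re (ip (act (y, 1) x) x)"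
  shows "\<exists>V\<in>ucarr. umult V (y, 1) = uone"
proof -
  interpret U: unital_complex_star_algebra "unitization A" uone
    by (intro unital_complex_star_algebra.intro unital_complex_star_algebra_axioms.intro
        unitization_star_algebra) auto
  have y1: "(y, 1) \<in> ucarr" using y by (simp add: ucarr_iff I_carrier)
  obtain B where B: "1 \<le> B" "\<And>x. x \<in> I \<Longrightarrow> sqnorm (act (y, 1) x) \<le> B * sqnorm x"
    using sqnorm_act_bounded[OF y1] by blast
  define d where "d = min \<delta> (1 / 2)"
  have d: "0 < d" "d \<le> 1 / 2" "d \<le> \<delta>" using \<delta> by (auto simp: d_def)
  \<comment> \<open>\<open>\<parallel>(1 - t S) x\<parallel>\<^sup>2 \<le> (1 - 2 t d + t\<^sup>2 B) \<parallel>x\<parallel>\<^sup>2\<close>, and this choice of \<open>t\<close> makes the factor \<open>1 - d t\<close>.\<close>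
  define t where "t = d / B"
  have t: "0 < t" "t \<le> 1 / 2"
  proof -
    show "0 < t" using d B by (simp add: t_def)
    have "d / B \<le> d / 1" using d B by (intro divide_left_mono) auto
    then have "d / B \<le> 1 / 2" using d(2) by (simp only: div_by_1)
    then show "t \<le> 1 / 2" by (simp only: t_def)
  qed
  define \<rho> where "\<rho> = 1 - d * t"
  have dt: "0 < d * t" "d * t \<le> 1 / 4"
    using d t mult_mono[of d "1/2" t "1/2"] by auto
  have below': "d * sqnorm x \<le> Re (ip (act (y, 1) x) x)" if "x \<in> I" for x
    using below[OF that] d sqnorm_nonneg[OF that] mult_right_mono[of d \<delta> "sqnorm x"] by linarith
  define c where "c = 1 - t"
  define z where "z = (complex_of_real (- t) \<odot> y, complex_of_real c)"
  have z: "z \<in> ucarr" using y by (simp add: z_def ucarr_iff I_carrier)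
  have z_contract: "sqnorm (act z x) \<le> \<rho> * sqnorm x" if x: "x \<in> I" for x
  proof -
    let ?S = "act (y, 1) x"
    have S: "?S \<in> I" using act_closed[OF y1 x] .
    have xc: "x \<in> carr" "y \<in> carr" using x y I_carrier by auto
    have "x \<boxplus> complex_of_real (- t) \<odot> ?S
        = complex_of_real (- t) \<odot> (y \<boxtimes> x) \<boxplus> (1 \<odot> x \<boxplus> complex_of_real (- t) \<odot> x)"
      using xc by (simp add: act_def expand)
    also have "1 \<odot> x \<boxplus> complex_of_real (- t) \<odot> x = (1 + complex_of_real (- t)) \<odot> x"
      by (rule scale_add_left[OF xc(1), symmetric])
    finally have "act z x = x \<boxplus> complex_of_real (- t) \<odot> ?S"
      using xc by (simp add: act_def z_def c_def mult_scale_left)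
    then have "sqnorm (act z x) = sqnorm x - 2 * t * Re (ip ?S x) + t\<^sup>2 * sqnorm ?S"
      using x S ip_cnj[of ?S x] by (simp add: sqnorm_add sqnorm_scale I_scale ip_scale_right)
    also have "\<dots> \<le> sqnorm x - 2 * t * (d * sqnorm x) + t\<^sup>2 * (B * sqnorm x)"
      using below'[OF x] B(2)[OF x] t by (intro add_mono diff_mono mult_left_mono) auto
    also have "t\<^sup>2 * (B * sqnorm x) = t * d * sqnorm x" using B by (simp add: t_def power2_eq_square)
    finally show ?thesis by (simp add: \<rho>_def algebra_simps)
  qed
  \<comment> \<open>\<open>m < 1\<close> dominates both the operator norm of \<open>z\<close> on \<open>I\<close> and its scalar component \<open>c\<close>.\<close>
  define m where "m = sqrt (max \<rho> (c\<^sup>2))"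
  have c01: "0 < c" "c < 1" using t by (auto simp: c_def)
  have m2: "m\<^sup>2 = max \<rho> (c\<^sup>2)" using dt by (simp add: m_def \<rho>_def le_max_iff_disj)
  have m: "0 < m" "m < 1" "c \<le> m" "\<rho> \<le> m\<^sup>2"
  proof -
    show "0 < m" using dt by (auto simp: m_def \<rho>_def less_max_iff_disj)
    have "c\<^sup>2 < 1" using c01 by (simp add: power_less_one_iff abs_square_less_1)
    then show "m < 1" using dt by (simp add: m_def \<rho>_def)
    show "c \<le> m" unfolding m_def using c01 by (intro real_le_rsqrt) auto
    show "\<rho> \<le> m\<^sup>2" by (simp add: m2)
  qed
  define Z where "Z = rec_nat z (\<lambda>_ X. umult X X)"
  have Z_0: "Z 0 = z" and Z_Suc: "Z (Suc k) = umult (Z k) (Z k)" for k by (simp_all add: Z_def)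
  have Z_carr: "Z k \<in> ucarr" for k
  proof (induction k)
    case (Suc k)
    then show ?case by (simp add: Z_Suc)
  qed (simp add: Z_0 z)
  define Y where "Y k = fst (Z k)" for k
  have snd_Z: "snd (Z k) = complex_of_real (c ^ 2 ^ k)" for k
  proof (induction k)
    case (Suc k)
    have "snd (Z (Suc k)) = snd (Z k) * snd (Z k)"
      by (simp add: Z_Suc unitization_def case_prod_unfold)
    also have "\<dots> = complex_of_real (c ^ 2 ^ k * c ^ 2 ^ k)" by (simp only: Suc of_real_mult)
    finally show ?case by (simp only: power_add[symmetric] mult_2[symmetric] power_Suc)
  qed (simp add: Z_0 z_def)
  have Y_Suc: "Y (Suc k) = Y k \<boxtimes> Y k \<boxplus> (snd (Z k) \<odot> Y k \<boxplus> snd (Z k) \<odot> Y k)" for k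
    by (simp add: Y_def Z_Suc unitization_def case_prod_unfold)
  have Y_I: "Y k \<in> I" for k
  proof (induction k)
    case 0
    then show ?case using y by (simp add: Y_def Z_0 z_def I_scale)
  next
    case (Suc k)
    then show ?case by (simp add: Y_Suc I_add I_mult I_scale I_carrier)
  qed
  have Y_carr: "Y k \<in> carr" for k using Y_I I_carrier by blast
  have Z_contract: "sqnorm (act (Z k) x) \<le> (m\<^sup>2) ^ 2 ^ k * sqnorm x" if "x \<in> I" for x k
    using that
  proof (induction k arbitrary: x)
    case 0
    have "\<rho> * sqnorm x \<le> m\<^sup>2 * sqnorm x" using m 0 sqnorm_nonneg by (intro mult_right_mono) auto
    then show ?case using z_contract[OF 0] by (simp add: Z_0)
  next
    case (Suc k)
    have "sqnorm (act (Z (Suc k)) x) = sqnorm (act (Z k) (act (Z k) x))"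
      using Z_carr Suc.prems by (simp add: Z_Suc act_umult)
    also have "\<dots> \<le> (m\<^sup>2) ^ 2 ^ k * sqnorm (act (Z k) x)"
      using Z_carr Suc.prems by (intro Suc.IH act_closed)
    also have "\<dots> \<le> (m\<^sup>2) ^ 2 ^ k * ((m\<^sup>2) ^ 2 ^ k * sqnorm x)"
      using m Suc by (intro mult_left_mono) auto
    also have "\<dots> = (m\<^sup>2) ^ 2 ^ Suc k * sqnorm x"
      by (simp only: mult.assoc[symmetric] power_add[symmetric] mult_2[symmetric] power_Suc)
    finally show ?case .
  qed
  have c_le: "c ^ 2 ^ k \<le> m ^ 2 ^ k" for k using c01 m by (intro power_mono) auto
  have sqnorm_Y_Suc: "sqnorm (Y (Suc k)) \<le> 4 * (m\<^sup>2) ^ 2 ^ k * sqnorm (Y k)" for k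
  proof -
    let ?c = "snd (Z k)"
    have "Y (Suc k) = act (Z k) (Y k) \<boxplus> ?c \<odot> Y k"
      using Y_carr[of k] by (simp add: Y_Suc act_def Y_def[symmetric] add_assoc)
    then have "sqnorm (Y (Suc k)) \<le> 2 * sqnorm (act (Z k) (Y k)) + 2 * sqnorm (?c \<odot> Y k)"
      using Y_I Z_carr by (auto intro!: sqnorm_add_le act_closed I_scale)
    moreover have "sqnorm (act (Z k) (Y k)) \<le> (m\<^sup>2) ^ 2 ^ k * sqnorm (Y k)" by (rule Z_contract[OF Y_I])
    moreover have "sqnorm (?c \<odot> Y k) \<le> (m\<^sup>2) ^ 2 ^ k * sqnorm (Y k)"
    proof -
      have "(cmod ?c)\<^sup>2 \<le> (m ^ 2 ^ k)\<^sup>2" unfolding snd_Z norm_of_real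
        using c01 c_le[of k] by (intro power_mono) auto
      also have "\<dots> = (m\<^sup>2) ^ 2 ^ k" by (simp only: power_mult[symmetric] mult.commute)
      finally show ?thesis using Y_I sqnorm_nonneg[OF Y_I] by (simp add: sqnorm_scale mult_right_mono)
    qed
    ultimately show ?thesis by linarith
  qed
  have sqnorm_Y: "m\<^sup>2 * sqnorm (Y k) \<le> 4 ^ k * (m\<^sup>2) ^ 2 ^ k * sqnorm (Y 0)" for k
  proof (induction k)
    case (Suc k)
    have "m\<^sup>2 * sqnorm (Y (Suc k)) \<le> m\<^sup>2 * (4 * (m\<^sup>2) ^ 2 ^ k * sqnorm (Y k))"
      by (intro mult_left_mono sqnorm_Y_Suc) simp
    also have "\<dots> = 4 * (m\<^sup>2) ^ 2 ^ k * (m\<^sup>2 * sqnorm (Y k))" by simp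
    also have "\<dots> \<le> 4 * (m\<^sup>2) ^ 2 ^ k * (4 ^ k * (m\<^sup>2) ^ 2 ^ k * sqnorm (Y 0))"
      by (intro mult_left_mono Suc) simp
    also have "\<dots> = 4 ^ Suc k * ((m\<^sup>2) ^ 2 ^ k * (m\<^sup>2) ^ 2 ^ k) * sqnorm (Y 0)" by simp
    also have "(m\<^sup>2) ^ 2 ^ k * (m\<^sup>2) ^ 2 ^ k = (m\<^sup>2) ^ 2 ^ Suc k"
      by (simp only: power_add[symmetric] mult_2[symmetric] power_Suc)
    finally show ?case .
  qed simp
  define \<beta> where "\<beta> = sqrt (sqnorm (Y 0)) / m"
  have \<beta>: "0 \<le> \<beta>" using m sqnorm_nonneg[OF Y_I] by (simp add: \<beta>_def)
  have root_Y: "sqrt (sqnorm (Y k)) \<le> 2 ^ k * m ^ 2 ^ k * \<beta>" for k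
  proof (rule real_le_lsqrt)
    have "m\<^sup>2 * (2 ^ k * m ^ 2 ^ k * \<beta>)\<^sup>2 = 4 ^ k * (m\<^sup>2) ^ 2 ^ k * sqnorm (Y 0)"
    proof -
      have "\<beta>\<^sup>2 * m\<^sup>2 = sqnorm (Y 0)" using m sqnorm_nonneg[OF Y_I[of 0]] by (simp add: \<beta>_def power_divide)
      moreover have "((2::real) ^ k)\<^sup>2 = 4 ^ k" by (simp add: power2_eq_square power_mult_distrib[symmetric])
      moreover have "(m ^ 2 ^ k)\<^sup>2 = (m\<^sup>2) ^ 2 ^ k" by (simp only: power_mult[symmetric] mult.commute)
      ultimately show ?thesis by (simp add: power_mult_distrib ac_simps)
    qed
    then have "m\<^sup>2 * sqnorm (Y k) \<le> m\<^sup>2 * (2 ^ k * m ^ 2 ^ k * \<beta>)\<^sup>2" using sqnorm_Y[of k] by simp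
    then show "sqnorm (Y k) \<le> (2 ^ k * m ^ 2 ^ k * \<beta>)\<^sup>2" using m by simp
  qed (use m \<beta> in simp)
  obtain Kn where Kn: "0 < Kn" "\<And>x y. x \<in> carr \<Longrightarrow> y \<in> carr \<Longrightarrow> nrm (x \<boxtimes> y) \<le> Kn * nrm x * nrm y"
    using norm_mult by blast
  \<comment> \<open>The Hilbert space norm of \<open>Y k\<close> is at most a multiple of \<open>2 ^ k exp (- 4 \<kappa> 2 ^ k)\<close>; the price \<open>exp (\<kappa> 2 ^ k)\<close>
    and the factor \<open>2 ^ k\<close> still leave \<open>exp (- \<kappa> 2 ^ k) \<le> \<delta>s k\<close>.\<close>
  define \<kappa> where "\<kappa> = - ln m / 4"
  have \<kappa>: "0 < \<kappa>" using m by (simp add: \<kappa>_def)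
  have m_pow: "m ^ 2 ^ k = exp (- 4 * \<kappa> * 2 ^ k)" for k
  proof -
    have "m ^ 2 ^ k = exp (ln m) ^ 2 ^ k" using m by simp
    also have "\<dots> = exp (real (2 ^ k) * ln m)" by (rule exp_of_nat_mult[symmetric])
    finally show ?thesis by (simp add: \<kappa>_def mult.commute)
  qed
  obtain \<delta>s Ks where \<delta>s: "\<And>n. exp (- \<kappa> * 2 ^ n) \<le> \<delta>s n" "\<And>n. \<delta>s n \<le> 1"
    "\<not> summable (\<lambda>n. ln (1 / \<delta>s n) / 2 ^ n)" and Ks: "0 < Ks"
    "\<And>n x. x \<in> I \<Longrightarrow> nrm (x \<boxtimes> x) \<le> Ks * nrm x * (exp (\<kappa> * 2 ^ n) * sqrt (sqnorm x) + \<delta>s n * nrm x)"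
    using spread_mult[OF \<kappa>] unfolding sqnorm_def by blast
  have \<delta>s_pos: "0 < \<delta>s n" for n by (rule less_le_trans[OF _ \<delta>s(1)]) simp
  \<comment> \<open>Below this threshold \<open>neumann_left_inverse\<close> applies to \<open>1 - Z k\<close>, whose scalar component \<open>1 - c ^ 2 ^ k\<close> is at least
    \<open>1 - c = t\<close>.\<close>
  define \<eta> where "\<eta> = t / Kn"
  have \<eta>: "0 < \<eta>" using t Kn by (simp add: \<eta>_def)
  define K1 where "K1 = Ks * (\<beta> / (2 * \<kappa>)) + 2"
  have K1: "0 < K1" using Ks(1) \<beta> \<kappa> by (simp add: K1_def add_nonneg_pos)
  have "\<exists>k. nrm (Y k) < \<eta>"
  proof (rule doubling_recursion_becomes_small[OF \<eta> _ _ \<delta>s_pos \<delta>s(2,3)])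
    show "0 < K1 / \<eta> + Ks" using K1 \<eta> Ks(1) by (simp add: add_pos_pos)
    show "0 \<le> nrm (Y k)" for k by (rule norm_nonneg[OF Y_carr])
    fix k assume big: "\<eta> \<le> nrm (Y k)"
    define N where "N = (2::real) ^ k"
    define a where "a = nrm (Y k)"
    have a: "0 \<le> a" "\<eta> \<le> a" using big norm_nonneg[OF Y_carr[of k]] by (auto simp: a_def)
    have e1: "exp (\<kappa> * N) * sqrt (sqnorm (Y k)) \<le> \<beta> / (2 * \<kappa>) * \<delta>s k"
    proof -
      have "exp (\<kappa> * N) * sqrt (sqnorm (Y k)) \<le> exp (\<kappa> * N) * (N * exp (- 4 * \<kappa> * N) * \<beta>)"
        using root_Y[of k] unfolding m_pow N_def by (intro mult_left_mono) auto
      also have "\<dots> = N * exp (- 3 * \<kappa> * N) * \<beta>" by (simp add: exp_add[symmetric] mult.commute mult.left_commute)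
      also have "\<dots> \<le> exp (2 * \<kappa> * N) / (2 * \<kappa>) * exp (- 3 * \<kappa> * N) * \<beta>"
      proof -
        have "2 * \<kappa> * N \<le> exp (2 * \<kappa> * N)" using exp_ge_add_one_self[of "2 * \<kappa> * N"] by linarith
        then have "N \<le> exp (2 * \<kappa> * N) / (2 * \<kappa>)" using \<kappa> by (simp add: pos_le_divide_eq mult.commute mult.left_commute)
        then show ?thesis using \<beta> by (intro mult_right_mono) auto
      qed
      also have "\<dots> = \<beta> / (2 * \<kappa>) * (exp (2 * \<kappa> * N) * exp (- 3 * \<kappa> * N))" by simp
      also have "exp (2 * \<kappa> * N) * exp (- 3 * \<kappa> * N) = exp (- \<kappa> * 2 ^ k)"
        by (simp add: exp_add[symmetric] N_def)
      also have "\<beta> / (2 * \<kappa>) * \<dots> \<le> \<beta> / (2 * \<kappa>) * \<delta>s k"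
        using \<beta> \<kappa> by (intro mult_left_mono \<delta>s) auto
      finally show ?thesis .
    qed
    have e2: "m ^ 2 ^ k \<le> \<delta>s k"
    proof -
      have "m ^ 2 ^ k \<le> exp (- \<kappa> * 2 ^ k)" unfolding m_pow using \<kappa> by simp
      then show ?thesis using \<delta>s(1)[of k] by linarith
    qed
    have "nrm (Y (Suc k)) \<le> nrm (Y k \<boxtimes> Y k) + nrm (snd (Z k) \<odot> Y k \<boxplus> snd (Z k) \<odot> Y k)"
      unfolding Y_Suc using Y_carr by (intro norm_triangle) auto
    moreover have "nrm (snd (Z k) \<odot> Y k \<boxplus> snd (Z k) \<odot> Y k) \<le> nrm (snd (Z k) \<odot> Y k) + nrm (snd (Z k) \<odot> Y k)"
      using Y_carr by (intro norm_triangle) auto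
    moreover have "nrm (snd (Z k) \<odot> Y k) \<le> \<delta>s k * a"
    proof -
      have "nrm (snd (Z k) \<odot> Y k) = c ^ 2 ^ k * a"
        using Y_carr c01 by (simp add: norm_scale snd_Z a_def norm_power)
      also have "\<dots> \<le> \<delta>s k * a" using c_le[of k] e2 a by (intro mult_right_mono) auto
      finally show ?thesis .
    qed
    moreover have "nrm (Y k \<boxtimes> Y k) \<le> Ks * a * (\<beta> / (2 * \<kappa>) * \<delta>s k + \<delta>s k * a)"
    proof -
      have "nrm (Y k \<boxtimes> Y k) \<le> Ks * a * (exp (\<kappa> * N) * sqrt (sqnorm (Y k)) + \<delta>s k * a)"
        unfolding a_def N_def by (rule Ks(2)[OF Y_I])
      also have "\<dots> \<le> Ks * a * (\<beta> / (2 * \<kappa>) * \<delta>s k + \<delta>s k * a)"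
        using e1 Ks(1) a by (intro mult_left_mono add_right_mono) auto
      finally show ?thesis .
    qed
    ultimately have "nrm (Y (Suc k)) \<le> Ks * a * (\<beta> / (2 * \<kappa>) * \<delta>s k + \<delta>s k * a) + (\<delta>s k * a + \<delta>s k * a)"
      by linarith
    also have "\<dots> = \<delta>s k * (K1 * a + Ks * a\<^sup>2)"
      by (simp add: K1_def algebra_simps power2_eq_square)
    finally have main: "nrm (Y (Suc k)) \<le> \<delta>s k * (K1 * a + Ks * a\<^sup>2)" .
    have "K1 * a \<le> K1 / \<eta> * a\<^sup>2"
    proof -
      have "1 * a \<le> a / \<eta> * a" using a \<eta> by (intro mult_right_mono) auto
      then have "K1 * (1 * a) \<le> K1 * (a / \<eta> * a)" using K1 by (intro mult_left_mono) auto
      then show ?thesis by (simp add: power2_eq_square)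
    qed
    then have "\<delta>s k * (K1 * a + Ks * a\<^sup>2) \<le> \<delta>s k * (K1 / \<eta> * a\<^sup>2 + Ks * a\<^sup>2)"
      using \<delta>s_pos[of k] by (intro mult_left_mono add_right_mono) auto
    with main show "nrm (Y (Suc k)) \<le> (K1 / \<eta> + Ks) * \<delta>s k * (nrm (Y k))\<^sup>2"
      by (simp add: a_def algebra_simps)
  qed
  then obtain k where k: "nrm (Y k) < \<eta>" by blast
  have one_minus_Z: "aadd (unitization A) uone (ascale (unitization A) (-1) (Z k)) = ((-1) \<odot> Y k, 1 - snd (Z k))" for k
    using Y_carr[of k] by (simp add: unitization_def uone_def Y_def case_prod_unfold zero_add)
  have "\<exists>s\<in>carr. umult (s, 1 / (1 - snd (Z k))) ((-1) \<odot> Y k, 1 - snd (Z k)) = uone"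
  proof (rule neumann_left_inverse[OF Kn Y_carr])
    have "Kn * nrm (Y k) < t" using k Kn(1) by (simp add: \<eta>_def pos_less_divide_eq mult.commute)
    also have "t \<le> 1 - c ^ 2 ^ k"
      using c01 power_decreasing[of 1 "2 ^ k" c] by (simp add: c_def)
    also have "\<dots> \<le> cmod (1 - snd (Z k))"
      unfolding snd_Z by (metis abs_ge_self norm_of_real of_real_1 of_real_diff)
    finally show "Kn * nrm (Y k) < cmod (1 - snd (Z k))" .
  qed
  then have "U.linv (aadd (unitization A) uone (ascale (unitization A) (-1) (Z k)))"
    unfolding one_minus_Z U.linv_def by (auto simp: ucarr_iff)
  then have "U.linv (aadd (unitization A) uone (ascale (unitization A) (-1) (Z 0)))"
  proof (induction k)
    case (Suc k)
    have "U.linv (aadd (unitization A) uone (ascale (unitization A) (-1) (umult (Z k) (Z k))))"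
      using Suc.prems unfolding Z_Suc .
    from Suc.IH[OF U.linv_sq[OF Z_carr this]] show ?case .
  qed
  then obtain V where V: "V \<in> ucarr" "umult V ((-1) \<odot> Y 0, 1 - snd (Z 0)) = uone"
    unfolding one_minus_Z U.linv_def by blast
  have "((-1) \<odot> Y 0, 1 - snd (Z 0)) = ascale (unitization A) (complex_of_real t) (y, 1)"
    using I_carrier[OF y] by (simp add: Y_def Z_0 z_def unitization_def scale_scale c_def)
  then have "umult (ascale (unitization A) (complex_of_real t) V) (y, 1) = uone"
    using V y1 by (simp add: U.mult_scale_left U.mult_scale_right)
  then show ?thesis using V by (intro bexI[of _ "ascale (unitization A) (complex_of_real t) V"]) auto
qed

text \<open>With \<open>P = a\<^sup>* a\<close>, positivity of \<open>P\<close> gives \<open>\<parallel>(e - P) x\<parallel>\<^sup>2 = \<bar>e\<bar>\<^sup>2 \<parallel>x\<parallel>\<^sup>2 - 2 Re e \<parallel>a x\<parallel>\<^sup>2 +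
  \<parallel>P x\<parallel>\<^sup>2\<close>. For \<open>Re c \<le> 0\<close> all terms are nonnegative; otherwise the value at \<open>c\<close> exceeds that at
  \<open>Re c\<close> by \<open>(Im c)\<^sup>2 \<parallel>x\<parallel>\<^sup>2\<close>.\<close>

lemma resolvent_bounded_below:
  assumes a: "a \<in> carr" and c: "c \<notin> \<real>\<^sub>\<ge>\<^sub>0"
  shows "\<exists>d>0. \<forall>x\<in>I. d * sqnorm x \<le> sqnorm (act ((-1) \<odot> (star a \<boxtimes> a), c) x)"
proof -
  have expand_q: "sqnorm (act ((-1) \<odot> (star a \<boxtimes> a), e) x) =
      (cmod e)\<^sup>2 * sqnorm x - 2 * Re e * sqnorm (a \<boxtimes> x) + sqnorm ((star a \<boxtimes> a) \<boxtimes> x)"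
    if x: "x \<in> I" for x e
  proof -
    let ?P = "(star a \<boxtimes> a) \<boxtimes> x"
    have P: "?P \<in> I" "a \<boxtimes> x \<in> I" using a x by (auto intro: I_mult)
    have "ip ?P x = ip (a \<boxtimes> x) (a \<boxtimes> x)"
      using a x P ip_mult[of "star a" "a \<boxtimes> x" x] by (simp add: mult_assoc I_carrier star_star)
    then have ipP: "ip ?P x = complex_of_real (sqnorm (a \<boxtimes> x))" using P by (simp add: ip_self)
    have "act ((-1) \<odot> (star a \<boxtimes> a), e) x = (-1) \<odot> ?P \<boxplus> e \<odot> x"
      using a x by (simp add: act_def mult_scale_left I_carrier)
    then show ?thesis
      using x P by (simp add: sqnorm_add I_scale sqnorm_scale ip_scale ip_scale_right ipP)
  qed
  have aa: "star a \<boxtimes> a \<in> carr" using a by simp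
  show ?thesis
  proof (cases "Re c \<le> 0")
    case True
    have "c \<noteq> 0" using c by auto
    have "(cmod c)\<^sup>2 * sqnorm x \<le> sqnorm (act ((-1) \<odot> (star a \<boxtimes> a), c) x)" if x: "x \<in> I" for x
    proof -
      have "0 \<le> sqnorm (a \<boxtimes> x)" "0 \<le> sqnorm ((star a \<boxtimes> a) \<boxtimes> x)"
        using a aa x by (auto intro!: sqnorm_nonneg I_mult)
      moreover have "Re c * sqnorm (a \<boxtimes> x) \<le> 0" using True calculation by (simp add: mult_nonpos_nonneg)
      ultimately show ?thesis unfolding expand_q[OF x] by linarith
    qed
    then show ?thesis using \<open>c \<noteq> 0\<close> by (intro exI[of _ "(cmod c)\<^sup>2"]) auto
  next
    case False
    then have im: "Im c \<noteq> 0" using c by (auto simp: complex_nonneg_Reals_iff)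
    have "(Im c)\<^sup>2 * sqnorm x \<le> sqnorm (act ((-1) \<odot> (star a \<boxtimes> a), c) x)" if x: "x \<in> I" for x
    proof -
      have "0 \<le> sqnorm (act ((-1) \<odot> (star a \<boxtimes> a), complex_of_real (Re c)) x)"
        using aa x by (intro sqnorm_nonneg act_closed) (auto simp: ucarr_iff)
      then show ?thesis unfolding expand_q[OF x] by (simp add: cmod_power2 distrib_right)
    qed
    then show ?thesis using im by (intro exI[of _ "(Im c)\<^sup>2"]) auto
  qed
qed

text \<open>Splitting off the small part \<open>h\<close> of \<open>a\<^sup>* a\<close> reduces the claim to an element \<open>1 - x\<close> with
  \<open>x \<in> I\<close>, and \<open>linv_of_bounded_below\<close> provides a left inverse \<open>V\<close> of \<open>(1 - x)\<^sup>* (1 - x)\<close>; then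
  \<open>V (1 - x)\<^sup>*\<close> is one of \<open>1 - x\<close>.\<close>

lemma resolvent_left_invertible:
  assumes a: "a \<in> carr" and c: "c \<notin> \<real>\<^sub>\<ge>\<^sub>0"
  shows "\<exists>V\<in>ucarr. umult V ((-1) \<odot> (star a \<boxtimes> a), c) = uone"
proof -
  interpret U: unital_complex_star_algebra "unitization A" uone
    by (intro unital_complex_star_algebra.intro unital_complex_star_algebra_axioms.intro
        unitization_star_algebra) auto
  obtain Kn where Kn: "0 < Kn" "\<And>x y. x \<in> carr \<Longrightarrow> y \<in> carr \<Longrightarrow> nrm (x \<boxtimes> y) \<le> Kn * nrm x * nrm y"
    using norm_mult by blast
  have c0: "c \<noteq> 0" using c by auto
  obtain g where g: "g \<in> I" "nrm (star (adiff A a g) \<boxtimes> adiff A a g) < cmod c / Kn"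
    using approx[OF a, of "cmod c / Kn"] c0 Kn(1) by auto
  have gc: "g \<in> carr" using g by (intro I_carrier)
  define h where "h = star (adiff A a g) \<boxtimes> adiff A a g"
  have h: "h \<in> carr" using a gc by (simp add: h_def adiff_def)
  have h_star: "star h = h" using a gc by (simp add: h_def adiff_def star_mult star_star)
  have small: "Kn * nrm h < cmod c" using g(2) Kn(1) by (simp add: h_def pos_less_divide_eq mult.commute)
  define b where "b = star a \<boxtimes> g \<boxplus> (star g \<boxtimes> a \<boxplus> (-1) \<odot> (star g \<boxtimes> g))"
  have "star (star a \<boxtimes> g) \<in> I" using a g(1) by (intro I_star I_mult) auto
  then have "star g \<boxtimes> a \<in> I" using a gc by (simp add: star_mult star_star)
  moreover have "star a \<boxtimes> g \<in> I" "star g \<boxtimes> g \<in> I" using a g(1) gc by (auto intro: I_mult)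
  ultimately have b: "b \<in> I" unfolding b_def by (intro I_add I_scale)
  then have bc: "b \<in> carr" by (rule I_carrier)
  have "h = star a \<boxtimes> a \<boxplus> (-1) \<odot> b"
    using a gc unfolding h_def b_def adiff_def by (simp add: expand)
  then have aa: "star a \<boxtimes> a = h \<boxplus> b" using a bc by (simp add: add_assoc minus_add add_zero)
  let ?H = "((-1) \<odot> h, c)"
  have H: "?H \<in> ucarr" using h by (simp add: ucarr_iff)
  obtain s where s: "s \<in> carr" "umult (s, 1 / c) ?H = uone"
    using neumann_left_inverse[OF Kn h small] by blast
  obtain s' where s': "s' \<in> carr" "umult (s', 1 / cnj c) ((-1) \<odot> h, cnj c) = uone"
    using neumann_left_inverse[OF Kn h, of "cnj c"] small by auto
  \<comment> \<open>\<open>h\<close> is self-adjoint, so the adjoint of a left inverse of \<open>cnj c - h\<close> is a right inverse of \<open>c - h\<close>.\<close>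
  have "umult (ustar ((-1) \<odot> h, cnj c)) (ustar (s', 1 / cnj c)) = uone"
    using s' h by (subst U.star_mult[symmetric]) (auto simp: ucarr_iff)
  moreover have "ustar ((-1) \<odot> h, cnj c) = ?H" using h by (simp add: unitization_def star_scale h_star)
  ultimately have right: "umult ?H (ustar (s', 1 / cnj c)) = uone" by simp
  define R where "R = ustar (s', 1 / cnj c)"
  have R: "R \<in> ucarr" unfolding R_def using s' by (intro U.star_closed) (simp add: ucarr_iff)
  define x where "x = act R b"
  have x: "x \<in> I" unfolding x_def by (rule act_closed[OF R b])
  have xc: "x \<in> carr" using x by (rule I_carrier)
  have Rb: "umult R (b, 0) = (x, 0)"
    using R bc by (cases R) (simp add: x_def act_def unitization_def add_zero)
  have "umult ?H (x, 0) = umult (umult ?H R) (b, 0)"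
    using H R bc unfolding Rb[symmetric] by (subst U.mult_assoc) (auto simp: ucarr_iff)
  also have "\<dots> = (b, 0)" using right bc by (simp add: R_def ucarr_iff)
  finally have Hx: "umult ?H (x, 0) = (b, 0)" .
  let ?X = "((-1) \<odot> x, 1)"
  have X: "?X \<in> ucarr" using xc by (simp add: ucarr_iff)
  have X_eq: "?X = aadd (unitization A) uone (ascale (unitization A) (-1) (x, 0))"
    using xc by (simp add: unitization_def uone_def zero_add)
  have x0: "(x, 0) \<in> ucarr" "(b, 0) \<in> ucarr" using xc bc by (auto simp: ucarr_iff)
  have "umult ?H ?X = aadd (unitization A) ?H (ascale (unitization A) (-1) (b, 0))"
    unfolding X_eq using H x0 by (simp add: U.mult_add_right U.mult_scale_right Hx)
  also have "\<dots> = ((-1) \<odot> (star a \<boxtimes> a), c)"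
    using h bc by (simp add: unitization_def aa scale_add_right)
  finally have factor: "umult ?H ?X = ((-1) \<odot> (star a \<boxtimes> a), c)" .
  \<comment> \<open>\<open>1 - x\<close> inherits the lower bound of \<open>c - a\<^sup>* a = (c - h)(1 - x)\<close>, since \<open>c - h\<close> acts boundedly.\<close>
  obtain d where d: "0 < d" "\<And>z. z \<in> I \<Longrightarrow> d * sqnorm z \<le> sqnorm (act ((-1) \<odot> (star a \<boxtimes> a), c) z)"
    using resolvent_bounded_below[OF a c] by blast
  obtain B where B: "1 \<le> B" "\<And>z. z \<in> I \<Longrightarrow> sqnorm (act ?H z) \<le> B * sqnorm z"
    using sqnorm_act_bounded[OF H] by blast
  have lower: "d / B * sqnorm z \<le> sqnorm (act ?X z)" if z: "z \<in> I" for z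
  proof -
    have "d * sqnorm z \<le> sqnorm (act ?H (act ?X z))"
      using d(2)[OF z] unfolding factor[symmetric] act_umult[OF H X z] .
    also have "\<dots> \<le> B * sqnorm (act ?X z)" by (rule B(2)[OF act_closed[OF X z]])
    finally show ?thesis using B(1) by (simp add: pos_divide_le_eq mult.commute)
  qed
  define y where "y = star x \<boxtimes> x \<boxplus> ((-1) \<odot> x \<boxplus> (-1) \<odot> star x)"
  have y: "y \<in> I" unfolding y_def using x xc by (intro I_add I_mult I_scale I_star) auto
  have Xy: "umult (ustar ?X) ?X = (y, 1)"
    using xc by (simp add: unitization_def y_def star_scale mult_scale_left mult_scale_right scale_scale scale_one)
  have "\<exists>V\<in>ucarr. umult V (y, 1) = uone"
  proof (rule linv_of_bounded_below[OF y])
    show "0 < d / B" using d(1) B(1) by simp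
    fix z assume z: "z \<in> I"
    have "ip (act (y, 1) z) z = ip (act (ustar ?X) (act ?X z)) z"
      using X z by (simp only: Xy[symmetric]) (simp add: act_umult U.star_closed)
    also have "\<dots> = ip (act ?X z) (act (ustar (ustar ?X)) z)"
      using X z by (intro ip_act act_closed U.star_closed)
    also have "ustar (ustar ?X) = ?X" using X by (rule U.star_star)
    finally have "Re (ip (act (y, 1) z) z) = sqnorm (act ?X z)" by (simp add: sqnorm_def)
    then show "d / B * sqnorm z \<le> Re (ip (act (y, 1) z) z)" using lower[OF z] by simp
  qed
  then have "U.linv (umult (ustar ?X) ?X)" unfolding Xy U.linv_def .
  then have "U.linv ?X" by (rule U.linv_right_factor[OF U.star_closed[OF X] X])
  moreover have "U.linv ?H" using s by (auto simp: U.linv_def ucarr_iff)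
  ultimately have "U.linv (umult ?H ?X)" using H X by (intro U.linv_mult)
  then show ?thesis unfolding factor U.linv_def .
qed

text \<open>The adjoint of a left inverse of \<open>cnj c - a\<^sup>* a\<close> is a right inverse of \<open>c - a\<^sup>* a\<close>.\<close>

lemma resolvent_invertible:
  assumes a: "a \<in> carr" and c: "c \<notin> \<real>\<^sub>\<ge>\<^sub>0"
  shows "\<exists>V\<in>ucarr. umult ((-1) \<odot> (star a \<boxtimes> a), c) V = uone \<and> umult V ((-1) \<odot> (star a \<boxtimes> a), c) = uone"
proof -
  interpret U: unital_complex_star_algebra "unitization A" uone
    by (intro unital_complex_star_algebra.intro unital_complex_star_algebra_axioms.intro
        unitization_star_algebra) auto
  let ?T = "\<lambda>c. ((-1) \<odot> (star a \<boxtimes> a), c)"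
  have T: "?T c \<in> ucarr" for c using a by (simp add: ucarr_iff)
  have T_star: "ustar (?T c) = ?T (cnj c)" for c
    using a by (simp add: unitization_def star_scale star_mult star_star)
  have "cnj c \<notin> \<real>\<^sub>\<ge>\<^sub>0" using c by (auto simp: complex_nonneg_Reals_iff)
  from resolvent_left_invertible[OF a this] obtain W where W: "W \<in> ucarr" "umult W (?T (cnj c)) = uone"
    by blast
  then have "umult (?T c) (ustar W) = uone"
    using U.star_mult[OF W(1) T, of "cnj c"] by (simp add: T_star)
  moreover obtain V where V: "V \<in> ucarr" "umult V (?T c) = uone"
    using resolvent_left_invertible[OF a c] by blast
  moreover have "V = ustar W"
  proof -
    have "V = umult V (umult (?T c) (ustar W))" using V(1) calculation(1) by simp
    also have "\<dots> = umult (umult V (?T c)) (ustar W)" using V(1) W(1) T by (simp add: U.mult_assoc U.star_closed)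
    also have "\<dots> = ustar W" using V W by (simp add: U.star_closed)
    finally show ?thesis .
  qed
  ultimately show ?thesis by blast
qed

text \<open>If \<open>A\<close> has a unit \<open>e\<close>, an inverse \<open>(v, k)\<close> in the unitization yields the inverse \<open>v + k e\<close>
  in \<open>A\<close>.\<close>

theorem symmetric: "symmetric_algebra A"
  unfolding symmetric_algebra_def
proof (intro ballI subsetI, rule ccontr)
  fix a c assume a: "a \<in> carr" and c: "c \<in> spectrum A (star a \<boxtimes> a)" and nn: "c \<notin> \<real>\<^sub>\<ge>\<^sub>0"
  obtain V where V: "V \<in> ucarr" "umult ((-1) \<odot> (star a \<boxtimes> a), c) V = uone"
    "umult V ((-1) \<odot> (star a \<boxtimes> a), c) = uone"
    using resolvent_invertible[OF a nn] by blast
  obtain v k where vk: "V = (v, k)" by (cases V)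
  have v: "v \<in> carr" using V(1) by (simp add: vk ucarr_iff)
  define p where "p = (-1) \<odot> (star a \<boxtimes> a)"
  have p: "p \<in> carr" using a by (simp add: p_def)
  have eqs: "p \<boxtimes> v \<boxplus> (c \<odot> v \<boxplus> k \<odot> p) = \<zero>" "v \<boxtimes> p \<boxplus> (k \<odot> p \<boxplus> c \<odot> v) = \<zero>" "c * k = 1"
    using V(2,3) by (simp_all add: vk unitization_def uone_def p_def[symmetric])
  show False
  proof (cases "unital A")
    case True
    then obtain e where e: "is_unit_of A e" by (auto simp: unital_def)
    have ec: "e \<in> carr" and e_left: "\<And>x. x \<in> carr \<Longrightarrow> e \<boxtimes> x = x" and e_right: "\<And>x. x \<in> carr \<Longrightarrow> x \<boxtimes> e = x"
      using e by (auto simp: is_unit_of_def)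
    have one: "aone A = e"
      unfolding aone_def
    proof (rule the_equality[where P="is_unit_of A", OF e])
      fix e' assume "is_unit_of A e'"
      then have "e' \<in> carr" "e' \<boxtimes> e = e" using ec by (auto simp: is_unit_of_def)
      then show "e' = e" using e_right by simp
    qed
    have "ainvertible A (adiff A (c \<odot> aone A) (star a \<boxtimes> a))"
      unfolding ainvertible_def one
    proof (rule bexI[of _ "v \<boxplus> k \<odot> e"], intro conjI)
      have T: "adiff A (c \<odot> e) (star a \<boxtimes> a) = c \<odot> e \<boxplus> p" by (simp add: adiff_def p_def)
      have "(c \<odot> e \<boxplus> p) \<boxtimes> (v \<boxplus> k \<odot> e) = (c * k) \<odot> e \<boxplus> (p \<boxtimes> v \<boxplus> (c \<odot> v \<boxplus> k \<odot> p))"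
        using ec p v by (simp add: expand e_left e_right mult.commute[of c k])
      then show "adiff A (c \<odot> e) (star a \<boxtimes> a) \<boxtimes> (v \<boxplus> k \<odot> e) = e"
        unfolding T using eqs ec by (simp add: scale_one add_zero)
      have "(v \<boxplus> k \<odot> e) \<boxtimes> (c \<odot> e \<boxplus> p) = (c * k) \<odot> e \<boxplus> (v \<boxtimes> p \<boxplus> (k \<odot> p \<boxplus> c \<odot> v))"
        using ec p v by (simp add: expand e_left e_right mult.commute)
      then show "(v \<boxplus> k \<odot> e) \<boxtimes> adiff A (c \<odot> e) (star a \<boxtimes> a) = e"
        unfolding T using eqs ec by (simp add: scale_one add_zero)
    qed (use v ec in auto)
    then show False using c True by (simp add: spectrum_def unital_spectrum_def)
  next
    case False
    have "adiff (unitization A) (ascale (unitization A) c (aone (unitization A))) (star a \<boxtimes> a, 0)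
        = ((-1) \<odot> (star a \<boxtimes> a), c)"
      unfolding aone_unitization using a by (simp add: adiff_def unitization_def uone_def zero_add)
    then have "ainvertible (unitization A) (adiff (unitization A)
        (ascale (unitization A) c (aone (unitization A))) (star a \<boxtimes> a, 0))"
      using V by (auto simp: ainvertible_def aone_unitization)
    then show False using c False by (simp add: spectrum_def unital_spectrum_def)
  qed
qed

end

section \<open>The algebra of almost-everywhere classes\<close>

context twisted_orlicz begin

abbreviation orlicz_alg where "orlicz_alg \<equiv> twisted_orlicz_star_alg M \<Phi> \<Psi> \<Omega> \<omega>"

definition cls :: "('a \<Rightarrow> complex) \<Rightarrow> ('a \<Rightarrow> complex) set" where
  "cls f = ae_rel M \<Phi> \<omega> `` {f}"

lemma ae_rel_iff: "(f, g) \<in> ae_rel M \<Phi> \<omega> \<longleftrightarrow> f \<in> space_A \<and> g \<in> space_A \<and> (AE s in M. f s = g s)"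
  by (simp add: ae_rel_def)

lemma equiv_ae_rel: "equiv space_A (ae_rel M \<Phi> \<omega>)"
proof (rule equivI)
  show "ae_rel M \<Phi> \<omega> \<subseteq> space_A \<times> space_A" by (auto simp: ae_rel_def)
  show "refl_on space_A (ae_rel M \<Phi> \<omega>)" by (rule refl_onI) (simp add: ae_rel_iff)
  show "sym (ae_rel M \<Phi> \<omega>)" by (rule symI) (auto simp: ae_rel_iff elim: eventually_mono)
  show "trans (ae_rel M \<Phi> \<omega>)" by (rule transI) (auto simp: ae_rel_iff elim: eventually_elim2)
qed

lemma cls_eq_iff: "f \<in> space_A \<Longrightarrow> g \<in> space_A \<Longrightarrow> cls f = cls g \<longleftrightarrow> (AE s in M. f s = g s)"
  unfolding cls_def by (simp add: eq_equiv_class_iff[OF equiv_ae_rel] ae_rel_iff)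

lemma cls_eqI: "f \<in> space_A \<Longrightarrow> g \<in> space_A \<Longrightarrow> (AE s in M. f s = g s) \<Longrightarrow> cls f = cls g"
  by (simp only: cls_eq_iff)

lemma mem_cls: "f \<in> space_A \<Longrightarrow> f \<in> cls f"
  by (simp add: cls_def ae_rel_iff)

lemma carrier_eq: "acarrier orlicz_alg = cls ` space_A"
  by (auto simp: twisted_orlicz_star_alg_def quotient_def cls_def)

lemma carrierE:
  assumes "X \<in> acarrier orlicz_alg" obtains f where "f \<in> space_A" "X = cls f"
  using assms unfolding carrier_eq by blast

lemma zero_cls: "azero orlicz_alg = cls (\<lambda>_. 0)"
  by (simp add: twisted_orlicz_star_alg_def cls_def)

lemma add_cls:
  assumes "f \<in> space_A" "g \<in> space_A"
  shows "aadd orlicz_alg (cls f) (cls g) = cls (\<lambda>s. f s + g s)"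
proof -
  have "congruent2 (ae_rel M \<Phi> \<omega>) (ae_rel M \<Phi> \<omega>) (\<lambda>f g. cls (\<lambda>s. f s + g s))"
  proof (rule congruent2I')
    fix f f' g g' assume *: "(f, f') \<in> ae_rel M \<Phi> \<omega>" "(g, g') \<in> ae_rel M \<Phi> \<omega>"
    then have "AE s in M. f s = f' s" "AE s in M. g s = g' s" by (simp_all add: ae_rel_iff)
    then have "AE s in M. f s + g s = f' s + g' s" by eventually_elim simp
    then show "cls (\<lambda>s. f s + g s) = cls (\<lambda>s. f' s + g' s)"
      using * by (intro cls_eqI space_A_add) (simp_all add: ae_rel_iff)
  qed
  from UN_equiv_class2[OF equiv_ae_rel equiv_ae_rel this assms]
  show ?thesis by (simp add: twisted_orlicz_star_alg_def cls_def)
qed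

lemma scale_cls:
  assumes "f \<in> space_A" shows "ascale orlicz_alg c (cls f) = cls (\<lambda>s. c * f s)"
proof -
  have "congruent (ae_rel M \<Phi> \<omega>) (\<lambda>f. cls (\<lambda>s. c * f s))"
  proof (rule congruentI)
    fix f f' assume *: "(f, f') \<in> ae_rel M \<Phi> \<omega>"
    then have "AE s in M. f s = f' s" by (simp add: ae_rel_iff)
    then have "AE s in M. c * f s = c * f' s" by eventually_elim simp
    then show "cls (\<lambda>s. c * f s) = cls (\<lambda>s. c * f' s)"
      using * by (intro cls_eqI space_A_scale) (simp_all add: ae_rel_iff)
  qed
  from UN_equiv_class[OF equiv_ae_rel this assms]
  show ?thesis by (simp add: twisted_orlicz_star_alg_def cls_def)
qed

lemma mult_cls:
  assumes "f \<in> space_A" "g \<in> space_A"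
  shows "amult orlicz_alg (cls f) (cls g) = cls (f \<circledast> g)"
proof -
  have "congruent2 (ae_rel M \<Phi> \<omega>) (ae_rel M \<Phi> \<omega>) (\<lambda>f g. cls (f \<circledast> g))"
  proof (rule congruent2I')
    fix f f' g g' assume *: "(f, f') \<in> ae_rel M \<Phi> \<omega>" "(g, g') \<in> ae_rel M \<Phi> \<omega>"
    have "f \<circledast> g = f' \<circledast> g'"
      by (rule conv_cong_AE) (use * in \<open>simp_all add: ae_rel_iff space_A_measurable\<close>)
    then show "cls (f \<circledast> g) = cls (f' \<circledast> g')" by simp
  qed
  from UN_equiv_class2[OF equiv_ae_rel equiv_ae_rel this assms]
  show ?thesis by (simp add: twisted_orlicz_star_alg_def cls_def)
qed

lemma star_cls:
  assumes "f \<in> space_A" shows "astar orlicz_alg (cls f) = cls (invol f)"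
proof -
  have "congruent (ae_rel M \<Phi> \<omega>) (\<lambda>f. cls (invol f))"
  proof (rule congruentI)
    fix f f' assume *: "(f, f') \<in> ae_rel M \<Phi> \<omega>"
    then have "AE s in M. f (- s) = f' (- s)" by (intro AE_uminus) (simp add: ae_rel_iff)
    then have "AE s in M. invol f s = invol f' s" by eventually_elim (simp add: twisted_star_def)
    then show "cls (invol f) = cls (invol f')"
      using * by (intro cls_eqI space_A_invol) (simp_all add: ae_rel_iff)
  qed
  from UN_equiv_class[OF equiv_ae_rel this assms]
  show ?thesis by (simp add: twisted_orlicz_star_alg_def cls_def)
qed

lemma norm_cls:
  assumes "f \<in> space_A" shows "anorm orlicz_alg (cls f) = enn2real (wnorm (mag f))"
proof -
  have "wnorm (mag g) = wnorm (mag f)" if "g \<in> cls f" for g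
  proof -
    have "AE s in M. f s = g s" using that by (simp add: cls_def ae_rel_iff)
    then have "AE s in M. mag g s \<le> mag f s" "AE s in M. mag f s \<le> mag g s" by (eventually_elim, simp)+
    then show ?thesis by (intro antisym wnorm_mono_AE)
  qed
  then have "(SUP g\<in>cls f. weighted_orlicz_norm M \<Psi> \<omega> g) = (SUP g\<in>cls f. wnorm (mag f))"
    by (intro SUP_cong refl) (simp add: weighted_orlicz_norm_eq)
  also have "\<dots> = wnorm (mag f)" using mem_cls[OF assms] by (intro cSUP_const) blast
  finally show ?thesis by (simp add: twisted_orlicz_star_alg_def)
qed

lemma anorm_nonneg: "0 \<le> anorm orlicz_alg X"
  by (simp add: twisted_orlicz_star_alg_def)

lemma diff_cls:
  assumes "f \<in> space_A" "g \<in> space_A"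
  shows "adiff orlicz_alg (cls f) (cls g) = cls (\<lambda>s. f s - g s)"
  unfolding adiff_def scale_cls[OF assms(2)] add_cls[OF assms(1) space_A_scale[OF assms(2)]] by simp

lemma space_A_diff: "f \<in> space_A \<Longrightarrow> g \<in> space_A \<Longrightarrow> (\<lambda>s. f s - g s) \<in> space_A"
  using space_A_add[OF _ space_A_scale[of g "-1"], of f] by simp

lemma norm_cls_ennreal: "f \<in> space_A \<Longrightarrow> ennreal (anorm orlicz_alg (cls f)) = wnorm (mag f)"
  by (simp add: norm_cls space_A_iff less_top)

lemma norm_cls_le: "f \<in> space_A \<Longrightarrow> 0 \<le> c \<Longrightarrow> wnorm (mag f) \<le> ennreal c \<Longrightarrow> anorm orlicz_alg (cls f) \<le> c"
  by (simp add: norm_cls enn2real_leI)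

lemma star_algebra: "complex_star_algebra orlicz_alg"
proof
  show "azero orlicz_alg \<in> acarrier orlicz_alg" unfolding zero_cls carrier_eq by (rule imageI[OF space_A_zero])
next
  fix X Y assume "X \<in> acarrier orlicz_alg" "Y \<in> acarrier orlicz_alg"
  then obtain f g where [simp]: "X = cls f" "Y = cls g" and fg: "f \<in> space_A" "g \<in> space_A" by (metis carrierE)
  note m = fg[THEN space_A_measurable]
  show "aadd orlicz_alg X Y \<in> acarrier orlicz_alg"
    by (simp add: add_cls fg carrier_eq space_A_add)
  show "amult orlicz_alg X Y \<in> acarrier orlicz_alg"
    by (simp add: mult_cls fg carrier_eq space_A_conv)
  show "aadd orlicz_alg X Y = aadd orlicz_alg Y X" by (simp add: add_cls fg add.commute)
  show "amult orlicz_alg (ascale orlicz_alg c X) Y = ascale orlicz_alg c (amult orlicz_alg X Y)" for c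
    by (simp add: mult_cls scale_cls fg space_A_scale space_A_conv conv_scale_left[abs_def])
  show "amult orlicz_alg X (ascale orlicz_alg c Y) = ascale orlicz_alg c (amult orlicz_alg X Y)" for c
    by (simp add: mult_cls scale_cls fg space_A_scale space_A_conv conv_scale_right[abs_def])
  show "ascale orlicz_alg c (aadd orlicz_alg X Y) = aadd orlicz_alg (ascale orlicz_alg c X) (ascale orlicz_alg c Y)" for c
    by (simp add: add_cls scale_cls fg space_A_scale space_A_add distrib_left)
  show "astar orlicz_alg (aadd orlicz_alg X Y) = aadd orlicz_alg (astar orlicz_alg X) (astar orlicz_alg Y)"
    by (simp add: add_cls star_cls fg space_A_invol space_A_add) (simp add: twisted_star_def[abs_def] distrib_right)
  show "astar orlicz_alg (amult orlicz_alg X Y) = amult orlicz_alg (astar orlicz_alg Y) (astar orlicz_alg X)"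
    by (simp add: mult_cls star_cls fg space_A_invol space_A_conv invol_conv[OF m])
  fix Z assume "Z \<in> acarrier orlicz_alg"
  then obtain h where [simp]: "Z = cls h" and h: "h \<in> space_A" by (metis carrierE)
  show "aadd orlicz_alg (aadd orlicz_alg X Y) Z = aadd orlicz_alg X (aadd orlicz_alg Y Z)"
    by (simp add: add_cls fg h space_A_add add.assoc)
  show "amult orlicz_alg (amult orlicz_alg X Y) Z = amult orlicz_alg X (amult orlicz_alg Y Z)"
    by (simp add: mult_cls fg h space_A_conv cls_eqI[OF _ _ conv_assoc[OF fg h]])
  show "amult orlicz_alg (aadd orlicz_alg X Y) Z = aadd orlicz_alg (amult orlicz_alg X Z) (amult orlicz_alg Y Z)"
    by (simp add: mult_cls add_cls fg h space_A_conv space_A_add cls_eqI[OF _ _ conv_add_left[OF fg h]])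
  show "amult orlicz_alg X (aadd orlicz_alg Y Z) = aadd orlicz_alg (amult orlicz_alg X Y) (amult orlicz_alg X Z)"
    by (simp add: mult_cls add_cls fg h space_A_conv space_A_add cls_eqI[OF _ _ conv_add_right[OF fg h]])
next
  fix X assume "X \<in> acarrier orlicz_alg"
  then obtain f where [simp]: "X = cls f" and f: "f \<in> space_A" by (metis carrierE)
  show "ascale orlicz_alg c X \<in> acarrier orlicz_alg" for c
    by (simp add: scale_cls f carrier_eq space_A_scale)
  show "astar orlicz_alg X \<in> acarrier orlicz_alg"
    by (simp add: star_cls f carrier_eq space_A_invol)
  show "aadd orlicz_alg X (azero orlicz_alg) = X"
    by (simp add: zero_cls add_cls f space_A_zero)
  show "adiff orlicz_alg X X = azero orlicz_alg"
    by (simp add: diff_cls f zero_cls)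
  show "ascale orlicz_alg 1 X = X" by (simp add: scale_cls f)
  show "ascale orlicz_alg c (ascale orlicz_alg d X) = ascale orlicz_alg (c * d) X" for c d
    by (simp add: scale_cls f space_A_scale mult.assoc)
  show "ascale orlicz_alg (c + d) X = aadd orlicz_alg (ascale orlicz_alg c X) (ascale orlicz_alg d X)" for c d
    by (simp add: scale_cls add_cls f space_A_scale distrib_right)
  show "astar orlicz_alg (astar orlicz_alg X) = X"
    by (simp add: star_cls f space_A_invol invol_invol)
  show "astar orlicz_alg (ascale orlicz_alg c X) = ascale orlicz_alg (cnj c) (astar orlicz_alg X)" for c
    by (simp add: star_cls scale_cls f space_A_invol space_A_scale) (simp add: twisted_star_def[abs_def] mult.assoc)
qed

lemma space_A_complete:
  fixes F :: "nat \<Rightarrow> 'a \<Rightarrow> complex"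
  assumes F: "\<And>n. F n \<in> space_A"
    and cauchy: "\<And>e. 0 < e \<Longrightarrow> \<exists>N. \<forall>m\<ge>N. \<forall>n\<ge>N. wnorm (mag (\<lambda>s. F m s - F n s)) < ennreal e"
  shows "\<exists>f\<in>space_A. \<forall>e>0. \<exists>N. \<forall>n\<ge>N. wnorm (mag (\<lambda>s. F n s - f s)) \<le> ennreal e"
proof -
  have m [measurable]: "F n \<in> borel_measurable M" for n by (rule space_A_measurable[OF F])
  define Y where "Y n s = F n s * of_real (\<omega> s)" for n :: nat and s
  have Ym: "Y n \<in> borel_measurable M" for n unfolding Y_def by measurable
  have Y: "gauge_norm (\<lambda>s. ennreal (norm (Y n s - h s * of_real (\<omega> s)))) = wnorm (mag (\<lambda>s. F n s - h s))" for n :: nat and h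
    using \<omega>_pos by (simp add: wnorm_def Y_def left_diff_distrib[symmetric] norm_mult ennreal_mult less_imp_le)
  have "\<exists>N. \<forall>m\<ge>N. \<forall>n\<ge>N. gauge_norm (\<lambda>s. ennreal (norm (Y m s - Y n s))) < ennreal e" if "0 < e" for e
  proof -
    have "(\<lambda>s. ennreal (norm (Y m s - Y n s))) = (\<lambda>s. ennreal (norm (Y m s - F n s * of_real (\<omega> s))))" for m n :: nat
      by (simp add: Y_def)
    then show ?thesis using cauchy[OF that] by (simp only: Y)
  qed
  from orlicz_complete[of Y, OF Ym this] obtain y where y [measurable]: "y \<in> borel_measurable M"
    and lim: "\<forall>e>0. \<exists>N. \<forall>n\<ge>N. gauge_norm (\<lambda>s. ennreal (norm (Y n s - y s))) \<le> ennreal e" by blast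
  define f where "f s = y s / of_real (\<omega> s)" for s
  have fm [measurable]: "f \<in> borel_measurable M" unfolding f_def by measurable
  have yf: "y s = f s * of_real (\<omega> s)" for s using \<omega>_pos[of s] by (simp add: f_def)
  have lim': "\<forall>e>0. \<exists>N. \<forall>n\<ge>N. wnorm (mag (\<lambda>s. F n s - f s)) \<le> ennreal e"
    using lim unfolding yf Y .
  obtain N where N: "wnorm (mag (\<lambda>s. F N s - f s)) \<le> ennreal 1" using lim' zero_less_one by blast
  have d: "(\<lambda>s. F N s - f s) \<in> space_A" unfolding space_A_iff
    by (intro conjI borel_measurable_diff m fm le_less_trans[OF N]) simp
  have "f \<in> space_A" using space_A_diff[OF F[of N] d] by simp
  with lim' show ?thesis by blast
qed

lemma banach_algebra: "banach_star_algebra orlicz_alg"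
proof -
  interpret complex_star_algebra orlicz_alg by (rule star_algebra)
  show ?thesis
  proof
    fix X assume "X \<in> acarrier orlicz_alg"
    then obtain f where [simp]: "X = cls f" and f: "f \<in> space_A" by (metis carrierE)
    note m = space_A_measurable[OF f]
    have fin: "wnorm (mag f) < \<infinity>" using f by (simp add: space_A_iff)
    show "0 \<le> anorm orlicz_alg X" by (simp add: anorm_nonneg)
    have "enn2real (wnorm (mag f)) = 0 \<longleftrightarrow> wnorm (mag f) = 0" using fin by (auto simp: enn2real_eq_0_iff)
    then show "anorm orlicz_alg X = 0 \<longleftrightarrow> X = azero orlicz_alg"
      by (simp add: norm_cls f zero_cls cls_eq_iff space_A_zero wnorm_eq_0_AE[OF m])
    show "anorm orlicz_alg (ascale orlicz_alg c X) = cmod c * anorm orlicz_alg X" for c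
      by (simp add: scale_cls f norm_cls space_A_scale wnorm_scale[OF m] enn2real_mult)
    show "anorm orlicz_alg (astar orlicz_alg X) = anorm orlicz_alg X"
      by (simp add: star_cls f norm_cls space_A_invol wnorm_invol[OF m])
    fix Y assume "Y \<in> acarrier orlicz_alg"
    then obtain g where [simp]: "Y = cls g" and g: "g \<in> space_A" by (metis carrierE)
    show "anorm orlicz_alg (aadd orlicz_alg X Y) \<le> anorm orlicz_alg X + anorm orlicz_alg Y"
    proof -
      have "ennreal (anorm orlicz_alg (aadd orlicz_alg X Y)) \<le> ennreal (anorm orlicz_alg X) + ennreal (anorm orlicz_alg Y)"
        using wnorm_triangle[OF m space_A_measurable[OF g]] by (simp add: add_cls norm_cls_ennreal f g space_A_add)
      then show ?thesis using f g by (simp add: norm_cls ennreal_plus[symmetric] del: ennreal_plus)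
    qed
  next
    obtain K where K: "0 < K" "\<And>F G. F \<in> nn_borel \<Longrightarrow> G \<in> nn_borel \<Longrightarrow>
        wnorm (nn_conv F G) \<le> ennreal K * wnorm F * wnorm G"
      using wnorm_nn_conv_le by blast
    show "\<exists>K>0. \<forall>X\<in>acarrier orlicz_alg. \<forall>Y\<in>acarrier orlicz_alg.
        anorm orlicz_alg (amult orlicz_alg X Y) \<le> K * anorm orlicz_alg X * anorm orlicz_alg Y"
    proof (intro exI[of _ K] conjI K(1) ballI)
      fix X Y assume "X \<in> acarrier orlicz_alg" "Y \<in> acarrier orlicz_alg"
      then obtain f g where [simp]: "X = cls f" "Y = cls g" and fg: "f \<in> space_A" "g \<in> space_A" by (metis carrierE)
      note m = fg[THEN space_A_measurable]
      have "wnorm (mag (f \<circledast> g)) \<le> wnorm (nn_conv (mag f) (mag g))"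
        by (intro wnorm_mono_AE AE_I2 norm_conv_le m)
      also have "\<dots> \<le> ennreal K * wnorm (mag f) * wnorm (mag g)" by (intro K mag_measurable m)
      also have "\<dots> = ennreal (K * anorm orlicz_alg X * anorm orlicz_alg Y)"
        unfolding \<open>X = cls f\<close> \<open>Y = cls g\<close> norm_cls_ennreal[OF fg(1), symmetric] norm_cls_ennreal[OF fg(2), symmetric]
        using K(1) by (simp only: ennreal_mult less_imp_le mult_nonneg_nonneg anorm_nonneg)
      finally show "anorm orlicz_alg (amult orlicz_alg X Y) \<le> K * anorm orlicz_alg X * anorm orlicz_alg Y"
        using fg K(1) unfolding \<open>X = cls f\<close> \<open>Y = cls g\<close> mult_cls[OF fg]
        by (intro norm_cls_le space_A_conv) (simp_all add: norm_cls)
    qed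
  next
    fix X :: "nat \<Rightarrow> ('a \<Rightarrow> complex) set"
    assume "\<And>n. X n \<in> acarrier orlicz_alg"
      and cauchy: "\<And>e. 0 < e \<Longrightarrow> \<exists>N. \<forall>m\<ge>N. \<forall>n\<ge>N. anorm orlicz_alg (adiff orlicz_alg (X m) (X n)) < e"
    then have "\<exists>f. f \<in> space_A \<and> X n = cls f" for n unfolding carrier_eq by blast
    then obtain F where F: "\<And>n. F n \<in> space_A" "\<And>n. X n = cls (F n)" by metis
    have nrm: "ennreal (anorm orlicz_alg (adiff orlicz_alg (X n) (cls f))) = wnorm (mag (\<lambda>s. F n s - f s))"
      if "f \<in> space_A" for n f
      using that by (simp add: F diff_cls norm_cls_ennreal space_A_diff)
    have "\<exists>N. \<forall>m\<ge>N. \<forall>n\<ge>N. wnorm (mag (\<lambda>s. F m s - F n s)) < ennreal e" if e: "0 < e" for e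
    proof -
      obtain N where "\<And>m n. N \<le> m \<Longrightarrow> N \<le> n \<Longrightarrow> anorm orlicz_alg (adiff orlicz_alg (X m) (X n)) < e"
        using cauchy[OF e] by blast
      then have "wnorm (mag (\<lambda>s. F m s - F n s)) < ennreal e" if "N \<le> m" "N \<le> n" for m n
        unfolding nrm[OF F(1), symmetric] F(2)[symmetric] using that e by (simp add: ennreal_lessI)
      then show ?thesis by blast
    qed
    from space_A_complete[of F, OF F(1) this] obtain f where f: "f \<in> space_A"
      and lim: "\<And>e. 0 < e \<Longrightarrow> \<exists>N. \<forall>n\<ge>N. wnorm (mag (\<lambda>s. F n s - f s)) \<le> ennreal e" by blast
    show "\<exists>x\<in>acarrier orlicz_alg. (\<lambda>n. anorm orlicz_alg (adiff orlicz_alg (X n) x)) \<longlonglongrightarrow> 0"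
    proof (intro bexI LIMSEQ_I)
      show "cls f \<in> acarrier orlicz_alg" using f by (simp add: carrier_eq)
      fix e :: real assume e: "0 < e"
      obtain N where N: "\<And>n. N \<le> n \<Longrightarrow> wnorm (mag (\<lambda>s. F n s - f s)) \<le> ennreal (e / 2)"
        using lim[of "e / 2"] e by auto
      have "norm (anorm orlicz_alg (adiff orlicz_alg (X n) (cls f)) - 0) < e" if n: "N \<le> n" for n
      proof -
        have "anorm orlicz_alg (adiff orlicz_alg (X n) (cls f)) \<le> e / 2"
          unfolding F diff_cls[OF F(1) f] using e by (intro norm_cls_le space_A_diff F f N n) simp
        moreover have "0 \<le> anorm orlicz_alg (adiff orlicz_alg (X n) (cls f))"
          unfolding F diff_cls[OF F(1) f] norm_cls[OF space_A_diff[OF F(1) f]] by simp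
        ultimately show ?thesis using e by simp
      qed
      then show "\<exists>N. \<forall>n\<ge>N. norm (anorm orlicz_alg (adiff orlicz_alg (X n) (cls f)) - 0) < e" by blast
    qed
  qed
qed

section \<open>Symmetry of the twisted Orlicz algebra\<close>

definition tail_part :: "nat \<Rightarrow> ('a \<Rightarrow> complex) \<Rightarrow> 'a \<Rightarrow> complex" where
  "tail_part n f s = (if norm (f s) \<le> real n then 0 else f s)"

lemma tail_part_measurable:
  assumes f: "f \<in> borel_measurable M" shows "tail_part n f \<in> borel_measurable M"
proof -
  have "{s \<in> space M. norm (f s) \<le> real n} \<in> sets M"
    by (rule borel_measurable_le[OF measurable_compose[OF f borel_measurable_norm] borel_measurable_const])
  then show ?thesis
    unfolding tail_part_def[abs_def] by (rule measurable_If[OF borel_measurable_const f])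
qed

lemma norm_tail_part_le: "norm (tail_part n f s) \<le> norm (f s)"
  by (simp add: tail_part_def)

lemma tail_part_space_A: "f \<in> space_A \<Longrightarrow> tail_part n f \<in> space_A"
  by (rule space_A_dominated) (assumption, rule tail_part_measurable[OF space_A_measurable], assumption, rule norm_tail_part_le)

lemma invol_tail_part: "invol (tail_part n f) = tail_part n (invol f)"
  by (rule ext) (simp add: tail_part_def twisted_star_def norm_mult)

text \<open>The norm itself need not tend to \<open>0\<close> on the tails, but \<open>core\<close> is an integral and dominated
  convergence applies.\<close>

lemma core_tail_part:
  assumes f: "f \<in> space_A" shows "(\<lambda>n. core (mag (tail_part n f))) \<longlonglongrightarrow> 0"
proof -
  note [measurable] = space_A_measurable[OF f] tail_part_measurable[OF space_A_measurable[OF f]]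
  obtain c where c: "0 < c" "\<And>F. F \<in> nn_borel \<Longrightarrow> core F \<le> ennreal c * wnorm F" using core_le by blast
  have "core (mag f) \<le> ennreal c * wnorm (mag f)" by (intro c(2) mag_measurable space_A_measurable f)
  also have "\<dots> < \<infinity>" using f by (simp add: space_A_iff ennreal_mult_less_top)
  finally have fin: "(\<integral>\<^sup>+s. mag f s * ennreal (\<omega> s * (w s)\<^sup>2) \<partial>M) < \<infinity>" unfolding core_def .
  have "(\<lambda>n. \<integral>\<^sup>+s. mag (tail_part n f) s * ennreal (\<omega> s * (w s)\<^sup>2) \<partial>M) \<longlonglongrightarrow> (\<integral>\<^sup>+s. 0 \<partial>M)"
  proof (rule nn_integral_dominated_convergence[OF _ _ _ _ fin])
    show "AE s in M. mag (tail_part n f) s * ennreal (\<omega> s * (w s)\<^sup>2) \<le> mag f s * ennreal (\<omega> s * (w s)\<^sup>2)" for n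
      by (intro AE_I2 mult_right_mono ennreal_leI norm_tail_part_le) simp
    show "AE s in M. (\<lambda>n. mag (tail_part n f) s * ennreal (\<omega> s * (w s)\<^sup>2)) \<longlonglongrightarrow> 0"
    proof (intro AE_I2 tendsto_eventually)
      fix s
      obtain N :: nat where "norm (f s) \<le> real N" using real_arch_simple by blast
      then have "tail_part n f s = 0" if "N \<le> n" for n using that by (simp add: tail_part_def)
      then show "\<forall>\<^sub>F n in sequentially. mag (tail_part n f) s * ennreal (\<omega> s * (w s)\<^sup>2) = 0"
        by (intro eventually_sequentiallyI[of N]) simp
    qed
  qed measurable
  then show ?thesis unfolding core_def by simp
qed

text \<open>A bounded integrable function is square-integrable.\<close>

lemma sq_integrable_head_part:
  assumes f: "f \<in> space_A" shows "sq_integrable (\<lambda>s. f s - tail_part n f s)"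
proof -
  note m [measurable] = space_A_measurable[OF f]
  have "(mag (\<lambda>s. f s - tail_part n f s) s)\<^sup>2 \<le> ennreal (real n) * mag f s" for s
  proof -
    have "(norm (f s - tail_part n f s))\<^sup>2 \<le> real n * norm (f s)"
      by (auto simp: tail_part_def power2_eq_square intro: mult_right_mono)
    then have "ennreal ((norm (f s - tail_part n f s))\<^sup>2) \<le> ennreal (real n * norm (f s))" by (rule ennreal_leI)
    then show ?thesis by (simp only: ennreal_power[OF norm_ge_zero] ennreal_mult[OF of_nat_0_le_iff norm_ge_zero])
  qed
  then have "(\<integral>\<^sup>+s. (mag (\<lambda>s. f s - tail_part n f s) s)\<^sup>2 \<partial>M) \<le> (\<integral>\<^sup>+s. ennreal (real n) * mag f s \<partial>M)"
    by (intro nn_integral_mono)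
  also have "\<dots> = ennreal (real n) * (\<integral>\<^sup>+s. mag f s \<partial>M)" by (rule nn_integral_cmult) (rule mag_measurable[OF m])
  also have "\<dots> < \<infinity>" using nn_integral_space_A_finite[OF f] by (simp add: ennreal_mult_less_top)
  finally have "(\<integral>\<^sup>+s. (mag (\<lambda>s. f s - tail_part n f s) s)\<^sup>2 \<partial>M) < \<infinity>" .
  then show ?thesis unfolding sq_integrable_def
    by (intro conjI borel_measurable_diff tail_part_measurable m)
qed

text \<open>In \<open>wnorm_nn_conv\<close> each summand contains the \<open>core\<close> of one factor. The tails of \<open>f\<close> and of
  its involution are small in \<open>core\<close> and bounded in norm.\<close>

lemma approx_sq_integrable:
  assumes f: "f \<in> space_A" and e: "0 < e"
  shows "\<exists>n. wnorm (mag (invol (tail_part n f) \<circledast> tail_part n f)) < ennreal e"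
proof -
  define N where "N = enn2real (wnorm (mag f))"
  have N: "wnorm (mag f) = ennreal N" "0 \<le> N" using f by (simp_all add: N_def space_A_iff less_top)
  define d where "d = e / (2 * K0 * (N + 1))"
  have d: "0 < d" using e K0_pos N(2) by (simp add: d_def)
  have fi: "invol f \<in> space_A" by (rule space_A_invol[OF f])
  have "\<forall>\<^sub>F n in sequentially. core (mag (tail_part n f)) < ennreal d \<and> core (mag (tail_part n (invol f))) < ennreal d"
    using d by (intro eventually_conj order_tendstoD(2)[OF core_tail_part] f fi) simp_all
  then obtain n where n: "core (mag (tail_part n f)) < ennreal d" "core (mag (tail_part n (invol f))) < ennreal d"
    using eventually_happens'[OF sequentially_bot] by blast
  let ?u = "tail_part n f" and ?v = "tail_part n (invol f)"
  have m: "?u \<in> borel_measurable M" "?v \<in> borel_measurable M"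
    by (intro tail_part_measurable space_A_measurable f fi)+
  have u: "wnorm (mag ?u) \<le> ennreal N"
    unfolding N(1)[symmetric] by (intro wnorm_mono_AE AE_I2 ennreal_leI norm_tail_part_le)
  have v: "wnorm (mag ?v) \<le> ennreal N"
    unfolding N(1)[symmetric] wnorm_invol[OF space_A_measurable[OF f], symmetric]
    by (intro wnorm_mono_AE AE_I2 ennreal_leI norm_tail_part_le)
  have "wnorm (mag (?v \<circledast> ?u)) \<le> wnorm (nn_conv (mag ?v) (mag ?u))"
    by (intro wnorm_mono_AE AE_I2 norm_conv_le m)
  also have "\<dots> \<le> ennreal K0 * (core (mag ?v) * wnorm (mag ?u) + wnorm (mag ?v) * core (mag ?u))"
    by (intro wnorm_nn_conv mag_measurable m)
  also have "\<dots> \<le> ennreal K0 * (ennreal d * ennreal N + ennreal N * ennreal d)"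
    by (rule mult_left_mono[OF add_mono[OF mult_mono mult_mono]]) (use n u v in \<open>simp_all add: less_imp_le\<close>)
  also have "\<dots> = ennreal (K0 * (d * N + N * d))"
    using K0_pos d N(2) by (simp only: ennreal_mult ennreal_plus less_imp_le mult_nonneg_nonneg add_nonneg_nonneg)
  also have "\<dots> < ennreal e"
  proof (rule ennreal_lessI[OF e])
    have "K0 * (d * N + N * d) = (d * (2 * K0)) * N" by (simp only: distrib_left mult_ac mult_2)
    also have "d * (2 * K0) = e / (N + 1)" using K0_pos by (simp add: d_def)
    also have "e / (N + 1) * N = e * (N / (N + 1))" by simp
    also have "\<dots> < e * 1" using e N(2) by (intro mult_strict_left_mono) simp_all
    finally show "K0 * (d * N + N * d) < e" by simp
  qed
  finally show ?thesis unfolding invol_tail_part by blast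
qed

definition sq_classes :: "('a \<Rightarrow> complex) set set" where
  "sq_classes = {cls f |f. f \<in> space_A \<and> sq_integrable f}"

definition class_ip :: "('a \<Rightarrow> complex) set \<Rightarrow> ('a \<Rightarrow> complex) set \<Rightarrow> complex" where
  "class_ip X Y = inner2 (SOME f. f \<in> X) (SOME g. g \<in> Y)"

lemma class_ip_cls:
  assumes "f \<in> space_A" "g \<in> space_A" shows "class_ip (cls f) (cls g) = inner2 f g"
proof -
  have rep: "(SOME f. f \<in> cls h) \<in> cls h" if "h \<in> space_A" for h
    unfolding some_in_eq using mem_cls[OF that] by blast
  define f' g' where fg': "f' = (SOME h. h \<in> cls f)" "g' = (SOME h. h \<in> cls g)"
  have "(f, f') \<in> ae_rel M \<Phi> \<omega>" "(g, g') \<in> ae_rel M \<Phi> \<omega>"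
    using rep[OF assms(1)] rep[OF assms(2)] unfolding fg' by (simp_all add: cls_def)
  then have f: "f' \<in> space_A" "AE s in M. f s = f' s" and g: "g' \<in> space_A" "AE s in M. g s = g' s"
    by (simp_all add: ae_rel_iff)
  have "inner2 f' g' = inner2 f g" unfolding inner2_def
  proof (rule integral_cong_AE)
    show "AE s in M. f' s * cnj (g' s) = f s * cnj (g s)" using f(2) g(2) by eventually_elim simp
  qed (intro borel_measurable_times borel_measurable_cnj space_A_measurable f g assms)+
  then show ?thesis by (simp add: class_ip_def fg')
qed

lemma sq_classesE:
  assumes "X \<in> sq_classes" obtains f where "f \<in> space_A" "sq_integrable f" "X = cls f"
  using assms unfolding sq_classes_def by blast

lemma sq_classesI: "f \<in> space_A \<Longrightarrow> sq_integrable f \<Longrightarrow> cls f \<in> sq_classes"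
  unfolding sq_classes_def by blast

lemma norm_square_spread:
  assumes "0 < \<kappa>"
  shows "\<exists>\<delta> K. (\<forall>n. exp (- \<kappa> * 2 ^ n) \<le> \<delta> n \<and> \<delta> n \<le> 1) \<and>
    \<not> summable (\<lambda>n. ln (1 / \<delta> n) / 2 ^ n) \<and> 0 < K \<and>
    (\<forall>n. \<forall>X\<in>sq_classes. anorm orlicz_alg (amult orlicz_alg X X) \<le> K * anorm orlicz_alg X *
       (exp (\<kappa> * 2 ^ n) * sqrt (Re (class_ip X X)) + \<delta> n * anorm orlicz_alg X))"
proof -
  obtain \<delta> c where c: "0 < c" and \<delta>: "\<And>n. exp (- \<kappa> * 2 ^ n) \<le> \<delta> n" "\<And>n. \<delta> n \<le> 1"
      "\<not> summable (\<lambda>n. ln (1 / \<delta> n) / 2 ^ n)"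
    and core: "\<And>n F b. F \<in> nn_borel \<Longrightarrow> 0 \<le> b \<Longrightarrow> (\<integral>\<^sup>+s. (F s)\<^sup>2 \<partial>M) \<le> ennreal (b\<^sup>2) \<Longrightarrow>
       core F \<le> ennreal c * (ennreal (exp (\<kappa> * 2 ^ n) * b) + ennreal (\<delta> n) * wnorm F)"
    using core_le_spread[OF assms] by blast
  have \<delta>0: "0 \<le> \<delta> n" for n by (rule order_trans[OF exp_ge_zero \<delta>(1)])
  have cls_le: "anorm orlicz_alg (cls (f \<circledast> f)) \<le> (2 * K0 * c) * anorm orlicz_alg (cls f) *
      (exp (\<kappa> * 2 ^ n) * sqrt (Re (inner2 f f)) + \<delta> n * anorm orlicz_alg (cls f))"
    if f: "f \<in> space_A" and sq: "sq_integrable f" for n f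
  proof -
    define N where "N = anorm orlicz_alg (cls f)"
    have N: "wnorm (mag f) = ennreal N" "0 \<le> N"
      unfolding N_def using norm_cls_ennreal[OF f] by (simp_all add: norm_cls[OF f])
    define b where "b = sqrt (Re (inner2 f f))"
    have b: "0 \<le> b" "b\<^sup>2 = Re (inner2 f f)" using inner2_self(2)[OF sq] by (simp_all add: b_def)
    note m = space_A_measurable[OF f]
    have "core (mag f) \<le> ennreal c * (ennreal (exp (\<kappa> * 2 ^ n) * b) + ennreal (\<delta> n) * wnorm (mag f))"
      by (rule core[OF mag_measurable[OF m] b(1)]) (simp only: b(2) inner2_self(1)[OF sq] order_refl)
    also have "\<dots> = ennreal (c * (exp (\<kappa> * 2 ^ n) * b + \<delta> n * N))"
      using c b(1) N(2) \<delta>0[of n] by (simp add: N(1) ennreal_mult ennreal_plus)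
    finally have cf: "core (mag f) \<le> ennreal (c * (exp (\<kappa> * 2 ^ n) * b + \<delta> n * N))" .
    have nn: "0 \<le> c * (exp (\<kappa> * 2 ^ n) * b + \<delta> n * N)" using c b(1) N(2) \<delta>0[of n] by simp
    have "wnorm (mag (f \<circledast> f)) \<le> wnorm (nn_conv (mag f) (mag f))"
      by (intro wnorm_mono_AE AE_I2 norm_conv_le m)
    also have "\<dots> \<le> ennreal K0 * (core (mag f) * wnorm (mag f) + wnorm (mag f) * core (mag f))"
      by (intro wnorm_nn_conv mag_measurable m)
    also have "\<dots> \<le> ennreal K0 * (ennreal (c * (exp (\<kappa> * 2 ^ n) * b + \<delta> n * N)) * ennreal N
        + ennreal N * ennreal (c * (exp (\<kappa> * 2 ^ n) * b + \<delta> n * N)))"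
      unfolding N(1) by (rule mult_left_mono[OF add_mono[OF mult_right_mono mult_left_mono]]) (use cf in simp_all)
    also have "\<dots> = ennreal ((2 * K0 * c) * N * (exp (\<kappa> * 2 ^ n) * b + \<delta> n * N))"
    proof -
      have "(2 * K0 * c) * N * (exp (\<kappa> * 2 ^ n) * b + \<delta> n * N)
          = K0 * (c * (exp (\<kappa> * 2 ^ n) * b + \<delta> n * N) * N + N * (c * (exp (\<kappa> * 2 ^ n) * b + \<delta> n * N)))"
        by (simp add: algebra_simps)
      then show ?thesis using K0_pos N(2) nn
        by (simp only: ennreal_mult ennreal_plus less_imp_le mult_nonneg_nonneg add_nonneg_nonneg)
    qed
    finally show ?thesis unfolding N_def[symmetric] b_def[symmetric]
      using K0_pos c b(1) N(2) \<delta>0[of n] by (intro norm_cls_le space_A_conv f) simp_all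
  qed
  have "anorm orlicz_alg (amult orlicz_alg X X) \<le> (2 * K0 * c) * anorm orlicz_alg X *
      (exp (\<kappa> * 2 ^ n) * sqrt (Re (class_ip X X)) + \<delta> n * anorm orlicz_alg X)"
    if X_sq: "X \<in> sq_classes" for n X
  proof -
    obtain f where f: "f \<in> space_A" "sq_integrable f" and X: "X = cls f" using X_sq by (rule sq_classesE)
    show ?thesis using cls_le[OF f, of n] unfolding X mult_cls[OF f(1) f(1)] class_ip_cls[OF f(1) f(1)] .
  qed
  moreover have "0 < 2 * K0 * c" using c K0_pos by simp
  ultimately show ?thesis using \<delta>(3)
    by (intro exI[of _ \<delta>] exI[of _ "2 * K0 * c"] conjI allI ballI \<delta>) assumption+
qed

theorem orlicz_spread_star_algebra: "spread_star_algebra orlicz_alg sq_classes class_ip"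
proof -
  interpret banach_star_algebra orlicz_alg by (rule banach_algebra)
  show ?thesis
  proof
    fix X assume "X \<in> sq_classes"
    then obtain f where X [simp]: "X = cls f" and f: "f \<in> space_A" "sq_integrable f" by (metis sq_classesE)
    show "X \<in> acarrier orlicz_alg" using f by (simp add: carrier_eq)
    show "ascale orlicz_alg c X \<in> sq_classes" for c
      by (simp add: scale_cls f sq_classesI space_A_scale sq_integrable_scale)
    show "astar orlicz_alg X \<in> sq_classes"
      by (simp add: star_cls f sq_classesI space_A_invol sq_integrable_invol)
    show "0 \<le> Re (class_ip X X)" by (simp add: class_ip_cls f inner2_self(2))
    fix Y assume "Y \<in> sq_classes"
    then obtain g where Y [simp]: "Y = cls g" and g: "g \<in> space_A" "sq_integrable g" by (metis sq_classesE)
    show "aadd orlicz_alg X Y \<in> sq_classes"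
      by (simp add: add_cls f g sq_classesI space_A_add sq_integrable_add)
    show "class_ip (ascale orlicz_alg c X) Y = c * class_ip X Y" for c
      by (simp add: scale_cls class_ip_cls f g space_A_scale) (simp add: inner2_def mult.assoc)
    have "cnj (inner2 f g) = (\<integral>s. cnj (f s * cnj (g s)) \<partial>M)"
      unfolding inner2_def by (rule Bochner_Integration.integral_cnj[symmetric])
    then show "class_ip Y X = cnj (class_ip X Y)"
      by (simp add: class_ip_cls f g inner2_def mult.commute)
    fix Z assume "Z \<in> sq_classes"
    then obtain h where Z [simp]: "Z = cls h" and h: "h \<in> space_A" "sq_integrable h" by (metis sq_classesE)
    have "inner2 (\<lambda>s. f s + g s) h = inner2 f h + inner2 g h"
      unfolding inner2_def distrib_right
      by (rule Bochner_Integration.integral_add) (rule inner2_integrable[OF f(2) h(2)] inner2_integrable[OF g(2) h(2)])+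
    then show "class_ip (aadd orlicz_alg X Y) Z = class_ip X Z + class_ip Y Z"
      by (simp add: add_cls class_ip_cls f g h space_A_add)
  next
    fix B assume "B \<in> acarrier orlicz_alg"
    then obtain f where B [simp]: "B = cls f" and f: "f \<in> space_A" by (metis carrierE)
    define P where "P = enn2real (\<integral>\<^sup>+s. mag f s \<partial>M)"
    have P: "(\<integral>\<^sup>+s. mag f s \<partial>M) = ennreal P" "0 \<le> P"
      using nn_integral_space_A_finite[OF f] by (simp_all add: P_def less_top)
    show "\<exists>C. \<forall>X\<in>sq_classes. Re (class_ip (amult orlicz_alg B X) (amult orlicz_alg B X)) \<le> C * Re (class_ip X X)"
    proof (intro exI[of _ "P\<^sup>2"] ballI)
      fix X assume "X \<in> sq_classes"
      then obtain g where X [simp]: "X = cls g" and g: "g \<in> space_A" "sq_integrable g" by (metis sq_classesE)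
      have "ennreal (Re (inner2 (f \<circledast> g) (f \<circledast> g))) \<le> (ennreal P)\<^sup>2 * ennreal (Re (inner2 g g))"
        unfolding inner2_self(1)[OF sq_integrable_conv[OF f g(2)]] inner2_self(1)[OF g(2)] P(1)[symmetric]
        by (intro sq_norm_conv_le space_A_measurable f g)
      also have "\<dots> = ennreal (P\<^sup>2 * Re (inner2 g g))"
        using P(2) inner2_self(2)[OF g(2)] by (simp add: ennreal_power ennreal_mult)
      finally have "Re (inner2 (f \<circledast> g) (f \<circledast> g)) \<le> P\<^sup>2 * Re (inner2 g g)"
        using inner2_self(2)[OF g(2)] by (subst (asm) ennreal_le_iff) simp_all
      then show "Re (class_ip (amult orlicz_alg B X) (amult orlicz_alg B X)) \<le> P\<^sup>2 * Re (class_ip X X)"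
        by (simp add: mult_cls class_ip_cls f g space_A_conv)
    qed
    show "\<exists>G\<in>sq_classes. anorm orlicz_alg (amult orlicz_alg (astar orlicz_alg (adiff orlicz_alg B G)) (adiff orlicz_alg B G)) < e"
      if e: "0 < e" for e
    proof -
      obtain n where n: "wnorm (mag (invol (tail_part n f) \<circledast> tail_part n f)) < ennreal (e / 2)"
        using approx_sq_integrable[OF f, of "e / 2"] e by auto
      let ?u = "tail_part n f" and ?g = "\<lambda>s. f s - tail_part n f s"
      have u: "?u \<in> space_A" by (rule tail_part_space_A[OF f])
      have g: "?g \<in> space_A" by (rule space_A_diff[OF f u])
      have "adiff orlicz_alg B (cls ?g) = cls ?u" using f g by (simp add: diff_cls)
      then have "amult orlicz_alg (astar orlicz_alg (adiff orlicz_alg B (cls ?g))) (adiff orlicz_alg B (cls ?g))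
          = cls (invol ?u \<circledast> ?u)"
        using u by (simp add: star_cls mult_cls space_A_invol)
      moreover have "anorm orlicz_alg (cls (invol ?u \<circledast> ?u)) \<le> e / 2"
        using n e u by (intro norm_cls_le space_A_conv space_A_invol) (simp_all add: less_imp_le)
      ultimately show ?thesis using e sq_classesI[OF g sq_integrable_head_part[OF f]]
        by (intro bexI[of _ "cls ?g"]) simp_all
    qed
    fix X assume "X \<in> sq_classes"
    then obtain g where X [simp]: "X = cls g" and g: "g \<in> space_A" "sq_integrable g" by (metis sq_classesE)
    show "amult orlicz_alg B X \<in> sq_classes"
      using f g by (simp add: mult_cls sq_classesI space_A_conv sq_integrable_conv)
    fix Y assume "Y \<in> sq_classes"
    then obtain h where Y [simp]: "Y = cls h" and h: "h \<in> space_A" "sq_integrable h" by (metis sq_classesE)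
    show "class_ip (amult orlicz_alg B X) Y = class_ip X (amult orlicz_alg (astar orlicz_alg B) Y)"
      using f g h by (simp add: mult_cls star_cls class_ip_cls space_A_conv space_A_invol inner2_conv)
  next
    fix \<kappa> :: real assume "0 < \<kappa>"
    then show "\<exists>\<delta> K. (\<forall>n. exp (- \<kappa> * 2 ^ n) \<le> \<delta> n \<and> \<delta> n \<le> 1) \<and>
        \<not> summable (\<lambda>n. ln (1 / \<delta> n) / 2 ^ n) \<and> 0 < K \<and>
        (\<forall>n. \<forall>X\<in>sq_classes. anorm orlicz_alg (amult orlicz_alg X X) \<le> K * anorm orlicz_alg X *
          (exp (\<kappa> * 2 ^ n) * sqrt (Re (class_ip X X)) + \<delta> n * anorm orlicz_alg X))"
      by (rule norm_square_spread)
  qed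
qed

theorem symmetric_twisted_orlicz_algebra: "symmetric_twisted_orlicz_algebra M \<Phi> \<Psi> \<Omega> \<omega>"
  unfolding symmetric_twisted_orlicz_algebra_def
  by (intro conjI twisted_orlicz_algebra banach_algebra spread_star_algebra.symmetric[OF orlicz_spread_star_algebra])

end

theorem theorem5p8:
  fixes M :: "'a::{topological_group_add, t2_space} measure"
    and U :: "'a set"
    and \<Phi> \<Psi> :: "real \<Rightarrow> ennreal"
    and \<Omega> :: "'a \<Rightarrow> 'a \<Rightarrow> complex"
    and C :: real
  assumes "locally compact (UNIV :: 'a set)"
    and "left_haar_measure M"
    and "compact_symmetric_generating_nbhd U"
    and "polynomial_growth M U"
    and "complementary_young_pair \<Phi> \<Psi>"
    and "\<forall>x\<ge>0. \<Phi> x < \<infinity>"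
    and "continuous_on {0..} \<Phi>"
    and "\<forall>x>0. \<Phi> x > 0"
    and "\<Omega> \<in> circle_cocycles"
    and "C > 0"
  shows "(\<forall>\<alpha>. 0 < \<alpha> \<and> \<alpha> < 1 \<longrightarrow>
            symmetric_twisted_orlicz_algebra M \<Phi> \<Psi> \<Omega> (sigma_weight U \<alpha> C)) \<and>
         (\<forall>\<gamma>>0. symmetric_twisted_orlicz_algebra M \<Phi> \<Psi> \<Omega> (rho_weight U \<gamma> C))"
proof -
  interpret haar_growth M U using assms(2-4) by (rule haar_growth.intro)
  have young: "young_pair \<Phi> \<Psi>" using assms(5-7) by (simp add: young_pair_def)
  have *: "symmetric_twisted_orlicz_algebra M \<Phi> \<Psi> \<Omega> \<omega>" if "gainful_weight M U \<omega> w K" for \<omega> w K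
  proof -
    have "twisted_orlicz M U \<omega> w K \<Phi> \<Psi> \<Omega>"
      by (intro twisted_orlicz.intro weighted_orlicz.intro twisted_orlicz_axioms.intro that young assms(9))
    then show ?thesis by (rule twisted_orlicz.symmetric_twisted_orlicz_algebra)
  qed
  show ?thesis
  proof (intro conjI allI impI)
    fix \<alpha> :: real assume "0 < \<alpha> \<and> \<alpha> < 1"
    then show "symmetric_twisted_orlicz_algebra M \<Phi> \<Psi> \<Omega> (sigma_weight U \<alpha> C)"
      using gainful_sigma_weight[OF _ _ assms(10)] * by blast
  next
    fix \<gamma> :: real assume "0 < \<gamma>"
    then show "symmetric_twisted_orlicz_algebra M \<Phi> \<Psi> \<Omega> (rho_weight U \<gamma> C)"
      using gainful_rho_weight[OF _ assms(10)] * by blast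
  qed
qed

end
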